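(* Let $\mathfrak{B} \subset \mathfrak{D}=\mathbb{C}[[z]][\partial]$ be a commutative subalgebra of rank $r$, with affine spectral curve $X_0=\mathrm{Spec}(\mathfrak{B})$, projective spectral curve $X = X_0\cup\{p\}$ and spectral module $F=\mathbb{C}[\partial]$. Let $H = \langle 1, \partial, \dots, \partial^{r-1}\rangle_{\mathbb{C}} \subset F$. Then the following hold. (1) There exists a pair $(\mathcal{F}, \varphi)$, where $\mathcal{F}$ is a torsion free coherent sheaf on $X$ and $\varphi\colon \Gamma(X_0, \mathcal{F}) \to F$ is an isomorphism of $\mathfrak{B}$-modules (using the identification $\mathfrak{B} \cong \Gamma(X_0, \mathcal{O})$) which induces an isomorphism of vector spaces $\Gamma(X,\mathcal{F}) \to H$; that is, identifying $\Gamma(X,\mathcal{F})$ with its image under the (injective) restriction map $\Gamma(X,\mathcal{F}) \hookrightarrow \Gamma(X_0,\mathcal{F})$, the map $\varphi$ restricts to an isomorphism of $\Gamma(X,\mathcal{F})$ onto $H$. (2) If $(\mathcal{F}', \varphi')$ is another pair with the properties in (1), then there exists an isomorphism $\psi\colon \mathcal{F} \to \mathcal{F}'$ such that $\varphi' \circ \Gamma(X_0, \psi) = \varphi$. In other words, the pair $(\mathcal F,\varphi)$ is unique up to an automorphism of $\mathcal F$. (3) The sheaf $\mathcal{F}$ (called the spectral sheaf of $\mathfrak{B}$) has the following additional properties: the evaluation map $\mathrm{ev}_p\colon\Gamma(X, \mathcal{F}) \to \mathcal{F}|_{p}$ is an isomorphism and $H^1(X, \mathcal{F}) = 0$.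
   Context: $\mathfrak{D}=\mathbb{C}[[z]][\partial]$ is the algebra of ordinary differential operators with formal power series coefficients. An operator of positive order $n$ is formally elliptic if its coefficient at $\partial^n$ is a nonzero constant; it is normalized if it has the form $\partial^n+b_{n-2}\partial^{n-2}+\dots+b_0$. Standing assumption: every commutative subalgebra $\mathfrak B\subset\mathfrak D$ considered contains a formally elliptic operator of positive order (then all its elements are formally elliptic) and is normalized, i.e. its elements of minimal positive order are normalized (up to a nonzero constant factor). The rank of $\mathfrak{B}$ is $r=\gcd\{\mathrm{ord}(P)\mid P\in\mathfrak{B}\}$. For $i\ge 0$ let $\mathfrak{B}_i=\{P\in\mathfrak{B}\mid \mathrm{ord}(P)\le ir\}$ and let $\widetilde{\mathfrak B}=\bigoplus_{i\ge0}\mathfrak{B}_it^i\subset\mathfrak{B}[t]$ be the Rees algebra. The spectral curve is $X=\mathrm{Proj}(\widetilde{\mathfrak{B}})$, an integral projective curve; $X=X_0\cup\{p\}$ where $X_0=\mathrm{Spec}(\mathfrak{B})$ and $p$ is the smooth point defined by the prime ideal $(t)$. The spectral module is $F=\mathfrak{D}/z\mathfrak{D}\cong\mathbb{C}[\partial]$, $\overline{a(z)\partial^n}\mapsto a(0)\partial^n$, a right $\mathfrak{D}$-module with $p(\partial)\diamond\partial=\partial\cdot p(\partial)$ and $p(\partial)\diamond z=p'(\partial)$; restricting to the commutative algebra $\mathfrak{B}$, it is regarded as a (left) $\mathfrak{B}$-module. $\mathcal{F}|_p$ denotes the fiber $\mathcal{F}\otimes\mathbb{C}(p)$. *)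

theory Defs
  imports
    "HOL-Analysis.Abstract_Topology"
    "HOL-Algebra.Subrings"
    "HOL-Algebra.UnivPoly"
    "HOL-Algebra.AbelCoset"
    "HOL-Computational_Algebra.Polynomial"
    "HOL-Computational_Algebra.Formal_Power_Series"
begin

section \<open>Modules\<close>

definition mod_iso ::
    "('a, 'x) ring_scheme \<Rightarrow> ('a, 'm, 'y) module_scheme \<Rightarrow> ('a, 'n, 'z) module_scheme
      \<Rightarrow> ('m \<Rightarrow> 'n) \<Rightarrow> bool" where
  "mod_iso R M N f \<longleftrightarrow>
     bij_betw f (carrier M) (carrier N) \<and>
     (\<forall>x\<in>carrier M. \<forall>y\<in>carrier M. f (x \<oplus>\<^bsub>M\<^esub> y) = f x \<oplus>\<^bsub>N\<^esub> f y) \<and>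
     (\<forall>a\<in>carrier R. \<forall>x\<in>carrier M. f (a \<odot>\<^bsub>M\<^esub> x) = a \<odot>\<^bsub>N\<^esub> f x)"

definition restrict_scalars :: "('a \<Rightarrow> 'b) \<Rightarrow> ('b, 'm, 'y) module_scheme \<Rightarrow> ('a, 'm) module" where
  "restrict_scalars h M =
     \<lparr>carrier = carrier M, monoid.mult = monoid.mult M, one = one M, zero = zero M, add = add M,
      Module.module.smult = (\<lambda>a x. h a \<odot>\<^bsub>M\<^esub> x)\<rparr>"

definition complex_ring :: "complex ring" where
  "complex_ring = \<lparr>carrier = UNIV, monoid.mult = (*), one = 1, zero = 0, add = (+)\<rparr>"


section \<open>Ringed spaces and sheaves of modules\<close>

record ('p, 'r) ringed_space =
  top_of :: "'p topology"
  rsec :: "'p set \<Rightarrow> 'r ring"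
  rres :: "'p set \<Rightarrow> 'p set \<Rightarrow> 'r \<Rightarrow> 'r"

record ('p, 'r, 'm) mod_presheaf =
  msec :: "'p set \<Rightarrow> ('r, 'm) module"
  mres :: "'p set \<Rightarrow> 'p set \<Rightarrow> 'm \<Rightarrow> 'm"

abbreviation whole :: "('p, 'r) ringed_space \<Rightarrow> 'p set" where
  "whole X \<equiv> topspace (top_of X)"

abbreviation is_open :: "('p, 'r) ringed_space \<Rightarrow> 'p set \<Rightarrow> bool" where
  "is_open X \<equiv> openin (top_of X)"

definition module_sheaf :: "('p, 'r) ringed_space \<Rightarrow> ('p, 'r, 'm) mod_presheaf \<Rightarrow> bool" where
  "module_sheaf X F \<longleftrightarrow>
     (\<forall>U. is_open X U \<longrightarrow> Module.module (rsec X U) (msec F U)) \<and>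
     (\<forall>U V. is_open X U \<and> is_open X V \<and> V \<subseteq> U \<longrightarrow>
        mres F U V \<in> carrier (msec F U) \<rightarrow> carrier (msec F V) \<and>
        (\<forall>s\<in>carrier (msec F U). \<forall>t\<in>carrier (msec F U).
           mres F U V (s \<oplus>\<^bsub>msec F U\<^esub> t) = mres F U V s \<oplus>\<^bsub>msec F V\<^esub> mres F U V t) \<and>
        (\<forall>a\<in>carrier (rsec X U). \<forall>s\<in>carrier (msec F U).
           mres F U V (a \<odot>\<^bsub>msec F U\<^esub> s) = rres X U V a \<odot>\<^bsub>msec F V\<^esub> mres F U V s)) \<and>
     (\<forall>U. is_open X U \<longrightarrow> (\<forall>s\<in>carrier (msec F U). mres F U U s = s)) \<and>
     (\<forall>U V W. is_open X U \<and> is_open X V \<and> is_open X W \<and> W \<subseteq> V \<and> V \<subseteq> U \<longrightarrow>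
        (\<forall>s\<in>carrier (msec F U). mres F V W (mres F U V s) = mres F U W s)) \<and>
     (\<forall>\<U>. (\<forall>U\<in>\<U>. is_open X U) \<longrightarrow>
        (\<forall>s\<in>carrier (msec F (\<Union>\<U>)). \<forall>t\<in>carrier (msec F (\<Union>\<U>)).
           (\<forall>U\<in>\<U>. mres F (\<Union>\<U>) U s = mres F (\<Union>\<U>) U t) \<longrightarrow> s = t)) \<and>
     (\<forall>\<U> s. (\<forall>U\<in>\<U>. is_open X U \<and> s U \<in> carrier (msec F U)) \<and>
        (\<forall>U\<in>\<U>. \<forall>V\<in>\<U>. mres F U (U \<inter> V) (s U) = mres F V (U \<inter> V) (s V)) \<longrightarrow>
        (\<exists>t\<in>carrier (msec F (\<Union>\<U>)). \<forall>U\<in>\<U>. mres F (\<Union>\<U>) U t = s U))"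

definition sheaf_iso ::
    "('p, 'r) ringed_space \<Rightarrow> ('p, 'r, 'm) mod_presheaf \<Rightarrow> ('p, 'r, 'n) mod_presheaf
      \<Rightarrow> ('p set \<Rightarrow> 'm \<Rightarrow> 'n) \<Rightarrow> bool" where
  "sheaf_iso X F G \<psi> \<longleftrightarrow>
     (\<forall>U. is_open X U \<longrightarrow> mod_iso (rsec X U) (msec F U) (msec G U) (\<psi> U)) \<and>
     (\<forall>U V. is_open X U \<and> is_open X V \<and> V \<subseteq> U \<longrightarrow>
        (\<forall>s\<in>carrier (msec F U). \<psi> V (mres F U V s) = mres G U V (\<psi> U s)))"

text \<open>On an integral scheme every ring of sections over a nonempty open set is a domain, and
  over the empty set it is zero, so the condition may be stated for all open sets.\<close>

definition torsion_free :: "('p, 'r) ringed_space \<Rightarrow> ('p, 'r, 'm) mod_presheaf \<Rightarrow> bool" where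
  "torsion_free X F \<longleftrightarrow>
     (\<forall>U. is_open X U \<longrightarrow> (\<forall>a\<in>carrier (rsec X U). \<forall>s\<in>carrier (msec F U).
        a \<odot>\<^bsub>msec F U\<^esub> s = \<zero>\<^bsub>msec F U\<^esub> \<longrightarrow> a = \<zero>\<^bsub>rsec X U\<^esub> \<or> s = \<zero>\<^bsub>msec F U\<^esub>))"

text \<open>Coherence is the general notion for sheaves of modules on a ringed space: finite type, and
  every finite family of sections over an open set has a sheaf of relations of finite type.\<close>

definition locally_generated_by ::
    "('p, 'r) ringed_space \<Rightarrow> ('p, 'r, 'm) mod_presheaf \<Rightarrow> 'p set \<Rightarrow> nat \<Rightarrow> (nat \<Rightarrow> 'm) \<Rightarrow> bool" where
  "locally_generated_by X F V n s \<longleftrightarrow>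
     (\<forall>W t y. is_open X W \<and> W \<subseteq> V \<and> t \<in> carrier (msec F W) \<and> y \<in> W \<longrightarrow>
        (\<exists>W' a. is_open X W' \<and> y \<in> W' \<and> W' \<subseteq> W \<and> a \<in> {..<n} \<rightarrow> carrier (rsec X W') \<and>
           mres F W W' t = (\<Oplus>\<^bsub>msec F W'\<^esub>i\<in>{..<n}. a i \<odot>\<^bsub>msec F W'\<^esub> mres F V W' (s i))))"

definition finite_type_on ::
    "('p, 'r) ringed_space \<Rightarrow> ('p, 'r, 'm) mod_presheaf \<Rightarrow> 'p set \<Rightarrow> bool" where
  "finite_type_on X F U \<longleftrightarrow>
     (\<forall>x\<in>U. \<exists>V n s. is_open X V \<and> x \<in> V \<and> V \<subseteq> U \<and> s \<in> {..<n} \<rightarrow> carrier (msec F V) \<and>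
        locally_generated_by X F V n s)"

text \<open>The kernel of \<open>\<O>\<^sub>U\<^sup>n \<rightarrow> F|\<^sub>U\<close> given by sections \<open>s 0, \<dots>, s (n - 1)\<close> over \<open>U\<close>; only its
  values on open subsets of \<open>U\<close> are meaningful. The fields \<open>mult\<close> and \<open>one\<close> are inherited from
  the library's record for modules and play no role.\<close>

definition relation_sheaf ::
    "('p, 'r) ringed_space \<Rightarrow> ('p, 'r, 'm) mod_presheaf \<Rightarrow> 'p set \<Rightarrow> nat \<Rightarrow> (nat \<Rightarrow> 'm)
      \<Rightarrow> ('p, 'r, nat \<Rightarrow> 'r) mod_presheaf" where
  "relation_sheaf X F U n s =
     \<lparr>msec = (\<lambda>W.
        \<lparr>carrier = {a \<in> {..<n} \<rightarrow>\<^sub>E carrier (rsec X W).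
            (\<Oplus>\<^bsub>msec F W\<^esub>i\<in>{..<n}. a i \<odot>\<^bsub>msec F W\<^esub> mres F U W (s i)) = \<zero>\<^bsub>msec F W\<^esub>},
         monoid.mult = undefined, one = undefined,
         zero = (\<lambda>i\<in>{..<n}. \<zero>\<^bsub>rsec X W\<^esub>),
         add = (\<lambda>a b. \<lambda>i\<in>{..<n}. a i \<oplus>\<^bsub>rsec X W\<^esub> b i),
         Module.module.smult = (\<lambda>c a. \<lambda>i\<in>{..<n}. c \<otimes>\<^bsub>rsec X W\<^esub> a i)\<rparr>),
      mres = (\<lambda>W W' a. \<lambda>i\<in>{..<n}. rres X W W' (a i))\<rparr>"

definition coherent :: "('p, 'r) ringed_space \<Rightarrow> ('p, 'r, 'm) mod_presheaf \<Rightarrow> bool" where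
  "coherent X F \<longleftrightarrow>
     finite_type_on X F (whole X) \<and>
     (\<forall>U n s. is_open X U \<and> s \<in> {..<n} \<rightarrow> carrier (msec F U) \<longrightarrow>
        finite_type_on X (relation_sheaf X F U n s) U)"


subsection \<open>Stalks and fibers\<close>

definition germ ::
    "'p topology \<Rightarrow> ('p set \<Rightarrow> 's set) \<Rightarrow> ('p set \<Rightarrow> 'p set \<Rightarrow> 's \<Rightarrow> 's) \<Rightarrow> 'p \<Rightarrow> 'p set \<Rightarrow> 's
      \<Rightarrow> ('p set \<times> 's) set" where
  "germ T S res x U s =
     {(V, t). openin T V \<and> x \<in> V \<and> t \<in> S V \<and>
        (\<exists>W. openin T W \<and> x \<in> W \<and> W \<subseteq> U \<inter> V \<and> res U W s = res V W t)}"

abbreviation rgerm :: "('p, 'r) ringed_space \<Rightarrow> 'p \<Rightarrow> 'p set \<Rightarrow> 'r \<Rightarrow> ('p set \<times> 'r) set" where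
  "rgerm X \<equiv> germ (top_of X) (\<lambda>U. carrier (rsec X U)) (rres X)"

abbreviation mgerm ::
    "('p, 'r) ringed_space \<Rightarrow> ('p, 'r, 'm) mod_presheaf \<Rightarrow> 'p \<Rightarrow> 'p set \<Rightarrow> 'm \<Rightarrow> ('p set \<times> 'm) set" where
  "mgerm X F \<equiv> germ (top_of X) (\<lambda>U. carrier (msec F U)) (mres F)"

text \<open>Operations on germs are defined as unions over all representatives; each of these unions
  ranges over equal sets.\<close>

definition stalk_ring :: "('p, 'r) ringed_space \<Rightarrow> 'p \<Rightarrow> ('p set \<times> 'r) set ring" where
  "stalk_ring X x =
     \<lparr>carrier = {rgerm X x U a | U a. is_open X U \<and> x \<in> U \<and> a \<in> carrier (rsec X U)},
      monoid.mult = (\<lambda>A B. \<Union>(U, a)\<in>A. \<Union>(V, b)\<in>B. rgerm X x (U \<inter> V)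
                (rres X U (U \<inter> V) a \<otimes>\<^bsub>rsec X (U \<inter> V)\<^esub> rres X V (U \<inter> V) b)),
      one = rgerm X x (whole X) \<one>\<^bsub>rsec X (whole X)\<^esub>,
      zero = rgerm X x (whole X) \<zero>\<^bsub>rsec X (whole X)\<^esub>,
      add = (\<lambda>A B. \<Union>(U, a)\<in>A. \<Union>(V, b)\<in>B. rgerm X x (U \<inter> V)
                (rres X U (U \<inter> V) a \<oplus>\<^bsub>rsec X (U \<inter> V)\<^esub> rres X V (U \<inter> V) b))\<rparr>"

definition stalk ::
    "('p, 'r) ringed_space \<Rightarrow> ('p, 'r, 'm) mod_presheaf \<Rightarrow> 'p
      \<Rightarrow> (('p set \<times> 'r) set, ('p set \<times> 'm) set) module" where
  "stalk X F x =
     \<lparr>carrier = {mgerm X F x U s | U s. is_open X U \<and> x \<in> U \<and> s \<in> carrier (msec F U)},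
      monoid.mult = undefined, one = undefined,
      zero = mgerm X F x (whole X) \<zero>\<^bsub>msec F (whole X)\<^esub>,
      add = (\<lambda>A B. \<Union>(U, s)\<in>A. \<Union>(V, t)\<in>B. mgerm X F x (U \<inter> V)
                (mres F U (U \<inter> V) s \<oplus>\<^bsub>msec F (U \<inter> V)\<^esub> mres F V (U \<inter> V) t)),
      Module.module.smult = (\<lambda>A B. \<Union>(U, a)\<in>A. \<Union>(V, s)\<in>B. mgerm X F x (U \<inter> V)
                (rres X U (U \<inter> V) a \<odot>\<^bsub>msec F (U \<inter> V)\<^esub> mres F V (U \<inter> V) s))\<rparr>"

text \<open>On a locally ringed space the maximal ideal of the stalk consists of the nonunits.\<close>

definition max_ideal_at :: "('p, 'r) ringed_space \<Rightarrow> 'p \<Rightarrow> ('p set \<times> 'r) set set" where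
  "max_ideal_at X x = carrier (stalk_ring X x) - Units (stalk_ring X x)"

definition max_ideal_stalk ::
    "('p, 'r) ringed_space \<Rightarrow> ('p, 'r, 'm) mod_presheaf \<Rightarrow> 'p \<Rightarrow> ('p set \<times> 'm) set set" where
  "max_ideal_stalk X F x =
     {(\<Oplus>\<^bsub>stalk X F x\<^esub>i\<in>{..<n}. a i \<odot>\<^bsub>stalk X F x\<^esub> m i) | (n::nat) a m.
        a \<in> {..<n} \<rightarrow> max_ideal_at X x \<and> m \<in> {..<n} \<rightarrow> carrier (stalk X F x)}"

text \<open>The fiber \<open>F \<otimes> \<kappa>(x) = F\<^sub>x / \<mm>\<^sub>x F\<^sub>x\<close>, as a module over the local ring at \<open>x\<close>.\<close>

definition fiber ::
    "('p, 'r) ringed_space \<Rightarrow> ('p, 'r, 'm) mod_presheaf \<Rightarrow> 'p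
      \<Rightarrow> (('p set \<times> 'r) set, ('p set \<times> 'm) set set) module" where
  "fiber X F x =
     \<lparr>carrier = a_rcosets\<^bsub>stalk X F x\<^esub> (max_ideal_stalk X F x),
      monoid.mult = undefined, one = undefined,
      zero = max_ideal_stalk X F x,
      add = (\<lambda>A B. A <+>\<^bsub>stalk X F x\<^esub> B),
      Module.module.smult = (\<lambda>c A. \<Union>m\<in>A. max_ideal_stalk X F x +>\<^bsub>stalk X F x\<^esub> (c \<odot>\<^bsub>stalk X F x\<^esub> m))\<rparr>"

definition ev_at ::
    "('p, 'r) ringed_space \<Rightarrow> ('p, 'r, 'm) mod_presheaf \<Rightarrow> 'p \<Rightarrow> 'm \<Rightarrow> ('p set \<times> 'm) set set" where
  "ev_at X F x s = max_ideal_stalk X F x +>\<^bsub>stalk X F x\<^esub> mgerm X F x (whole X) s"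


subsection \<open>First cohomology\<close>

text \<open>\<open>H\<^sup>1\<close> is the Cech cohomology group, the colimit over all open covers; in degree one this
  agrees with derived functor cohomology for every sheaf on every topological space. The covers are
  indexed by the points, \<open>x \<in> U x\<close>. Such covers are cofinal, and refinement is pointwise
  inclusion, so that no refinement map has to be chosen.\<close>

definition pt_cover :: "('p, 'r) ringed_space \<Rightarrow> ('p \<Rightarrow> 'p set) \<Rightarrow> bool" where
  "pt_cover X U \<longleftrightarrow> (\<forall>x\<in>whole X. is_open X (U x) \<and> x \<in> U x)"

definition cech_cocycles ::
    "('p, 'r) ringed_space \<Rightarrow> ('p, 'r, 'm) mod_presheaf \<Rightarrow> (('p \<Rightarrow> 'p set) \<times> ('p \<Rightarrow> 'p \<Rightarrow> 'm)) set" where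
  "cech_cocycles X F =
     {(U, c). pt_cover X U \<and>
        (\<forall>x\<in>whole X. \<forall>y\<in>whole X. c x y \<in> carrier (msec F (U x \<inter> U y))) \<and>
        (\<forall>x\<in>whole X. \<forall>y\<in>whole X. \<forall>z\<in>whole X.
           let W = U x \<inter> U y \<inter> U z in
           mres F (U x \<inter> U z) W (c x z) =
           mres F (U x \<inter> U y) W (c x y) \<oplus>\<^bsub>msec F W\<^esub> mres F (U y \<inter> U z) W (c y z))}"

text \<open>Two cocycles are related iff they become cohomologous on a common refinement.\<close>

definition cech_rel ::
    "('p, 'r) ringed_space \<Rightarrow> ('p, 'r, 'm) mod_presheaf
      \<Rightarrow> ((('p \<Rightarrow> 'p set) \<times> ('p \<Rightarrow> 'p \<Rightarrow> 'm)) \<times> (('p \<Rightarrow> 'p set) \<times> ('p \<Rightarrow> 'p \<Rightarrow> 'm))) set" where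
  "cech_rel X F =
     {((U, c), (V, d)). (U, c) \<in> cech_cocycles X F \<and> (V, d) \<in> cech_cocycles X F \<and>
        (\<exists>W b. pt_cover X W \<and>
           (\<forall>x\<in>whole X. W x \<subseteq> U x \<inter> V x \<and> b x \<in> carrier (msec F (W x))) \<and>
           (\<forall>x\<in>whole X. \<forall>y\<in>whole X.
              let Z = W x \<inter> W y in
              mres F (U x \<inter> U y) Z (c x y) \<ominus>\<^bsub>msec F Z\<^esub> mres F (V x \<inter> V y) Z (d x y) =
              mres F (W y) Z (b y) \<ominus>\<^bsub>msec F Z\<^esub> mres F (W x) Z (b x)))}"

definition H1 ::
    "('p, 'r) ringed_space \<Rightarrow> ('p, 'r, 'm) mod_presheaf
      \<Rightarrow> (('p \<Rightarrow> 'p set) \<times> ('p \<Rightarrow> 'p \<Rightarrow> 'm)) set set" where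
  "H1 X F = cech_cocycles X F // cech_rel X F"

definition H1_zero ::
    "('p, 'r) ringed_space \<Rightarrow> ('p, 'r, 'm) mod_presheaf
      \<Rightarrow> (('p \<Rightarrow> 'p set) \<times> ('p \<Rightarrow> 'p \<Rightarrow> 'm)) set" where
  "H1_zero X F = cech_rel X F `` {(\<lambda>_. whole X, \<lambda>_ _. \<zero>\<^bsub>msec F (whole X)\<^esub>)}"


section \<open>Proj of a graded ring\<close>

text \<open>The grading of \<open>S\<close> is given by its homogeneous components \<open>G n\<close>.\<close>

definition Proj_points :: "('a, 'b) ring_scheme \<Rightarrow> (nat \<Rightarrow> 'a set) \<Rightarrow> 'a set set" where
  "Proj_points S G =
     {q. primeideal q S \<and> Idl\<^bsub>S\<^esub> (q \<inter> (\<Union>n. G n)) = q \<and> \<not> (\<Union>n\<in>{0<..}. G n) \<subseteq> q}"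

definition Proj_top :: "('a, 'b) ring_scheme \<Rightarrow> (nat \<Rightarrow> 'a set) \<Rightarrow> 'a set topology" where
  "Proj_top S G =
     topology (\<lambda>U. \<exists>T \<subseteq> (\<Union>n. G n). U = Proj_points S G - {q \<in> Proj_points S G. T \<subseteq> q})"

text \<open>The fraction \<open>a/f\<close> in the degree zero part of the localization of \<open>S\<close> at the homogeneous
  elements outside \<open>q\<close>, as an equivalence class of pairs.\<close>

definition hfrac ::
    "('a, 'b) ring_scheme \<Rightarrow> (nat \<Rightarrow> 'a set) \<Rightarrow> 'a set \<Rightarrow> 'a \<Rightarrow> 'a \<Rightarrow> ('a \<times> 'a) set" where
  "hfrac S G q a f =
     {(b, g). (\<exists>n. b \<in> G n \<and> g \<in> G n) \<and> g \<notin> q \<and>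
        (\<exists>h\<in>(\<Union>n. G n). h \<notin> q \<and> h \<otimes>\<^bsub>S\<^esub> (a \<otimes>\<^bsub>S\<^esub> g) = h \<otimes>\<^bsub>S\<^esub> (b \<otimes>\<^bsub>S\<^esub> f))}"

definition hfrac_add ::
    "('a, 'b) ring_scheme \<Rightarrow> (nat \<Rightarrow> 'a set) \<Rightarrow> 'a set \<Rightarrow> ('a \<times> 'a) set \<Rightarrow> ('a \<times> 'a) set \<Rightarrow> ('a \<times> 'a) set" where
  "hfrac_add S G q A B =
     (\<Union>(a, f)\<in>A. \<Union>(b, g)\<in>B. hfrac S G q (a \<otimes>\<^bsub>S\<^esub> g \<oplus>\<^bsub>S\<^esub> b \<otimes>\<^bsub>S\<^esub> f) (f \<otimes>\<^bsub>S\<^esub> g))"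

definition hfrac_mult ::
    "('a, 'b) ring_scheme \<Rightarrow> (nat \<Rightarrow> 'a set) \<Rightarrow> 'a set \<Rightarrow> ('a \<times> 'a) set \<Rightarrow> ('a \<times> 'a) set \<Rightarrow> ('a \<times> 'a) set" where
  "hfrac_mult S G q A B =
     (\<Union>(a, f)\<in>A. \<Union>(b, g)\<in>B. hfrac S G q (a \<otimes>\<^bsub>S\<^esub> b) (f \<otimes>\<^bsub>S\<^esub> g))"

text \<open>A section of the structure sheaf over \<open>U\<close> assigns to each \<open>q \<in> U\<close> an element of the
  homogeneous localization at \<open>q\<close>, and is locally given by one fraction.\<close>

definition Proj_sections ::
    "('a, 'b) ring_scheme \<Rightarrow> (nat \<Rightarrow> 'a set) \<Rightarrow> 'a set set \<Rightarrow> ('a set \<Rightarrow> ('a \<times> 'a) set) ring" where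
  "Proj_sections S G U =
     \<lparr>carrier = {s \<in> extensional U. \<forall>q\<in>U. \<exists>V n a f.
         openin (Proj_top S G) V \<and> q \<in> V \<and> V \<subseteq> U \<and> a \<in> G n \<and> f \<in> G n \<and>
         (\<forall>q'\<in>V. f \<notin> q' \<and> s q' = hfrac S G q' a f)},
      monoid.mult = (\<lambda>s t. \<lambda>q\<in>U. hfrac_mult S G q (s q) (t q)),
      one = (\<lambda>q\<in>U. hfrac S G q \<one>\<^bsub>S\<^esub> \<one>\<^bsub>S\<^esub>),
      zero = (\<lambda>q\<in>U. hfrac S G q \<zero>\<^bsub>S\<^esub> \<one>\<^bsub>S\<^esub>),
      add = (\<lambda>s t. \<lambda>q\<in>U. hfrac_add S G q (s q) (t q))\<rparr>"

definition Proj ::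
    "('a, 'b) ring_scheme \<Rightarrow> (nat \<Rightarrow> 'a set) \<Rightarrow> ('a set, 'a set \<Rightarrow> ('a \<times> 'a) set) ringed_space" where
  "Proj S G =
     \<lparr>top_of = Proj_top S G, rsec = Proj_sections S G, rres = (\<lambda>U V s. restrict s V)\<rparr>"


section \<open>Differential operators\<close>

text \<open>The operator \<open>\<Sum>\<^sub>i a\<^sub>i(z) \<partial>\<^sup>i\<close> is represented by the polynomial with coefficients \<open>a\<^sub>i\<close>;
  the product of operators is not the product of the type of polynomials, but comes from
  \<open>\<partial>\<^sup>i b = \<Sum>\<^sub>k (i choose k) b\<^sup>(\<^sup>k\<^sup>) \<partial>\<^sup>i\<^sup>-\<^sup>k\<close>. The order of a nonzero operator is its \<open>degree\<close>.\<close>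

type_synonym diffop = "complex fps poly"

definition op_mult :: "diffop \<Rightarrow> diffop \<Rightarrow> diffop" where
  "op_mult P Q =
     (\<Sum>i\<le>degree P. \<Sum>j\<le>degree Q. \<Sum>k\<le>i.
        Polynomial.monom
          (of_nat (i choose k) * Polynomial.coeff P i * (fps_deriv ^^ k) (Polynomial.coeff Q j))
          (i - k + j))"

definition diffop_ring :: "diffop ring" where
  "diffop_ring = \<lparr>carrier = UNIV, monoid.mult = op_mult, one = 1, zero = 0, add = (+)\<rparr>"

definition const_op :: "complex \<Rightarrow> diffop" where
  "const_op c = [:fps_const c:]"

definition formally_elliptic :: "diffop \<Rightarrow> bool" where
  "formally_elliptic P \<longleftrightarrow> degree P > 0 \<and> (\<exists>c. c \<noteq> 0 \<and> lead_coeff P = fps_const c)"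

definition normalized_op :: "diffop \<Rightarrow> bool" where
  "normalized_op P \<longleftrightarrow>
     degree P > 0 \<and> lead_coeff P = 1 \<and> Polynomial.coeff P (degree P - 1) = 0"

text \<open>Two elements of minimal positive order \<open>n\<close> agree up to a constant factor and an additive
  constant. Hence for \<open>n \<ge> 2\<close> one of them is normalized up to a factor iff all are; for \<open>n = 1\<close> the
  existential form is the one that admits the algebra \<open>\<complex>[\<partial>]\<close>.\<close>

definition spectral_algebra :: "diffop set \<Rightarrow> bool" where
  "spectral_algebra B \<longleftrightarrow>
     subcring B diffop_ring \<and> range const_op \<subseteq> B \<and>
     (\<exists>P\<in>B. formally_elliptic P) \<and>
     (\<exists>P\<in>B. 0 < degree P \<and> (\<forall>Q\<in>B. 0 < degree Q \<longrightarrow> degree P \<le> degree Q) \<and>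
        (\<exists>c N. c \<noteq> 0 \<and> normalized_op N \<and> P = Polynomial.smult (fps_const c) N))"

definition alg_rank :: "diffop set \<Rightarrow> nat" where
  "alg_rank B = Gcd (degree ` B)"

abbreviation alg_ring :: "diffop set \<Rightarrow> diffop ring" where
  "alg_ring B \<equiv> diffop_ring\<lparr>carrier := B\<rparr>"


section \<open>The spectral curve\<close>

definition filt :: "diffop set \<Rightarrow> nat \<Rightarrow> diffop set" where
  "filt B i = {P \<in> B. degree P \<le> i * alg_rank B}"

text \<open>The library represents the polynomial \<open>\<Sum>\<^sub>i P\<^sub>i t\<^sup>i\<close> by the function \<open>i \<mapsto> P\<^sub>i\<close>.\<close>

type_synonym rees = "nat \<Rightarrow> diffop"

definition rees_ring :: "diffop set \<Rightarrow> (diffop, rees) up_ring" where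
  "rees_ring B =
     (let R = UP (alg_ring B) in R\<lparr>carrier := {f \<in> carrier R. \<forall>i. f i \<in> filt B i}\<rparr>)"

definition rees_grading :: "diffop set \<Rightarrow> nat \<Rightarrow> rees set" where
  "rees_grading B n = {f \<in> carrier (rees_ring B). \<forall>i. i \<noteq> n \<longrightarrow> f i = 0}"

definition tmon :: "diffop \<Rightarrow> nat \<Rightarrow> rees" where
  "tmon P n = (\<lambda>i. if i = n then P else 0)"

type_synonym spt = "rees set"
type_synonym sfun = "spt \<Rightarrow> (rees \<times> rees) set"

definition curve :: "diffop set \<Rightarrow> (spt, sfun) ringed_space" where
  "curve B = Proj (rees_ring B) (rees_grading B)"

text \<open>The affine open subset \<open>D\<^sub>+(t)\<close>, whose ring of functions, the degree zero part of the
  localization of the Rees algebra at \<open>t\<close>, is identified with \<open>B\<close>; see \<open>alg_section\<close>.\<close>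

definition affine_part :: "diffop set \<Rightarrow> spt set" where
  "affine_part B = {q \<in> Proj_points (rees_ring B) (rees_grading B). tmon 1 1 \<notin> q}"

definition inf_pt :: "diffop set \<Rightarrow> spt" where
  "inf_pt B = PIdl\<^bsub>rees_ring B\<^esub> (tmon 1 1)"

text \<open>The identification \<open>B \<cong> \<Gamma>(X\<^sub>0, \<O>)\<close> sends \<open>P\<close> to \<open>P t\<^sup>n / t\<^sup>n\<close> for any \<open>n\<close> with \<open>P \<in> filt B n\<close>;
  \<open>n = ord P\<close> is such an exponent because the rank is positive.\<close>

definition alg_section :: "diffop set \<Rightarrow> diffop \<Rightarrow> sfun" where
  "alg_section B P =
     (\<lambda>q\<in>affine_part B.
        hfrac (rees_ring B) (rees_grading B) q (tmon P (degree P)) (tmon 1 (degree P)))"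

definition const_section :: "diffop set \<Rightarrow> spt set \<Rightarrow> complex \<Rightarrow> sfun" where
  "const_section B U c =
     (\<lambda>q\<in>U. hfrac (rees_ring B) (rees_grading B) q (tmon (const_op c) 0) (tmon 1 0))"

definition sections_on_affine ::
    "diffop set \<Rightarrow> (spt, sfun, 'm) mod_presheaf \<Rightarrow> (diffop, 'm) module" where
  "sections_on_affine B F = restrict_scalars (alg_section B) (msec F (affine_part B))"

definition global_sections ::
    "diffop set \<Rightarrow> (spt, sfun, 'm) mod_presheaf \<Rightarrow> (complex, 'm) module" where
  "global_sections B F =
     restrict_scalars (const_section B (whole (curve B))) (msec F (whole (curve B)))"

definition fiber_at_inf ::
    "diffop set \<Rightarrow> (spt, sfun, 'm) mod_presheaf \<Rightarrow> (complex, (spt set \<times> 'm) set set) module" where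
  "fiber_at_inf B F =
     restrict_scalars
       (\<lambda>c. rgerm (curve B) (inf_pt B) (whole (curve B)) (const_section B (whole (curve B)) c))
       (fiber (curve B) F (inf_pt B))"


section \<open>The spectral module\<close>

text \<open>The right action of \<open>P\<close> on the class of \<open>f(\<partial>)\<close> in the quotient of the operators by the
  left multiples of \<open>z\<close>: the class of the product \<open>f(\<partial>) P\<close>, read off in \<open>\<complex>[\<partial>]\<close> by evaluating
  the coefficients at \<open>0\<close>.\<close>

definition op_action :: "complex poly \<Rightarrow> diffop \<Rightarrow> complex poly" where
  "op_action f P = map_poly (\<lambda>a. fps_nth a 0) (op_mult (map_poly fps_const f) P)"

definition spectral_module :: "(diffop, complex poly) module" where
  "spectral_module =
     \<lparr>carrier = UNIV, monoid.mult = undefined, one = undefined, zero = 0, add = (+),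
      Module.module.smult = (\<lambda>P f. op_action f P)\<rparr>"

definition low_space :: "nat \<Rightarrow> (complex, complex poly) module" where
  "low_space r =
     \<lparr>carrier = {\<Sum>i<r. Polynomial.monom (c i) i | c. True},
      monoid.mult = undefined, one = undefined, zero = 0, add = (+), Module.module.smult = Polynomial.smult\<rparr>"

definition spectral_pair ::
    "diffop set \<Rightarrow> (spt, sfun, 'm) mod_presheaf \<Rightarrow> ('m \<Rightarrow> complex poly) \<Rightarrow> bool" where
  "spectral_pair B F \<phi> \<longleftrightarrow>
     module_sheaf (curve B) F \<and> coherent (curve B) F \<and> torsion_free (curve B) F \<and>
     mod_iso (alg_ring B) (sections_on_affine B F) spectral_module \<phi> \<and>
     mod_iso complex_ring (global_sections B F) (low_space (alg_rank B))
       (\<lambda>s. \<phi> (mres F (whole (curve B)) (affine_part B) s))"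

end

theory Submission
  imports Defs
begin

text \<open>The sheaf has an explicit model inside the module \<open>K\<close> of fractions \<open>f/Q\<close> with \<open>f \<in> \<complex>[\<partial>]\<close> and
  nonzero \<open>Q \<in> B\<close>: a section over \<open>U\<close> is a fraction which, for every \<open>q \<in> U\<close>, has a representative \<open>f/Q\<close>
  with \<open>Q t\<^sup>n \<notin> q\<close> and \<open>ord f < (n + 1) r\<close>. Leading coefficients of elements of \<open>B\<close> are constant, so
  orders add up, and dividing with remainder gives \<open>K = \<complex>[\<partial>] + K\<^sub>p\<close> and \<open>\<complex>[\<partial>] \<inter> K\<^sub>p = H\<close> for the stalk
  \<open>K\<^sub>p\<close> of the model at infinity.

  The sections of any pair embed into \<open>K\<close> by clearing denominators; coherence and torsion freeness make
  restrictions injective. Over \<open>X\<^sub>0\<close> the stalks are those of the model because \<open>\<phi>\<close> identifies the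
  sections over \<open>X\<^sub>0\<close> with \<open>\<complex>[\<partial>]\<close>. The stalk at infinity contains \<open>H\<close>, hence \<open>K\<^sub>p\<close> by Nakayama's lemma,
  and a larger stalk would produce a global section outside \<open>H\<close>. So every pair is isomorphic to the model.

  The maximal ideal at infinity times \<open>K\<^sub>p\<close> consists of the \<open>f/Q\<close> with \<open>ord f < ord Q\<close>, and it is
  complementary to \<open>H\<close> in \<open>K\<^sub>p\<close>. A cocycle takes values in \<open>K\<close>, where it is a difference
  \<open>\<beta> y - \<beta> x\<close>; locally \<open>\<beta>\<close> is constant modulo stalks. Clearing denominators on the affine curve \<open>X\<^sub>0\<close>
  yields a single element of \<open>K\<close> approximating \<open>\<beta>\<close> at all of its points, and \<open>K = \<complex>[\<partial>] + K\<^sub>p\<close> permits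
  its correction at infinity.\<close>

text \<open>The main obstacle is finiteness, since B enters without generators and without a
  Noetherian property. Over the affine part, the elements R of B for which a local assertion holds
  on \<open>aff R\<close> are arranged to form an ideal; if every point lies in one of these sets, a
  Zorn argument puts 1 into the ideal. For coherence, one elliptic E of order d r suffices: division
  by E makes \<complex>[\<partial>] finitely generated over \<complex>[E], and orders modulo d r
  leave finitely many minimal leading positions among relations. At infinity only orders count. The
  least positive difference of two orders in B is r, so some C/A with ord A = ord C + r serves as a
  local parameter. The bound ord f < (n + 1) r is the shift for which a polynomial is regular at
  infinity exactly when its degree is below r, and this produces H. Every nonempty open set contains
  the generic point, so functions and sections of the model are single fractions and restriction
  does not change them. The empty open set is the exception and has its own clause in the
  definitions of the model.\<close>

notation op_mult (infixl \<open>\<star>\<close> 70)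
notation op_action (infixl \<open>\<diamondop>\<close> 70)

section \<open>Differential operators\<close>

text \<open>The action of operators on power series. It is faithful and turns \<open>op_mult\<close>
  into composition of maps, so associativity and the other ring laws are inherited from composition
  instead of being checked on triple sums of coefficients.\<close>

definition op_apply :: "diffop \<Rightarrow> complex fps \<Rightarrow> complex fps" where
  "op_apply P u = (\<Sum>i\<le>degree P. Polynomial.coeff P i * (fps_deriv ^^ i) u)"

lemma op_apply_bound:
  assumes "degree P \<le> N"
  shows "op_apply P u = (\<Sum>i\<le>N. Polynomial.coeff P i * (fps_deriv ^^ i) u)"
  unfolding op_apply_def using assms
  by (intro sum.mono_neutral_left) (auto simp: coeff_eq_0)

lemma op_apply_add: "op_apply (P + Q) u = op_apply P u + op_apply Q u"
proof -
  let ?N = "max (degree P) (degree Q)"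
  have "degree (P + Q) \<le> ?N" by (rule degree_add_le_max)
  then show ?thesis
    by (simp add: op_apply_bound[of _ ?N] sum.distrib[symmetric] algebra_simps)
qed

lemma op_apply_0 [simp]: "op_apply 0 u = 0"
  by (simp add: op_apply_def)

lemma op_apply_1 [simp]: "op_apply 1 u = u"
  by (simp add: op_apply_def)

lemma op_apply_minus: "op_apply (- P) u = - op_apply P u"
  using op_apply_add[of P "- P" u] by (simp add: eq_neg_iff_add_eq_0 add.commute)

lemma op_apply_diff: "op_apply (P - Q) u = op_apply P u - op_apply Q u"
  using op_apply_add[of P "- Q" u] by (simp add: op_apply_minus)

lemma op_apply_sum: "op_apply (sum f A) u = (\<Sum>i\<in>A. op_apply (f i) u)"
  by (induction A rule: infinite_finite_induct) (auto simp: op_apply_add)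

lemma op_apply_monom: "op_apply (Polynomial.monom c n) u = c * (fps_deriv ^^ n) u"
proof -
  have "op_apply (Polynomial.monom c n) u = (\<Sum>i\<le>n. if i = n then c * (fps_deriv ^^ n) u else 0)"
    by (subst op_apply_bound[of _ n]) (simp add: degree_monom_le, intro sum.cong, auto)
  then show ?thesis by simp
qed

lemma fps_deriv_pow_add: "(fps_deriv ^^ n) (u + v) = (fps_deriv ^^ n) u + (fps_deriv ^^ n) (v :: complex fps)"
  by (induction n) auto

lemma fps_deriv_pow_0 [simp]: "(fps_deriv ^^ n) 0 = (0 :: complex fps)"
  by (induction n) auto

lemma fps_deriv_pow_sum:
  "(fps_deriv ^^ n) (sum f A) = (\<Sum>i\<in>A. (fps_deriv ^^ n) (f i :: complex fps))"
  by (induction A rule: infinite_finite_induct) (auto simp: fps_deriv_pow_add)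

text \<open>The general Leibniz rule; the induction step is Pascal's identity. It is the commutation
  rule that \<open>op_mult\<close> encodes, and it is what makes \<open>op_apply_mult\<close>
  hold.\<close>

lemma fps_deriv_pow_mult:
  "(fps_deriv ^^ n) (u * v) =
     (\<Sum>k\<le>n. of_nat (n choose k) * (fps_deriv ^^ k) u * (fps_deriv ^^ (n - k)) (v :: complex fps))"
proof (induction n)
  case 0
  then show ?case by simp
next
  case (Suc n)
  let ?t = "\<lambda>i j. (fps_deriv ^^ i) u * (fps_deriv ^^ j) v"
  have D: "fps_deriv (of_nat m * (fps_deriv ^^ i) u * (fps_deriv ^^ j) v) =
      of_nat m * ?t (Suc i) j + of_nat m * ?t i (Suc j)" for m i j
    by (simp add: algebra_simps)
  have "(fps_deriv ^^ Suc n) (u * v) = (\<Sum>k\<le>n. fps_deriv (of_nat (n choose k) * (fps_deriv ^^ k) u * (fps_deriv ^^ (n - k)) v))"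
    by (simp add: Suc fps_deriv_sum)
  also have "\<dots> = (\<Sum>k\<le>n. of_nat (n choose k) * ?t (Suc k) (n - k)) + (\<Sum>k\<le>n. of_nat (n choose k) * ?t k (Suc n - k))"
    unfolding D by (simp add: sum.distrib Suc_diff_le)
  also have "(\<Sum>k\<le>n. of_nat (n choose k) * ?t k (Suc n - k)) = (\<Sum>k\<le>Suc n. of_nat (n choose k) * ?t k (Suc n - k))"
    by simp
  also have "\<dots> = ?t 0 (Suc n) + (\<Sum>k\<le>n. of_nat (n choose Suc k) * ?t (Suc k) (n - k))"
    by (subst sum.atMost_Suc_shift) simp
  also have "(\<Sum>k\<le>n. of_nat (n choose k) * ?t (Suc k) (n - k)) + (?t 0 (Suc n) + (\<Sum>k\<le>n. of_nat (n choose Suc k) * ?t (Suc k) (n - k)))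
      = ?t 0 (Suc n) + (\<Sum>k\<le>n. of_nat (Suc n choose Suc k) * ?t (Suc k) (n - k))"
    by (simp add: sum.distrib[symmetric] algebra_simps)
  also have "\<dots> = (\<Sum>k\<le>Suc n. of_nat (Suc n choose k) * ?t k (Suc n - k))"
    by (subst sum.atMost_Suc_shift) simp
  finally show ?case by (simp add: mult.assoc)
qed

lemma op_apply_mult: "op_apply (P \<star> Q) u = op_apply P (op_apply Q u)"
proof -
  have pow: "(fps_deriv ^^ i) ((fps_deriv ^^ j) u) = (fps_deriv ^^ (i + j)) u" for i j
    by (simp add: funpow_add)
  have "op_apply (P \<star> Q) u = (\<Sum>i\<le>degree P. \<Sum>j\<le>degree Q. \<Sum>k\<le>i.
      of_nat (i choose k) * Polynomial.coeff P i * (fps_deriv ^^ k) (Polynomial.coeff Q j) * (fps_deriv ^^ (i - k + j)) u)"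
    unfolding op_mult_def by (simp add: op_apply_sum op_apply_monom)
  also have "\<dots> = (\<Sum>i\<le>degree P. \<Sum>j\<le>degree Q. Polynomial.coeff P i * (fps_deriv ^^ i) (Polynomial.coeff Q j * (fps_deriv ^^ j) u))"
    by (simp add: fps_deriv_pow_mult sum_distrib_left pow algebra_simps)
  also have "\<dots> = op_apply P (op_apply Q u)"
    by (simp add: op_apply_def fps_deriv_pow_sum sum_distrib_left)
  finally show ?thesis .
qed

lemma fps_deriv_pow_const_mult:
  "(fps_deriv ^^ n) (fps_const c * u) = fps_const c * (fps_deriv ^^ n) (u :: complex fps)"
  by (induction n) auto

lemma fps_deriv_pow_X_power: "(fps_deriv ^^ n) (fps_X ^ n :: complex fps) = fps_const (fact n)"
proof (induction n)
  case (Suc n)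
  have "(fps_deriv ^^ Suc n) (fps_X ^ Suc n :: complex fps) = (fps_deriv ^^ n) (fps_deriv (fps_X ^ Suc n))"
    by (simp only: funpow_Suc_right o_apply)
  also have "fps_deriv (fps_X ^ Suc n :: complex fps) = fps_const (of_nat (Suc n)) * fps_X ^ n"
    by (subst fps_deriv_power) simp
  finally show ?case
    by (simp only: fps_deriv_pow_const_mult Suc) simp
qed simp

text \<open>Testing on z^n, with n the lowest index of a nonzero coefficient, isolates that
  coefficient: lower terms are absent and higher derivatives kill z^n. Hence the action is
  faithful.\<close>

lemma op_apply_eq_0D:
  assumes "\<And>u. op_apply P u = 0"
  shows "P = 0"
proof (rule ccontr)
  assume "P \<noteq> 0"
  define n where "n = (LEAST n. Polynomial.coeff P n \<noteq> 0)"
  have ex: "\<exists>n. Polynomial.coeff P n \<noteq> 0" using \<open>P \<noteq> 0\<close> by (metis leading_coeff_0_iff)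
  have n: "Polynomial.coeff P n \<noteq> 0" unfolding n_def by (rule LeastI_ex[OF ex])
  have less: "Polynomial.coeff P i = 0" if "i < n" for i
    using that not_less_Least unfolding n_def by blast
  have big: "(fps_deriv ^^ i) (fps_X ^ n :: complex fps) = 0" if "i > n" for i
  proof -
    define k where "k = i - Suc n"
    then have "i = k + Suc n" using that by simp
    then have "(fps_deriv ^^ i) (fps_X ^ n :: complex fps) = (fps_deriv ^^ k) (fps_deriv ((fps_deriv ^^ n) (fps_X ^ n)))"
      by (simp only: funpow_add funpow.simps o_apply)
    then show ?thesis by (simp add: fps_deriv_pow_X_power)
  qed
  have "op_apply P (fps_X ^ n) = (\<Sum>i\<le>degree P. if i = n then Polynomial.coeff P n * fps_const (fact n) else 0)"
    unfolding op_apply_def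
  proof (intro sum.cong refl)
    fix i
    show "Polynomial.coeff P i * (fps_deriv ^^ i) (fps_X ^ n) = (if i = n then Polynomial.coeff P n * fps_const (fact n) else 0)"
      using less big fps_deriv_pow_X_power by (cases i n rule: linorder_cases) auto
  qed
  also have "\<dots> = Polynomial.coeff P n * fps_const (fact n)"
    using le_degree[OF n] by simp
  finally show False using assms n by simp
qed

lemma op_eqI: "(\<And>u. op_apply P u = op_apply Q u) \<Longrightarrow> P = Q"
  using op_apply_eq_0D[of "P - Q"] by (simp add: op_apply_diff)

lemma op_apply_add_right: "op_apply P (u + v) = op_apply P u + op_apply P v"
  by (simp add: op_apply_def fps_deriv_pow_add algebra_simps sum.distrib)

lemma op_apply_0_right [simp]: "op_apply P 0 = 0"
  by (simp add: op_apply_def)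

lemma op_mult_assoc: "P \<star> Q \<star> R = P \<star> (Q \<star> R)"
  by (rule op_eqI) (simp add: op_apply_mult)

lemma op_mult_add_left: "(P + Q) \<star> R = P \<star> R + Q \<star> R"
  by (rule op_eqI) (simp add: op_apply_mult op_apply_add)

lemma op_mult_add_right: "P \<star> (Q + R) = P \<star> Q + P \<star> R"
  by (rule op_eqI) (simp add: op_apply_mult op_apply_add op_apply_add_right)

lemma op_mult_1_left [simp]: "1 \<star> P = P"
  by (rule op_eqI) (simp add: op_apply_mult)

lemma op_mult_1_right [simp]: "P \<star> 1 = P"
  by (rule op_eqI) (simp add: op_apply_mult)

lemma op_mult_0_left [simp]: "0 \<star> P = 0"
  by (rule op_eqI) (simp add: op_apply_mult)

lemma op_mult_0_right [simp]: "P \<star> 0 = 0"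
  by (rule op_eqI) (simp add: op_apply_mult)

lemma op_mult_minus_left: "(- P) \<star> Q = - (P \<star> Q)"
  using op_mult_add_left[of P "- P" Q] by (simp add: eq_neg_iff_add_eq_0 add.commute)

lemma op_mult_minus_right: "P \<star> (- Q) = - (P \<star> Q)"
  using op_mult_add_right[of P Q "- Q"] by (simp add: eq_neg_iff_add_eq_0 add.commute)

lemma op_mult_diff_left: "(P - Q) \<star> R = P \<star> R - Q \<star> R"
  using op_mult_add_left[of P "- Q" R] by (simp add: op_mult_minus_left)

lemma op_mult_diff_right: "P \<star> (Q - R) = P \<star> Q - P \<star> R"
  using op_mult_add_right[of P Q "- R"] by (simp add: op_mult_minus_right)

primrec op_pow :: "diffop \<Rightarrow> nat \<Rightarrow> diffop" where
  "op_pow P 0 = 1"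
| "op_pow P (Suc n) = P \<star> op_pow P n"

lemma op_pow_add: "op_pow P (m + n) = op_pow P m \<star> op_pow P n"
  by (induction m) (auto simp: op_mult_assoc)

lemma ring_diffop_ring: "ring diffop_ring"
proof (rule ringI)
  show "abelian_group diffop_ring"
    proof (rule abelian_groupI)
    fix P assume "P \<in> carrier diffop_ring"
    show "\<exists>Q\<in>carrier diffop_ring. Q \<oplus>\<^bsub>diffop_ring\<^esub> P = \<zero>\<^bsub>diffop_ring\<^esub>"
      by (rule bexI[of _ "- P"]) (auto simp: diffop_ring_def)
  qed (auto simp: diffop_ring_def add_ac)
  show "monoid diffop_ring"
    by (rule monoidI) (auto simp: diffop_ring_def op_mult_assoc)
qed (auto simp: diffop_ring_def op_mult_add_left op_mult_add_right)

lemma op_mult_degree_le: "degree (P \<star> Q) \<le> degree P + degree Q"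
  unfolding op_mult_def
  by (intro degree_sum_le finite_atMost) (auto intro!: order.trans[OF degree_monom_le])

lemma op_mult_coeff_sum:
  assumes "degree P \<le> n" "degree Q \<le> d"
  shows "P \<star> Q = (\<Sum>i\<le>n. \<Sum>j\<le>d. \<Sum>k\<le>i.
        Polynomial.monom
          (of_nat (i choose k) * Polynomial.coeff P i * (fps_deriv ^^ k) (Polynomial.coeff Q j))
          (i - k + j))"
proof -
  have "(\<Sum>j\<le>degree Q. \<Sum>k\<le>i.
        Polynomial.monom
          (of_nat (i choose k) * Polynomial.coeff P i * (fps_deriv ^^ k) (Polynomial.coeff Q j))
          (i - k + j)) = (\<Sum>j\<le>d. \<Sum>k\<le>i.
        Polynomial.monom
          (of_nat (i choose k) * Polynomial.coeff P i * (fps_deriv ^^ k) (Polynomial.coeff Q j))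
          (i - k + j))" for i
    using assms by (intro sum.mono_neutral_left) (auto simp: coeff_eq_0)
  moreover have "(\<Sum>i\<le>degree P. \<Sum>j\<le>d. \<Sum>k\<le>i.
        Polynomial.monom
          (of_nat (i choose k) * Polynomial.coeff P i * (fps_deriv ^^ k) (Polynomial.coeff Q j))
          (i - k + j)) = (\<Sum>i\<le>n. \<Sum>j\<le>d. \<Sum>k\<le>i.
        Polynomial.monom
          (of_nat (i choose k) * Polynomial.coeff P i * (fps_deriv ^^ k) (Polynomial.coeff Q j))
          (i - k + j))"
    using assms by (intro sum.mono_neutral_left) (auto simp: coeff_eq_0)
  ultimately show ?thesis unfolding op_mult_def by simp
qed

text \<open>Only i = n, j = d and k = 0 reach order n + d. The numbers n and d are mere bounds, so
  the rule also covers factors whose coefficient at that place vanishes.\<close>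

lemma op_mult_coeff_top:
  assumes "degree P \<le> n" "degree Q \<le> d"
  shows "Polynomial.coeff (P \<star> Q) (n + d) = Polynomial.coeff P n * Polynomial.coeff Q d"
proof -
  have "Polynomial.coeff (P \<star> Q) (n + d) = (\<Sum>i\<le>n. \<Sum>j\<le>d. \<Sum>k\<le>i.
     if i - k + j = n + d then of_nat (i choose k) * Polynomial.coeff P i * (fps_deriv ^^ k) (Polynomial.coeff Q j) else 0)"
    by (simp add: op_mult_coeff_sum[OF assms] coeff_sum)
  also have "\<dots> = (\<Sum>i\<le>n. \<Sum>j\<le>d. \<Sum>k\<le>i.
     if k = 0 then if j = d then if i = n then Polynomial.coeff P n * Polynomial.coeff Q d else 0 else 0 else 0)"
    by (intro sum.cong refl) auto
  also have "\<dots> = Polynomial.coeff P n * Polynomial.coeff Q d"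
    by (simp)
  finally show ?thesis .
qed

lemma op_mult_monom_monom:
  "Polynomial.monom a n \<star> Polynomial.monom b d =
     (\<Sum>k\<le>n. Polynomial.monom (of_nat (n choose k) * a * (fps_deriv ^^ k) b) (n - k + d))"
proof (rule op_eqI)
  fix u :: "complex fps"
  have "(fps_deriv ^^ (n - k)) ((fps_deriv ^^ d) u) = (fps_deriv ^^ (n - k + d)) u" for k
    by (simp only: funpow_add o_apply)
  then show "op_apply (Polynomial.monom a n \<star> Polynomial.monom b d) u =
    op_apply (\<Sum>k\<le>n. Polynomial.monom (of_nat (n choose k) * a * (fps_deriv ^^ k) b) (n - k + d)) u"
    by (simp add: op_apply_mult op_apply_monom op_apply_sum fps_deriv_pow_mult sum_distrib_left
        mult_ac)
qed

text \<open>Each derivative that falls on b lowers the order by one, so only the summand k = 1 of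
  the Leibniz expansion lands here; its binomial coefficient is n.\<close>

lemma op_mult_monom_monom_subtop:
  assumes "n + d > 0"
  shows "Polynomial.coeff (Polynomial.monom a n \<star> Polynomial.monom b d) (n + d - 1) = of_nat n * a * fps_deriv b"
proof -
  have "Polynomial.coeff (Polynomial.monom a n \<star> Polynomial.monom b d) (n + d - 1) =
    (\<Sum>k\<le>n. if n - k + d = n + d - 1 then of_nat (n choose k) * a * (fps_deriv ^^ k) b else 0)"
    by (simp add: op_mult_monom_monom coeff_sum)
  also have "\<dots> = (\<Sum>k\<le>n. if k = 1 then of_nat n * a * fps_deriv b else 0)"
    using assms by (intro sum.cong refl) auto
  also have "\<dots> = of_nat n * a * fps_deriv b"
    by (cases n) auto
  finally show ?thesis .
qed

lemma op_mult_nonzero: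
  assumes "P \<noteq> 0" "Q \<noteq> 0"
  shows "P \<star> Q \<noteq> 0" "degree (P \<star> Q) = degree P + degree Q"
proof -
  have "Polynomial.coeff (P \<star> Q) (degree P + degree Q) \<noteq> 0"
    using assms by (simp add: op_mult_coeff_top)
  then show "P \<star> Q \<noteq> 0" "degree (P \<star> Q) = degree P + degree Q"
    using op_mult_degree_le[of P Q] le_degree le_antisym by (metis coeff_0, metis le_degree le_antisym)
qed

lemma op_mult_eq_0_iff [simp]: "P \<star> Q = 0 \<longleftrightarrow> P = 0 \<or> Q = 0"
  using op_mult_nonzero(1) by auto

text \<open>The coefficient of \<open>[P, Q]\<close> just below the top is \<open>n a b'\<close>, where \<open>a\<close> and \<open>b\<close> are the
  leading coefficients and \<open>a\<close> is constant.\<close>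

lemma lead_coeff_deriv_eq_0:
  assumes ell: "formally_elliptic P" and comm: "P \<star> Q = Q \<star> P"
  shows "fps_deriv (lead_coeff Q) = 0"
proof -
  define n d a b where "n = degree P" and "d = degree Q" and "a = lead_coeff P" and "b = lead_coeff Q"
  define P1 Q1 where "P1 = P - Polynomial.monom a n" and "Q1 = Q - Polynomial.monom b d"
  let ?M = "Polynomial.monom a n" and ?N = "Polynomial.monom b d"
  obtain c where c: "c \<noteq> 0" "a = fps_const c" and n: "n > 0"
    using ell unfolding formally_elliptic_def n_def a_def by blast
  have P: "P = ?M + P1" and Q: "Q = ?N + Q1" by (auto simp: P1_def Q1_def)
  have P1: "degree P1 \<le> n - 1"
    unfolding P1_def a_def n_def by (rule degree_le) (use n n_def in \<open>auto simp: coeff_eq_0\<close>)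
  \<comment> \<open>For d = 0 the truncated difference d - 1 is again 0, and the bound would not
    express that Q1 is of lower order; so its vanishing is recorded separately.\<close>
  have Q1: "degree Q1 \<le> d - 1" "d = 0 \<Longrightarrow> Q1 = 0"
  proof -
    show "degree Q1 \<le> d - 1"
      unfolding Q1_def b_def d_def
    proof (rule degree_le, intro allI impI)
      fix i assume "i > degree Q - 1"
      then show "Polynomial.coeff (Q - Polynomial.monom (lead_coeff Q) (degree Q)) i = 0"
        by (cases "i = degree Q") (auto simp: coeff_eq_0)
    qed
    show "Q1 = 0" if "d = 0"
      using that unfolding Q1_def b_def d_def
      by (metis degree_0_id diff_self monom_0 of_nat_0 degree_eq_zeroE lead_coeff_pCons(2) coeff_pCons_0)
  qed
  \<comment> \<open>The orders n and d - 1 add up to n + d - 1, so this is a top coefficient, and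
    there the product is commutative. The next claim is the same with the roles exchanged.\<close>
  have MQ1: "Polynomial.coeff (?M \<star> Q1) (n + d - 1) = Polynomial.coeff (Q1 \<star> ?M) (n + d - 1)"
  proof (cases "d = 0")
    case False
    then have "n + d - 1 = n + (d - 1)" by simp
    moreover have "Polynomial.coeff (?M \<star> Q1) (n + (d - 1)) = Polynomial.coeff (Q1 \<star> ?M) ((d - 1) + n)"
      by (simp only: op_mult_coeff_top[OF degree_monom_le Q1(1)] op_mult_coeff_top[OF Q1(1) degree_monom_le] mult.commute)
    ultimately show ?thesis by (simp add: add.commute)
  qed (simp add: Q1)
  have NP1: "Polynomial.coeff (?N \<star> P1) (n + d - 1) = Polynomial.coeff (P1 \<star> ?N) (n + d - 1)"
  proof -
    have "Polynomial.coeff (?N \<star> P1) (d + (n - 1)) = Polynomial.coeff (P1 \<star> ?N) ((n - 1) + d)"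
      by (simp only: op_mult_coeff_top[OF degree_monom_le P1(1)] op_mult_coeff_top[OF P1(1) degree_monom_le] mult.commute)
    moreover have "d + (n - 1) = n + d - 1" "(n - 1) + d = n + d - 1" using n by auto
    ultimately show ?thesis by (simp only:)
  qed
  have PQ1: "Polynomial.coeff (P1 \<star> Q1) (n + d - 1) = 0" "Polynomial.coeff (Q1 \<star> P1) (n + d - 1) = 0"
  proof -
    have "P1 \<star> Q1 = 0 \<and> Q1 \<star> P1 = 0 \<or> degree P1 + degree Q1 < n + d - 1"
      using P1 Q1 n by (cases "d = 0") auto
    then show "Polynomial.coeff (P1 \<star> Q1) (n + d - 1) = 0" "Polynomial.coeff (Q1 \<star> P1) (n + d - 1) = 0"
      using op_mult_degree_le[of P1 Q1] op_mult_degree_le[of Q1 P1]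
      by (auto simp: coeff_eq_0)
  qed
  have "Polynomial.coeff (?M \<star> ?N) (n + d - 1) = Polynomial.coeff (?N \<star> ?M) (d + n - 1)"
    using arg_cong[OF comm, of "\<lambda>p. Polynomial.coeff p (n + d - 1)"] MQ1 NP1 PQ1
    unfolding P Q by (simp add: op_mult_add_left op_mult_add_right add.commute)
  \<comment> \<open>The right side vanishes because a is constant; n and a are nonzero, which leaves
    b' = 0.\<close>
  then have "of_nat n * a * fps_deriv b = of_nat d * b * fps_deriv a"
    using n op_mult_monom_monom_subtop[of n d a b] op_mult_monom_monom_subtop[of d n b a] by simp
  then show ?thesis using n c by (simp add: b_def)
qed

section \<open>The spectral module\<close>

abbreviation ev0 :: "diffop \<Rightarrow> complex poly" where
  "ev0 \<equiv> map_poly (\<lambda>a. fps_nth a 0)"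

abbreviation const_coeffs :: "complex poly \<Rightarrow> diffop" where
  "const_coeffs \<equiv> map_poly fps_const"

lemma ev0_add: "ev0 (P + Q) = ev0 P + ev0 Q"
  by (rule poly_eqI) (simp add: coeff_map_poly)

lemma degree_ev0_le: "degree (ev0 P) \<le> degree P"
  by (rule degree_le) (simp add: coeff_map_poly coeff_eq_0)

lemma ev0_sum: "ev0 (sum f A) = (\<Sum>i\<in>A. ev0 (f i))"
  by (induction A rule: infinite_finite_induct) (auto simp: ev0_add)

lemma ev0_monom: "ev0 (Polynomial.monom c n) = Polynomial.monom (fps_nth c 0) n"
  by (simp add: map_poly_monom)

lemma ev0_const_coeffs [simp]: "ev0 (const_coeffs f) = f"
  by (rule poly_eqI) (simp add: coeff_map_poly)

lemma const_coeffs_add: "const_coeffs (f + g) = const_coeffs f + const_coeffs g"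
  by (rule poly_eqI) (simp add: coeff_map_poly)

lemma degree_const_coeffs [simp]: "degree (const_coeffs f) = degree f"
  by (simp add: degree_map_poly)

text \<open>The coefficients of the left factor enter a product undifferentiated, so evaluation at 0
  commutes with right multiplication. In other words, the left multiples of z form a right ideal;
  this is why \<open>op_action\<close> is a right action.\<close>

lemma op_action_ev0: "ev0 R \<diamondop> Q = ev0 (R \<star> Q)"
proof -
  have "degree (const_coeffs (ev0 R)) \<le> degree R"
    by (simp add: degree_ev0_le)
  then have "ev0 R \<diamondop> Q = ev0 (\<Sum>i\<le>degree R. \<Sum>j\<le>degree Q. \<Sum>k\<le>i.
        Polynomial.monom
          (of_nat (i choose k) * Polynomial.coeff (const_coeffs (ev0 R)) i * (fps_deriv ^^ k) (Polynomial.coeff Q j))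
          (i - k + j))"
    unfolding op_action_def by (subst op_mult_coeff_sum) auto
  also have "\<dots> = ev0 (R \<star> Q)"
    unfolding op_mult_def by (simp add: ev0_sum ev0_monom coeff_map_poly fps_of_nat[symmetric])
  finally show ?thesis .
qed

lemma op_action_mult: "f \<diamondop> (P \<star> Q) = (f \<diamondop> P) \<diamondop> Q"
proof -
  have "f \<diamondop> (P \<star> Q) = ev0 (const_coeffs f \<star> P \<star> Q)"
    by (simp add: op_action_def op_mult_assoc)
  also have "\<dots> = (f \<diamondop> P) \<diamondop> Q"
    by (simp add: op_action_ev0[symmetric])
  finally show ?thesis .
qed

lemma op_action_add_left: "(f + g) \<diamondop> P = f \<diamondop> P + g \<diamondop> P"
  by (simp add: op_action_def const_coeffs_add op_mult_add_left ev0_add)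

lemma op_action_add_right: "f \<diamondop> (P + Q) = f \<diamondop> P + f \<diamondop> Q"
  by (simp add: op_action_def op_mult_add_right ev0_add)

lemma op_action_1 [simp]: "f \<diamondop> 1 = f"
  by (simp add: op_action_def)

lemma op_action_0_left [simp]: "0 \<diamondop> P = 0"
  using op_action_add_left[of 0 0 P] by simp

lemma op_action_0_right [simp]: "f \<diamondop> 0 = 0"
  using op_action_add_right[of f 0 0] by simp

lemma op_action_minus_left: "(- f) \<diamondop> P = - (f \<diamondop> P)"
  using op_action_add_left[of f "- f" P] by (simp add: eq_neg_iff_add_eq_0 add.commute)

lemma op_action_diff_left: "(f - g) \<diamondop> P = f \<diamondop> P - g \<diamondop> P"
  using op_action_add_left[of f "- g" P] by (simp add: op_action_minus_left)

lemma op_action_minus_right: "f \<diamondop> (- P) = - (f \<diamondop> P)"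
  using op_action_add_right[of f P "- P"] by (simp add: eq_neg_iff_add_eq_0 add.commute)

lemma op_action_diff_right: "f \<diamondop> (P - Q) = f \<diamondop> P - f \<diamondop> Q"
  using op_action_add_right[of f P "- Q"] by (simp add: op_action_minus_right)

lemma op_action_sum_left: "(sum f A) \<diamondop> P = (\<Sum>i\<in>A. f i \<diamondop> P)"
  by (induction A rule: infinite_finite_induct) (auto simp: op_action_add_left)

lemma const_op_mult: "const_op c \<star> P = Polynomial.smult (fps_const c) P"
proof (rule op_eqI)
  fix u
  have "op_apply (Polynomial.smult (fps_const c) P) u = fps_const c * op_apply P u"
    by (subst op_apply_bound[of _ "degree P"])
       (auto simp: op_apply_def sum_distrib_left mult_ac intro: degree_smult_le)
  then show "op_apply (const_op c \<star> P) u = op_apply (Polynomial.smult (fps_const c) P) u"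
    by (simp add: op_apply_mult) (simp add: op_apply_def const_op_def)
qed

lemma op_action_const_op: "f \<diamondop> const_op c = Polynomial.smult c f"
proof -
  have "const_coeffs f \<star> const_op c = Polynomial.smult (fps_const c) (const_coeffs f)"
  proof (rule op_eqI)
    fix u
    have "op_apply (Polynomial.smult (fps_const c) (const_coeffs f)) u = fps_const c * op_apply (const_coeffs f) u"
      by (subst op_apply_bound[of _ "degree f"])
         (auto simp: op_apply_def sum_distrib_left mult_ac intro: degree_smult_le)
    moreover have "op_apply (const_op c) u = fps_const c * u"
      by (simp add: op_apply_def const_op_def)
    ultimately show "op_apply (const_coeffs f \<star> const_op c) u = op_apply (Polynomial.smult (fps_const c) (const_coeffs f)) u"
      by (simp add: op_apply_mult) (simp add: op_apply_def fps_deriv_pow_const_mult sum_distrib_left mult.left_commute)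
  qed
  then show ?thesis
    unfolding op_action_def by (intro poly_eqI) (simp add: coeff_map_poly)
qed

lemma degree_op_action_le: "degree (f \<diamondop> P) \<le> degree f + degree P"
  unfolding op_action_def
  using order.trans[OF degree_ev0_le op_mult_degree_le[of "const_coeffs f" P]] by simp

lemma op_action_coeff_top:
  assumes "degree f \<le> n" "degree P \<le> d"
  shows "Polynomial.coeff (f \<diamondop> P) (n + d) = Polynomial.coeff f n * fps_nth (Polynomial.coeff P d) 0"
  unfolding op_action_def using assms by (simp add: coeff_map_poly op_mult_coeff_top)

section \<open>Commutative algebras of differential operators\<close>

locale spectral =
  fixes B :: "diffop set"
  assumes spectral: "spectral_algebra B"
begin

abbreviation r :: nat where "r \<equiv> alg_rank B"

lemma subcring_B: "subcring B diffop_ring"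
  using spectral by (simp add: spectral_algebra_def)

lemma cring_B: "cring (alg_ring B)"
  using ring.subcring_iff[OF ring_diffop_ring, of B] subcring_B
  by (simp add: diffop_ring_def)

lemma const_B [simp]: "const_op c \<in> B"
  using spectral by (auto simp: spectral_algebra_def)

lemma one_B [simp]: "1 \<in> B" and add_B [simp]: "P \<in> B \<Longrightarrow> Q \<in> B \<Longrightarrow> P + Q \<in> B"
  and mult_B [simp]: "P \<in> B \<Longrightarrow> Q \<in> B \<Longrightarrow> P \<star> Q \<in> B"
  and zero_B [simp]: "0 \<in> B"
  and mult_comm: "P \<in> B \<Longrightarrow> Q \<in> B \<Longrightarrow> P \<star> Q = Q \<star> P"
  using subcringE[OF subcring_B] by (auto simp: diffop_ring_def)

lemma const_op_neg1: "const_op (-1) \<star> P = - P"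
  by (simp add: const_op_mult fps_const_neg[symmetric])

lemma uminus_B [simp]: "P \<in> B \<Longrightarrow> - P \<in> B"
  using mult_B[OF const_B[of "-1"], of P] by (simp add: const_op_neg1)

lemma diff_B [simp]: "P \<in> B \<Longrightarrow> Q \<in> B \<Longrightarrow> P - Q \<in> B"
  using add_B[of P "- Q"] by simp

lemma pow_B [simp]: "P \<in> B \<Longrightarrow> op_pow P n \<in> B"
  by (induction n) auto

lemma mult_left_comm: "P \<in> B \<Longrightarrow> Q \<in> B \<Longrightarrow> P \<star> (Q \<star> R) = Q \<star> (P \<star> R)"
  by (metis mult_comm op_mult_assoc)

lemmas mult_ac_B = op_mult_assoc mult_comm mult_left_comm

lemma mult_cancel_B:
  assumes "P \<in> B" "Q \<in> B" "R \<in> B" "R \<noteq> 0"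
  shows "P \<star> R = Q \<star> R \<longleftrightarrow> P = Q"
proof
  assume "P \<star> R = Q \<star> R"
  then have "(P - Q) \<star> R = 0" by (simp add: op_mult_diff_left)
  then show "P = Q" using assms by simp
qed simp

lemma pow_mult_distrib:
  "P \<in> B \<Longrightarrow> Q \<in> B \<Longrightarrow> op_pow (P \<star> Q) n = op_pow P n \<star> op_pow Q n"
  by (induction n) (auto simp: mult_ac_B)

lemma pow_nonzero: "P \<noteq> 0 \<Longrightarrow> op_pow P n \<noteq> 0"
  by (induction n) auto

lemma degree_pow: "P \<noteq> 0 \<Longrightarrow> degree (op_pow P n) = n * degree P"
  by (induction n) (auto simp: op_mult_nonzero pow_nonzero)

lemma act_comm: "P \<in> B \<Longrightarrow> Q \<in> B \<Longrightarrow> f \<diamondop> P \<diamondop> Q = f \<diamondop> Q \<diamondop> P"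
  by (metis mult_comm op_action_mult)

text \<open>P commutes with an elliptic element. A nonconstant leading coefficient could vanish at z
  = 0 and disappear in the spectral module; a nonzero constant cannot, and so orders add up under
  the action in \<open>act_nonzero\<close>.\<close>

lemma lead_coeff_const:
  assumes "P \<in> B" "P \<noteq> 0"
  obtains c where "c \<noteq> 0" "lead_coeff P = fps_const c"
proof -
  obtain E where E: "E \<in> B" "formally_elliptic E"
    using spectral by (auto simp: spectral_algebra_def)
  have "fps_deriv (lead_coeff P) = 0"
    using lead_coeff_deriv_eq_0[OF E(2), of P] E assms by (simp add: mult_comm)
  then have c: "lead_coeff P = fps_const (fps_nth (lead_coeff P) 0)"
    by (simp add: fps_deriv_eq_0_iff)
  moreover have "fps_nth (lead_coeff P) 0 \<noteq> 0"
    using c assms(2) by (metis fps_const_0_eq_0 leading_coeff_0_iff)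
  ultimately show thesis using that by blast
qed

lemma act_nonzero:
  assumes "P \<in> B" "P \<noteq> 0" "f \<noteq> 0"
  shows "f \<diamondop> P \<noteq> 0" "degree (f \<diamondop> P) = degree f + degree P"
proof -
  obtain c where c: "c \<noteq> 0" "lead_coeff P = fps_const c" using lead_coeff_const assms by blast
  have *: "Polynomial.coeff (f \<diamondop> P) (degree f + degree P) \<noteq> 0"
    using c assms by (simp add: op_action_coeff_top)
  show "f \<diamondop> P \<noteq> 0" using * by auto
  show "degree (f \<diamondop> P) = degree f + degree P"
    using le_degree[OF *] degree_op_action_le[of f P] by simp
qed

lemma act_eq_0_iff: "P \<in> B \<Longrightarrow> f \<diamondop> P = 0 \<longleftrightarrow> f = 0 \<or> P = 0"
  using act_nonzero(1) by auto

lemma act_cancel: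
  assumes "P \<in> B" "P \<noteq> 0"
  shows "f \<diamondop> P = g \<diamondop> P \<longleftrightarrow> f = g"
  using act_eq_0_iff[OF assms(1), of "f - g"] assms(2) by (auto simp: op_action_diff_left)

lemma elliptic: obtains E where "E \<in> B" "E \<noteq> 0" "degree E > 0"
  using spectral by (fastforce simp: spectral_algebra_def formally_elliptic_def)

lemma r_dvd: "P \<in> B \<Longrightarrow> r dvd degree P"
  unfolding alg_rank_def by (rule Gcd_dvd) simp

lemma r_pos [simp]: "r > 0"
proof -
  obtain E where "E \<in> B" "degree E > 0" using elliptic by blast
  then show ?thesis using r_dvd[of E] by (metis dvd_0_left_iff gr0I less_irrefl)
qed

lemma degree_eq_0_const:
  assumes "P \<in> B" "degree P = 0"
  obtains c where "P = const_op c"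
proof (cases "P = 0")
  case True
  have "P = const_op 0" using True by (simp add: const_op_def)
  then show thesis by (rule that)
next
  case False
  obtain c where c: "lead_coeff P = fps_const c" using lead_coeff_const assms False by blast
  have "P = [:lead_coeff P:]" using assms(2) by (metis degree_0_id degree_eq_zeroE lead_coeff_pCons(2) coeff_pCons_0)
  then show thesis using c that by (simp add: const_op_def)
qed

lemma const_op_nonzero_inv: "c \<noteq> 0 \<Longrightarrow> const_op (1 / c) \<star> const_op c = 1"
  by (simp add: const_op_mult) (simp add: const_op_def one_pCons)

lemma cancel_lead:
  assumes "P \<in> B" "Q \<in> B" "P \<noteq> 0" "Q \<noteq> 0" "degree P = degree Q"
  obtains c where "c \<noteq> 0" "P - const_op c \<star> Q = 0 \<or> degree (P - const_op c \<star> Q) < degree P"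
proof -
  obtain a where a: "a \<noteq> 0" "lead_coeff P = fps_const a" using lead_coeff_const assms by blast
  obtain b where b: "b \<noteq> 0" "lead_coeff Q = fps_const b" using lead_coeff_const assms by blast
  let ?R = "P - const_op (a / b) \<star> Q"
  have "degree ?R \<le> degree P"
    using assms(5) by (intro degree_diff_le) (auto simp: const_op_mult intro: order.trans[OF degree_smult_le])
  moreover have "Polynomial.coeff ?R (degree P) = 0"
    using a b assms(5) by (simp add: const_op_mult fps_const_mult[symmetric] del: fps_const_mult)
      (simp add: fps_const_mult)
  ultimately have "?R = 0 \<or> degree ?R < degree P"
    by (metis eq_zero_or_degree_less)
  then show thesis using that[of "a / b"] a b by simp
qed

text \<open>The leading coefficient of P is a nonzero constant, so a suitable monomial g removes the
  leading term of f, as in ordinary polynomial division.\<close>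

lemma act_division:
  assumes "P \<in> B" "P \<noteq> 0"
  obtains g h where "f = g \<diamondop> P + h" "h = 0 \<or> degree h < degree P"
proof -
  have "\<exists>g h. f = g \<diamondop> P + h \<and> (h = 0 \<or> degree h < degree P)"
  \<comment> \<open>Zero and the nonzero constants both have degree 0. The measure separates them,
    so that cancelling a constant also counts as progress.\<close>
  proof (induction "if f = 0 then 0 else Suc (degree f)" arbitrary: f rule: less_induct)
    case less
    show ?case
    proof (cases "f = 0 \<or> degree f < degree P")
      case True
      then show ?thesis by (intro exI[of _ 0] exI[of _ f]) auto
    next
      case False
      obtain c where c: "c \<noteq> 0" "lead_coeff P = fps_const c" using lead_coeff_const assms by blast
      define g where "g = Polynomial.monom (lead_coeff f / c) (degree f - degree P)"
      let ?f = "f - g \<diamondop> P"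
      have dg: "degree g \<le> degree f - degree P" unfolding g_def by (rule degree_monom_le)
      have "degree ?f \<le> degree f"
        using degree_op_action_le[of g P] dg False by (intro degree_diff_le) auto
      moreover have "Polynomial.coeff ?f (degree f) = 0"
        using op_action_coeff_top[OF dg order.refl, of P] c False by (simp add: g_def)
      ultimately have "?f = 0 \<or> degree ?f < degree f" by (metis eq_zero_or_degree_less)
      then have "\<exists>g' h. ?f = g' \<diamondop> P + h \<and> (h = 0 \<or> degree h < degree P)"
        using False by (intro less) auto
      then obtain g' h where "?f = g' \<diamondop> P + h" "h = 0 \<or> degree h < degree P" by blast
      then show ?thesis
        by (intro exI[of _ "g + g'"] exI[of _ h]) (auto simp: op_action_add_left algebra_simps)
    qed
  qed
  then show thesis using that by blast
qed

text \<open>The order differences of \<open>B\<close> form a group, so their least positive element is the rank.\<close>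

lemma degree_difference:
  obtains A C where "A \<in> B" "C \<in> B" "A \<noteq> 0" "C \<noteq> 0" "degree A = degree C + r"
proof -
  let ?X = "\<lambda>k. k > 0 \<and> (\<exists>A C. A \<in> B \<and> C \<in> B \<and> A \<noteq> 0 \<and> C \<noteq> 0 \<and> degree A = degree C + k)"
  define g where "g = (LEAST k. ?X k)"
  obtain E where E: "E \<in> B" "E \<noteq> 0" "degree E > 0" using elliptic by blast
  have "?X (degree E)" using E by (intro conjI exI[of _ E] exI[of _ 1]) auto
  then have g: "?X g" unfolding g_def by (rule LeastI)
  then obtain A C where AC: "A \<in> B" "C \<in> B" "A \<noteq> 0" "C \<noteq> 0" "degree A = degree C + g" by blast
  have "g dvd degree Q" if "Q \<in> B" for Q
  proof (cases "Q = 0")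
    case False
    define q s where "q = degree Q div g" and "s = degree Q mod g"
    have Q: "degree Q = q * g + s" by (simp add: q_def s_def)
    have "s = 0"
    proof (rule ccontr)
      assume "s \<noteq> 0"
      \<comment> \<open>Since ord A = ord C + g and ord Q = q g + s, multiplying Q by C^q makes its
        order comparable with that of A^q: the remainder s is itself a difference of orders, against
        the minimality of g.\<close>
      have "degree (Q \<star> op_pow C q) = degree (op_pow A q) + s"
        using False AC Q by (simp add: op_mult_nonzero pow_nonzero degree_pow algebra_simps)
      then have "?X s" using \<open>s \<noteq> 0\<close> False AC that
        by (intro conjI exI[of _ "Q \<star> op_pow C q"] exI[of _ "op_pow A q"]) (auto simp: pow_nonzero)
      then have "g \<le> s" unfolding g_def by (rule Least_le)
      moreover have "s < g" using g by (simp add: s_def)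
      ultimately show False by simp
    qed
    then show ?thesis using Q by simp
  qed simp
  then have "g dvd r" unfolding alg_rank_def by (intro Gcd_greatest) auto
  moreover have "r dvd g"
    using r_dvd[of A] r_dvd[of C] AC dvd_diff_nat[of r "degree A" "degree C"] by simp
  ultimately have "g = r" by (rule dvd_antisym)
  then show thesis using AC that by blast
qed

lemma filtD [dest]: "P \<in> filt B n \<Longrightarrow> P \<in> B"
  by (simp add: filt_def)

lemma filt_zero [simp]: "0 \<in> filt B n" and filt_one [simp]: "1 \<in> filt B n"
  and filt_const [simp]: "const_op c \<in> filt B n"
  by (auto simp: filt_def) (auto simp: const_op_def)

lemma filt_add [simp]: "P \<in> filt B n \<Longrightarrow> Q \<in> filt B n \<Longrightarrow> P + Q \<in> filt B n"
  by (auto simp: filt_def intro: degree_add_le)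

lemma filt_diff [simp]: "P \<in> filt B n \<Longrightarrow> Q \<in> filt B n \<Longrightarrow> P - Q \<in> filt B n"
  by (auto simp: filt_def intro: degree_diff_le)

lemma filt_sum [simp]: "(\<And>i. i \<in> A \<Longrightarrow> f i \<in> filt B n) \<Longrightarrow> sum f A \<in> filt B n"
  by (induction A rule: infinite_finite_induct) auto

lemma filt_uminus [simp]: "P \<in> filt B n \<Longrightarrow> - P \<in> filt B n"
  by (auto simp: filt_def)

lemma filt_mult [simp]: "P \<in> filt B n \<Longrightarrow> Q \<in> filt B m \<Longrightarrow> P \<star> Q \<in> filt B (n + m)"
  using op_mult_degree_le[of P Q] by (auto simp: filt_def add_mult_distrib)

lemma filt_mono: "P \<in> filt B n \<Longrightarrow> n \<le> m \<Longrightarrow> P \<in> filt B m"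
  using mult_le_mono1[of n m r] by (auto simp: filt_def intro: order.trans)

lemma filt_pow: "P \<in> filt B n \<Longrightarrow> op_pow P k \<in> filt B (k * n)"
  by (induction k) auto

lemma filt_degree: "P \<in> B \<Longrightarrow> degree P \<le> n \<Longrightarrow> P \<in> filt B n"
proof -
  assume "P \<in> B" "degree P \<le> n"
  moreover from this(2) have "degree P \<le> n * r" by (rule_tac order.trans) (auto simp: Suc_le_eq)
  ultimately show "P \<in> filt B n" by (simp add: filt_def)
qed

lemma filt_degree_Suc: "P \<in> B \<Longrightarrow> P \<in> filt B (Suc (degree P))"
  by (rule filt_degree) auto

section \<open>The Rees algebra\<close>

abbreviation S where "S \<equiv> rees_ring B"
abbreviation G where "G \<equiv> rees_grading B"

lemma finsum_alg_ring: "f \<in> A \<rightarrow> B \<Longrightarrow> finsum (alg_ring B) f A = sum f A"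
proof -
  interpret cring "alg_ring B" by (rule cring_B)
  show "f \<in> A \<rightarrow> B \<Longrightarrow> finsum (alg_ring B) f A = sum f A"
  proof (induction A rule: infinite_finite_induct)
    case (infinite A)
    then show ?case by (simp add: finsum_infinite) (simp add: diffop_ring_def)
  next
    case empty
    then show ?case by (simp) (simp add: diffop_ring_def)
  next
    case (insert x F)
    then have "finsum (alg_ring B) f (insert x F) = f x \<oplus>\<^bsub>alg_ring B\<^esub> finsum (alg_ring B) f F"
      by (intro finsum_insert) (auto simp: Pi_def)
    then show ?case using insert by (simp add: Pi_def) (simp add: diffop_ring_def)
  qed
qed

lemma up_alg_ring: "f \<in> up (alg_ring B) \<longleftrightarrow> (\<forall>i. f i \<in> B) \<and> (\<exists>n. \<forall>m>n. f m = 0)"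
  by (auto simp: up_def diffop_ring_def bound_def Pi_def)

lemma carrier_rees: "carrier S = {f. (\<forall>i. f i \<in> filt B i) \<and> (\<exists>n. \<forall>m>n. f m = 0)}"
  by (auto simp: rees_ring_def Let_def UP_def up_alg_ring)

lemma rees_up: "f \<in> carrier S \<Longrightarrow> f \<in> up (alg_ring B)"
  by (auto simp: carrier_rees up_alg_ring)

lemma rees_mult:
  assumes "f \<in> carrier S" "g \<in> carrier S"
  shows "f \<otimes>\<^bsub>S\<^esub> g = (\<lambda>n. \<Sum>i\<le>n. f i \<star> g (n - i))"
proof -
  have up: "f \<in> up (alg_ring B)" "g \<in> up (alg_ring B)" using assms rees_up by auto
  have mult: "x \<otimes>\<^bsub>alg_ring B\<^esub> y = x \<star> y" for x y by (simp add: diffop_ring_def)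
  have "f \<otimes>\<^bsub>S\<^esub> g = (\<lambda>n. \<Oplus>\<^bsub>alg_ring B\<^esub>i\<in>{..n}. f i \<otimes>\<^bsub>alg_ring B\<^esub> g (n - i))"
    unfolding rees_ring_def Let_def UP_def using up by simp
  also have "\<dots> = (\<lambda>n. \<Oplus>\<^bsub>alg_ring B\<^esub>i\<in>{..n}. f i \<star> g (n - i))"
    by (simp only: mult)
  also have "\<dots> = (\<lambda>n. \<Sum>i\<le>n. f i \<star> g (n - i))"
  proof
    fix n
    have "(\<lambda>i. f i \<star> g (n - i)) \<in> {..n} \<rightarrow> B"
      using assms by (auto simp: carrier_rees intro!: mult_B)
    then show "(\<Oplus>\<^bsub>alg_ring B\<^esub>i\<in>{..n}. f i \<star> g (n - i)) = (\<Sum>i\<le>n. f i \<star> g (n - i))"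
      by (rule finsum_alg_ring)
  qed
  finally show ?thesis .
qed

lemma rees_add:
  assumes "f \<in> carrier S" "g \<in> carrier S"
  shows "f \<oplus>\<^bsub>S\<^esub> g = (\<lambda>n. f n + g n)"
proof -
  have up: "f \<in> up (alg_ring B)" "g \<in> up (alg_ring B)" using assms rees_up by auto
  have add: "x \<oplus>\<^bsub>alg_ring B\<^esub> y = x + y" for x y by (simp add: diffop_ring_def)
  have "f \<oplus>\<^bsub>S\<^esub> g = (\<lambda>i. f i \<oplus>\<^bsub>alg_ring B\<^esub> g i)"
    unfolding rees_ring_def Let_def UP_def using up by simp
  then show ?thesis by (simp only: add)
qed

lemma rees_one: "\<one>\<^bsub>S\<^esub> = tmon 1 0" and rees_zero: "\<zero>\<^bsub>S\<^esub> = (\<lambda>_. 0)"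
  by (simp_all add: rees_ring_def Let_def UP_def diffop_ring_def tmon_def cong: if_cong)

lemma tmon_carrier [simp]: "P \<in> filt B n \<Longrightarrow> tmon P n \<in> carrier S"
  by (auto simp: carrier_rees tmon_def)

lemma tmon_apply [simp]: "tmon P n n = P" by (simp add: tmon_def)

lemma tmon_zero: "tmon 0 n = \<zero>\<^bsub>S\<^esub>"
  by (auto simp: tmon_def rees_zero)

lemma tmon_inject [simp]: "tmon P n = tmon Q n \<longleftrightarrow> P = Q"
  by (metis tmon_apply)

lemma rees_mult_closed:
  assumes "f \<in> carrier S" "g \<in> carrier S"
  shows "f \<otimes>\<^bsub>S\<^esub> g \<in> carrier S"
proof -
  obtain n m where nm: "\<And>k. k > n \<Longrightarrow> f k = 0" "\<And>k. k > m \<Longrightarrow> g k = 0"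
    using assms by (auto simp: carrier_rees)
  have "f i \<star> g (k - i) \<in> filt B k" if "i \<le> k" for i k
    using filt_mult[of "f i" i "g (k - i)" "k - i"] assms that by (auto simp: carrier_rees)
  moreover have "f i \<star> g (k - i) = 0" if "k > n + m" for i k
    using nm(1)[of i] nm(2)[of "k - i"] that by (cases "i > n") auto
  ultimately show ?thesis
    by (auto simp: rees_mult[OF assms] carrier_rees simp del: op_mult_eq_0_iff
        intro!: exI[of _ "n + m"] sum.neutral filt_sum)
qed

lemma cring_S: "cring S"
proof -
  define R where "R = UP (alg_ring B)"
  interpret UP_cring "alg_ring B" R
    by (intro UP_cring.intro) (auto simp: cring_B R_def)
  have R: "cring R" by (rule P.is_cring)
  have S: "S = R\<lparr>carrier := carrier S\<rparr>"
    by (simp add: rees_ring_def Let_def R_def)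
  have ops: "x \<otimes>\<^bsub>S\<^esub> y = x \<otimes>\<^bsub>R\<^esub> y" "x \<oplus>\<^bsub>S\<^esub> y = x \<oplus>\<^bsub>R\<^esub> y" "\<one>\<^bsub>S\<^esub> = \<one>\<^bsub>R\<^esub>" "\<zero>\<^bsub>S\<^esub> = \<zero>\<^bsub>R\<^esub>" for x y
    by (simp_all add: rees_ring_def Let_def R_def)
  have sub: "carrier S \<subseteq> carrier R"
    by (auto simp: rees_ring_def Let_def R_def)
  have add: "f \<oplus>\<^bsub>S\<^esub> g \<in> carrier S" if fg: "f \<in> carrier S" "g \<in> carrier S" for f g
  proof -
    obtain n m where "\<And>k. k > n \<Longrightarrow> f k = 0" "\<And>k. k > m \<Longrightarrow> g k = 0"
      using fg by (auto simp: carrier_rees)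
    then show ?thesis using fg
      by (auto simp: rees_add carrier_rees intro!: exI[of _ "max n m"])
  qed
  have "subring (carrier S) R"
  proof (rule P.subringI[OF sub])
    show "\<one>\<^bsub>R\<^esub> \<in> carrier S" using tmon_carrier[of 1 0] by (simp add: rees_one[symmetric] ops)
    fix f assume f: "f \<in> carrier S"
    have h: "(\<lambda>i. - f i) \<in> carrier S" using f by (auto simp: carrier_rees)
    have "f \<oplus>\<^bsub>R\<^esub> (\<lambda>i. - f i) = \<zero>\<^bsub>R\<^esub>"
      using rees_add[OF f h] by (simp add: ops(2,4)[symmetric] rees_zero)
    then have "\<ominus>\<^bsub>R\<^esub> f = (\<lambda>i. - f i)"
      using P.add.m_comm[OF subsetD[OF sub f] subsetD[OF sub h]] subsetD[OF sub f] subsetD[OF sub h]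
      by (intro P.minus_equality) auto
    then show "\<ominus>\<^bsub>R\<^esub> f \<in> carrier S" using h by simp
  next
    fix f g assume "f \<in> carrier S" "g \<in> carrier S"
    then show "f \<otimes>\<^bsub>R\<^esub> g \<in> carrier S" "f \<oplus>\<^bsub>R\<^esub> g \<in> carrier S"
      using rees_mult_closed add by (auto simp: ops)
  qed
  then have "subcring (carrier S) R" by (rule P.subcringI')
  then show ?thesis using P.subcring_iff[OF sub] S by simp
qed

lemma rees_uminus:
  assumes f: "f \<in> carrier S" shows "\<ominus>\<^bsub>S\<^esub> f = (\<lambda>i. - f i)"
proof -
  interpret cring S by (rule cring_S)
  have h: "(\<lambda>i. - f i) \<in> carrier S" using f by (auto simp: carrier_rees)
  show ?thesis
    using rees_add[OF h f] f h by (intro minus_equality) (auto simp: rees_zero)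
qed

lemma mem_G: "x \<in> G n \<longleftrightarrow> (\<exists>P\<in>filt B n. x = tmon P n)"
proof
  assume x: "x \<in> G n"
  then have "x = tmon (x n) n" by (auto simp: rees_grading_def tmon_def)
  moreover have "x n \<in> filt B n" using x by (auto simp: rees_grading_def carrier_rees)
  ultimately show "\<exists>P\<in>filt B n. x = tmon P n" by blast
qed (auto simp: rees_grading_def, simp add: tmon_def)

lemma tmon_G [simp]: "tmon P n \<in> G n \<longleftrightarrow> P \<in> filt B n"
  by (auto simp: mem_G)

lemma tmon_mult:
  assumes "P \<in> filt B n" "Q \<in> filt B m"
  shows "tmon P n \<otimes>\<^bsub>S\<^esub> tmon Q m = tmon (P \<star> Q) (n + m)"
proof
  fix k
  have "(tmon P n \<otimes>\<^bsub>S\<^esub> tmon Q m) k = (\<Sum>i\<le>k. tmon P n i \<star> tmon Q m (k - i))"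
    using assms by (simp add: rees_mult)
  also have "\<dots> = (\<Sum>i\<le>k. if i = n then if k = n + m then P \<star> Q else 0 else 0)"
    by (intro sum.cong refl) (auto simp: tmon_def)
  also have "\<dots> = tmon (P \<star> Q) (n + m) k"
    by (auto simp: tmon_def)
  finally show "(tmon P n \<otimes>\<^bsub>S\<^esub> tmon Q m) k = tmon (P \<star> Q) (n + m) k" .
qed

lemma tmon_add:
  assumes "P \<in> filt B n" "Q \<in> filt B n"
  shows "tmon P n \<oplus>\<^bsub>S\<^esub> tmon Q n = tmon (P + Q) n"
  unfolding rees_add[OF tmon_carrier[OF assms(1)] tmon_carrier[OF assms(2)]]
  by (auto simp: tmon_def)

section \<open>Points of the spectral curve\<close>

abbreviation pts where "pts \<equiv> Proj_points S G"

lemma ptD: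
  assumes "q \<in> pts"
  shows "primeideal q S" "ideal q S" "Idl\<^bsub>S\<^esub> (q \<inter> (\<Union>n. G n)) = q"
  using assms by (auto simp: Proj_points_def primeideal.axioms(1))

lemma pt_zero: "q \<in> pts \<Longrightarrow> tmon 0 n \<in> q"
  using additive_subgroup.zero_closed[OF ideal.axioms(1)[OF ptD(2)]] by (simp add: tmon_zero)

lemma pt_add:
  assumes "q \<in> pts" "P \<in> filt B n" "Q \<in> filt B n" "tmon P n \<in> q" "tmon Q n \<in> q"
  shows "tmon (P + Q) n \<in> q"
  using additive_subgroup.a_closed[OF ideal.axioms(1)[OF ptD(2)[OF assms(1)]] assms(4,5)] assms(2,3)
  by (simp add: tmon_add)

lemma pt_mult:
  assumes "q \<in> pts" "P \<in> filt B n" "Q \<in> filt B m" "tmon P n \<in> q"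
  shows "tmon (P \<star> Q) (n + m) \<in> q"
  using ideal.I_r_closed[OF ptD(2)[OF assms(1)] assms(4), of "tmon Q m"] assms(2,3)
  by (simp add: tmon_mult)

lemma pt_prime:
  assumes "q \<in> pts" "P \<in> filt B n" "Q \<in> filt B m"
  shows "tmon (P \<star> Q) (n + m) \<in> q \<longleftrightarrow> tmon P n \<in> q \<or> tmon Q m \<in> q"
proof
  assume "tmon (P \<star> Q) (n + m) \<in> q"
  then show "tmon P n \<in> q \<or> tmon Q m \<in> q"
    using primeideal.I_prime[OF ptD(1)[OF assms(1)], of "tmon P n" "tmon Q m"] assms(2,3)
    by (auto simp: tmon_mult)
next
  assume "tmon P n \<in> q \<or> tmon Q m \<in> q"
  then show "tmon (P \<star> Q) (n + m) \<in> q"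
    using pt_mult[OF assms(1,2,3)] pt_mult[OF assms(1,3,2)] assms(2,3)
    by (auto simp: add.commute mult_comm filtD)
qed

lemma pt_one: "q \<in> pts \<Longrightarrow> tmon 1 0 \<notin> q"
  using primeideal.I_notcarr[OF ptD(1)] ideal.one_imp_carrier[OF ptD(2)] by (auto simp: rees_one)

lemma pt_nonvanishing:
  assumes "q \<in> pts"
  obtains n P where "n > 0" "P \<in> filt B n" "tmon P n \<notin> q"
  using assms by (fastforce simp: Proj_points_def mem_G subset_iff)

lemma pt_pow:
  assumes "q \<in> pts" "P \<in> filt B n"
  shows "tmon P n \<notin> q \<Longrightarrow> tmon (op_pow P k) (k * n) \<notin> q"
  by (induction k) (auto simp: pt_one pt_prime assms filt_pow)

lemma pt_eqI:
  assumes "q \<in> pts" "q' \<in> pts" "\<And>n P. P \<in> filt B n \<Longrightarrow> tmon P n \<in> q \<longleftrightarrow> tmon P n \<in> q'"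
  shows "q = q'"
proof -
  have "q \<inter> (\<Union>n. G n) = q' \<inter> (\<Union>n. G n)"
    using assms(3) by (auto simp: mem_G)
  then show ?thesis
    using ptD(3)[OF assms(1), symmetric] ptD(3)[OF assms(2)] by (rule_tac trans) (simp_all only:)
qed

text \<open>A homogeneous ideal is given by its components \<open>J n\<close>.\<close>

lemma homogeneous_prime:
  assumes sub: "\<And>n. J n \<subseteq> filt B n" and zero: "\<And>n. 0 \<in> J n"
    and add: "\<And>n P Q. P \<in> J n \<Longrightarrow> Q \<in> J n \<Longrightarrow> P + Q \<in> J n"
    and mult: "\<And>n m P Q. P \<in> J n \<Longrightarrow> Q \<in> filt B m \<Longrightarrow> P \<star> Q \<in> J (n + m)"
    and prime: "\<And>n m P Q. P \<in> filt B n - J n \<Longrightarrow> Q \<in> filt B m - J m \<Longrightarrow> P \<star> Q \<notin> J (n + m)"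
    and one: "1 \<notin> J 0" and irr: "n0 > 0" "J n0 \<noteq> filt B n0"
  defines "q \<equiv> {f \<in> carrier S. \<forall>i. f i \<in> J i}"
  shows "q \<in> pts" "tmon P n \<in> q \<longleftrightarrow> P \<in> J n"
proof -
  interpret S: cring S by (rule cring_S)
  have uminus: "- P \<in> J n" if "P \<in> J n" for P n
    using mult[OF that filt_const[of "-1" 0]] that sub[of n]
    by (metis add_0_right const_op_neg1 const_B mult_comm filtD subsetD)
  have sumJ: "sum f A \<in> J n" if "\<And>i. i \<in> A \<Longrightarrow> f i \<in> J n" for f :: "nat \<Rightarrow> diffop" and A n
    using that by (induction A rule: infinite_finite_induct) (auto simp: zero add)
  have mem: "tmon P n \<in> q \<longleftrightarrow> P \<in> J n" for P n
  proof
    assume "tmon P n \<in> q"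
    then have "tmon P n n \<in> J n" unfolding q_def by blast
    then show "P \<in> J n" by simp
  next
    assume "P \<in> J n"
    moreover from this have "P \<in> filt B n" using sub by blast
    ultimately show "tmon P n \<in> q" using zero tmon_carrier[of P n] by (auto simp: q_def tmon_def)
  qed
  then show "tmon P n \<in> q \<longleftrightarrow> P \<in> J n" .
  have r_closed: "f \<otimes>\<^bsub>S\<^esub> g \<in> q" if "f \<in> q" "g \<in> carrier S" for f g
  proof -
    have "f \<in> carrier S" "\<And>i. f i \<in> J i" using that by (auto simp: q_def)
    moreover have "f i \<star> g (k - i) \<in> J k" if "i \<le> k" for i k
      using mult[of "f i" i "g (k - i)" "k - i"] \<open>\<And>i. f i \<in> J i\<close> \<open>g \<in> carrier S\<close> that
      by (auto simp: carrier_rees)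
    ultimately have "\<forall>k. (f \<otimes>\<^bsub>S\<^esub> g) k \<in> J k"
      using that(2) by (auto simp: rees_mult intro!: sumJ)
    then show ?thesis using \<open>f \<in> carrier S\<close> that(2) by (simp add: q_def)
  qed
  have ideal: "ideal q S"
  proof (rule idealI)
    show "subgroup q (add_monoid S)"
    proof (rule S.add.subgroupI)
      show "q \<noteq> {}" using mem[of 0 0] zero by auto
      show "\<ominus>\<^bsub>S\<^esub> f \<in> q" if "f \<in> q" for f
      proof -
        have "f \<in> carrier S" using that by (simp add: q_def)
        then have "\<ominus>\<^bsub>S\<^esub> f = (\<lambda>i. - f i)" "\<ominus>\<^bsub>S\<^esub> f \<in> carrier S"
          by (rule rees_uminus, rule S.a_inv_closed)
        then show ?thesis using that uminus by (auto simp: q_def)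
      qed
      show "f \<oplus>\<^bsub>S\<^esub> g \<in> q" if "f \<in> q" "g \<in> q" for f g
      proof -
        have "f \<in> carrier S" "g \<in> carrier S" using that by (auto simp: q_def)
        then have "f \<oplus>\<^bsub>S\<^esub> g = (\<lambda>i. f i + g i)" "f \<oplus>\<^bsub>S\<^esub> g \<in> carrier S"
          by (rule rees_add, rule S.a_closed)
        then show ?thesis using that add by (auto simp: q_def)
      qed
    qed (auto simp: q_def)
    show "ring S" by (rule cring.axioms(1)[OF cring_S])
    show "f \<otimes>\<^bsub>S\<^esub> g \<in> q" "g \<otimes>\<^bsub>S\<^esub> f \<in> q" if "f \<in> q" "g \<in> carrier S" for f g
      using r_closed[OF that] S.m_comm[of f g] that by (auto simp: q_def)
  qed
  have primeideal: "primeideal q S"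
  proof (rule primeidealI[OF ideal cring_S])
    show "carrier S \<noteq> q" using mem[of 1 0] one by auto
    fix f g assume fg: "f \<in> carrier S" "g \<in> carrier S" "f \<otimes>\<^bsub>S\<^esub> g \<in> q"
    show "f \<in> q \<or> g \<in> q"
    proof (rule ccontr)
      assume "\<not> (f \<in> q \<or> g \<in> q)"
      then have ex: "\<exists>i. f i \<notin> J i" "\<exists>i. g i \<notin> J i" using fg by (auto simp: q_def)
      \<comment> \<open>Take the lowest components of f and g outside J. Modulo J, the component of
        the product in degree i + j is the single term \<open>f i \<star> g j\<close>, to which
        primality for homogeneous elements applies.\<close>
      define i where "i = (LEAST i. f i \<notin> J i)"
      define j where "j = (LEAST i. g i \<notin> J i)"
      have i: "f i \<notin> J i" "\<And>k. k < i \<Longrightarrow> f k \<in> J k"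
        unfolding i_def using LeastI_ex[OF ex(1)] not_less_Least by auto
      have j: "g j \<notin> J j" "\<And>k. k < j \<Longrightarrow> g k \<in> J k"
        unfolding j_def using LeastI_ex[OF ex(2)] not_less_Least by auto
      have memf: "f k \<in> filt B k" "g k \<in> filt B k" for k using fg by (auto simp: carrier_rees)
      have "(\<Sum>k\<in>{..i+j} - {i}. f k \<star> g (i + j - k)) \<in> J (i + j)"
      proof (rule sumJ)
        fix k assume k: "k \<in> {..i + j} - {i}"
        show "f k \<star> g (i + j - k) \<in> J (i + j)"
        proof (cases "k < i")
          case True
          then show ?thesis using mult[OF i(2)[OF True] memf(2)[of "i + j - k"]] by simp
        next
          case False
          then have "i + j - k < j" using k by auto
          then have "g (i + j - k) \<star> f k \<in> J (i + j)"
            using mult[OF j(2) memf(1)[of k], of "i + j - k"] k by simp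
          then show ?thesis using memf[of k] memf[of "i + j - k"] by (metis mult_comm filtD)
        qed
      qed
      moreover have "(f \<otimes>\<^bsub>S\<^esub> g) (i + j) = f i \<star> g j + (\<Sum>k\<in>{..i+j} - {i}. f k \<star> g (i + j - k))"
        using fg by (simp add: rees_mult) (subst sum.remove[of _ i], auto)
      moreover have "(f \<otimes>\<^bsub>S\<^esub> g) (i + j) \<in> J (i + j)" using fg(3) by (simp add: q_def)
      ultimately have "f i \<star> g j \<in> J (i + j)"
        using add[of "(f \<otimes>\<^bsub>S\<^esub> g) (i + j)" "i + j" "- (\<Sum>k\<in>{..i+j} - {i}. f k \<star> g (i + j - k))"] uminus
        by simp
      then show False using prime[of "f i" i "g j" j] i j memf by auto
    qed
  qed
  have "Idl\<^bsub>S\<^esub> (q \<inter> (\<Union>n. G n)) = q"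
  proof
    show "Idl\<^bsub>S\<^esub> (q \<inter> (\<Union>n. G n)) \<subseteq> q" by (rule S.genideal_minimal[OF ideal]) auto
    let ?I = "Idl\<^bsub>S\<^esub> (q \<inter> (\<Union>n. G n))"
    have subc: "q \<inter> (\<Union>n. G n) \<subseteq> carrier S" by (auto simp: q_def)
    have idealI: "ideal ?I S" by (rule S.genideal_ideal[OF subc])
    \<comment> \<open>An element of q is the sum of its finitely many components, each of which lies
      in q; the induction splits off the top one.\<close>
    have "f \<in> ?I" if "f \<in> q" "\<And>k. k \<ge> N \<Longrightarrow> f k = 0" for f N
      using that
    proof (induction N arbitrary: f)
      case 0
      then have "f = \<zero>\<^bsub>S\<^esub>" by (auto simp: rees_zero)
      then show ?case using additive_subgroup.zero_closed[OF ideal.axioms(1)[OF idealI]] by simp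
    next
      case (Suc N)
      define g where "g = f(N := 0)"
      have f: "f i \<in> J i" "f i \<in> filt B i" for i
        using Suc.prems(1) sub by (auto simp: q_def carrier_rees)
      have "g \<in> q"
        using Suc.prems zero f by (auto simp: q_def g_def carrier_rees)
      moreover have "g k = 0" if "k \<ge> N" for k
        using Suc.prems(2)[of k] that by (cases "k = N") (auto simp: g_def)
      ultimately have "g \<in> ?I" by (rule Suc.IH)
      moreover have "tmon (f N) N \<in> ?I"
      proof (rule subsetD[OF S.genideal_self[OF subc]])
        have "tmon (f N) N \<in> G N" using f by simp
        moreover have "tmon (f N) N \<in> q" using f mem by simp
        ultimately show "tmon (f N) N \<in> q \<inter> (\<Union>n. G n)" by blast
      qed
      moreover have "f = g \<oplus>\<^bsub>S\<^esub> tmon (f N) N"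
      proof -
        have "g \<in> carrier S" using \<open>g \<in> q\<close> by (simp add: q_def)
        then have "g \<oplus>\<^bsub>S\<^esub> tmon (f N) N = (\<lambda>n. g n + tmon (f N) N n)"
          using f by (intro rees_add) auto
        then show ?thesis by (auto simp: g_def tmon_def)
      qed
      ultimately show ?case
        using additive_subgroup.a_closed[OF ideal.axioms(1)[OF idealI], of g "tmon (f N) N"] by simp
    qed
    moreover have "\<exists>N. \<forall>k\<ge>N. f k = 0" if "f \<in> q" for f
    proof -
      have "f \<in> carrier S" using that by (simp add: q_def)
      then obtain N where "\<forall>k>N. f k = 0" by (auto simp: carrier_rees)
      then show ?thesis by (intro exI[of _ "Suc N"]) auto
    qed
    ultimately show "q \<subseteq> ?I" by blast
  qed
  moreover have "\<not> (\<Union>n\<in>{0<..}. G n) \<subseteq> q"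
  proof -
    obtain P where "P \<in> filt B n0" "P \<notin> J n0" using irr(2) sub by blast
    then have "tmon P n0 \<in> G n0" "tmon P n0 \<notin> q" using mem by auto
    then show ?thesis using irr(1) by blast
  qed
  ultimately show "q \<in> pts" using primeideal by (simp add: Proj_points_def)
qed

section \<open>The topology of the spectral curve and its point at infinity\<close>

abbreviation X where "X \<equiv> curve B"
abbreviation X0 where "X0 \<equiv> affine_part B"
abbreviation pinf where "pinf \<equiv> inf_pt B"

text \<open>The distinguished open set of the homogeneous element Q t^n. The exponent n matters only
  at infinity, where t vanishes.\<close>

definition basic :: "nat \<Rightarrow> diffop \<Rightarrow> spt set" where
  "basic n Q = {q \<in> pts. tmon Q n \<notin> q}"

text \<open>The zero ideal, written by components to fit \<open>homogeneous_prime\<close>.\<close>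

definition generic_pt :: spt where
  "generic_pt = {f \<in> carrier S. \<forall>i. f i \<in> {0}}"

lemma homogeneousE:
  assumes "T \<subseteq> (\<Union>n. G n)" "x \<in> T"
  obtains P n where "x = tmon P n" "P \<in> filt B n"
proof -
  have "x \<in> (\<Union>n. G n)" using assms by (rule subsetD)
  then obtain n where "x \<in> G n" by (rule UN_E)
  then show thesis using that by (auto simp: mem_G)
qed

lemma istopology_Proj:
  "istopology (\<lambda>U. \<exists>T \<subseteq> (\<Union>n. G n). U = pts - {q \<in> pts. T \<subseteq> q})"
proof -
  let ?P = "\<lambda>U. \<exists>T \<subseteq> (\<Union>n. G n). U = pts - {q \<in> pts. T \<subseteq> q}"
  have Int: "?P (U \<inter> V)" if U: "?P U" and V: "?P V" for U V
  proof -
    obtain T1 T2 where T: "T1 \<subseteq> (\<Union>n. G n)" "U = pts - {q \<in> pts. T1 \<subseteq> q}"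
      "T2 \<subseteq> (\<Union>n. G n)" "V = pts - {q \<in> pts. T2 \<subseteq> q}" using U V by blast
    \<comment> \<open>The products of elements of T1 and T2 lie in a prime q exactly if T1 or T2
      lies in q.\<close>
    define T where "T = {tmon (P \<star> Q) (n + m) | P Q n m. P \<in> filt B n \<and> Q \<in> filt B m \<and> tmon P n \<in> T1 \<and> tmon Q m \<in> T2}"
    have "T \<subseteq> (\<Union>n. G n)" unfolding T_def by (auto simp: mem_G) (use filt_mult in blast)
    moreover have "T \<subseteq> q \<longleftrightarrow> T1 \<subseteq> q \<or> T2 \<subseteq> q" if q: "q \<in> pts" for q
    proof
      assume Tq: "T \<subseteq> q"
      show "T1 \<subseteq> q \<or> T2 \<subseteq> q"
      proof (rule ccontr)
        assume "\<not> ?thesis"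
        then obtain x y where xy: "x \<in> T1" "x \<notin> q" "y \<in> T2" "y \<notin> q" by blast
        obtain P n Q m where PQ: "x = tmon P n" "P \<in> filt B n" "y = tmon Q m" "Q \<in> filt B m"
          using homogeneousE[OF T(1) xy(1)] homogeneousE[OF T(3) xy(3)] by metis
        then have "tmon (P \<star> Q) (n + m) \<in> q" using Tq xy unfolding T_def by blast
        then show False using pt_prime[OF q] PQ xy by simp
      qed
    next
      assume "T1 \<subseteq> q \<or> T2 \<subseteq> q"
      then show "T \<subseteq> q"
        unfolding T_def using pt_prime[OF q] by fastforce
    qed
    ultimately show ?thesis unfolding T(2,4) by (intro exI[of _ T]) blast
  qed
  have Un: "?P (\<Union>K)" if K: "\<forall>U\<in>K. ?P U" for K
  proof -
    define T where "T U = (SOME T. T \<subseteq> (\<Union>n. G n) \<and> U = pts - {q \<in> pts. T \<subseteq> q})" for U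
    have T: "T U \<subseteq> (\<Union>n. G n) \<and> U = pts - {q \<in> pts. T U \<subseteq> q}" if "U \<in> K" for U
      unfolding T_def by (rule someI_ex[OF bspec[OF K that]])
    have memU: "q \<in> U \<longleftrightarrow> q \<in> pts \<and> \<not> T U \<subseteq> q" if "U \<in> K" for U q
      by (subst conjunct2[OF T[OF that]]) blast
    have "(\<Union>U\<in>K. T U) \<subseteq> (\<Union>n. G n)" using T by (intro UN_least) simp
    moreover have "\<Union>K = pts - {q \<in> pts. (\<Union>U\<in>K. T U) \<subseteq> q}"
      using memU by (auto simp: UN_subset_iff)
    ultimately show ?thesis by (intro exI[of _ "\<Union>U\<in>K. T U"]) simp
  qed
  show ?thesis unfolding istopology_def using Int Un by simp
qed

lemma is_open_iff: "is_open X U \<longleftrightarrow> (\<exists>T \<subseteq> (\<Union>n. G n). U = pts - {q \<in> pts. T \<subseteq> q})"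
  unfolding curve_def Proj_def Proj_top_def by (simp add: topology_inverse'[OF istopology_Proj])

lemma open_subset_pts: "is_open X U \<Longrightarrow> U \<subseteq> pts"
  by (auto simp: is_open_iff)

lemma open_basic [simp]: "Q \<in> filt B n \<Longrightarrow> is_open X (basic n Q)"
proof -
  assume "Q \<in> filt B n"
  then have "{tmon Q n} \<subseteq> (\<Union>n. G n)" using tmon_G[of Q n] by blast
  moreover have "basic n Q = pts - {q \<in> pts. {tmon Q n} \<subseteq> q}" by (auto simp: basic_def)
  ultimately show "is_open X (basic n Q)" unfolding is_open_iff by blast
qed

lemma basic_one: "basic 0 1 = pts"
  by (auto simp: basic_def pt_one)

lemma whole_X [simp]: "whole X = pts"
proof
  show "whole X \<subseteq> pts" using open_subset_pts[OF openin_topspace] .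
  show "pts \<subseteq> whole X" using openin_subset[OF open_basic[of 1 0]] by (simp add: basic_one)
qed

lemma open_pts [simp]: "is_open X pts"
  using open_basic[of 1 0] by (simp add: basic_one)

lemma open_base:
  assumes "is_open X U" "q \<in> U"
  obtains n Q where "Q \<in> filt B n" "q \<in> basic n Q" "basic n Q \<subseteq> U"
proof -
  obtain T where T: "T \<subseteq> (\<Union>n. G n)" "U = pts - {q \<in> pts. T \<subseteq> q}"
    using assms(1) unfolding is_open_iff by blast
  then obtain x where x: "x \<in> T" "x \<notin> q" using assms(2) by blast
  obtain n Q where "Q \<in> filt B n" "x = tmon Q n" using homogeneousE[OF T(1) x(1)] by metis
  then show thesis using x T(2) assms(2) by (intro that[of Q n]) (auto simp: basic_def)
qed

lemma basic_mult:
  assumes "P \<in> filt B n" "Q \<in> filt B m"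
  shows "basic (n + m) (P \<star> Q) = basic n P \<inter> basic m Q"
  using assms by (auto simp: basic_def pt_prime)

lemma basic_nonzero: "q \<in> basic n Q \<Longrightarrow> Q \<noteq> 0"
  by (auto simp: basic_def pt_zero)

lemma generic_pt: "generic_pt \<in> pts" "Q \<in> filt B n \<Longrightarrow> tmon Q n \<in> generic_pt \<longleftrightarrow> Q = 0"
proof -
  obtain E where E: "E \<in> B" "E \<noteq> 0" "degree E > 0" by (rule elliptic)
  have "{0} \<noteq> filt B (Suc 0)" using filt_one[of "Suc 0"] by (metis singletonD zero_neq_one)
  note * = homogeneous_prime[of "\<lambda>_. {0}" "Suc 0", folded generic_pt_def]
  show "generic_pt \<in> pts" by (rule *(1)) (use \<open>{0} \<noteq> filt B (Suc 0)\<close> in auto)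
  show "tmon Q n \<in> generic_pt \<longleftrightarrow> Q = 0"
    using *(2)[of Q n] \<open>{0} \<noteq> filt B (Suc 0)\<close> by auto
qed

lemma generic_pt_basic: "Q \<in> filt B n \<Longrightarrow> Q \<noteq> 0 \<Longrightarrow> generic_pt \<in> basic n Q"
  by (simp add: basic_def generic_pt)

text \<open>A basic open set around a point belongs to a nonzero Q, and the generic point contains
  no nonzero homogeneous element. So the curve is irreducible, and two functions or sections can
  always be compared at the generic point.\<close>

lemma generic_pt_open:
  assumes "is_open X U" "U \<noteq> {}"
  shows "generic_pt \<in> U"
proof -
  obtain q where q: "q \<in> U" using assms(2) by blast
  obtain n Q where Q: "Q \<in> filt B n" "q \<in> basic n Q" "basic n Q \<subseteq> U"
    by (rule open_base[OF assms(1) q])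
  show ?thesis using generic_pt_basic[OF Q(1) basic_nonzero[OF Q(2)]] Q(3) by blast
qed

lemma open_Int_nonempty:
  "is_open X U \<Longrightarrow> is_open X V \<Longrightarrow> U \<noteq> {} \<Longrightarrow> V \<noteq> {} \<Longrightarrow> U \<inter> V \<noteq> {}"
  using generic_pt_open by blast

text \<open>Multiplication by t shifts the components by one place. The condition ord P + r \<le> i
  r says that P lies in \<open>filt B (i - 1)\<close>; written without subtraction, it leaves only 0
  for i = 0.\<close>

lemma pinf_eq: "pinf = {f \<in> carrier S. \<forall>i. f i \<in> {P \<in> filt B i. P = 0 \<or> degree P + r \<le> i * r}}"
proof (intro equalityI subsetI)
  have t: "tmon 1 1 \<in> carrier S" by (simp add: tmon_carrier)
  have mult: "g \<otimes>\<^bsub>S\<^esub> tmon 1 1 = (\<lambda>i. if i = 0 then 0 else g (i - 1))" if "g \<in> carrier S" for g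
  proof
    fix n
    have "(g \<otimes>\<^bsub>S\<^esub> tmon 1 1) n = (\<Sum>i\<le>n. g i \<star> tmon 1 1 (n - i))"
      using rees_mult[OF that t] by simp
    also have "\<dots> = (\<Sum>i\<le>n. if i = n - 1 then if n = 0 then 0 else g (n - 1) else 0)"
      by (intro sum.cong refl) (auto simp: tmon_def)
    finally show "(g \<otimes>\<^bsub>S\<^esub> tmon 1 1) n = (if n = 0 then 0 else g (n - 1))" by simp
  qed
  {
    fix f assume "f \<in> pinf"
    then obtain g where g: "g \<in> carrier S" "f = g \<otimes>\<^bsub>S\<^esub> tmon 1 1"
      by (auto simp: inf_pt_def cgenideal_def)
    have fg: "f = (\<lambda>i. if i = 0 then 0 else g (i - 1))" unfolding g(2) by (rule mult[OF g(1)])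
    have "f \<in> carrier S" using g rees_mult_closed t by simp
    moreover have "f i = 0 \<or> degree (f i) + r \<le> i * r" for i
    proof (cases i)
      case (Suc j)
      have "g j \<in> filt B j" using g by (simp add: carrier_rees)
      then show ?thesis using Suc by (simp add: fg filt_def)
    qed (simp add: fg)
    ultimately show "f \<in> {f \<in> carrier S. \<forall>i. f i \<in> {P \<in> filt B i. P = 0 \<or> degree P + r \<le> i * r}}"
      by (simp add: carrier_rees)
  next
    fix f assume "f \<in> {f \<in> carrier S. \<forall>i. f i \<in> {P \<in> filt B i. P = 0 \<or> degree P + r \<le> i * r}}"
    then have f: "f \<in> carrier S" "\<And>i. f i \<in> filt B i" "\<And>i. f i = 0 \<or> degree (f i) + r \<le> i * r" by auto
    define g where "g = (\<lambda>i. f (Suc i))"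
    have "f (Suc i) \<in> filt B i" for i
      using f(2)[of "Suc i"] f(3)[of "Suc i"] by (auto simp: filt_def)
    moreover obtain n where "\<forall>m>n. f m = 0" using f(1) by (auto simp: carrier_rees)
    ultimately have g: "g \<in> carrier S" by (auto simp: carrier_rees g_def intro!: exI[of _ n])
    have "f 0 = 0" using f(3)[of 0] r_pos by auto
    then have "f = g \<otimes>\<^bsub>S\<^esub> tmon 1 1" using mult[OF g] by (auto simp: g_def)
    then show "f \<in> pinf" using g by (auto simp: inf_pt_def cgenideal_def)
  }
qed

text \<open>Orders are multiples of r, so a component in degree n that is not divisible by t has
  order exactly n r. These extremal orders add up under products, hence (t) is prime.\<close>

lemma pinf: "pinf \<in> pts" "P \<in> filt B n \<Longrightarrow> tmon P n \<notin> pinf \<longleftrightarrow> P \<noteq> 0 \<and> degree P = n * r"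
proof -
  define J where "J = (\<lambda>i. {P \<in> filt B i. P = 0 \<or> degree P + r \<le> i * r})"
  have J: "P \<in> filt B n - J n \<longleftrightarrow> P \<in> filt B n \<and> P \<noteq> 0 \<and> degree P = n * r" for P n
  proof
    assume P: "P \<in> filt B n - J n"
    then have *: "P \<in> B" "P \<noteq> 0" "degree P \<le> n * r" "n * r < degree P + r" by (auto simp: J_def filt_def)
    obtain k where k: "degree P = r * k" using r_dvd[OF *(1)] by blast
    have "k \<le> n" "n < Suc k" 
      using *(3,4) k mult_le_cancel2[of k r n] mult_less_cancel2[of n r "Suc k"] by (auto simp: mult.commute)
    then show "P \<in> filt B n \<and> P \<noteq> 0 \<and> degree P = n * r" using P * k by (auto simp: mult.commute)
  next
    assume "P \<in> filt B n \<and> P \<noteq> 0 \<and> degree P = n * r"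
    then show "P \<in> filt B n - J n" using r_pos by (auto simp: J_def)
  qed
  have 1: "J n \<subseteq> filt B n" "0 \<in> J n" for n by (auto simp: J_def)
  have 2: "P + Q \<in> J n" if "P \<in> J n" "Q \<in> J n" for P Q n
    using that degree_add_le_max[of P Q] by (auto simp: J_def)
  have 3: "P \<star> Q \<in> J (n + m)" if "P \<in> J n" "Q \<in> filt B m" for P Q n m
    using that op_mult_degree_le[of P Q] filt_mult[of P n Q m]
    by (auto simp: J_def filt_def add_mult_distrib)
  have 4: "P \<star> Q \<notin> J (n + m)" if "P \<in> filt B n - J n" "Q \<in> filt B m - J m" for P Q n m
  proof -
    have "P \<noteq> 0" "Q \<noteq> 0" "degree P = n * r" "degree Q = m * r" using that J by auto
    then show ?thesis using r_pos by (auto simp: J_def op_mult_nonzero add_mult_distrib)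
  qed
  have 5: "1 \<notin> J 0" using r_pos by (auto simp: J_def)
  \<comment> \<open>A power of t times E lying at its extremal order is a homogeneous element of
    positive degree outside (t), so the irrelevant ideal is not contained in (t).\<close>
  obtain E where E: "E \<in> B" "E \<noteq> 0" "degree E > 0" by (rule elliptic)
  obtain k where k: "degree E = r * k" using r_dvd[OF E(1)] by blast
  have "E \<in> filt B k - J k" unfolding J using E k by (simp add: filt_def mult.commute)
  then have 6: "k > 0" "J k \<noteq> filt B k" using E k by (auto intro: ccontr)
  have p: "pinf = {f \<in> carrier S. \<forall>i. f i \<in> J i}" unfolding J_def by (rule pinf_eq)
  show "pinf \<in> pts" unfolding p by (rule homogeneous_prime(1)[OF 1 2 3 4 5 6])
  show "P \<in> filt B n \<Longrightarrow> tmon P n \<notin> pinf \<longleftrightarrow> P \<noteq> 0 \<and> degree P = n * r"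
    unfolding p using homogeneous_prime(2)[OF 1 2 3 4 5 6, of P n] J[of P n] by auto
qed

lemma X0_basic: "X0 = basic 1 1"
  by (auto simp: affine_part_def basic_def)

lemma open_X0 [simp]: "is_open X X0" by (simp add: X0_basic)

lemma X0_sub_pts: "X0 \<subseteq> pts" by (auto simp: X0_basic basic_def)

lemma X0_nonempty: "X0 \<noteq> {}"
  using generic_pt_basic[of 1 1] by (auto simp: X0_basic)

text \<open>Suppose t \<in> q, let P t^n be of extremal order and Q t^k outside q. The powers Q^n
  and P^k have the same order, so a constant multiple of one cancels the leading term of the other
  and the difference is divisible by t. If P t^n were in q, then so would be (Q t^k)^n.\<close>

lemma pts_cases:
  assumes q: "q \<in> pts"
  obtains "q \<in> X0" | "q = pinf"
proof (cases "q \<in> X0")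
  case False
  then have t: "tmon 1 1 \<in> q" using q by (auto simp: X0_basic basic_def)
  \<comment> \<open>An order below n r is at most (n - 1) r, because it is a multiple of r; so P t^n
    is a multiple of t.\<close>
  have low: "tmon P n \<in> q" if "P \<in> filt B n" "P = 0 \<or> degree P < n * r" for P n
  proof (cases "P = 0")
    case False
    then have d: "P \<in> B" "degree P < n * r" using that by auto
    obtain k where k: "degree P = r * k" using r_dvd[OF d(1)] by blast
    then have "k < n" using d(2) by (simp add: mult.commute)
    then obtain m where m: "n = Suc m" "k \<le> m" by (cases n) auto
    then have "P \<in> filt B m" using d k by (auto simp: filt_def mult.commute)
    then show ?thesis using pt_prime[OF q, of P m 1 1] t m by simp
  qed (simp add: pt_zero q)
  have "q = pinf"
  proof (rule pt_eqI[OF q pinf(1)])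
    fix n P assume P: "P \<in> filt B n"
    show "tmon P n \<in> q \<longleftrightarrow> tmon P n \<in> pinf"
    proof
      assume "tmon P n \<in> pinf"
      then show "tmon P n \<in> q"
        using pinf(2)[OF P] low[OF P] P by (fastforce simp: filt_def)
    next
      assume Pq: "tmon P n \<in> q"
      show "tmon P n \<in> pinf"
      proof (rule ccontr)
        assume "tmon P n \<notin> pinf"
        then have Pn: "P \<noteq> 0" "degree P = n * r" "P \<in> B" using pinf(2)[OF P] P by auto
        have "n > 0"
        proof (rule ccontr)
          assume "\<not> n > 0"
          then obtain c where c: "P = const_op c" using degree_eq_0_const[of P thesis] Pn by auto
          then have "c \<noteq> 0" using Pn by (auto simp: const_op_def)
          then have "const_op (1 / c) \<star> P = 1" using c const_op_nonzero_inv by simp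
          then show False
            using pt_prime[OF q, of "const_op (1 / c)" 0 P 0] Pq pt_one[OF q] P \<open>\<not> n > 0\<close> by simp
        qed
        obtain k Q where Q: "k > 0" "Q \<in> filt B k" "tmon Q k \<notin> q" by (rule pt_nonvanishing[OF q])
        have Qk: "Q \<noteq> 0" "degree Q = k * r"
        proof -
          have "\<not> (Q = 0 \<or> degree Q < k * r)" using low[OF Q(2)] Q(3) by blast
          moreover have "degree Q \<le> k * r" using Q(2) by (simp add: filt_def)
          ultimately show "Q \<noteq> 0" "degree Q = k * r" by auto
        qed
        let ?Q = "op_pow Q n" and ?P = "op_pow P k"
        have mem: "?Q \<in> filt B (n * k)" "?P \<in> filt B (n * k)"
          using filt_pow[OF Q(2), of n] filt_pow[OF P, of k] by (simp_all add: mult.commute)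
        have "degree ?Q = n * k * r" "degree ?P = n * k * r"
          using degree_pow Pn Qk by (simp_all add: mult_ac)
        then obtain c where c: "?Q - const_op c \<star> ?P = 0 \<or> degree (?Q - const_op c \<star> ?P) < n * k * r"
          using cancel_lead[of ?Q ?P thesis] mem pow_nonzero Pn Qk by (auto dest!: filtD)
        have cP: "const_op c \<star> ?P \<in> filt B (n * k)" using filt_mult[of "const_op c" 0 ?P "n * k"] mem by simp
        have 1: "tmon (?Q - const_op c \<star> ?P) (n * k) \<in> q" using mem c cP by (intro low) auto
        have "tmon ?P (n * k) \<in> q"
        proof -
          obtain j where "k = Suc j" using Q(1) by (cases k) auto
          moreover have "tmon (P \<star> op_pow P j) (n + j * n) \<in> q"
            using pt_prime[OF q P filt_pow[OF P]] Pq by blast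
          ultimately show ?thesis by (simp add: mult.commute)
        qed
        then have "tmon (const_op c \<star> ?P) (n * k) \<in> q"
          using pt_prime[OF q, of "const_op c" 0 ?P "n * k"] mem by simp
        then have "tmon ?Q (n * k) \<in> q"
          using pt_add[OF q _ cP 1] mem cP by simp
        then show False using pt_pow[OF q Q(2,3)] by simp
      qed
    qed
  qed
  then show thesis by (rule that(2))
qed (rule that(1))

text \<open>The distinguished open subset of Spec B. With an exponent above the order, Q t^(ord Q +
  1) is a multiple of t, which excludes the point at infinity even when Q is constant.\<close>

definition aff :: "diffop \<Rightarrow> spt set" where
  "aff Q = basic (Suc (degree Q)) Q"

lemma X0_tmon_one: "q \<in> X0 \<Longrightarrow> tmon 1 n \<notin> q"
proof -
  assume q: "q \<in> X0"
  have "op_pow 1 n = 1" by (induction n) auto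
  then show "tmon 1 n \<notin> q" using pt_pow[of q 1 1 n] q by (simp add: X0_basic basic_def)
qed

lemma aff_X0: "Q \<in> B \<Longrightarrow> aff Q \<subseteq> X0"
  using pt_prime[of _ Q "degree Q" 1 1] filt_degree[of Q "degree Q"]
  by (auto simp: aff_def basic_def X0_basic)

lemma X0_tmon_iff:
  assumes "q \<in> X0" "Q \<in> filt B n" "Q \<in> filt B m"
  shows "tmon Q n \<in> q \<longleftrightarrow> tmon Q m \<in> q"
proof -
  have q: "q \<in> pts" using assms X0_sub_pts by auto
  show ?thesis
    using pt_prime[OF q assms(2), of 1 m] pt_prime[OF q assms(3), of 1 n]
      X0_tmon_one[OF assms(1)] by (simp add: add.commute)
qed

lemma aff_iff:
  assumes "q \<in> X0" "Q \<in> filt B n"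
  shows "q \<in> aff Q \<longleftrightarrow> tmon Q n \<notin> q"
  using X0_tmon_iff[OF assms filt_degree_Suc[OF filtD[OF assms(2)]]] assms X0_sub_pts
  by (auto simp: aff_def basic_def)

lemma open_aff [simp]: "Q \<in> B \<Longrightarrow> is_open X (aff Q)"
  by (simp add: aff_def filt_degree_Suc)

lemma aff_one [simp]: "aff 1 = X0"
  by (simp add: aff_def X0_basic)

lemma aff_zero [simp]: "aff 0 = {}"
  by (auto simp: aff_def basic_def pt_zero)

lemma aff_mult: "P \<in> B \<Longrightarrow> Q \<in> B \<Longrightarrow> aff (P \<star> Q) = aff P \<inter> aff Q"
proof -
  assume PQ: "P \<in> B" "Q \<in> B"
  have "q \<in> aff (P \<star> Q) \<longleftrightarrow> q \<in> aff P \<inter> aff Q" if q: "q \<in> X0" for q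
    using aff_iff[OF q filt_mult[of P "degree P" Q "degree Q"]] aff_iff[OF q, of P "degree P"]
      aff_iff[OF q, of Q "degree Q"] PQ q X0_sub_pts filt_degree pt_prime[of q P "degree P" Q "degree Q"]
    by auto
  then show "aff (P \<star> Q) = aff P \<inter> aff Q" using aff_X0 PQ mult_B by blast
qed

lemma aff_pow: "P \<in> B \<Longrightarrow> aff P \<subseteq> aff (op_pow P n)"
  by (induction n) (auto simp: aff_mult dest: subsetD[OF aff_X0])

lemma aff_add: "P \<in> B \<Longrightarrow> Q \<in> B \<Longrightarrow> aff (P + Q) \<subseteq> aff P \<union> aff Q"
proof
  fix q assume PQ: "P \<in> B" "Q \<in> B" and q: "q \<in> aff (P + Q)"
  have q0: "q \<in> X0" "q \<in> pts" using q aff_X0[of "P + Q"] PQ X0_sub_pts by auto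
  let ?n = "max (degree P) (degree Q)"
  have "P \<in> filt B ?n" "Q \<in> filt B ?n" using PQ by (auto intro: filt_degree)
  then show "q \<in> aff P \<union> aff Q"
    using q pt_add[OF q0(2), of P ?n Q] aff_iff[OF q0(1)] filt_add by blast
qed

lemma generic_pt_aff: "Q \<in> B \<Longrightarrow> Q \<noteq> 0 \<Longrightarrow> generic_pt \<in> aff Q"
  unfolding aff_def by (rule generic_pt_basic) (auto simp: filt_degree_Suc)

lemma aff_base:
  assumes "is_open X U" "q \<in> U" "q \<in> X0"
  obtains Q where "Q \<in> B" "Q \<noteq> 0" "q \<in> aff Q" "aff Q \<subseteq> U"
proof -
  obtain n Q where Q: "Q \<in> filt B n" "q \<in> basic n Q" "basic n Q \<subseteq> U"
    by (rule open_base[OF assms(1,2)])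
  have "aff Q \<subseteq> basic n Q"
    using aff_iff[OF _ Q(1)] aff_X0[of Q] Q(1) X0_sub_pts by (auto simp: basic_def)
  then show thesis
    using Q aff_iff[OF assms(3) Q(1)] basic_nonzero[OF Q(2)] by (intro that[of Q]) (auto simp: basic_def)
qed

text \<open>An ideal M maximal among those that contain J and avoid all powers of f is prime. Its
  intersections with the spaces \<open>filt B n\<close> are the components of a point of
  \<open>aff f\<close> that lies in no \<open>aff R\<close> with R \<in> J, contrary to the
  hypothesis. Zorn's lemma replaces any finiteness of B.\<close>

lemma nullstellensatz:
  assumes J: "J \<subseteq> B" "0 \<in> J" "\<And>P Q. P \<in> J \<Longrightarrow> Q \<in> J \<Longrightarrow> P + Q \<in> J"
    "\<And>P Q. P \<in> J \<Longrightarrow> Q \<in> B \<Longrightarrow> P \<star> Q \<in> J"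
    and f: "f \<in> B" and loc: "\<And>q. q \<in> aff f \<Longrightarrow> \<exists>R\<in>J. q \<in> aff R"
  obtains N where "op_pow f N \<in> J"
proof (rule ccontr)
  assume "\<not> thesis"
  then have no: "op_pow f N \<notin> J" for N using that by blast
  define \<A> where "\<A> = {I. J \<subseteq> I \<and> I \<subseteq> B \<and> (\<forall>P\<in>I. \<forall>Q\<in>I. P + Q \<in> I) \<and> (\<forall>P\<in>I. \<forall>Q\<in>B. P \<star> Q \<in> I) \<and> (\<forall>N. op_pow f N \<notin> I)}"
  have "J \<in> \<A>" using J no by (auto simp: \<A>_def)
  moreover have "\<Union>C \<in> \<A>" if C: "C \<noteq> {}" "subset.chain \<A> C" for C
  proof -
    have sub: "C \<subseteq> \<A>" and tot: "I \<subseteq> I' \<or> I' \<subseteq> I" if "I \<in> C" "I' \<in> C" for I I'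
      using C(2) that by (auto simp: subset.chain_def)
    have CA: "I \<in> \<A>" if "I \<in> C" for I using sub[OF that that] that by blast
    have "P + Q \<in> \<Union>C" if "P \<in> \<Union>C" "Q \<in> \<Union>C" for P Q
    proof -
      obtain I I' where I: "I \<in> C" "I' \<in> C" "P \<in> I" "Q \<in> I'" using \<open>P \<in> \<Union>C\<close> \<open>Q \<in> \<Union>C\<close> by blast
      obtain K where K: "K \<in> C" "P \<in> K" "Q \<in> K" using tot[OF I(1,2)] I by blast
      then have "P + Q \<in> K" using CA[OF K(1)] by (simp add: \<A>_def)
      then show ?thesis using K(1) by blast
    qed
    moreover have "J \<subseteq> \<Union>C" "\<Union>C \<subseteq> B" using C(1) CA by (fastforce simp: \<A>_def)+
    moreover have "P \<star> Q \<in> \<Union>C" if "P \<in> \<Union>C" "Q \<in> B" for P Q using CA that by (auto simp: \<A>_def)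
    moreover have "op_pow f N \<notin> \<Union>C" for N using CA by (auto simp: \<A>_def)
    ultimately show ?thesis by (simp add: \<A>_def)
  qed
  ultimately obtain M where M: "M \<in> \<A>" "\<And>I. I \<in> \<A> \<Longrightarrow> M \<subseteq> I \<Longrightarrow> I = M"
    using subset_Zorn_nonempty[of \<A>] by blast
  have sub: "J \<subseteq> M" "M \<subseteq> B" and add: "\<And>P Q. P \<in> M \<Longrightarrow> Q \<in> M \<Longrightarrow> P + Q \<in> M"
    and mult: "\<And>P Q. P \<in> M \<Longrightarrow> Q \<in> B \<Longrightarrow> P \<star> Q \<in> M" and noM: "\<And>N. op_pow f N \<notin> M"
    using M(1) by (auto simp: \<A>_def)
  \<comment> \<open>By maximality, the ideal generated by M and an element outside M contains a
    power of f. Multiplying two such powers gives primality of M.\<close>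
  have ext: "\<exists>N P Q. P \<in> M \<and> Q \<in> B \<and> op_pow f N = P + A \<star> Q" if A: "A \<in> B" "A \<notin> M" for A
  proof (rule ccontr)
    assume neg: "\<not> ?thesis"
    let ?I = "{P + A \<star> Q | P Q. P \<in> M \<and> Q \<in> B}"
    have "P + A \<star> 0 \<in> ?I" if "P \<in> M" for P using that zero_B by blast
    then have MI: "M \<subseteq> ?I" by auto
    have "0 + A \<star> 1 \<in> ?I" using sub J(2) one_B by blast
    then have AI: "A \<in> ?I" by simp
    have "?I \<in> \<A>"
      unfolding \<A>_def
    proof (rule CollectI, intro conjI ballI allI)
      show "J \<subseteq> ?I" using MI sub by blast
      show "?I \<subseteq> B" using sub A by auto
      show "P + Q \<in> ?I" if "P \<in> ?I" "Q \<in> ?I" for P Q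
      proof -
        obtain P1 P2 Q1 Q2 where *: "P = P1 + A \<star> P2" "Q = Q1 + A \<star> Q2" "P1 \<in> M" "Q1 \<in> M" "P2 \<in> B" "Q2 \<in> B"
          using \<open>P \<in> ?I\<close> \<open>Q \<in> ?I\<close> by blast
        then have "P + Q = (P1 + Q1) + A \<star> (P2 + Q2)" by (simp add: op_mult_add_right)
        moreover have "P1 + Q1 \<in> M" "P2 + Q2 \<in> B" using * add by auto
        ultimately show ?thesis by blast
      qed
      show "P \<star> Q \<in> ?I" if "P \<in> ?I" "Q \<in> B" for P Q
      proof -
        obtain P1 P2 where *: "P = P1 + A \<star> P2" "P1 \<in> M" "P2 \<in> B" using \<open>P \<in> ?I\<close> by blast
        then have "P \<star> Q = P1 \<star> Q + A \<star> (P2 \<star> Q)" by (simp add: op_mult_add_left op_mult_assoc)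
        moreover have "P1 \<star> Q \<in> M" "P2 \<star> Q \<in> B" using * mult \<open>Q \<in> B\<close> by auto
        ultimately show ?thesis by blast
      qed
      show "op_pow f N \<notin> ?I" for N using neg by blast
    qed
    then show False using M(2)[OF _ MI] AI A by blast
  qed
  have prime: "A \<star> C \<notin> M" if AC: "A \<in> B" "A \<notin> M" "C \<in> B" "C \<notin> M" for A C
  proof
    assume ACM: "A \<star> C \<in> M"
    obtain N P Q where 1: "P \<in> M" "Q \<in> B" "op_pow f N = P + A \<star> Q" using ext AC by blast
    obtain N' P' Q' where 2: "P' \<in> M" "Q' \<in> B" "op_pow f N' = P' + C \<star> Q'" using ext AC by blast
    have PB: "P \<in> B" "P' \<in> B" using 1 2 sub by auto
    have "(A \<star> Q) \<star> P' = P' \<star> (A \<star> Q)" using 1 AC PB by (simp add: mult_comm)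
    moreover have "(A \<star> Q) \<star> (C \<star> Q') = (A \<star> C) \<star> (Q \<star> Q')"
      using 1 2 AC by (simp add: op_mult_assoc mult_left_comm)
    ultimately have "op_pow f (N + N') = P \<star> (P' + C \<star> Q') + (P' \<star> (A \<star> Q) + (A \<star> C) \<star> (Q \<star> Q'))"
      unfolding op_pow_add 1(3) 2(3) by (simp add: op_mult_add_left op_mult_add_right)
    moreover have "\<dots> \<in> M"
      using mult[OF 1(1), of "P' + C \<star> Q'"] mult[OF 2(1), of "A \<star> Q"] mult[OF ACM, of "Q \<star> Q'"] 1 2 AC PB
      by (intro add) auto
    ultimately show False using noM by metis
  qed
  have prime': "P \<in> M \<or> Q \<in> M" if "P \<star> Q \<in> M" "P \<in> filt B n" "Q \<in> filt B m" for P Q n m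
    using prime[of P Q] that filtD by blast
  have "1 \<notin> M" using noM[of 0] by simp
  define q where "q = {g \<in> carrier S. \<forall>i. g i \<in> M \<inter> filt B i}"
  have ne: "M \<inter> filt B (Suc 0) \<noteq> filt B (Suc 0)" using \<open>1 \<notin> M\<close> filt_one by blast
  have q: "q \<in> pts \<and> (\<forall>P n. tmon P n \<in> q \<longleftrightarrow> P \<in> M \<inter> filt B n)"
    unfolding q_def
    by (intro conjI allI homogeneous_prime[where ?J = "\<lambda>n. M \<inter> filt B n" and ?n0.0 = "Suc 0"])
       (use ne sub J(2) add mult \<open>1 \<notin> M\<close> in \<open>auto dest: filtD prime'\<close>)
  then have q0: "q \<in> X0" using \<open>1 \<notin> M\<close> by (simp add: X0_basic basic_def)
  have "f \<notin> M" using noM[of 1] by simp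
  then have "q \<in> aff f" using aff_iff[OF q0 filt_degree_Suc[OF f]] q by blast
  then obtain R where R: "R \<in> J" "q \<in> aff R" using loc by blast
  then have "R \<in> B" "R \<in> M" using J(1) sub by auto
  then have "q \<notin> aff R" using aff_iff[OF q0 filt_degree_Suc[of R]] q filt_degree_Suc by blast
  then show False using R by blast
qed

text \<open>Quasi-compactness of X0 in the form used throughout: J collects the elements over whose
  distinguished open set a construction succeeds, and 1 \<in> J means that it succeeds on all of
  X0.\<close>

lemma affine_cover:
  assumes J: "J \<subseteq> B" "0 \<in> J" "\<And>P Q. P \<in> J \<Longrightarrow> Q \<in> J \<Longrightarrow> P + Q \<in> J"
    "\<And>P Q. P \<in> J \<Longrightarrow> Q \<in> B \<Longrightarrow> P \<star> Q \<in> J"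
    and loc: "\<And>q. q \<in> X0 \<Longrightarrow> \<exists>R\<in>J. q \<in> aff R"
  shows "1 \<in> J"
proof -
  obtain N where "op_pow 1 N \<in> J"
    using nullstellensatz[OF J one_B] loc by auto
  moreover have "op_pow 1 N = 1" by (induction N) auto
  ultimately show ?thesis by simp
qed

section \<open>The structure sheaf\<close>

text \<open>The germ at \<open>q\<close> of the rational function \<open>A/Q\<close>; it is empty if \<open>A/Q\<close> is not regular at \<open>q\<close>.\<close>

definition frac_at :: "spt \<Rightarrow> diffop \<Rightarrow> diffop \<Rightarrow> (rees \<times> rees) set" where
  "frac_at q A Q = {(tmon C m, tmon R m) | C R m.
     C \<in> filt B m \<and> R \<in> filt B m \<and> tmon R m \<notin> q \<and> A \<star> R = C \<star> Q}"

definition sect :: "spt set \<Rightarrow> diffop \<Rightarrow> diffop \<Rightarrow> sfun" where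
  "sect U A Q = (\<lambda>q\<in>U. frac_at q A Q)"

definition reg :: "spt \<Rightarrow> diffop \<Rightarrow> diffop \<Rightarrow> bool" where
  "reg q A Q \<longleftrightarrow> (\<exists>C R m. C \<in> filt B m \<and> R \<in> filt B m \<and> tmon R m \<notin> q \<and> A \<star> R = C \<star> Q)"

definition fraction :: "diffop \<Rightarrow> diffop \<Rightarrow> bool" where
  "fraction A Q \<longleftrightarrow> A \<in> B \<and> Q \<in> B \<and> Q \<noteq> 0"

lemma tmon_notin_nonzero: "q \<in> pts \<Longrightarrow> tmon R m \<notin> q \<Longrightarrow> R \<noteq> 0"
  using pt_zero by auto

lemma regE:
  assumes "q \<in> pts" "reg q A Q"
  obtains C R m where "C \<in> filt B m" "R \<in> filt B m" "tmon R m \<notin> q" "R \<noteq> 0" "fraction C R" "A \<star> R = C \<star> Q"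
  using assms tmon_notin_nonzero unfolding reg_def fraction_def by (metis filtD)

lemma tmon_eq_iff: "P \<noteq> 0 \<Longrightarrow> tmon P n = tmon Q m \<longleftrightarrow> n = m \<and> P = Q"
  by (auto simp: tmon_def fun_eq_iff split: if_splits)

lemma frac_at_mem:
  assumes "q \<in> pts"
  shows "(tmon C m, tmon R m) \<in> frac_at q A Q \<longleftrightarrow> C \<in> filt B m \<and> R \<in> filt B m \<and> tmon R m \<notin> q \<and> A \<star> R = C \<star> Q"
proof
  assume "(tmon C m, tmon R m) \<in> frac_at q A Q"
  then obtain C' R' m' where *: "tmon C m = tmon C' m'" "tmon R m = tmon R' m'"
     "C' \<in> filt B m'" "R' \<in> filt B m'" "tmon R' m' \<notin> q" "A \<star> R' = C' \<star> Q"
    unfolding frac_at_def by blast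
  have "R' \<noteq> 0" using tmon_notin_nonzero[OF assms *(5)] .
  then have "m = m'" "R = R'" using *(2) tmon_eq_iff[of R' m' R m] by auto
  then show "C \<in> filt B m \<and> R \<in> filt B m \<and> tmon R m \<notin> q \<and> A \<star> R = C \<star> Q"
    using * by simp
qed (auto simp: frac_at_def)

lemma frac_at_nonempty_iff: "frac_at q A Q \<noteq> {} \<longleftrightarrow> reg q A Q"
  by (auto simp: frac_at_def reg_def)

lemma cross_trans:
  assumes "A \<in> B" "Q \<in> B" "Q \<noteq> 0" "A' \<in> B" "Q' \<in> B" "C \<in> B" "R \<in> B"
    "A \<star> Q' = A' \<star> Q" "A \<star> R = C \<star> Q"
  shows "A' \<star> R = C \<star> Q'"
proof -
  have "(A' \<star> R) \<star> Q = (A \<star> Q') \<star> R" using assms by (simp add: mult_ac_B)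
  also have "\<dots> = (A \<star> R) \<star> Q'" using assms(1-7) by (simp add: mult_ac_B)
  also have "\<dots> = (C \<star> Q') \<star> Q" unfolding assms(9) using assms(1-7) by (simp add: mult_ac_B)
  finally show ?thesis using assms by (subst (asm) mult_cancel_B) auto
qed

lemma frac_at_cong:
  assumes "fraction A Q" "fraction A' Q'" "A \<star> Q' = A' \<star> Q"
  shows "frac_at q A Q = frac_at q A' Q'"
proof -
  have "A \<star> R = C \<star> Q \<longleftrightarrow> A' \<star> R = C \<star> Q'" if "C \<in> filt B m" "R \<in> filt B m" for C R m
    using cross_trans[of A Q A' Q' C R] cross_trans[of A' Q' A Q C R] assms that filtD
    unfolding fraction_def by metis
  then show ?thesis unfolding frac_at_def by blast
qed

lemma reg_cong:
  assumes "fraction A Q" "fraction A' Q'" "A \<star> Q' = A' \<star> Q"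
  shows "reg q A Q \<longleftrightarrow> reg q A' Q'"
  using frac_at_cong[OF assms, of q] frac_at_nonempty_iff by metis

text \<open>Regularity of A/Q provides a representative C/R shared by both germs, and this compares
  the fractions. Germs of functions with a pole at q are all empty and could not be told
  apart.\<close>

lemma frac_at_inject:
  assumes q: "q \<in> pts" and fr: "fraction A Q" "fraction A' Q'" and "reg q A Q"
    and eq: "frac_at q A Q = frac_at q A' Q'"
  shows "A \<star> Q' = A' \<star> Q"
proof -
  obtain C R m where C: "C \<in> filt B m" "R \<in> filt B m" "tmon R m \<notin> q" "R \<noteq> 0" "A \<star> R = C \<star> Q"
    using regE[OF q assms(4)] by metis
  then have "(tmon C m, tmon R m) \<in> frac_at q A' Q'" using frac_at_mem[OF q] eq by metis
  then have "A' \<star> R = C \<star> Q'" using frac_at_mem[OF q] by blast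
  then have "C \<star> Q' = A' \<star> R" by simp
  moreover have "C \<star> Q = A \<star> R" using C by simp
  ultimately show ?thesis
    using cross_trans[of C R A Q A' Q'] C fr filtD unfolding fraction_def by metis
qed

text \<open>Products of nonzero operators are nonzero, so the auxiliary factor h in
  \<open>hfrac\<close> cancels in one direction, and h = 1 serves in the other.\<close>

lemma hfrac_eq:
  assumes q: "q \<in> pts" and "A \<in> filt B n" "Q \<in> filt B n"
  shows "hfrac S G q (tmon A n) (tmon Q n) = frac_at q A Q"
proof (intro equalityI subsetI)
  fix x assume "x \<in> hfrac S G q (tmon A n) (tmon Q n)"
  then obtain b g m h where x: "x = (b, g)" "b \<in> G m" "g \<in> G m" "g \<notin> q" "h \<in> (\<Union>n. G n)" "h \<notin> q"
     "h \<otimes>\<^bsub>S\<^esub> (tmon A n \<otimes>\<^bsub>S\<^esub> g) = h \<otimes>\<^bsub>S\<^esub> (b \<otimes>\<^bsub>S\<^esub> tmon Q n)"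
    unfolding hfrac_def by blast
  obtain C R where CR: "b = tmon C m" "C \<in> filt B m" "g = tmon R m" "R \<in> filt B m"
    using x(2,3) by (auto simp: mem_G)
  obtain H k where H: "h = tmon H k" "H \<in> filt B k" by (rule homogeneousE[OF _ x(5)]) auto
  have H0: "H \<noteq> 0" using tmon_notin_nonzero[OF q] x(6) H by blast
  have "tmon (H \<star> (A \<star> R)) (k + (n + m)) = tmon (H \<star> (C \<star> Q)) (k + (m + n))"
    using x(7) assms CR H by (simp add: tmon_mult)
  then have "H \<star> (A \<star> R) = H \<star> (C \<star> Q)" by (simp add: add.commute)
  then have "H \<star> (A \<star> R - C \<star> Q) = 0" by (simp add: op_mult_diff_right)
  then have "A \<star> R = C \<star> Q" using H0 by simp
  then show "x \<in> frac_at q A Q"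
    using CR x by (simp add: frac_at_mem[OF q])
next
  fix x assume "x \<in> frac_at q A Q"
  then obtain C R m where *: "x = (tmon C m, tmon R m)" "C \<in> filt B m" "R \<in> filt B m" "tmon R m \<notin> q" "A \<star> R = C \<star> Q"
    unfolding frac_at_def by blast
  have "tmon 1 0 \<otimes>\<^bsub>S\<^esub> (tmon A n \<otimes>\<^bsub>S\<^esub> tmon R m) = tmon 1 0 \<otimes>\<^bsub>S\<^esub> (tmon C m \<otimes>\<^bsub>S\<^esub> tmon Q n)"
    using * assms by (simp add: tmon_mult add.commute)
  moreover have "tmon 1 0 \<in> (\<Union>n. G n)" by (rule UN_I[of 0]) simp_all
  ultimately have "\<exists>h\<in>(\<Union>n. G n). h \<notin> q \<and> h \<otimes>\<^bsub>S\<^esub> (tmon A n \<otimes>\<^bsub>S\<^esub> tmon R m) = h \<otimes>\<^bsub>S\<^esub> (tmon C m \<otimes>\<^bsub>S\<^esub> tmon Q n)"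
    using pt_one[OF q] by blast
  moreover have "\<exists>n. tmon C m \<in> G n \<and> tmon R m \<in> G n" using * by (intro exI[of _ m]) simp
  ultimately show "x \<in> hfrac S G q (tmon A n) (tmon Q n)"
    unfolding hfrac_def *(1) using *(4) by blast
qed

lemma frac_add: "fraction A Q \<Longrightarrow> fraction A' Q' \<Longrightarrow> fraction (A \<star> Q' + A' \<star> Q) (Q \<star> Q')"
  and frac_mult: "fraction A Q \<Longrightarrow> fraction A' Q' \<Longrightarrow> fraction (A \<star> A') (Q \<star> Q')"
  and frac_uminus: "fraction A Q \<Longrightarrow> fraction (- A) Q"
  and frac_one: "A \<in> B \<Longrightarrow> fraction A 1"
  by (auto simp: fraction_def)

lemma cross_add:
  assumes "fraction A Q" "fraction A' Q'" "fraction C R" "fraction C' R'" "A \<star> R = C \<star> Q" "A' \<star> R' = C' \<star> Q'"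
  shows "(A \<star> Q' + A' \<star> Q) \<star> (R \<star> R') = (C \<star> R' + C' \<star> R) \<star> (Q \<star> Q')"
proof -
  have m: "A \<in> B" "Q \<in> B" "A' \<in> B" "Q' \<in> B" "C \<in> B" "R \<in> B" "C' \<in> B" "R' \<in> B"
    using assms by (auto simp: fraction_def)
  have "(A \<star> Q') \<star> (R \<star> R') = (A \<star> R) \<star> (Q' \<star> R')" using m by (simp add: mult_ac_B)
  also have "\<dots> = (C \<star> R') \<star> (Q \<star> Q')" unfolding assms(5) using m by (simp add: mult_ac_B)
  finally have 1: "(A \<star> Q') \<star> (R \<star> R') = (C \<star> R') \<star> (Q \<star> Q')" .
  have "(A' \<star> Q) \<star> (R \<star> R') = (A' \<star> R') \<star> (Q \<star> R)" using m by (simp add: mult_ac_B)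
  also have "\<dots> = (C' \<star> R) \<star> (Q \<star> Q')" unfolding assms(6) using m by (simp add: mult_ac_B)
  finally show ?thesis using 1 by (simp add: op_mult_add_left)
qed

lemma cross_mult:
  assumes "fraction A Q" "fraction A' Q'" "fraction C R" "fraction C' R'" "A \<star> R = C \<star> Q" "A' \<star> R' = C' \<star> Q'"
  shows "(A \<star> A') \<star> (R \<star> R') = (C \<star> C') \<star> (Q \<star> Q')"
proof -
  have m: "A \<in> B" "Q \<in> B" "A' \<in> B" "Q' \<in> B" "C \<in> B" "R \<in> B" "C' \<in> B" "R' \<in> B"
    using assms by (auto simp: fraction_def)
  have "(A \<star> A') \<star> (R \<star> R') = (A \<star> R) \<star> (A' \<star> R')" using m by (simp add: mult_ac_B)
  also have "\<dots> = (C \<star> C') \<star> (Q \<star> Q')" unfolding assms(5,6) using m by (simp add: mult_ac_B)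
  finally show ?thesis .
qed

lemma
  assumes q: "q \<in> pts" and fr: "fraction A Q" "fraction A' Q'" and rg: "reg q A Q" "reg q A' Q'"
  shows reg_add: "reg q (A \<star> Q' + A' \<star> Q) (Q \<star> Q')"
    and reg_mult: "reg q (A \<star> A') (Q \<star> Q')"
    and hfrac_add_frac_at: "hfrac_add S G q (frac_at q A Q) (frac_at q A' Q') = frac_at q (A \<star> Q' + A' \<star> Q) (Q \<star> Q')"
    and hfrac_mult_frac_at: "hfrac_mult S G q (frac_at q A Q) (frac_at q A' Q') = frac_at q (A \<star> A') (Q \<star> Q')"
proof -
  \<comment> \<open>The value for one arbitrary choice of representatives. It does not depend on
    them, so the unions in \<open>hfrac_add\<close> and \<open>hfrac_mult\<close> collapse to a
    single set.\<close>
  have key: "hfrac S G q (tmon C m \<otimes>\<^bsub>S\<^esub> tmon R' m' \<oplus>\<^bsub>S\<^esub> tmon C' m' \<otimes>\<^bsub>S\<^esub> tmon R m) (tmon R m \<otimes>\<^bsub>S\<^esub> tmon R' m')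
       = frac_at q (A \<star> Q' + A' \<star> Q) (Q \<star> Q') \<and>
     hfrac S G q (tmon C m \<otimes>\<^bsub>S\<^esub> tmon C' m') (tmon R m \<otimes>\<^bsub>S\<^esub> tmon R' m')
       = frac_at q (A \<star> A') (Q \<star> Q') \<and> reg q (A \<star> Q' + A' \<star> Q) (Q \<star> Q') \<and> reg q (A \<star> A') (Q \<star> Q')"
    if C: "C \<in> filt B m" "R \<in> filt B m" "tmon R m \<notin> q" "A \<star> R = C \<star> Q"
      and C': "C' \<in> filt B m'" "R' \<in> filt B m'" "tmon R' m' \<notin> q" "A' \<star> R' = C' \<star> Q'" for C R m C' R' m'
  proof -
    have f: "fraction C R" "fraction C' R'"
      using C C' tmon_notin_nonzero[OF q] by (auto simp: fraction_def)
    have mem: "C \<star> R' + C' \<star> R \<in> filt B (m + m')" "R \<star> R' \<in> filt B (m + m')" "C \<star> C' \<in> filt B (m + m')"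
       "C \<star> R' \<in> filt B (m + m')" "C' \<star> R \<in> filt B (m + m')" 
      using C C' filt_mult[OF C'(1) C(2)] filt_mult[OF C(1) C'(2)] filt_mult[OF C(1) C'(1)] filt_mult[OF C(2) C'(2)]
      by (simp_all add: add.commute)
    have nz: "tmon (R \<star> R') (m + m') \<notin> q" using pt_prime[OF q C(2) C'(2)] C C' by simp
    have 1: "(A \<star> Q' + A' \<star> Q) \<star> (R \<star> R') = (C \<star> R' + C' \<star> R) \<star> (Q \<star> Q')"
      by (rule cross_add[OF fr f C(4) C'(4)])
    have 2: "(A \<star> A') \<star> (R \<star> R') = (C \<star> C') \<star> (Q \<star> Q')"
      by (rule cross_mult[OF fr f C(4) C'(4)])
    have "tmon C m \<otimes>\<^bsub>S\<^esub> tmon R' m' \<oplus>\<^bsub>S\<^esub> tmon C' m' \<otimes>\<^bsub>S\<^esub> tmon R m = tmon (C \<star> R' + C' \<star> R) (m + m')"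
      using tmon_mult[OF C(1) C'(2)] tmon_mult[OF C'(1) C(2)] tmon_add[OF mem(4,5)] by (simp add: add.commute)
    moreover have "tmon C m \<otimes>\<^bsub>S\<^esub> tmon C' m' = tmon (C \<star> C') (m + m')" "tmon R m \<otimes>\<^bsub>S\<^esub> tmon R' m' = tmon (R \<star> R') (m + m')"
      using tmon_mult C C' by auto
    moreover have "frac_at q (C \<star> R' + C' \<star> R) (R \<star> R') = frac_at q (A \<star> Q' + A' \<star> Q) (Q \<star> Q')"
      by (rule frac_at_cong[OF frac_add[OF f] frac_add[OF fr] 1[symmetric]])
    moreover have "frac_at q (C \<star> C') (R \<star> R') = frac_at q (A \<star> A') (Q \<star> Q')"
      by (rule frac_at_cong[OF frac_mult[OF f] frac_mult[OF fr] 2[symmetric]])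
    moreover have "reg q (A \<star> Q' + A' \<star> Q) (Q \<star> Q')" "reg q (A \<star> A') (Q \<star> Q')"
      unfolding reg_def using mem nz 1 2 by blast+
    ultimately show ?thesis using hfrac_eq[OF q] mem by simp
  qed
  obtain C R m where C: "C \<in> filt B m" "R \<in> filt B m" "tmon R m \<notin> q" "A \<star> R = C \<star> Q"
    using rg(1) unfolding reg_def by blast
  obtain C' R' m' where C': "C' \<in> filt B m'" "R' \<in> filt B m'" "tmon R' m' \<notin> q" "A' \<star> R' = C' \<star> Q'"
    using rg(2) unfolding reg_def by blast
  show "reg q (A \<star> Q' + A' \<star> Q) (Q \<star> Q')" "reg q (A \<star> A') (Q \<star> Q')"
    using key[OF C C'] by auto
  have mem: "(tmon C m, tmon R m) \<in> frac_at q A Q" "(tmon C' m', tmon R' m') \<in> frac_at q A' Q'"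
    using C C' by (auto simp: frac_at_mem[OF q])
  have un: "(\<Union>(a, f)\<in>M. \<Union>(b, g)\<in>N. h a f b g) = Z"
    if "\<And>a f b g. (a, f) \<in> M \<Longrightarrow> (b, g) \<in> N \<Longrightarrow> h a f b g = Z" "x \<in> M" "y \<in> N"
    for M N h Z x y using that by (cases x; cases y) fastforce
  show "hfrac_add S G q (frac_at q A Q) (frac_at q A' Q') = frac_at q (A \<star> Q' + A' \<star> Q) (Q \<star> Q')"
    unfolding hfrac_add_def
  proof (rule un[OF _ mem])
    fix a f b g assume "(a, f) \<in> frac_at q A Q" "(b, g) \<in> frac_at q A' Q'"
    then show "hfrac S G q (a \<otimes>\<^bsub>S\<^esub> g \<oplus>\<^bsub>S\<^esub> b \<otimes>\<^bsub>S\<^esub> f) (f \<otimes>\<^bsub>S\<^esub> g) = frac_at q (A \<star> Q' + A' \<star> Q) (Q \<star> Q')"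
      using key unfolding frac_at_def[of q A Q] frac_at_def[of q A' Q'] by blast
  qed
  show "hfrac_mult S G q (frac_at q A Q) (frac_at q A' Q') = frac_at q (A \<star> A') (Q \<star> Q')"
    unfolding hfrac_mult_def
  proof (rule un[OF _ mem])
    fix a f b g assume "(a, f) \<in> frac_at q A Q" "(b, g) \<in> frac_at q A' Q'"
    then show "hfrac S G q (a \<otimes>\<^bsub>S\<^esub> b) (f \<otimes>\<^bsub>S\<^esub> g) = frac_at q (A \<star> A') (Q \<star> Q')"
      using key unfolding frac_at_def[of q A Q] frac_at_def[of q A' Q'] by blast
  qed
qed

abbreviation OX where "OX \<equiv> rsec X"

definition regular_on :: "spt set \<Rightarrow> diffop \<Rightarrow> diffop \<Rightarrow> bool" where
  "regular_on U A Q \<longleftrightarrow> fraction A Q \<and> (\<forall>q\<in>U. reg q A Q)"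

lemma frac_at_basic:
  assumes "A \<in> filt B n" "Q \<in> filt B n" "tmon Q n \<notin> q"
  shows "reg q A Q"
  using assms unfolding reg_def by (metis filtD mult_comm)

lemma OX_carrier_def:
  "carrier (OX U) = {s \<in> extensional U. \<forall>q\<in>U. \<exists>V n a f.
         openin (Proj_top S G) V \<and> q \<in> V \<and> V \<subseteq> U \<and> a \<in> G n \<and> f \<in> G n \<and>
         (\<forall>q'\<in>V. f \<notin> q' \<and> s q' = hfrac S G q' a f)}"
  by (simp add: curve_def Proj_def Proj_sections_def)

lemma top_of_X: "top_of X = Proj_top S G"
  by (simp add: curve_def Proj_def)

text \<open>All local fractions of a section agree at the generic point, which lies in each of their
  domains. Hence they are equal as rational functions, and the one found near the generic point
  represents the section on all of U; the local ones show that it is regular.\<close>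

lemma OX_carrier:
  assumes U: "is_open X U"
  shows "carrier (OX U) = {sect U A Q | A Q. regular_on U A Q}"
proof (intro equalityI subsetI)
  fix s assume "s \<in> carrier (OX U)"
  then have s: "s \<in> extensional U" and loc: "\<forall>q\<in>U. \<exists>V n a f.
         openin (Proj_top S G) V \<and> q \<in> V \<and> V \<subseteq> U \<and> a \<in> G n \<and> f \<in> G n \<and>
         (\<forall>q'\<in>V. f \<notin> q' \<and> s q' = hfrac S G q' a f)"
    unfolding OX_carrier_def mem_Collect_eq by (rule conjunct1, rule conjunct2)
  have loc': "\<exists>V n A Q. is_open X V \<and> q \<in> V \<and> V \<subseteq> U \<and> A \<in> filt B n \<and> Q \<in> filt B n \<and>
      (\<forall>q'\<in>V. tmon Q n \<notin> q' \<and> s q' = frac_at q' A Q)" if q: "q \<in> U" for q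
  proof -
    obtain V n a f where *: "openin (Proj_top S G) V \<and> q \<in> V \<and> V \<subseteq> U \<and> a \<in> G n \<and> f \<in> G n \<and>
         (\<forall>q'\<in>V. f \<notin> q' \<and> s q' = hfrac S G q' a f)"
      using bspec[OF loc q] by (elim exE)
    obtain A where A: "a = tmon A n" "A \<in> filt B n" using * by (auto simp: mem_G)
    obtain Q where Q: "f = tmon Q n" "Q \<in> filt B n" using * by (auto simp: mem_G)
    have V: "is_open X V" using * by (simp add: top_of_X)
    have loc: "tmon Q n \<notin> q' \<and> s q' = frac_at q' A Q" if q': "q' \<in> V" for q'
    proof -
      have "q' \<in> pts" using open_subset_pts[OF V] q' by (rule subsetD)
      then show ?thesis using * q' hfrac_eq A Q by simp
    qed
    have "is_open X V \<and> q \<in> V \<and> V \<subseteq> U \<and> A \<in> filt B n \<and> Q \<in> filt B n \<and>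
      (\<forall>q'\<in>V. tmon Q n \<notin> q' \<and> s q' = frac_at q' A Q)"
      using V * A Q loc by simp
    then show ?thesis by (intro exI)
  qed
  show "s \<in> {sect U A Q | A Q. regular_on U A Q}"
  proof (cases "U = {}")
    case True
    then have "s = sect U 0 1" using s by (auto simp: sect_def)
    moreover have "regular_on U 0 1" using True by (auto simp: regular_on_def fraction_def)
    ultimately show ?thesis by blast
  next
    case False
    then have g: "generic_pt \<in> U" using generic_pt_open U by blast
    obtain V n A Q where *: "is_open X V \<and> generic_pt \<in> V \<and> V \<subseteq> U \<and> A \<in> filt B n \<and> Q \<in> filt B n \<and>
      (\<forall>q'\<in>V. tmon Q n \<notin> q' \<and> s q' = frac_at q' A Q)"
      using loc'[OF g] by (elim exE)
    then have V: "is_open X V" "generic_pt \<in> V" "A \<in> filt B n" "Q \<in> filt B n"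
      "\<And>q'. q' \<in> V \<Longrightarrow> tmon Q n \<notin> q' \<and> s q' = frac_at q' A Q"
      by simp_all
    have fr: "fraction A Q"
      using V(2-5) tmon_notin_nonzero[OF generic_pt(1)] by (auto simp: fraction_def)
    have *: "s q = frac_at q A Q \<and> reg q A Q" if q: "q \<in> U" for q
    proof -
      obtain V' n' A' Q' where *: "is_open X V' \<and> q \<in> V' \<and> V' \<subseteq> U \<and> A' \<in> filt B n' \<and> Q' \<in> filt B n' \<and>
        (\<forall>q'\<in>V'. tmon Q' n' \<notin> q' \<and> s q' = frac_at q' A' Q')"
        using loc'[OF q] by (elim exE)
      then have V': "is_open X V'" "q \<in> V'" "A' \<in> filt B n'" "Q' \<in> filt B n'"
        "\<And>q'. q' \<in> V' \<Longrightarrow> tmon Q' n' \<notin> q' \<and> s q' = frac_at q' A' Q'"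
        by simp_all
      have g': "generic_pt \<in> V'" using generic_pt_open[OF V'(1)] V'(2) by blast
      have fr': "fraction A' Q'"
        using V'(3,4) V'(5)[OF g'] tmon_notin_nonzero[OF generic_pt(1)] by (auto simp: fraction_def)
      have "frac_at generic_pt A Q = frac_at generic_pt A' Q'" using V(5)[OF V(2)] V'(5)[OF g'] by simp
      then have eq: "A \<star> Q' = A' \<star> Q"
        using frac_at_inject[OF generic_pt(1) fr fr'] frac_at_basic[OF V(3,4)] V(5)[OF V(2)] by blast
      show ?thesis
        using frac_at_cong[OF fr fr' eq, of q] reg_cong[OF fr fr' eq, of q] V'(5)[OF V'(2)]
          frac_at_basic[OF V'(3,4)] by simp
    qed
    then have "s = sect U A Q"
      unfolding sect_def by (intro extensionalityI[OF s]) auto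
    moreover have "regular_on U A Q" using * fr by (simp add: regular_on_def)
    ultimately show ?thesis by blast
  qed
next
  fix s assume "s \<in> {sect U A Q | A Q. regular_on U A Q}"
  then obtain A Q where s: "s = sect U A Q" "regular_on U A Q" by blast
  have "\<exists>V n a f. openin (Proj_top S G) V \<and> q \<in> V \<and> V \<subseteq> U \<and> a \<in> G n \<and> f \<in> G n \<and>
         (\<forall>q'\<in>V. f \<notin> q' \<and> s q' = hfrac S G q' a f)" if q: "q \<in> U" for q
  proof -
    have qp: "q \<in> pts" using open_subset_pts[OF U] q by auto
    obtain C R m where C: "C \<in> filt B m" "R \<in> filt B m" "tmon R m \<notin> q" "R \<noteq> 0" "fraction C R" "A \<star> R = C \<star> Q"
      using regE[OF qp] s(2) q unfolding regular_on_def by metis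
    have "is_open X (U \<inter> basic m R)" using U C by (intro openin_Int) auto
    moreover have "s q' = hfrac S G q' (tmon C m) (tmon R m)" if "q' \<in> U \<inter> basic m R" for q'
    proof -
      have "s q' = frac_at q' A Q" using that s by (simp add: sect_def)
      also have "\<dots> = frac_at q' C R" using s C by (intro frac_at_cong) (auto simp: regular_on_def)
      finally show ?thesis using hfrac_eq[of q' C m R] C that by (auto simp: basic_def)
    qed
    ultimately show ?thesis
      using C q qp
      by (intro exI[of _ "U \<inter> basic m R"] exI[of _ m] exI[of _ "tmon C m"] exI[of _ "tmon R m"])
         (auto simp: basic_def top_of_X)
  qed
  moreover have "s \<in> extensional U" by (simp add: s sect_def)
  ultimately show "s \<in> carrier (OX U)" unfolding OX_carrier_def by blast
qed

lemma sectE: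
  assumes "is_open X U" "s \<in> carrier (OX U)"
  obtains A Q where "s = sect U A Q" "regular_on U A Q"
  using assms OX_carrier by auto

lemma sect_closed [simp]: "is_open X U \<Longrightarrow> regular_on U A Q \<Longrightarrow> sect U A Q \<in> carrier (OX U)"
  using OX_carrier by auto

lemma sect_eqI:
  assumes "regular_on U A Q" "regular_on U A' Q'" "A \<star> Q' = A' \<star> Q"
  shows "sect U A Q = sect U A' Q'"
  using assms frac_at_cong unfolding sect_def regular_on_def by (metis (no_types))

lemma sect_eqD:
  assumes "is_open X U" "U \<noteq> {}" "regular_on U A Q" "regular_on U A' Q'" "sect U A Q = sect U A' Q'"
  shows "A \<star> Q' = A' \<star> Q"
proof -
  have g: "generic_pt \<in> U" using generic_pt_open assms by blast
  then have "frac_at generic_pt A Q = frac_at generic_pt A' Q'"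
    using fun_cong[OF assms(5), of generic_pt] by (simp add: sect_def)
  then show ?thesis
    using frac_at_inject[OF generic_pt(1)] assms(3,4) g by (auto simp: regular_on_def)
qed

lemma regular_on_cong:
  assumes "regular_on U A Q" "fraction A' Q'" "A \<star> Q' = A' \<star> Q"
  shows "regular_on U A' Q'"
  using assms reg_cong[of A Q A' Q'] by (simp add: regular_on_def)

lemma OX_res: "rres X U V s = restrict s V"
  by (simp add: curve_def Proj_def)

lemma sect_res [simp]: "V \<subseteq> U \<Longrightarrow> rres X U V (sect U A Q) = sect V A Q"
  by (auto simp: OX_res sect_def fun_eq_iff)

lemma regular_on_mono: "regular_on U A Q \<Longrightarrow> V \<subseteq> U \<Longrightarrow> regular_on V A Q"
  by (auto simp: regular_on_def)

lemma regular_on_add: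
  "U \<subseteq> pts \<Longrightarrow> regular_on U A Q \<Longrightarrow> regular_on U A' Q' \<Longrightarrow> regular_on U (A \<star> Q' + A' \<star> Q) (Q \<star> Q')"
  and regular_on_mult:
  "U \<subseteq> pts \<Longrightarrow> regular_on U A Q \<Longrightarrow> regular_on U A' Q' \<Longrightarrow> regular_on U (A \<star> A') (Q \<star> Q')"
  using reg_add reg_mult by (auto simp: regular_on_def frac_add frac_mult subset_iff)

lemma regular_on_const: "U \<subseteq> pts \<Longrightarrow> A \<in> filt B 0 \<Longrightarrow> regular_on U A 1"
  using frac_at_basic[of A 0 1] pt_one by (auto simp: regular_on_def fraction_def)

lemma regular_on_X0: "U \<subseteq> X0 \<Longrightarrow> A \<in> B \<Longrightarrow> regular_on U A 1"
  using frac_at_basic[of A "degree A" 1] X0_tmon_one filt_degree by (auto simp: regular_on_def fraction_def)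

lemma regular_on_uminus: "regular_on U A Q \<Longrightarrow> regular_on U (- A) Q"
  unfolding regular_on_def reg_def by (metis filt_uminus frac_uminus op_mult_minus_left)

lemma sect_add [simp]:
  assumes "is_open X U" "regular_on U A Q" "regular_on U A' Q'"
  shows "sect U A Q \<oplus>\<^bsub>OX U\<^esub> sect U A' Q' = sect U (A \<star> Q' + A' \<star> Q) (Q \<star> Q')"
  using assms open_subset_pts[OF assms(1)] hfrac_add_frac_at
  by (auto simp: curve_def Proj_def Proj_sections_def sect_def fun_eq_iff regular_on_def subset_iff)

lemma sect_mult [simp]:
  assumes "is_open X U" "regular_on U A Q" "regular_on U A' Q'"
  shows "sect U A Q \<otimes>\<^bsub>OX U\<^esub> sect U A' Q' = sect U (A \<star> A') (Q \<star> Q')"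
  using assms open_subset_pts[OF assms(1)] hfrac_mult_frac_at
  by (auto simp: curve_def Proj_def Proj_sections_def sect_def fun_eq_iff regular_on_def subset_iff)

lemma sect_zero: "is_open X U \<Longrightarrow> \<zero>\<^bsub>OX U\<^esub> = sect U 0 1"
  and sect_one: "is_open X U \<Longrightarrow> \<one>\<^bsub>OX U\<^esub> = sect U 1 1"
  using open_subset_pts[of U] hfrac_eq[of _ 0 0 1] hfrac_eq[of _ 1 0 1]
  by (auto simp: curve_def Proj_def Proj_sections_def sect_def fun_eq_iff subset_iff rees_one tmon_zero)

lemma cring_OX:
  assumes U: "is_open X U"
  shows "cring (OX U)"
proof -
  note sub = open_subset_pts[OF U]
  have c0: "regular_on U 0 1" and c1: "regular_on U 1 1" using regular_on_const[OF sub] by auto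
  have regB: "A \<in> B" "Q \<in> B" "Q \<noteq> 0" if "regular_on U A Q" for A Q
    using that by (auto simp: regular_on_def fraction_def)
  note simps = U sub regular_on_add regular_on_mult c0 c1 regular_on_uminus
  note alg = op_mult_add_left op_mult_add_right mult_ac_B
  show ?thesis
  proof (rule cringI)
    show "abelian_group (OX U)"
    proof (rule abelian_groupI)
      fix x y assume "x \<in> carrier (OX U)" "y \<in> carrier (OX U)"
      then obtain A Q A' Q' where x: "x = sect U A Q" "regular_on U A Q" and y: "y = sect U A' Q'" "regular_on U A' Q'"
        using sectE[OF U] by metis
      show "x \<oplus>\<^bsub>OX U\<^esub> y \<in> carrier (OX U)" using x y by (simp add: simps)
      show "x \<oplus>\<^bsub>OX U\<^esub> y = y \<oplus>\<^bsub>OX U\<^esub> x"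
        using x y regB[OF x(2)] regB[OF y(2)]
        by (simp add: simps, intro sect_eqI, simp add: simps, simp add: simps, simp add: alg add_ac)
      fix z assume "z \<in> carrier (OX U)"
      then obtain A'' Q'' where z: "z = sect U A'' Q''" "regular_on U A'' Q''" using sectE[OF U] by metis
      show "x \<oplus>\<^bsub>OX U\<^esub> y \<oplus>\<^bsub>OX U\<^esub> z = x \<oplus>\<^bsub>OX U\<^esub> (y \<oplus>\<^bsub>OX U\<^esub> z)"
        using x y z regB[OF x(2)] regB[OF y(2)] regB[OF z(2)]
        by (simp add: simps, intro sect_eqI, simp add: simps, simp add: simps, simp add: alg add_ac)
    next
      show "\<zero>\<^bsub>OX U\<^esub> \<in> carrier (OX U)" by (simp add: simps sect_zero)
      fix x assume "x \<in> carrier (OX U)"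
      then obtain A Q where x: "x = sect U A Q" "regular_on U A Q" using sectE[OF U] by metis
      show "\<zero>\<^bsub>OX U\<^esub> \<oplus>\<^bsub>OX U\<^esub> x = x" using x by (simp add: simps sect_zero)
      have "sect U (- A) Q \<oplus>\<^bsub>OX U\<^esub> x = sect U (- A \<star> Q + A \<star> Q) (Q \<star> Q)"
        using x by (simp add: simps)
      also have "\<dots> = \<zero>\<^bsub>OX U\<^esub>"
        unfolding sect_zero[OF U]
        by (intro sect_eqI regular_on_add sub c0 regular_on_uminus x(2)) (simp add: op_mult_minus_left)
      finally have "sect U (- A) Q \<oplus>\<^bsub>OX U\<^esub> x = \<zero>\<^bsub>OX U\<^esub>" .
      then show "\<exists>y\<in>carrier (OX U). y \<oplus>\<^bsub>OX U\<^esub> x = \<zero>\<^bsub>OX U\<^esub>"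
        using x by (intro bexI[of _ "sect U (- A) Q"]) (auto simp: simps)
    qed
    show "comm_monoid (OX U)"
    proof (rule comm_monoidI)
      fix x y assume "x \<in> carrier (OX U)" "y \<in> carrier (OX U)"
      then obtain A Q A' Q' where x: "x = sect U A Q" "regular_on U A Q" and y: "y = sect U A' Q'" "regular_on U A' Q'"
        using sectE[OF U] by metis
      show "x \<otimes>\<^bsub>OX U\<^esub> y \<in> carrier (OX U)" using x y by (simp add: simps)
      show "x \<otimes>\<^bsub>OX U\<^esub> y = y \<otimes>\<^bsub>OX U\<^esub> x"
        using x y regB[OF x(2)] regB[OF y(2)] by (simp add: simps) (simp add: mult_comm)
      fix z assume "z \<in> carrier (OX U)"
      then obtain A'' Q'' where z: "z = sect U A'' Q''" "regular_on U A'' Q''" using sectE[OF U] by metis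
      show "x \<otimes>\<^bsub>OX U\<^esub> y \<otimes>\<^bsub>OX U\<^esub> z = x \<otimes>\<^bsub>OX U\<^esub> (y \<otimes>\<^bsub>OX U\<^esub> z)"
        using x y z by (simp add: simps) (simp add: op_mult_assoc)
    next
      show "\<one>\<^bsub>OX U\<^esub> \<in> carrier (OX U)" by (simp add: simps sect_one)
      fix x assume "x \<in> carrier (OX U)"
      then obtain A Q where x: "x = sect U A Q" "regular_on U A Q" using sectE[OF U] by metis
      show "\<one>\<^bsub>OX U\<^esub> \<otimes>\<^bsub>OX U\<^esub> x = x" using x by (simp add: simps sect_one)
    qed
    fix x y z assume "x \<in> carrier (OX U)" "y \<in> carrier (OX U)" "z \<in> carrier (OX U)"
    then obtain A Q A' Q' A'' Q'' where x: "x = sect U A Q" "regular_on U A Q" and y: "y = sect U A' Q'" "regular_on U A' Q'"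
      and z: "z = sect U A'' Q''" "regular_on U A'' Q''"
      using sectE[OF U] by metis
    show "(x \<oplus>\<^bsub>OX U\<^esub> y) \<otimes>\<^bsub>OX U\<^esub> z = x \<otimes>\<^bsub>OX U\<^esub> z \<oplus>\<^bsub>OX U\<^esub> y \<otimes>\<^bsub>OX U\<^esub> z"
      using x y z regB[OF x(2)] regB[OF y(2)] regB[OF z(2)]
      by (simp add: simps, intro sect_eqI, simp add: simps, simp add: simps, simp add: alg add_ac)
  qed
qed

lemma alg_section_eq: "P \<in> B \<Longrightarrow> alg_section B P = sect X0 P 1"
  using X0_sub_pts hfrac_eq[of _ P "degree P" 1] filt_degree[of P "degree P"]
  by (auto simp: alg_section_def sect_def fun_eq_iff)

lemma const_section_eq: "U \<subseteq> pts \<Longrightarrow> const_section B U c = sect U (const_op c) 1"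
  using hfrac_eq[of _ "const_op c" 0 1]
  by (auto simp: const_section_def sect_def fun_eq_iff)

section \<open>Fractions of the spectral module\<close>

text \<open>The fraction f/Q as the set of its representatives g/R. As nonzero elements of B act
  injectively on \<complex>[\<partial>], plain cross multiplication is an equivalence
  relation.\<close>

definition fr :: "complex poly \<Rightarrow> diffop \<Rightarrow> (complex poly \<times> diffop) set" where
  "fr f Q = {(g, R). R \<in> B \<and> R \<noteq> 0 \<and> f \<diamondop> R = g \<diamondop> Q}"

definition FK :: "(complex poly \<times> diffop) set set" where
  "FK = {fr f Q | f Q. Q \<in> B \<and> Q \<noteq> 0}"

text \<open>Addition through a common denominator; \<open>fadd_fr\<close> shows independence of the
  choice. In the same way \<open>fsm A C\<close> is multiplication by the rational function
  A/C.\<close>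

definition fadd :: "(complex poly \<times> diffop) set \<Rightarrow> (complex poly \<times> diffop) set \<Rightarrow> (complex poly \<times> diffop) set" where
  "fadd x y = (SOME z. \<exists>f g Q. Q \<in> B \<and> Q \<noteq> 0 \<and> x = fr f Q \<and> y = fr g Q \<and> z = fr (f + g) Q)"

definition fsm :: "diffop \<Rightarrow> diffop \<Rightarrow> (complex poly \<times> diffop) set \<Rightarrow> (complex poly \<times> diffop) set" where
  "fsm A C x = (SOME z. \<exists>f Q. Q \<in> B \<and> Q \<noteq> 0 \<and> x = fr f Q \<and> z = fr (f \<diamondop> A) (Q \<star> C))"

lemma fr_eq_iff:
  assumes "Q \<in> B" "Q \<noteq> 0" "R \<in> B" "R \<noteq> 0"
  shows "fr f Q = fr g R \<longleftrightarrow> f \<diamondop> R = g \<diamondop> Q"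
proof
  assume "fr f Q = fr g R"
  moreover have "(g, R) \<in> fr g R" using assms by (simp add: fr_def)
  ultimately show "f \<diamondop> R = g \<diamondop> Q" by (auto simp: fr_def)
next
  assume eq: "f \<diamondop> R = g \<diamondop> Q"
  have "f \<diamondop> T = h \<diamondop> Q \<longleftrightarrow> g \<diamondop> T = h \<diamondop> R" if T: "T \<in> B" for h T
  proof -
    have "f \<diamondop> T = h \<diamondop> Q \<longleftrightarrow> f \<diamondop> T \<diamondop> R = h \<diamondop> Q \<diamondop> R" using act_cancel assms by simp
    also have "f \<diamondop> T \<diamondop> R = g \<diamondop> T \<diamondop> Q"
      using act_comm[OF T assms(3), of f] act_comm[OF assms(1) T, of g] eq by simp
    also have "h \<diamondop> Q \<diamondop> R = h \<diamondop> R \<diamondop> Q" by (rule act_comm[OF assms(1,3)])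
    also have "g \<diamondop> T \<diamondop> Q = h \<diamondop> R \<diamondop> Q \<longleftrightarrow> g \<diamondop> T = h \<diamondop> R" using act_cancel assms by simp
    finally show ?thesis .
  qed
  then show "fr f Q = fr g R" by (auto simp: fr_def)
qed

lemma fr_cancel:
  assumes "Q \<in> B" "Q \<noteq> 0" "R \<in> B" "R \<noteq> 0"
  shows "fr (f \<diamondop> R) (Q \<star> R) = fr f Q" "fr (f \<diamondop> R) (R \<star> Q) = fr f Q"
  using assms by (simp_all add: fr_eq_iff op_action_mult[symmetric] mult_comm)

lemma fr_FK [simp]: "Q \<in> B \<Longrightarrow> Q \<noteq> 0 \<Longrightarrow> fr f Q \<in> FK"
  by (auto simp: FK_def)

lemma FK_E:
  assumes "x \<in> FK"
  obtains f Q where "Q \<in> B" "Q \<noteq> 0" "x = fr f Q"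
  using assms by (auto simp: FK_def)

lemma FK_common:
  assumes "x \<in> FK" "y \<in> FK"
  obtains f g Q where "Q \<in> B" "Q \<noteq> 0" "x = fr f Q" "y = fr g Q"
proof -
  obtain f Q g R where *: "Q \<in> B" "Q \<noteq> 0" "x = fr f Q" "R \<in> B" "R \<noteq> 0" "y = fr g R"
    using assms by (auto simp: FK_def)
  then show thesis
    using fr_cancel[of Q R f] fr_cancel[of R Q g] by (intro that[of "Q \<star> R" "f \<diamondop> R" "g \<diamondop> Q"]) auto
qed

lemma FK_common_finite:
  assumes "\<And>i. i < (n::nat) \<Longrightarrow> x i \<in> FK"
  obtains f Q where "Q \<in> B" "Q \<noteq> 0" "\<forall>i<n. x i = fr (f i) Q"
proof -
  have "\<exists>f Q. Q \<in> B \<and> Q \<noteq> 0 \<and> (\<forall>i<n. x i = fr (f i) Q)"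
    using assms
  proof (induction n)
    case 0
    show ?case by (rule exI, rule exI[of _ 1]) simp
  next
    case (Suc n)
    then obtain f Q where *: "Q \<in> B" "Q \<noteq> 0" "\<forall>i<n. x i = fr (f i) Q" by auto
    obtain g R where **: "R \<in> B" "R \<noteq> 0" "x n = fr g R" by (rule FK_E[of "x n"]) (use Suc.prems in auto)
    let ?h = "\<lambda>i. if i < n then f i \<diamondop> R else g \<diamondop> Q"
    have "x i = fr (?h i) (Q \<star> R)" if "i < Suc n" for i
      using that * ** fr_cancel(1)[of Q R "f i"] fr_cancel(2)[of R Q g] by (auto simp: less_Suc_eq)
    then have "\<forall>i<Suc n. x i = fr (?h i) (Q \<star> R)" by blast
    moreover have "Q \<star> R \<in> B" "Q \<star> R \<noteq> 0" using * ** by auto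
    ultimately show ?case by (intro exI[of _ ?h] exI[of _ "Q \<star> R"] conjI)
  qed
  then show thesis using that by blast
qed

lemma fadd_fr [simp]:
  assumes "Q \<in> B" "Q \<noteq> 0"
  shows "fadd (fr f Q) (fr g Q) = fr (f + g) Q"
  unfolding fadd_def
proof (rule some_equality)
  show "\<exists>f' g' Q'. Q' \<in> B \<and> Q' \<noteq> 0 \<and> fr f Q = fr f' Q' \<and> fr g Q = fr g' Q' \<and> fr (f + g) Q = fr (f' + g') Q'"
    using assms by blast
  fix z assume "\<exists>f' g' Q'. Q' \<in> B \<and> Q' \<noteq> 0 \<and> fr f Q = fr f' Q' \<and> fr g Q = fr g' Q' \<and> z = fr (f' + g') Q'"
  then obtain f' g' Q' where *: "Q' \<in> B" "Q' \<noteq> 0" "fr f Q = fr f' Q'" "fr g Q = fr g' Q'" "z = fr (f' + g') Q'"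
    by blast
  then show "z = fr (f + g) Q" using assms by (simp add: fr_eq_iff op_action_add_left)
qed

lemma fsm_fr [simp]:
  assumes "Q \<in> B" "Q \<noteq> 0" "fraction A C"
  shows "fsm A C (fr f Q) = fr (f \<diamondop> A) (Q \<star> C)"
  unfolding fsm_def
proof (rule some_equality)
  show "\<exists>f' Q'. Q' \<in> B \<and> Q' \<noteq> 0 \<and> fr f Q = fr f' Q' \<and> fr (f \<diamondop> A) (Q \<star> C) = fr (f' \<diamondop> A) (Q' \<star> C)"
    using assms by blast
  fix z assume "\<exists>f' Q'. Q' \<in> B \<and> Q' \<noteq> 0 \<and> fr f Q = fr f' Q' \<and> z = fr (f' \<diamondop> A) (Q' \<star> C)"
  then obtain f' Q' where *: "Q' \<in> B" "Q' \<noteq> 0" "fr f Q = fr f' Q'" "z = fr (f' \<diamondop> A) (Q' \<star> C)"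
    by blast
  have "f \<diamondop> Q' = f' \<diamondop> Q" using * assms by (simp add: fr_eq_iff)
  then have "f' \<diamondop> A \<diamondop> Q = f \<diamondop> A \<diamondop> Q'"
    using act_comm assms * unfolding fraction_def by metis
  then show "z = fr (f \<diamondop> A) (Q \<star> C)" using assms * by (simp add: fr_eq_iff op_action_mult fraction_def)
qed

lemma fadd_FK [simp]: "x \<in> FK \<Longrightarrow> y \<in> FK \<Longrightarrow> fadd x y \<in> FK"
  using FK_common[of x y] by (metis fadd_fr fr_FK)

lemma fsm_FK [simp]: "x \<in> FK \<Longrightarrow> fraction A C \<Longrightarrow> fsm A C x \<in> FK"
proof -
  assume x: "x \<in> FK" and AC: "fraction A C"
  obtain f Q where "Q \<in> B" "Q \<noteq> 0" "x = fr f Q" by (rule FK_E[OF x])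
  then show "fsm A C x \<in> FK" using AC by (simp) (simp add: fraction_def)
qed

lemma fr_eq_zero_iff: "Q \<in> B \<Longrightarrow> Q \<noteq> 0 \<Longrightarrow> fr f Q = fr 0 1 \<longleftrightarrow> f = 0"
  by (simp add: fr_eq_iff)

text \<open>K as an additive group. The record type of rings is the one on which
  \<open>abelian_group\<close> is stated; only addition and zero are meant.\<close>

definition FKgrp :: "(complex poly \<times> diffop) set ring" where
  "FKgrp = \<lparr>carrier = FK, monoid.mult = undefined, one = undefined, zero = fr 0 1, add = fadd\<rparr>"

lemma FK_abelian: "abelian_group FKgrp"
proof (rule abelian_groupI)
  fix x y assume xy: "x \<in> carrier FKgrp" "y \<in> carrier FKgrp"
  obtain f g Q where *: "Q \<in> B" "Q \<noteq> 0" "x = fr f Q" "y = fr g Q"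
    by (rule FK_common[of x y]) (use xy in \<open>auto simp: FKgrp_def\<close>)
  show "x \<oplus>\<^bsub>FKgrp\<^esub> y \<in> carrier FKgrp" "x \<oplus>\<^bsub>FKgrp\<^esub> y = y \<oplus>\<^bsub>FKgrp\<^esub> x"
    using * by (auto simp: FKgrp_def add.commute)
  fix z assume z: "z \<in> carrier FKgrp"
  have memb: "(if i = 0 then x else if i = 1 then y else z) \<in> FK" if "i < 3" for i :: nat
    using xy z by (simp add: FKgrp_def)
  obtain h R where **: "R \<in> B" "R \<noteq> 0" "\<forall>i<3::nat. (if i = 0 then x else if i = 1 then y else z) = fr (h i) R"
    by (rule FK_common_finite[OF memb])
  have "x = fr (h 0) R" "y = fr (h 1) R" "z = fr (h 2) R"
    using **(3)[rule_format, of 0] **(3)[rule_format, of 1] **(3)[rule_format, of 2] by auto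
  then show "x \<oplus>\<^bsub>FKgrp\<^esub> y \<oplus>\<^bsub>FKgrp\<^esub> z = x \<oplus>\<^bsub>FKgrp\<^esub> (y \<oplus>\<^bsub>FKgrp\<^esub> z)"
    using ** by (simp add: FKgrp_def add.assoc)
next
  show "\<zero>\<^bsub>FKgrp\<^esub> \<in> carrier FKgrp" by (simp add: FKgrp_def)
  fix x assume "x \<in> carrier FKgrp"
  then obtain f Q where *: "Q \<in> B" "Q \<noteq> 0" "x = fr f Q" by (auto simp: FKgrp_def elim: FK_E)
  have "\<zero>\<^bsub>FKgrp\<^esub> = fr 0 Q" using * by (simp add: FKgrp_def fr_eq_iff)
  then show "\<zero>\<^bsub>FKgrp\<^esub> \<oplus>\<^bsub>FKgrp\<^esub> x = x" using * by (simp add: FKgrp_def)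
  have "fr (- f) Q \<oplus>\<^bsub>FKgrp\<^esub> x = \<zero>\<^bsub>FKgrp\<^esub>" using * by (simp add: FKgrp_def fr_eq_zero_iff)
  then show "\<exists>y\<in>carrier FKgrp. y \<oplus>\<^bsub>FKgrp\<^esub> x = \<zero>\<^bsub>FKgrp\<^esub>"
    using * by (intro bexI[of _ "fr (- f) Q"]) (auto simp: FKgrp_def)
qed

lemma FKgrp_simps [simp]: "carrier FKgrp = FK" "x \<oplus>\<^bsub>FKgrp\<^esub> y = fadd x y" "\<zero>\<^bsub>FKgrp\<^esub> = fr 0 1"
  by (simp_all add: FKgrp_def)

lemma FK_uminus: "Q \<in> B \<Longrightarrow> Q \<noteq> 0 \<Longrightarrow> \<ominus>\<^bsub>FKgrp\<^esub> fr f Q = fr (- f) Q"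
proof -
  assume Q: "Q \<in> B" "Q \<noteq> 0"
  interpret abelian_group FKgrp by (rule FK_abelian)
  show ?thesis using Q by (intro minus_equality) (auto simp: fr_eq_zero_iff)
qed

text \<open>The stalk at \<open>q\<close> of the sheaf associated with the graded module of the spaces
  \<open>{f. ord f < (n + 1) r}\<close>.\<close>

definition in_stalk :: "spt \<Rightarrow> (complex poly \<times> diffop) set \<Rightarrow> bool" where
  "in_stalk q x \<longleftrightarrow> (\<exists>n f Q. Q \<in> filt B n \<and> tmon Q n \<notin> q \<and> degree f < Suc n * r \<and> x = fr f Q)"

lemma in_stalkE:
  assumes "q \<in> pts" "in_stalk q x"
  obtains n f Q where "Q \<in> filt B n" "tmon Q n \<notin> q" "Q \<in> B" "Q \<noteq> 0" "degree f < Suc n * r" "x = fr f Q"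
  using assms tmon_notin_nonzero unfolding in_stalk_def by (metis filtD)

lemma in_stalk_FK: "q \<in> pts \<Longrightarrow> in_stalk q x \<Longrightarrow> x \<in> FK"
  by (erule (1) in_stalkE) simp

lemma in_stalk_zero: "q \<in> pts \<Longrightarrow> in_stalk q (fr 0 1)"
  unfolding in_stalk_def by (intro exI[of _ 0] exI[of _ 1]) (auto simp: pt_one)

lemma degree_act_filt: "Q \<in> filt B n \<Longrightarrow> degree f < Suc m * r \<Longrightarrow> degree (f \<diamondop> Q) < Suc (m + n) * r"
  using degree_op_action_le[of f Q] by (auto simp: filt_def add_mult_distrib)

lemma in_stalk_add:
  assumes q: "q \<in> pts" and "in_stalk q x" "in_stalk q y"
  shows "in_stalk q (fadd x y)"
proof -
  obtain n f Q where 1: "Q \<in> filt B n" "tmon Q n \<notin> q" "Q \<in> B" "Q \<noteq> 0" "degree f < Suc n * r" "x = fr f Q"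
    by (rule in_stalkE[OF q assms(2)])
  obtain m g R where 2: "R \<in> filt B m" "tmon R m \<notin> q" "R \<in> B" "R \<noteq> 0" "degree g < Suc m * r" "y = fr g R"
    by (rule in_stalkE[OF q assms(3)])
  have "x = fr (f \<diamondop> R) (Q \<star> R)" "y = fr (g \<diamondop> Q) (Q \<star> R)" using 1 2 fr_cancel by auto
  then have "fadd x y = fr (f \<diamondop> R + g \<diamondop> Q) (Q \<star> R)" using 1 2 by simp
  moreover have "degree (f \<diamondop> R + g \<diamondop> Q) < Suc (n + m) * r"
    using degree_act_filt[OF 2(1) 1(5)] degree_act_filt[OF 1(1) 2(5)]
    by (intro degree_add_less) (auto simp: add.commute)
  moreover have "tmon (Q \<star> R) (n + m) \<notin> q" using pt_prime[OF q] 1 2 by simp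
  ultimately show ?thesis unfolding in_stalk_def using filt_mult[OF 1(1) 2(1)] by blast
qed

lemma in_stalk_smult:
  assumes q: "q \<in> pts" and "in_stalk q x" and AC: "fraction A C" "reg q A C"
  shows "in_stalk q (fsm A C x)"
proof -
  obtain n f Q where 1: "Q \<in> filt B n" "tmon Q n \<notin> q" "Q \<in> B" "Q \<noteq> 0" "degree f < Suc n * r" "x = fr f Q"
    by (rule in_stalkE[OF q assms(2)])
  obtain A' R m where 2: "A' \<in> filt B m" "R \<in> filt B m" "tmon R m \<notin> q" "R \<noteq> 0" "fraction A' R" "A \<star> R = A' \<star> C"
    using regE[OF q AC(2)] by metis
  have m: "R \<in> B" "A' \<in> B" "A \<in> B" "C \<in> B" "C \<noteq> 0" using 2 AC by (auto simp: fraction_def)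
  have "f \<diamondop> A \<diamondop> R = f \<diamondop> A' \<diamondop> C" using 2(6) by (metis op_action_mult)
  then have "f \<diamondop> A \<diamondop> (Q \<star> R) = f \<diamondop> A' \<diamondop> (Q \<star> C)"
    unfolding op_action_mult using 1 m act_comm by metis
  then have "fsm A C x = fr (f \<diamondop> A') (Q \<star> R)"
    using 1 2 AC m by (simp add: fr_eq_iff)
  moreover have "tmon (Q \<star> R) (n + m) \<notin> q" using pt_prime[OF q] 1 2 by simp
  ultimately show ?thesis
    unfolding in_stalk_def using filt_mult[OF 1(1) 2(2)] degree_act_filt[OF 2(1) 1(5)] by blast
qed

text \<open>At a point of X0 the exponent n of Q t^n can be raised without moving the element into
  or out of q, so the bound on ord f can always be met.\<close>

lemma in_stalk_X0:
  assumes q: "q \<in> X0"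
  shows "in_stalk q x \<longleftrightarrow> (\<exists>f Q. Q \<in> B \<and> q \<in> aff Q \<and> x = fr f Q)"
proof
  have qp: "q \<in> pts" using q X0_sub_pts by auto
  assume "in_stalk q x"
  then obtain n f Q where 1: "Q \<in> filt B n" "tmon Q n \<notin> q" "Q \<in> B" "Q \<noteq> 0" "degree f < Suc n * r" "x = fr f Q"
    using in_stalkE[OF qp] by metis
  then show "\<exists>f Q. Q \<in> B \<and> q \<in> aff Q \<and> x = fr f Q" using aff_iff[OF q 1(1)] by blast
next
  assume "\<exists>f Q. Q \<in> B \<and> q \<in> aff Q \<and> x = fr f Q"
  then obtain f Q where 1: "Q \<in> B" "q \<in> aff Q" "x = fr f Q" by blast
  let ?n = "max (degree Q) (degree f)"
  have "Q \<in> filt B ?n" by (rule filt_degree[OF 1(1)]) simp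
  moreover from this have "tmon Q ?n \<notin> q" using aff_iff[OF q] 1 by blast
  moreover have "degree f < Suc ?n * r"
  proof -
    have "degree f < Suc ?n * 1" by simp
    also have "\<dots> \<le> Suc ?n * r" by (intro mult_le_mono) (auto simp: Suc_le_eq)
    finally show ?thesis .
  qed
  ultimately show "in_stalk q x" unfolding in_stalk_def using 1 by blast
qed

lemma in_stalk_X0_fr: "q \<in> X0 \<Longrightarrow> in_stalk q (fr f 1)"
  unfolding in_stalk_X0 by (intro exI[of _ f] exI[of _ 1]) auto

text \<open>A denominator admissible at infinity has order exactly n r, so the bound reads ord f <
  ord Q + r. This form passes to every representative because orders add up.\<close>

lemma in_stalk_pinf:
  assumes "Q \<in> B" "Q \<noteq> 0"
  shows "in_stalk pinf (fr f Q) \<longleftrightarrow> degree f < degree Q + r"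
proof
  assume "in_stalk pinf (fr f Q)"
  then obtain n g R where 1: "R \<in> filt B n" "tmon R n \<notin> pinf" "R \<in> B" "R \<noteq> 0" "degree g < Suc n * r" "fr f Q = fr g R"
    by (rule in_stalkE[OF pinf(1)])
  then have eq: "f \<diamondop> R = g \<diamondop> Q" using assms by (simp add: fr_eq_iff)
  show "degree f < degree Q + r"
  proof (cases "f = 0")
    case False
    then have "g \<noteq> 0" using eq act_nonzero 1 assms by fastforce
    then have "degree f + degree R = degree g + degree Q" using eq act_nonzero(2) 1 assms False by metis
    moreover have "degree R = n * r" using pinf(2)[OF 1(1)] 1 by simp
    ultimately show ?thesis using 1(5) by simp
  qed simp
next
  assume *: "degree f < degree Q + r"
  obtain n where n: "degree Q = r * n" using r_dvd[OF assms(1)] by blast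
  then have "Q \<in> filt B n" using assms by (simp add: filt_def mult.commute)
  moreover from this have "tmon Q n \<notin> pinf" using pinf(2) assms n by (simp add: mult.commute)
  moreover have "degree f < Suc n * r" using * n by (simp add: mult.commute)
  ultimately show "in_stalk pinf (fr f Q)" unfolding in_stalk_def by blast
qed

text \<open>The denominators of x form an ideal, and regularity at each point of X0 makes
  \<open>affine_cover\<close> applicable to it.\<close>

lemma FK_X0:
  assumes "x \<in> FK" "\<And>q. q \<in> X0 \<Longrightarrow> in_stalk q x"
  obtains f where "x = fr f 1"
proof -
  obtain f Q where x: "Q \<in> B" "Q \<noteq> 0" "x = fr f Q" by (rule FK_E[OF assms(1)])
  define J where "J = {R \<in> B. \<exists>g. f \<diamondop> R = g \<diamondop> Q}"
  have "1 \<in> J"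
  proof (rule affine_cover)
    show "0 \<in> J" unfolding J_def by (auto intro!: exI[of _ 0])
    show "P + R \<in> J" if "P \<in> J" "R \<in> J" for P R
    proof -
      obtain g h where "f \<diamondop> P = g \<diamondop> Q" "f \<diamondop> R = h \<diamondop> Q" using \<open>P \<in> J\<close> \<open>R \<in> J\<close> by (auto simp: J_def)
      then have "f \<diamondop> (P + R) = (g + h) \<diamondop> Q" by (simp add: op_action_add_left op_action_add_right)
      moreover have "P + R \<in> B" using that by (simp add: J_def)
      ultimately show ?thesis unfolding J_def by blast
    qed
    show "P \<star> R \<in> J" if "P \<in> J" "R \<in> B" for P R
    proof -
      obtain g where "f \<diamondop> P = g \<diamondop> Q" using \<open>P \<in> J\<close> by (auto simp: J_def)
      then have "f \<diamondop> (P \<star> R) = (g \<diamondop> R) \<diamondop> Q" using act_comm[OF x(1) that(2), of g] by (simp add: op_action_mult)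
      then show ?thesis using that unfolding J_def by auto
    qed
    show "\<exists>R\<in>J. q \<in> aff R" if q: "q \<in> X0" for q
    proof -
      obtain g R where R: "R \<in> B" "q \<in> aff R" "x = fr g R" using assms(2)[OF q] in_stalk_X0[OF q] by blast
      have "R \<noteq> 0" using R(2) by auto
      then have "f \<diamondop> R = g \<diamondop> Q" using R x by (simp add: fr_eq_iff)
      then show ?thesis using R unfolding J_def by blast
    qed
  qed (auto simp: J_def)
  then obtain g where "f = g \<diamondop> Q" by (auto simp: J_def)
  then have "x = fr g 1" using x by (simp add: fr_eq_iff)
  then show thesis by (rule that)
qed

section \<open>The spectral sheaf\<close>

text \<open>A sheaf has only the zero section over the empty set, where the condition on stalks
  would be vacuous and admit all of K.\<close>

definition F0_carrier :: "spt set \<Rightarrow> (complex poly \<times> diffop) set set" where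
  "F0_carrier U = (if U = {} then {fr 0 1} else {x \<in> FK. \<forall>q\<in>U. in_stalk q x})"

text \<open>The choice is that of a fraction A/Q representing s; by \<open>F0_smult_sect\<close> the
  result does not depend on it as soon as U is nonempty.\<close>

definition F0_smult :: "spt set \<Rightarrow> sfun \<Rightarrow> (complex poly \<times> diffop) set \<Rightarrow> (complex poly \<times> diffop) set" where
  "F0_smult U s x = (if U = {} then fr 0 1
     else SOME y. \<exists>A Q. regular_on U A Q \<and> s = sect U A Q \<and> y = fsm A Q x)"

definition F0 :: "(spt, sfun, (complex poly \<times> diffop) set) mod_presheaf" where
  "F0 = \<lparr>msec = (\<lambda>U. \<lparr>carrier = F0_carrier U, monoid.mult = undefined, one = undefined, zero = fr 0 1,
            add = fadd, Module.module.smult = F0_smult U\<rparr>),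
         mres = (\<lambda>U V x. if V = {} then fr 0 1 else x)\<rparr>"

lemma F0_simps [simp]:
  "carrier (msec F0 U) = F0_carrier U" "\<zero>\<^bsub>msec F0 U\<^esub> = fr 0 1" "x \<oplus>\<^bsub>msec F0 U\<^esub> y = fadd x y"
  "s \<odot>\<^bsub>msec F0 U\<^esub> x = F0_smult U s x" "mres F0 U V x = (if V = {} then fr 0 1 else x)"
  by (simp_all add: F0_def)

lemma F0_carrier_empty [simp]: "F0_carrier {} = {fr 0 1}"
  by (simp add: F0_carrier_def)

lemma F0_carrierI: "x \<in> FK \<Longrightarrow> (\<And>q. q \<in> U \<Longrightarrow> in_stalk q x) \<Longrightarrow> U \<noteq> {} \<Longrightarrow> x \<in> F0_carrier U"
  by (simp add: F0_carrier_def)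

lemma F0_carrierD:
  assumes "x \<in> F0_carrier U" "U \<subseteq> pts"
  shows "x \<in> FK" "q \<in> U \<Longrightarrow> in_stalk q x"
  using assms by (auto simp: F0_carrier_def split: if_splits)

lemma F0_carrier_zero: "U \<subseteq> pts \<Longrightarrow> fr 0 1 \<in> F0_carrier U"
  using in_stalk_zero by (auto simp: F0_carrier_def)

lemma F0_carrier_add: "U \<subseteq> pts \<Longrightarrow> x \<in> F0_carrier U \<Longrightarrow> y \<in> F0_carrier U \<Longrightarrow> fadd x y \<in> F0_carrier U"
  using in_stalk_add by (auto simp: F0_carrier_def subset_iff split: if_splits)

lemma fsm_cong:
  assumes "fraction A Q" "fraction A' Q'" "A \<star> Q' = A' \<star> Q" "x \<in> FK"
  shows "fsm A Q x = fsm A' Q' x"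
proof -
  obtain f R where x: "R \<in> B" "R \<noteq> 0" "x = fr f R" by (rule FK_E[OF assms(4)])
  have m: "A \<in> B" "Q \<in> B" "A' \<in> B" "Q' \<in> B" "Q \<noteq> 0" "Q' \<noteq> 0" using assms by (auto simp: fraction_def)
  have "A \<star> (R \<star> Q') = A' \<star> (R \<star> Q)" using assms(3) m x by (metis mult_left_comm)
  then have "f \<diamondop> A \<diamondop> (R \<star> Q') = f \<diamondop> A' \<diamondop> (R \<star> Q)" by (metis op_action_mult)
  then show ?thesis using x m assms by (simp add: fr_eq_iff)
qed

lemma F0_smult_sect:
  assumes "is_open X U" "U \<noteq> {}" "regular_on U A Q" "x \<in> FK"
  shows "F0_smult U (sect U A Q) x = fsm A Q x"
proof -
  have "(SOME y. \<exists>A' Q'. regular_on U A' Q' \<and> sect U A Q = sect U A' Q' \<and> y = fsm A' Q' x) = fsm A Q x"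
  proof (rule some_equality)
    fix y assume "\<exists>A' Q'. regular_on U A' Q' \<and> sect U A Q = sect U A' Q' \<and> y = fsm A' Q' x"
    then obtain A' Q' where *: "regular_on U A' Q'" "sect U A Q = sect U A' Q'" "y = fsm A' Q' x" by blast
    have "A \<star> Q' = A' \<star> Q" by (rule sect_eqD[OF assms(1,2,3) *(1,2)])
    then show "y = fsm A Q x" using fsm_cong[of A Q A' Q' x] assms * by (simp add: regular_on_def)
  qed (use assms in blast)
  then show ?thesis using assms(2) by (simp add: F0_smult_def)
qed

lemma F0_smult_closed:
  assumes U: "is_open X U" and "s \<in> carrier (OX U)" "x \<in> F0_carrier U"
  shows "F0_smult U s x \<in> F0_carrier U"
proof (cases "U = {}")
  case True
  then show ?thesis by (simp add: F0_smult_def)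
next
  case False
  note sub = open_subset_pts[OF U]
  obtain A Q where s: "s = sect U A Q" "regular_on U A Q" by (rule sectE[OF U assms(2)])
  note x = F0_carrierD[OF assms(3) sub]
  show ?thesis
    unfolding s(1) F0_smult_sect[OF U False s(2) x(1)]
    using s(2) x sub False by (intro F0_carrierI in_stalk_smult) (auto simp: regular_on_def)
qed

lemma F0_abelian:
  assumes U: "is_open X U"
  shows "abelian_group (msec F0 U)"
proof -
  interpret FK: abelian_group FKgrp by (rule FK_abelian)
  note sub = open_subset_pts[OF U]
  note mem = F0_carrierD(1)[OF _ sub]
  show ?thesis
  proof (rule abelian_groupI)
    fix x y z assume "x \<in> carrier (msec F0 U)" "y \<in> carrier (msec F0 U)" "z \<in> carrier (msec F0 U)"
    then show "x \<oplus>\<^bsub>msec F0 U\<^esub> y \<oplus>\<^bsub>msec F0 U\<^esub> z = x \<oplus>\<^bsub>msec F0 U\<^esub> (y \<oplus>\<^bsub>msec F0 U\<^esub> z)"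
      using FK.a_assoc[of x y z] mem by simp
  next
    fix x y assume "x \<in> carrier (msec F0 U)" "y \<in> carrier (msec F0 U)"
    then show "x \<oplus>\<^bsub>msec F0 U\<^esub> y \<in> carrier (msec F0 U)" "x \<oplus>\<^bsub>msec F0 U\<^esub> y = y \<oplus>\<^bsub>msec F0 U\<^esub> x"
      using FK.a_comm[of x y] mem F0_carrier_add[OF sub] by auto
  next
    show "\<zero>\<^bsub>msec F0 U\<^esub> \<in> carrier (msec F0 U)" using F0_carrier_zero[OF sub] by simp
    fix x assume x: "x \<in> carrier (msec F0 U)"
    then show "\<zero>\<^bsub>msec F0 U\<^esub> \<oplus>\<^bsub>msec F0 U\<^esub> x = x"
      using FK.l_zero[of x] mem by simp
    show "\<exists>y\<in>carrier (msec F0 U). y \<oplus>\<^bsub>msec F0 U\<^esub> x = \<zero>\<^bsub>msec F0 U\<^esub>"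
    proof (cases "U = {}")
      case True
      then show ?thesis using x FK.l_zero[of "fr 0 1"] by simp
    next
      case False
      \<comment> \<open>The negative is a multiple by the regular function -1, so its membership in
        all stalks is a case of closure under multiplication.\<close>
      have reg: "regular_on U (- 1) 1"
        using regular_on_uminus[OF regular_on_const[OF sub, of 1]] by simp
      obtain f Q where f: "Q \<in> B" "Q \<noteq> 0" "x = fr f Q" using FK_E mem x by (metis F0_simps(1))
      have "fsm (- 1) 1 x = fr (- f) Q"
        using f reg by (simp add: regular_on_def op_action_minus_right)
      moreover have "fsm (- 1) 1 x \<in> F0_carrier U"
        using F0_smult_closed[OF U sect_closed[OF U reg], of x] F0_smult_sect[OF U False reg] x mem by simp
      ultimately show ?thesis
        using f by (intro bexI[of _ "fr (- f) Q"]) (auto simp: fr_eq_zero_iff)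
    qed
  qed
qed

lemma fsm_fadd:
  assumes "x \<in> FK" "y \<in> FK" "fraction A Q"
  shows "fsm A Q (fadd x y) = fadd (fsm A Q x) (fsm A Q y)"
proof -
  obtain f g R where *: "R \<in> B" "R \<noteq> 0" "x = fr f R" "y = fr g R" by (rule FK_common[OF assms(1,2)])
  have "R \<star> Q \<in> B" "R \<star> Q \<noteq> 0" using * assms(3) by (auto simp: fraction_def)
  then show ?thesis using * assms(3) by (simp add: op_action_add_left)
qed

lemma fsm_add:
  assumes "x \<in> FK" "fraction A Q" "fraction A' Q'"
  shows "fsm (A \<star> Q' + A' \<star> Q) (Q \<star> Q') x = fadd (fsm A Q x) (fsm A' Q' x)"
proof -
  obtain f R where *: "R \<in> B" "R \<noteq> 0" "x = fr f R" by (rule FK_E[OF assms(1)])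
  have m: "A \<in> B" "Q \<in> B" "A' \<in> B" "Q' \<in> B" "Q \<noteq> 0" "Q' \<noteq> 0" using assms by (auto simp: fraction_def)
  have "fsm A Q x = fr (f \<diamondop> A \<diamondop> Q') (R \<star> Q \<star> Q')"
    using * m assms fr_cancel(1)[of "R \<star> Q" Q' "f \<diamondop> A"] by simp
  moreover have "fsm A' Q' x = fr (f \<diamondop> A' \<diamondop> Q) (R \<star> Q' \<star> Q)"
    using * m assms fr_cancel(1)[of "R \<star> Q'" Q "f \<diamondop> A'"] by simp
  moreover have "R \<star> Q' \<star> Q = R \<star> Q \<star> Q'" using m by (simp add: op_mult_assoc mult_comm)
  moreover have "R \<star> Q \<star> Q' \<in> B" "R \<star> Q \<star> Q' \<noteq> 0" using * m by auto
  ultimately have "fadd (fsm A Q x) (fsm A' Q' x) = fr (f \<diamondop> A \<diamondop> Q' + f \<diamondop> A' \<diamondop> Q) (R \<star> Q \<star> Q')" by simp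
  then show ?thesis
    using * frac_add[OF assms(2,3)] by (simp add: op_action_add_right op_action_mult op_mult_assoc)
qed

lemma fsm_mult:
  assumes "x \<in> FK" "fraction A Q" "fraction A' Q'"
  shows "fsm (A \<star> A') (Q \<star> Q') x = fsm A Q (fsm A' Q' x)"
proof -
  obtain f R where *: "R \<in> B" "R \<noteq> 0" "x = fr f R" by (rule FK_E[OF assms(1)])
  have m: "A \<in> B" "Q \<in> B" "A' \<in> B" "Q' \<in> B" "Q \<noteq> 0" "Q' \<noteq> 0" using assms by (auto simp: fraction_def)
  have "fsm A Q (fsm A' Q' x) = fr (f \<diamondop> A' \<diamondop> A) (R \<star> Q' \<star> Q)" using * m assms by simp
  moreover have "R \<star> Q' \<star> Q = R \<star> (Q \<star> Q')" using m by (simp add: op_mult_assoc mult_comm)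
  moreover have "f \<diamondop> A' \<diamondop> A = f \<diamondop> (A \<star> A')" using m act_comm by (simp add: op_action_mult)
  ultimately show ?thesis using * frac_mult[OF assms(2,3)] by simp
qed

lemma fsm_one: "x \<in> FK \<Longrightarrow> fsm 1 1 x = x"
  by (erule FK_E) (simp add: fraction_def)

lemma F0_module:
  assumes U: "is_open X U"
  shows "Module.module (OX U) (msec F0 U)"
proof (cases "U = {}")
  case True
  interpret FK: abelian_group FKgrp by (rule FK_abelian)
  have "fadd (fr 0 1) (fr 0 1) = fr 0 1" using FK.l_zero[of "fr 0 1"] by simp
  then show ?thesis
    using True by (intro moduleI cring_OX F0_abelian U) (auto simp: F0_smult_def)
next
  case False
  note sub = open_subset_pts[OF U]
  note mem = F0_carrierD(1)[OF _ sub]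
  show ?thesis
  proof (rule moduleI[OF cring_OX[OF U] F0_abelian[OF U]])
    fix a x assume a: "a \<in> carrier (OX U)" and x: "x \<in> carrier (msec F0 U)"
    show "a \<odot>\<^bsub>msec F0 U\<^esub> x \<in> carrier (msec F0 U)" using F0_smult_closed[OF U a] x by simp
    obtain A Q where A: "a = sect U A Q" "regular_on U A Q" by (rule sectE[OF U a])
    then have fA: "fraction A Q" by (simp add: regular_on_def)
    {
      fix y assume y: "y \<in> carrier (msec F0 U)"
      show "a \<odot>\<^bsub>msec F0 U\<^esub> (x \<oplus>\<^bsub>msec F0 U\<^esub> y) = a \<odot>\<^bsub>msec F0 U\<^esub> x \<oplus>\<^bsub>msec F0 U\<^esub> a \<odot>\<^bsub>msec F0 U\<^esub> y"
        using x y mem A fA F0_smult_sect[OF U False A(2)] by (simp add: fsm_fadd)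
    next
      fix b assume b: "b \<in> carrier (OX U)"
      obtain A' Q' where B: "b = sect U A' Q'" "regular_on U A' Q'" by (rule sectE[OF U b])
      then have fB: "fraction A' Q'" by (simp add: regular_on_def)
      show "(a \<oplus>\<^bsub>OX U\<^esub> b) \<odot>\<^bsub>msec F0 U\<^esub> x = a \<odot>\<^bsub>msec F0 U\<^esub> x \<oplus>\<^bsub>msec F0 U\<^esub> b \<odot>\<^bsub>msec F0 U\<^esub> x"
        using x mem A B fA fB F0_smult_sect[OF U False] regular_on_add[OF sub A(2) B(2)] U by (simp add: fsm_add)
      show "(a \<otimes>\<^bsub>OX U\<^esub> b) \<odot>\<^bsub>msec F0 U\<^esub> x = a \<odot>\<^bsub>msec F0 U\<^esub> (b \<odot>\<^bsub>msec F0 U\<^esub> x)"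
        using x mem A B fA fB F0_smult_sect[OF U False] regular_on_mult[OF sub A(2) B(2)] U by (simp add: fsm_mult)
    }
  next
    fix x assume x: "x \<in> carrier (msec F0 U)"
    show "\<one>\<^bsub>OX U\<^esub> \<odot>\<^bsub>msec F0 U\<^esub> x = x"
      using x mem F0_smult_sect[OF U False regular_on_const[OF sub]] by (simp add: sect_one U fsm_one)
  qed
qed

lemma F0_carrier_mono: "V \<subseteq> U \<Longrightarrow> V \<noteq> {} \<Longrightarrow> x \<in> F0_carrier U \<Longrightarrow> x \<in> F0_carrier V"
  by (auto simp: F0_carrier_def split: if_splits)

text \<open>Restriction to a nonempty set is the identity on K. Locality is then immediate, and
  gluing rests on irreducibility alone.\<close>

lemma F0_sheaf: "module_sheaf X F0"
  unfolding module_sheaf_def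
proof (intro conjI allI impI ballI)
  interpret FK: abelian_group FKgrp by (rule FK_abelian)
  have z: "fadd (fr 0 1) (fr 0 1) = fr 0 1" using FK.l_zero[of "fr 0 1"] by simp
  show "Module.module (OX U) (msec F0 U)" if "is_open X U" for U using F0_module that .
  {
    fix U V assume UV: "is_open X U \<and> is_open X V \<and> V \<subseteq> U"
    show "mres F0 U V \<in> carrier (msec F0 U) \<rightarrow> carrier (msec F0 V)"
      using UV F0_carrier_mono[of V U] F0_carrier_zero[OF open_subset_pts, of V] by auto
    show "mres F0 U V (s \<oplus>\<^bsub>msec F0 U\<^esub> t) = mres F0 U V s \<oplus>\<^bsub>msec F0 V\<^esub> mres F0 U V t" for s t
      using z by simp
    show "mres F0 U V (a \<odot>\<^bsub>msec F0 U\<^esub> s) = rres X U V a \<odot>\<^bsub>msec F0 V\<^esub> mres F0 U V s"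
      if "a \<in> carrier (OX U)" "s \<in> carrier (msec F0 U)" for a s
    proof (cases "V = {}")
      case False
      then have ne: "U \<noteq> {}" using UV by blast
      have U: "is_open X U" using UV by simp
      obtain A Q where A: "a = sect U A Q" "regular_on U A Q" by (rule sectE[OF U \<open>a \<in> carrier (OX U)\<close>])
      have s: "s \<in> FK" using that UV F0_carrierD(1) open_subset_pts by simp
      have "F0_smult U (sect U A Q) s = F0_smult V (sect V A Q) s"
        using F0_smult_sect[OF _ ne A(2) s] F0_smult_sect[OF _ False regular_on_mono[OF A(2)] s] UV by simp
      then show ?thesis using A False UV by simp
    qed (simp add: F0_smult_def)
  }
  show "mres F0 U U s = s" if "is_open X U" "s \<in> carrier (msec F0 U)" for U s
    using that by auto
  show "mres F0 V W (mres F0 U V s) = mres F0 U W s"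
    if "is_open X U \<and> is_open X V \<and> is_open X W \<and> W \<subseteq> V \<and> V \<subseteq> U" for U V W s
    using that by auto
  {
    fix \<U> s t assume U: "\<forall>U\<in>\<U>. is_open X U" and s: "s \<in> carrier (msec F0 (\<Union>\<U>))" and t: "t \<in> carrier (msec F0 (\<Union>\<U>))"
      and eq: "\<forall>U\<in>\<U>. mres F0 (\<Union>\<U>) U s = mres F0 (\<Union>\<U>) U t"
    show "s = t"
    proof (cases "\<Union>\<U> = {}")
      case True
      then have "F0_carrier (\<Union>\<U>) = {fr 0 1}" by (simp only: F0_carrier_empty)
      then show ?thesis using s t by (metis F0_simps(1) singletonD)
    next
      case False
      then obtain U where "U \<in> \<U>" "U \<noteq> {}" by blast
      then show ?thesis using bspec[OF eq, of U] by simp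
    qed
  }
  {
    fix \<U> :: "spt set set" and s
    assume U: "(\<forall>U\<in>\<U>. is_open X U \<and> s U \<in> carrier (msec F0 U)) \<and>
      (\<forall>U\<in>\<U>. \<forall>V\<in>\<U>. mres F0 U (U \<inter> V) (s U) = mres F0 V (U \<inter> V) (s V))"
    show "\<exists>t\<in>carrier (msec F0 (\<Union>\<U>)). \<forall>U\<in>\<U>. mres F0 (\<Union>\<U>) U t = s U"
    proof (cases "\<Union>\<U> = {}")
      case True
      then have "s V = fr 0 1" if "V \<in> \<U>" for V
      proof -
        have "V = {}" using True that by blast
        moreover have "s V \<in> carrier (msec F0 V)" using U that by blast
        ultimately show ?thesis by simp
      qed
      moreover have "\<forall>V\<in>\<U>. V = {}" using True by blast
      ultimately show ?thesis using True by (intro bexI[of _ "fr 0 1"]) (simp_all only: F0_simps F0_carrier_empty, auto)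
    next
      case False
      then obtain V where V: "V \<in> \<U>" "V \<noteq> {}" by blast
      \<comment> \<open>Nonempty members of the cover meet, so compatible sections are one and the
        same element of K.\<close>
      have eq: "s W = s V" if "W \<in> \<U>" "W \<noteq> {}" for W
      proof -
        have "W \<inter> V \<noteq> {}" using open_Int_nonempty U V that by blast
        moreover have "mres F0 W (W \<inter> V) (s W) = mres F0 V (W \<inter> V) (s V)" using U V that by blast
        ultimately show ?thesis by simp
      qed
      have sV: "s V \<in> FK" using F0_carrierD(1)[of "s V" V] U V open_subset_pts by auto
      have "in_stalk q (s V)" if "q \<in> \<Union>\<U>" for q
      proof -
        obtain W where W: "W \<in> \<U>" "q \<in> W" using \<open>q \<in> \<Union>\<U>\<close> by blast
        then have "s W \<in> F0_carrier W" "W \<subseteq> pts" using U open_subset_pts by auto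
        then have "in_stalk q (s W)" by (rule F0_carrierD(2)) (rule W(2))
        moreover have "s W = s V" using eq[OF W(1)] W(2) by blast
        ultimately show ?thesis by simp
      qed
      then have "s V \<in> F0_carrier (\<Union>\<U>)" using False sV by (intro F0_carrierI)
      moreover have "mres F0 (\<Union>\<U>) W (s V) = s W" if "W \<in> \<U>" for W
        using eq[OF that] U that by auto
      ultimately show ?thesis by (intro bexI[of _ "s V"]) simp_all
    qed
  }
qed

lemma F0_torsion_free: "torsion_free X F0"
  unfolding torsion_free_def
proof (intro allI impI ballI)
  fix U a s assume U: "is_open X U" and a: "a \<in> carrier (OX U)" and s: "s \<in> carrier (msec F0 U)"
    and eq: "a \<odot>\<^bsub>msec F0 U\<^esub> s = \<zero>\<^bsub>msec F0 U\<^esub>"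
  show "a = \<zero>\<^bsub>OX U\<^esub> \<or> s = \<zero>\<^bsub>msec F0 U\<^esub>"
  proof (cases "U = {}")
    case False
    note sub = open_subset_pts[OF U]
    obtain A Q where A: "a = sect U A Q" "regular_on U A Q" by (rule sectE[OF U a])
    then have fA: "fraction A Q" by (simp add: regular_on_def)
    have sK: "s \<in> FK" using s F0_carrierD(1)[OF _ sub] by simp
    obtain f R where R: "R \<in> B" "R \<noteq> 0" "s = fr f R" by (rule FK_E[OF sK])
    have "fr (f \<diamondop> A) (R \<star> Q) = fr 0 1"
      using eq F0_smult_sect[OF U False A(2) sK] R fA A by simp
    then have "f \<diamondop> A = 0" using R fA by (simp add: fr_eq_zero_iff fraction_def)
    then consider "A = 0" | "f = 0" using act_eq_0_iff fA by (auto simp: fraction_def)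
    then show ?thesis
    proof cases
      case 1
      then have "a = sect U 0 1"
        unfolding A(1) using A(2) regular_on_const[OF sub, of 0] by (intro sect_eqI) auto
      then show ?thesis by (simp add: sect_zero U)
    qed (use R in \<open>simp add: fr_eq_zero_iff\<close>)
  qed (use s in simp)
qed

section \<open>Affine and global sections of the model\<close>

definition phi0 :: "(complex poly \<times> diffop) set \<Rightarrow> complex poly" where
  "phi0 x = (THE f. x = fr f 1)"

lemma phi0_fr [simp]: "phi0 (fr f 1) = f"
  unfolding phi0_def by (rule the_equality) (auto simp: fr_eq_iff)

lemma F0_X0: "F0_carrier X0 = {fr f 1 | f. True}"
proof (intro equalityI subsetI)
  fix x assume x: "x \<in> F0_carrier X0"
  obtain f where "x = fr f 1"
    by (rule FK_X0[of x]) (use F0_carrierD[OF x X0_sub_pts] in auto)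
  then show "x \<in> {fr f 1 | f. True}" by blast
next
  fix x assume "x \<in> {fr f 1 | f. True}"
  then show "x \<in> F0_carrier X0"
    using X0_nonempty in_stalk_X0_fr by (auto intro!: F0_carrierI)
qed

lemma pts_eq: "pts = insert pinf X0"
  using X0_sub_pts pinf(1) pts_cases by blast

text \<open>Regularity on X0 forces denominator 1, and then the condition at infinity is deg f < r.
  This is where the space H arises.\<close>

lemma F0_pts: "F0_carrier pts = {fr f 1 | f. degree f < r}"
proof (intro equalityI subsetI)
  fix x assume x: "x \<in> F0_carrier pts"
  then have "x \<in> F0_carrier X0" using F0_carrier_mono X0_sub_pts X0_nonempty by blast
  then obtain f where f: "x = fr f 1" using F0_X0 by auto
  have "in_stalk pinf x" using F0_carrierD(2)[OF x] pinf(1) by simp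
  then have "degree f < r" using in_stalk_pinf[of 1 f] f by simp
  then show "x \<in> {fr f 1 | f. degree f < r}" using f by blast
next
  fix x assume "x \<in> {fr f 1 | f. degree f < r}"
  then obtain f where f: "x = fr f 1" "degree f < r" by blast
  have "in_stalk q x" if "q \<in> pts" for q
    using that in_stalk_X0_fr[of q f] in_stalk_pinf[of 1 f] f unfolding pts_eq by auto
  then show "x \<in> F0_carrier pts" using f pinf(1) by (intro F0_carrierI) auto
qed

lemma low_space_carrier: "carrier (low_space r) = {f. degree f < r}"
proof -
  have "(\<exists>c. f = (\<Sum>i<r. Polynomial.monom (c i) i)) \<longleftrightarrow> degree f < r" for f
  proof
    assume "\<exists>c. f = (\<Sum>i<r. Polynomial.monom (c i) i)"
    then obtain c where c: "f = (\<Sum>i<r. Polynomial.monom (c i) i)" by blast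
    have "degree f \<le> r - 1"
      unfolding c by (intro degree_sum_le) (auto intro!: order.trans[OF degree_monom_le])
    then show "degree f < r" using r_pos by linarith
  next
    assume d: "degree f < r"
    have "f = (\<Sum>i<r. Polynomial.monom (Polynomial.coeff f i) i)"
    proof (rule poly_eqI)
      fix n
      show "Polynomial.coeff f n = Polynomial.coeff (\<Sum>i<r. Polynomial.monom (Polynomial.coeff f i) i) n"
        using d by (simp add: coeff_sum coeff_eq_0)
    qed
    then show "\<exists>c. f = (\<Sum>i<r. Polynomial.monom (c i) i)" by blast
  qed
  then show ?thesis by (auto simp: low_space_def)
qed

lemma F0_affine_iso: "mod_iso (alg_ring B) (sections_on_affine B F0) spectral_module phi0"
proof -
  have car: "carrier (sections_on_affine B F0) = {fr f 1 | f. True}"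
    by (simp add: sections_on_affine_def restrict_scalars_def F0_X0)
  have sm: "P \<odot>\<^bsub>sections_on_affine B F0\<^esub> fr f 1 = fr (f \<diamondop> P) 1" if "P \<in> B" for P f
  proof -
    have "P \<odot>\<^bsub>sections_on_affine B F0\<^esub> fr f 1 = F0_smult X0 (sect X0 P 1) (fr f 1)"
      using alg_section_eq[OF that] by (simp add: sections_on_affine_def restrict_scalars_def)
    also have "\<dots> = fsm P 1 (fr f 1)"
      using regular_on_X0[of X0 P] that by (intro F0_smult_sect X0_nonempty) auto
    finally show ?thesis using that by (simp add: frac_one)
  qed
  have "bij_betw phi0 {fr f 1 | f. True} UNIV"
    by (rule bij_betw_byWitness[where f' = "\<lambda>f. fr f 1"]) auto
  then show ?thesis
    unfolding mod_iso_def car using sm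
    by (auto simp: spectral_module_def) (auto simp: sections_on_affine_def restrict_scalars_def diffop_ring_def spectral_module_def)
qed

lemma F0_global_iso: "mod_iso complex_ring (global_sections B F0) (low_space r) (\<lambda>s. phi0 (mres F0 (whole X) X0 s))"
proof -
  have car: "carrier (global_sections B F0) = {fr f 1 | f. degree f < r}"
    by (simp add: global_sections_def restrict_scalars_def F0_pts)
  have sm: "c \<odot>\<^bsub>global_sections B F0\<^esub> fr f 1 = fr (Polynomial.smult c f) 1" for c f
  proof -
    have "c \<odot>\<^bsub>global_sections B F0\<^esub> fr f 1 = F0_smult pts (sect pts (const_op c) 1) (fr f 1)"
      using const_section_eq[of pts c] by (simp add: global_sections_def restrict_scalars_def)
    also have "\<dots> = fsm (const_op c) 1 (fr f 1)"
      using pinf(1) by (intro F0_smult_sect regular_on_const) auto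
    finally show ?thesis by (simp add: frac_one op_action_const_op)
  qed
  have "bij_betw phi0 {fr f 1 | f. degree f < r} {f. degree f < r}"
    by (rule bij_betw_byWitness[where f' = "\<lambda>f. fr f 1"]) auto
  then show ?thesis
    unfolding mod_iso_def car low_space_carrier using sm X0_nonempty
    by (auto simp: complex_ring_def low_space_def) (auto simp: global_sections_def restrict_scalars_def)
qed

end

lemma finsum_lessThan_Suc:
  assumes "abelian_monoid M" "f \<in> {..<Suc n} \<rightarrow> carrier M"
  shows "finsum M f {..<Suc n} = f n \<oplus>\<^bsub>M\<^esub> finsum M f {..<n}"
proof -
  interpret abelian_monoid M by fact
  show ?thesis using assms(2) unfolding lessThan_Suc by (intro finsum_insert) auto
qed

lemma relation_sheaf_simps [simp]:
  "carrier (msec (relation_sheaf X F U n s) W) = {a \<in> {..<n} \<rightarrow>\<^sub>E carrier (rsec X W).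
            (\<Oplus>\<^bsub>msec F W\<^esub>i\<in>{..<n}. a i \<odot>\<^bsub>msec F W\<^esub> mres F U W (s i)) = \<zero>\<^bsub>msec F W\<^esub>}"
  "\<zero>\<^bsub>msec (relation_sheaf X F U n s) W\<^esub> = (\<lambda>i\<in>{..<n}. \<zero>\<^bsub>rsec X W\<^esub>)"
  "a \<oplus>\<^bsub>msec (relation_sheaf X F U n s) W\<^esub> b = (\<lambda>i\<in>{..<n}. a i \<oplus>\<^bsub>rsec X W\<^esub> b i)"
  "c \<odot>\<^bsub>msec (relation_sheaf X F U n s) W\<^esub> a = (\<lambda>i\<in>{..<n}. c \<otimes>\<^bsub>rsec X W\<^esub> a i)"
  "mres (relation_sheaf X F U n s) W W' a = (\<lambda>i\<in>{..<n}. rres X W W' (a i))"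
  by (simp_all add: relation_sheaf_def)

text \<open>Just enough structure to evaluate the finite sums that occur when generators of a
  relation sheaf are tested.\<close>

lemma relation_sheaf_abelian_monoid:
  assumes M: "Module.module (rsec X W) (msec F W)"
    and s: "\<And>i. i < n \<Longrightarrow> mres F U W (s i) \<in> carrier (msec F W)"
  shows "abelian_monoid (msec (relation_sheaf X F U n s) W)"
proof -
  interpret M: Module.module "rsec X W" "msec F W" by (rule M)
  let ?t = "\<lambda>a i. a i \<odot>\<^bsub>msec F W\<^esub> mres F U W (s i)"
  show ?thesis
  proof (rule abelian_monoidI)
    fix a b c
    assume a: "a \<in> carrier (msec (relation_sheaf X F U n s) W)"
      and b: "b \<in> carrier (msec (relation_sheaf X F U n s) W)"
    have mem: "a i \<in> carrier (rsec X W)" "b i \<in> carrier (rsec X W)" if "i < n" for i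
      using a b that by (auto simp: PiE_iff)
    have "(\<Oplus>\<^bsub>msec F W\<^esub>i\<in>{..<n}. ?t (\<lambda>i\<in>{..<n}. a i \<oplus>\<^bsub>rsec X W\<^esub> b i) i)
        = (\<Oplus>\<^bsub>msec F W\<^esub>i\<in>{..<n}. ?t a i \<oplus>\<^bsub>msec F W\<^esub> ?t b i)"
      using mem s by (intro M.M.finsum_cong') (auto simp: M.smult_l_distr)
    also have "\<dots> = (\<Oplus>\<^bsub>msec F W\<^esub>i\<in>{..<n}. ?t a i) \<oplus>\<^bsub>msec F W\<^esub> (\<Oplus>\<^bsub>msec F W\<^esub>i\<in>{..<n}. ?t b i)"
      using mem s by (intro M.M.finsum_addf) auto
    also have "\<dots> = \<zero>\<^bsub>msec F W\<^esub>" using a b by simp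
    finally show "a \<oplus>\<^bsub>msec (relation_sheaf X F U n s) W\<^esub> b \<in> carrier (msec (relation_sheaf X F U n s) W)"
      using mem by simp
    show "a \<oplus>\<^bsub>msec (relation_sheaf X F U n s) W\<^esub> b = b \<oplus>\<^bsub>msec (relation_sheaf X F U n s) W\<^esub> a"
      using mem by (auto simp: M.R.a_comm intro!: restrict_ext)
    assume c: "c \<in> carrier (msec (relation_sheaf X F U n s) W)"
    then show "a \<oplus>\<^bsub>msec (relation_sheaf X F U n s) W\<^esub> b \<oplus>\<^bsub>msec (relation_sheaf X F U n s) W\<^esub> c =
      a \<oplus>\<^bsub>msec (relation_sheaf X F U n s) W\<^esub> (b \<oplus>\<^bsub>msec (relation_sheaf X F U n s) W\<^esub> c)"
      using mem by (auto simp: M.R.a_assoc PiE_iff intro!: restrict_ext)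
  next
    have "(\<Oplus>\<^bsub>msec F W\<^esub>i\<in>{..<n}. ?t (\<lambda>i\<in>{..<n}. \<zero>\<^bsub>rsec X W\<^esub>) i) = (\<Oplus>\<^bsub>msec F W\<^esub>i\<in>{..<n}. \<zero>\<^bsub>msec F W\<^esub>)"
      using s by (intro M.M.finsum_cong') auto
    then show "\<zero>\<^bsub>msec (relation_sheaf X F U n s) W\<^esub> \<in> carrier (msec (relation_sheaf X F U n s) W)"
      by simp
    fix a assume "a \<in> carrier (msec (relation_sheaf X F U n s) W)"
    then show "\<zero>\<^bsub>msec (relation_sheaf X F U n s) W\<^esub> \<oplus>\<^bsub>msec (relation_sheaf X F U n s) W\<^esub> a = a"
      by (auto simp: PiE_iff extensional_def fun_eq_iff)
  qed
qed

context spectral begin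

section \<open>Coherence of the spectral sheaf\<close>

lemma finsum_F0:
  assumes W: "is_open X W" "W \<noteq> {}" and R: "R \<in> B" "R \<noteq> 0"
    and reg: "\<And>i. i < n \<Longrightarrow> regular_on W (A i) Q" and s: "\<And>i. i < n \<Longrightarrow> fr (f i) R \<in> F0_carrier W"
    and Q: "Q \<in> B" "Q \<noteq> 0"
  shows "(\<Oplus>\<^bsub>msec F0 W\<^esub>i\<in>{..<n::nat}. sect W (A i) Q \<odot>\<^bsub>msec F0 W\<^esub> fr (f i) R) = fr (\<Sum>i<n. f i \<diamondop> A i) (R \<star> Q)"
  using reg s
proof (induction n)
  interpret M: Module.module "OX W" "msec F0 W" by (rule F0_module[OF W(1)])
  case 0
  have "fr 0 (R \<star> Q) = fr 0 1" using R Q by (simp add: fr_eq_zero_iff)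
  then show ?case using M.M.finsum_empty by simp
next
  interpret M: Module.module "OX W" "msec F0 W" by (rule F0_module[OF W(1)])
  case (Suc n)
  let ?g = "\<lambda>i. sect W (A i) Q \<odot>\<^bsub>msec F0 W\<^esub> fr (f i) R"
  have "?g \<in> {..<Suc n} \<rightarrow> carrier (msec F0 W)"
    using Suc.prems W by (intro Pi_I M.smult_closed) auto
  then have "finsum (msec F0 W) ?g {..<Suc n} = ?g n \<oplus>\<^bsub>msec F0 W\<^esub> finsum (msec F0 W) ?g {..<n}"
    by (rule finsum_lessThan_Suc[OF M.M.abelian_monoid_axioms])
  also have "finsum (msec F0 W) ?g {..<n} = fr (\<Sum>i<n. f i \<diamondop> A i) (R \<star> Q)"
    using Suc.prems by (intro Suc.IH) auto
  also have "?g n = fr (f n \<diamondop> A n) (R \<star> Q)"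
    using F0_smult_sect[OF W Suc.prems(1)[of n]] R Suc.prems(1)[of n] by (simp add: regular_on_def)
  finally show ?case using R Q by (simp add: add.commute)
qed

lemma finsum_OX:
  assumes W: "is_open X W" and reg: "\<And>i. i < n \<Longrightarrow> regular_on W (A i) Q" and "fraction 0 Q"
  shows "(\<Oplus>\<^bsub>OX W\<^esub>i\<in>{..<n::nat}. sect W (A i) Q) = sect W (\<Sum>i<n. A i) Q \<and> regular_on W (\<Sum>i<n. A i) Q"
  using reg
proof (induction n)
  interpret R: cring "OX W" by (rule cring_OX[OF W])
  note sub = open_subset_pts[OF W]
  have 0: "regular_on W 0 Q"
    using regular_on_cong[OF regular_on_const[OF sub, of 0] assms(3)] by simp
  case 0
  then show ?case using \<open>regular_on W 0 Q\<close> sect_eqI[OF regular_on_const[OF sub, of 0] \<open>regular_on W 0 Q\<close>]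
    by (simp add: sect_zero W)
next
  interpret R: cring "OX W" by (rule cring_OX[OF W])
  note sub = open_subset_pts[OF W]
  case (Suc n)
  have IH: "finsum (OX W) (\<lambda>i. sect W (A i) Q) {..<n} = sect W (\<Sum>i<n. A i) Q" "regular_on W (\<Sum>i<n. A i) Q"
    using Suc by simp_all
  have An: "regular_on W (A n) Q" using Suc.prems by simp
  have mem: "A n \<in> B" "Q \<in> B" "Q \<noteq> 0" "(\<Sum>i<n. A i) \<in> B"
    using An IH(2) by (auto simp: regular_on_def fraction_def)
  have eq: "(A n \<star> Q + (\<Sum>i<n. A i) \<star> Q) \<star> Q = (\<Sum>i<Suc n. A i) \<star> (Q \<star> Q)"
    by (simp add: op_mult_add_left op_mult_assoc add.commute)
  have reg: "regular_on W (A n \<star> Q + (\<Sum>i<n. A i) \<star> Q) (Q \<star> Q)" by (rule regular_on_add[OF sub An IH(2)])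
  have reg': "regular_on W (\<Sum>i<Suc n. A i) Q"
    by (rule regular_on_cong[OF reg _ eq]) (use mem in \<open>simp add: fraction_def\<close>)
  have "finsum (OX W) (\<lambda>i. sect W (A i) Q) {..<Suc n} = sect W (A n) Q \<oplus>\<^bsub>OX W\<^esub> sect W (\<Sum>i<n. A i) Q"
    using finsum_lessThan_Suc[OF R.abelian_monoid_axioms, of "\<lambda>i. sect W (A i) Q" n] Suc.prems W IH by simp
  also have "\<dots> = sect W (A n \<star> Q + (\<Sum>i<n. A i) \<star> Q) (Q \<star> Q)"
    by (rule sect_add[OF W An IH(2)])
  also have "\<dots> = sect W (\<Sum>i<Suc n. A i) Q"
    by (rule sect_eqI[OF reg reg' eq])
  finally show ?case using reg' by simp
qed

text \<open>Near y finitely many functions share one denominator Q t^m, with all numerators in the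
  same degree m. The formula is stated for every smaller W' because later arguments shrink the
  neighbourhood further.\<close>

lemma sections_common_local:
  assumes W: "is_open X W" "y \<in> W" and a: "\<And>i. i < n \<Longrightarrow> a i \<in> carrier (OX W)"
  obtains m Q A where "Q \<in> filt B m" "tmon Q m \<notin> y" "Q \<noteq> 0" "\<forall>i<(n::nat). A i \<in> filt B m"
    "\<forall>i<n. \<forall>W' \<subseteq> W \<inter> basic m Q. rres X W W' (a i) = sect W' (A i) Q"
proof -
  have yp: "y \<in> pts" using open_subset_pts[OF W(1)] W(2) by auto
  have "\<exists>m Q A. Q \<in> filt B m \<and> tmon Q m \<notin> y \<and> Q \<noteq> 0 \<and> (\<forall>i<n. A i \<in> filt B m) \<and>
     (\<forall>i<n. \<forall>W' \<subseteq> W \<inter> basic m Q. rres X W W' (a i) = sect W' (A i) Q)"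
    using a
  proof (induction n)
    case 0
    show ?case by (intro exI[of _ 0] exI[of _ 1] exI) (auto simp: pt_one yp)
  next
    case (Suc n)
    then obtain m Q A where 1: "Q \<in> filt B m" "tmon Q m \<notin> y" "Q \<noteq> 0" "\<forall>i<n. A i \<in> filt B m"
       "\<forall>i<n. \<forall>W' \<subseteq> W \<inter> basic m Q. rres X W W' (a i) = sect W' (A i) Q"
      by (metis less_SucI)
    obtain C T where an: "a n = sect W C T" "regular_on W C T"
      using sectE[OF W(1) Suc.prems[of n]] by blast
    then have "reg y C T" using W(2) by (simp add: regular_on_def)
    then obtain C' R k where 2: "C' \<in> filt B k" "R \<in> filt B k" "tmon R k \<notin> y" "R \<noteq> 0" "fraction C' R" "C \<star> R = C' \<star> T"
      using regE[OF yp] by metis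
    define A' where "A' = (\<lambda>i. if i < n then A i \<star> R else C' \<star> Q)"
    have mem: "\<And>i. i < n \<Longrightarrow> A i \<star> R \<in> filt B (m + k)" "C' \<star> Q \<in> filt B (m + k)" "Q \<star> R \<in> filt B (m + k)"
      using filt_mult[OF _ 2(2)] 1 filt_mult[OF 2(1) 1(1)] by (auto simp: add.commute[of k m])
    have nz: "tmon (Q \<star> R) (m + k) \<notin> y" "Q \<star> R \<noteq> 0" using pt_prime[OF yp 1(1) 2(2)] 1 2 by auto
    have bas: "basic (m + k) (Q \<star> R) = basic m Q \<inter> basic k R" by (rule basic_mult[OF 1(1) 2(2)])
    have "rres X W W' (a i) = sect W' (A' i) (Q \<star> R)"
      if i: "i < Suc n" and W': "W' \<subseteq> W \<inter> basic (m + k) (Q \<star> R)" for i W'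
    proof (cases "i < n")
      case True
      have "rres X W W' (a i) = sect W' (A i) Q" using 1(5) True W' bas by auto
      also have "\<dots> = sect W' (A' i) (Q \<star> R)"
        unfolding sect_def
        by (intro restrict_ext frac_at_cong) (use True 1 2 in \<open>auto simp: A'_def fraction_def mult_ac_B filtD\<close>)
      finally show ?thesis .
    next
      case False
      then have "i = n" using i by simp
      then have "rres X W W' (a i) = sect W' C T" using an W' by simp
      also have "\<dots> = sect W' C' R"
        unfolding sect_def
        by (intro restrict_ext frac_at_cong) (use an 2 in \<open>auto simp: regular_on_def\<close>)
      also have "\<dots> = sect W' (A' i) (Q \<star> R)"
        unfolding sect_def
        by (intro restrict_ext frac_at_cong) (use False 1 2 in \<open>auto simp: A'_def fraction_def mult_ac_B filtD\<close>)
      finally show ?thesis .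
    qed
    moreover have "\<forall>i<Suc n. A' i \<in> filt B (m + k)" using mem by (auto simp: A'_def)
    ultimately show ?case using mem(3) nz
      by (intro exI[of _ "m + k"] exI[of _ "Q \<star> R"] exI[of _ A']) auto
  qed
  then show thesis using that by metis
qed

lemma regular_on_basic:
  assumes "A \<in> filt B n" "Q \<in> filt B n" "Q \<noteq> 0" "W \<subseteq> basic n Q"
  shows "regular_on W A Q"
  unfolding regular_on_def
proof (intro conjI ballI)
  show "fraction A Q" using assms by (auto simp: fraction_def)
  show "reg q A Q" if "q \<in> W" for q
    using frac_at_basic[OF assms(1,2)] assms(4) that by (auto simp: basic_def)
qed

lemma elliptic_filt:
  obtains E d where "E \<in> B" "E \<noteq> 0" "d > 0" "degree E = d * r" "E \<in> filt B d"
proof -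
  obtain E where E: "E \<in> B" "E \<noteq> 0" "degree E > 0" by (rule elliptic)
  obtain d where d: "degree E = r * d" using r_dvd[OF E(1)] by blast
  show thesis
    by (rule that[of E d]) (use E d in \<open>auto simp: mult.commute filt_def intro: ccontr\<close>)
qed

text \<open>Repeated division by E. Each division lowers the order by d r and its remainder is a
  combination of monomials with constant coefficients, so l divisions leave coefficients of
  filtration degree d l. The range of monomials is (d + 1) r, not d r, because that is the bound on
  f for l = 0.\<close>

lemma spectral_module_generators:
  assumes E: "E \<in> B" "E \<noteq> 0" "degree E = d * r" "E \<in> filt B d"
    and f: "degree f < Suc (d * l + d) * r"
  shows "\<exists>c. (\<forall>i. c i \<in> filt B (d * l)) \<and> f = (\<Sum>i<Suc d * r. Polynomial.monom 1 i \<diamondop> c i)"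
  using f
proof (induction l arbitrary: f)
  case 0
  have "f = (\<Sum>i<Suc d * r. Polynomial.monom (Polynomial.coeff f i) i)"
  proof (rule poly_eqI)
    fix n show "Polynomial.coeff f n = Polynomial.coeff (\<Sum>i<Suc d * r. Polynomial.monom (Polynomial.coeff f i) i) n"
      using 0 by (simp add: coeff_sum coeff_eq_0)
  qed
  then show ?case
    by (intro exI[of _ "\<lambda>i. const_op (Polynomial.coeff f i)"]) (simp add: op_action_const_op smult_monom)
next
  case (Suc l)
  obtain g h where gh: "f = g \<diamondop> E + h" "h = 0 \<or> degree h < degree E" by (rule act_division[OF E(1,2)])
  have h: "degree h < Suc d * r" using gh(2) E r_pos by auto
  have "degree g < Suc (d * l + d) * r"
  proof (cases "g = 0")
    case False
    have "degree (g \<diamondop> E) = degree g + d * r" using act_nonzero(2)[OF E(1,2) False] E by simp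
    moreover have "g \<diamondop> E = f - h" using gh by simp
    then have "degree (g \<diamondop> E) < Suc (d * Suc l + d) * r"
      using degree_diff_less[OF Suc.prems, of h] h by (simp add: add_mult_distrib)
    ultimately show ?thesis by (simp add: add_mult_distrib)
  qed simp
  then obtain c where c: "\<forall>i. c i \<in> filt B (d * l)" "g = (\<Sum>i<Suc d * r. Polynomial.monom 1 i \<diamondop> c i)"
    using Suc.IH by blast
  have "h = (\<Sum>i<Suc d * r. Polynomial.monom (Polynomial.coeff h i) i)"
  proof (rule poly_eqI)
    fix n show "Polynomial.coeff h n = Polynomial.coeff (\<Sum>i<Suc d * r. Polynomial.monom (Polynomial.coeff h i) i) n"
      using h by (simp add: coeff_sum coeff_eq_0)
  qed
  then have h': "h = (\<Sum>i<Suc d * r. Polynomial.monom 1 i \<diamondop> const_op (Polynomial.coeff h i))"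
    by (simp add: op_action_const_op smult_monom)
  have "f = (\<Sum>i<Suc d * r. Polynomial.monom 1 i \<diamondop> c i) \<diamondop> E + (\<Sum>i<Suc d * r. Polynomial.monom 1 i \<diamondop> const_op (Polynomial.coeff h i))"
    using gh(1) c(2) h' by simp
  also have "\<dots> = (\<Sum>i<Suc d * r. Polynomial.monom 1 i \<diamondop> (c i \<star> E + const_op (Polynomial.coeff h i)))"
    by (simp only: op_action_sum_left sum.distrib[symmetric] op_action_add_right op_action_mult)
  finally show ?case
    using c(1) E(4) filt_mult[of _ "d * l" E d]
    by (intro exI[of _ "\<lambda>i. c i \<star> E + const_op (Polynomial.coeff h i)"]) (auto simp: add.commute)
qed

text \<open>The curve is covered by the sets where t^d and E t^d do not vanish. On these, h = 1 and
  h = E^l, taken in degree l d, are the local units.\<close>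

lemma neighbourhood_cases:
  assumes E: "E \<in> B" "E \<noteq> 0" "degree E = d * r" "E \<in> filt B d" and q: "q \<in> pts"
  obtains h where "h \<in> B" "h \<noteq> 0" "h \<in> filt B (l * d)" "q \<in> basic (l * d) h"
  using q
proof (cases rule: pts_cases)
  case 1
  then show thesis
    using that[of 1] X0_tmon_one[of q "l * d"] q by (auto simp: basic_def)
next
  case 2
  then have "tmon E d \<notin> q" using pinf(2)[OF E(4)] E by simp
  then have "tmon (op_pow E l) (l * d) \<notin> q" by (rule pt_pow[OF q E(4)])
  then show thesis
    using that[of "op_pow E l"] E filt_pow[OF E(4), of l] pow_nonzero[OF E(2)] q by (auto simp: basic_def)
qed

text \<open>Near x the generators are the fractions \<partial>^i / h with i < (d + 1) r, where h is
  a local unit of degree d. That they generate is \<open>spectral_module_generators\<close> applied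
  to a suitably expanded numerator.\<close>

lemma F0_finite_type: "finite_type_on X F0 (whole X)"
  unfolding finite_type_on_def
proof
  fix x assume "x \<in> whole X"
  then have xp: "x \<in> pts" by simp
  obtain E d where E: "E \<in> B" "E \<noteq> 0" "d > 0" "degree E = d * r" "E \<in> filt B d" by (rule elliptic_filt)
  obtain h where h: "h \<in> B" "h \<noteq> 0" "h \<in> filt B (1 * d)" "x \<in> basic (1 * d) h"
    by (rule neighbourhood_cases[OF E(1,2,4,5) xp])
  let ?V = "basic d h"
  let ?n = "Suc d * r"
  let ?s = "\<lambda>i. fr (Polynomial.monom 1 i) h"
  have V: "is_open X ?V" using h by simp
  have s: "?s i \<in> F0_carrier W" if "i < ?n" "W \<subseteq> ?V" "W \<noteq> {}" for i W
  proof (rule F0_carrierI[OF _ _ that(3)])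
    show "?s i \<in> FK" using h by simp
    show "in_stalk q (?s i)" if "q \<in> W" for q
      unfolding in_stalk_def using h \<open>W \<subseteq> ?V\<close> \<open>i < ?n\<close> that
      by (intro exI[of _ d] exI[of _ "Polynomial.monom 1 i"] exI[of _ h]) (auto simp: basic_def degree_monom_eq)
  qed
  have gen: "locally_generated_by X F0 ?V ?n ?s"
    unfolding locally_generated_by_def
  proof (intro allI impI)
    fix W t y assume *: "is_open X W \<and> W \<subseteq> ?V \<and> t \<in> carrier (msec F0 W) \<and> y \<in> W"
    then have W: "is_open X W" "W \<subseteq> ?V" "y \<in> W" and t: "t \<in> F0_carrier W" by auto
    have sub: "W \<subseteq> pts" using open_subset_pts[OF W(1)] .
    have yp: "y \<in> pts" using sub W by auto
    obtain m f Q where Q: "Q \<in> filt B m" "tmon Q m \<notin> y" "Q \<in> B" "Q \<noteq> 0" "degree f < Suc m * r" "t = fr f Q"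
      by (rule in_stalkE[OF yp F0_carrierD(2)[OF t sub W(3)]])
    let ?W = "W \<inter> basic m Q"
    obtain d' where d': "d = Suc d'" using E(3) by (cases d) auto
    \<comment> \<open>Expanding f/Q by T = Q^(d-1) h gives the denominator Q^d h of degree d m + d.
      This is the shape in which division by E yields coefficients of degree d m, and these become
      regular functions after division by Q^d.\<close>
    let ?T = "op_pow Q d' \<star> h"
    let ?Q = "Q \<star> ?T"
    have T: "?T \<in> filt B (d' * m + d)" "?T \<noteq> 0" using filt_mult[OF filt_pow[OF Q(1)] h(3)] Q h pow_nonzero by auto
    have QT: "?Q \<in> filt B (d * m + d)" "?Q \<noteq> 0" "?Q \<in> B" using filt_mult[OF Q(1) T(1)] Q T d' by (auto simp: add_ac)
    have W1: "is_open X ?W" using W Q by (intro openin_Int) simp_all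
    have yW: "y \<in> ?W" using W Q yp by (auto simp: basic_def)
    have sub1: "?W \<subseteq> basic (d * m + d) ?Q"
    proof
      fix q assume q: "q \<in> ?W"
      then have "q \<in> pts" "tmon Q m \<notin> q" "tmon h d \<notin> q" using W(2) by (auto simp: basic_def)
      then have "tmon ?T (d' * m + d) \<notin> q"
        using pt_prime[of q "op_pow Q d'" "d' * m" h d] pt_pow[of q Q m d'] Q(1) h(3) filt_pow[OF Q(1)] by simp
      then have "tmon ?Q (m + (d' * m + d)) \<notin> q"
        using pt_prime[OF \<open>q \<in> pts\<close> Q(1) T(1)] \<open>tmon Q m \<notin> q\<close> by simp
      then show "q \<in> basic (d * m + d) ?Q" using \<open>q \<in> pts\<close> d' by (simp add: basic_def add_ac)
    qed
    have "degree (f \<diamondop> ?T) < Suc (m + (d' * m + d)) * r" by (rule degree_act_filt[OF T(1) Q(5)])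
    then have "degree (f \<diamondop> ?T) < Suc (d * m + d) * r" using d' by (simp add: add_ac)
    then obtain c where c: "\<forall>i. c i \<in> filt B (d * m)" "f \<diamondop> ?T = (\<Sum>i<?n. Polynomial.monom 1 i \<diamondop> c i)"
      using spectral_module_generators[OF E(1,2,4,5)] by blast
    have ch: "c i \<star> h \<in> filt B (d * m + d)" for i using filt_mult[of "c i" "d * m" h d] c(1) h(3) by simp
    have reg: "regular_on ?W (c i \<star> h) ?Q" for i
      using ch QT(1,2) sub1 by (rule regular_on_basic)
    have "(\<Oplus>\<^bsub>msec F0 ?W\<^esub>i\<in>{..<?n}. sect ?W (c i \<star> h) ?Q \<odot>\<^bsub>msec F0 ?W\<^esub> ?s i)
       = fr (\<Sum>i<?n. Polynomial.monom 1 i \<diamondop> (c i \<star> h)) (h \<star> ?Q)"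
      using W1 yW W(2) by (intro finsum_F0 reg s h QT) auto
    also have "(\<Sum>i<?n. Polynomial.monom 1 i \<diamondop> (c i \<star> h)) = (\<Sum>i<?n. Polynomial.monom 1 i \<diamondop> c i) \<diamondop> h"
      by (simp only: op_action_sum_left op_action_mult)
    also have "(\<Sum>i<?n. Polynomial.monom 1 i \<diamondop> c i) = f \<diamondop> ?T" by (rule c(2)[symmetric])
    also have "fr (f \<diamondop> ?T \<diamondop> h) (h \<star> ?Q) = t"
      using fr_cancel(2)[of ?Q h "f \<diamondop> ?T"] fr_cancel(1)[of Q ?T f] QT Q h T filtD by auto
    finally have eq: "(\<Oplus>\<^bsub>msec F0 ?W\<^esub>i\<in>{..<?n}. sect ?W (c i \<star> h) ?Q \<odot>\<^bsub>msec F0 ?W\<^esub> ?s i) = t" .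
    have ne: "?W \<noteq> {}" using yW by blast
    show "\<exists>W' a. is_open X W' \<and> y \<in> W' \<and> W' \<subseteq> W \<and> a \<in> {..<?n} \<rightarrow> carrier (OX W') \<and>
      mres F0 W W' t = (\<Oplus>\<^bsub>msec F0 W'\<^esub>i\<in>{..<?n}. a i \<odot>\<^bsub>msec F0 W'\<^esub> mres F0 ?V W' (?s i))"
      using W1 yW eq ne reg by (intro exI[of _ ?W] exI[of _ "\<lambda>i. sect ?W (c i \<star> h) ?Q"]) auto
  qed
  have "?s \<in> {..<?n} \<rightarrow> carrier (msec F0 ?V)" using s h by auto
  then show "\<exists>V n s. is_open X V \<and> x \<in> V \<and> V \<subseteq> whole X \<and> s \<in> {..<n} \<rightarrow> carrier (msec F0 V) \<and>
        locally_generated_by X F0 V n s"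
    using V h gen open_subset_pts[OF V] by (intro exI[of _ ?V] exI[of _ ?n] exI[of _ ?s]) auto
qed

text \<open>A Groebner type argument for the graded module of relations: leading positions are pairs of an
  order and an index, and multiplication by the elliptic operator \<open>E\<close> shifts the order by \<open>d r\<close>, so
  only finitely many leading positions are minimal.\<close>

lemma relation_generators:
  fixes n :: nat and f :: "nat \<Rightarrow> complex poly"
  assumes E: "E \<in> B" "E \<noteq> 0" "degree E = d * r" "E \<in> filt B d" "d > 0"
  obtains K :: nat and e :: "nat \<Rightarrow> nat \<Rightarrow> diffop" and b :: nat where
    "\<forall>j<K. \<forall>i<n. e j i \<in> filt B (Suc b * d)"
    "\<forall>j<K. (\<Sum>i<n. f i \<diamondop> e j i) = 0"
    "\<forall>l A. (\<forall>i<n. A i \<in> filt B (Suc b * d + l * d)) \<and> (\<Sum>i<n. f i \<diamondop> A i) = 0 \<longrightarrow>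
       (\<exists>c. (\<forall>j. c j \<in> filt B (l * d)) \<and> (\<forall>i<n. A i = (\<Sum>j<K. c j \<star> e j i)))"
proof -
  define N where "N A \<longleftrightarrow> (\<forall>i<n. A i \<in> B) \<and> (\<Sum>i<n. f i \<diamondop> A i) = 0" for A
  \<comment> \<open>A leading position is the maximal order D in the family together with the first
    index at which it is attained.\<close>
  define lead where "lead A D i \<longleftrightarrow> i < n \<and> Polynomial.coeff (A i) D \<noteq> 0 \<and> (\<forall>j<n. degree (A j) \<le> D) \<and>
     (\<forall>j<i. Polynomial.coeff (A j) D = 0)" for A :: "nat \<Rightarrow> diffop" and D i :: nat
  define LM where "LM = {(D, i). \<exists>A. N A \<and> lead A D i}"
  let ?dr = "d * r"
  have dr: "?dr > 0" using E(5) by simp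
  have N_mult: "N (\<lambda>i. A i \<star> Q)" if "N A" "Q \<in> B" for A Q
    using that unfolding N_def by (simp add: op_action_mult op_action_sum_left[symmetric])
  have lead_mult: "lead (\<lambda>i. A i \<star> Q) (D + degree Q) i" if "lead A D i" "Q \<noteq> 0" for A Q D i
    unfolding lead_def
  proof (intro conjI allI impI)
    have deg: "degree (A j) \<le> D" if "j < n" for j using \<open>lead A D i\<close> that by (simp add: lead_def)
    have coeff: "Polynomial.coeff (A j \<star> Q) (D + degree Q) = Polynomial.coeff (A j) D * lead_coeff Q" if "j < n" for j
      using op_mult_coeff_top[OF deg[OF that] order.refl, of Q] .
    show "i < n" using that by (simp add: lead_def)
    then show "Polynomial.coeff (A i \<star> Q) (D + degree Q) \<noteq> 0"
      using coeff that by (simp add: lead_def)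
    show "degree (A j \<star> Q) \<le> D + degree Q" if "j < n" for j
      using op_mult_degree_le[of "A j" Q] deg[OF that] by simp
    show "Polynomial.coeff (A j \<star> Q) (D + degree Q) = 0" if "j < i" for j
      using coeff[of j] \<open>lead A D i\<close> that by (simp add: lead_def)
  qed
  have LM_shift: "(D + k * ?dr, i) \<in> LM" if "(D, i) \<in> LM" for D i k
  proof -
    obtain A where A: "N A" "lead A D i" using \<open>(D, i) \<in> LM\<close> by (auto simp: LM_def)
    have "N (\<lambda>i. A i \<star> op_pow E k)" "lead (\<lambda>i. A i \<star> op_pow E k) (D + degree (op_pow E k)) i"
      using N_mult[OF A(1)] lead_mult[OF A(2)] E pow_nonzero by auto
    then show ?thesis unfolding LM_def using degree_pow[OF E(2), of k] E(3) by auto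
  qed
  define M0 where "M0 = {(D, i) \<in> LM. D < ?dr \<or> (D - ?dr, i) \<notin> LM}"
  \<comment> \<open>Two positions with the same index and the same residue of the order modulo d r
    differ by a shift under a power of E. So the larger one is not minimal, and a pair of residue
    and index determines a minimal position.\<close>
  have noM0: False if D: "(D, i) \<in> LM" and D': "(D', i) \<in> M0" and less: "D < D'" and md: "D mod ?dr = D' mod ?dr" for D D' i
  proof -
    obtain k where k: "D' = D + ?dr * k"
      using mod_eq_nat1E[OF md[symmetric] less_imp_le[OF less]] by blast
    then obtain k' where k': "k = Suc k'" using less by (cases k) auto
    then have "D' - ?dr = D + k' * ?dr" "\<not> D' < ?dr" using k by auto
    then show False using LM_shift[OF D, of k'] D' by (auto simp: M0_def)
  qed
  have M0_eq: "D = D'" if M: "(D, i) \<in> M0" "(D', i) \<in> M0" and md: "D mod ?dr = D' mod ?dr" for D D' i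
  proof -
    have LM: "(D, i) \<in> LM" "(D', i) \<in> LM" using M by (auto simp: M0_def)
    show ?thesis
      using noM0[OF LM(1) M(2) _ md] noM0[OF LM(2) M(1) _ md[symmetric]] by (metis linorder_neqE_nat)
  qed
  have "inj_on (\<lambda>(D, i). (D mod ?dr, i)) M0"
    unfolding inj_on_def using M0_eq by auto
  moreover have "(\<lambda>(D, i). (D mod ?dr, i)) ` M0 \<subseteq> {..<?dr} \<times> {..<n}"
    using dr by (auto simp: M0_def LM_def lead_def)
  ultimately have "finite M0" by (rule inj_on_finite) simp
  then have "finite (fst ` M0)" by simp
  then obtain b where b: "\<forall>D\<in>fst ` M0. D \<le> b" using finite_nat_set_iff_bounded_le by blast
  \<comment> \<open>The degree J is chosen so that J r exceeds every minimal order and is at least d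
    r; it is a multiple of d so that \<open>neighbourhood_cases\<close> supplies a local unit of
    degree J.\<close>
  let ?J = "Suc b * d"
  have Jb: "b < ?J * r" and Jdr: "?dr \<le> ?J * r"
  proof -
    have "b < Suc b * 1" by simp
    also have "Suc b * 1 \<le> Suc b * ?dr" using dr by (intro mult_le_mono2) linarith
    finally show "b < ?J * r" by (simp only: mult.assoc)
    show "?dr \<le> ?J * r" by simp
  qed
  have step: "?dr \<le> D \<and> (D - ?dr, i) \<in> LM" if "(D, i) \<in> LM" "?J * r < D" for D i
  proof -
    have "(D, i) \<notin> M0" using b that Jb by force
    moreover have "?dr \<le> D" using that(2) Jdr by linarith
    ultimately show ?thesis using that(1) unfolding M0_def by auto
  qed
  \<comment> \<open>Above order J r no position is minimal, so one can descend by d r inside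
    \<open>LM\<close>. At most l descents are made, which bounds the power of E used later by degree
    l d.\<close>
  have reach: "\<exists>k\<le>l. k * ?dr \<le> D \<and> D - k * ?dr \<le> ?J * r \<and> (D - k * ?dr, i) \<in> LM"
    if "(D, i) \<in> LM" "D \<le> (?J + l * d) * r" for D i l
    using that
  proof (induction l arbitrary: D)
    case 0
    then show ?case by (intro exI[of _ 0]) simp
  next
    case (Suc l)
    show ?case
    proof (cases "D \<le> ?J * r")
      case True
      then show ?thesis using Suc by (intro exI[of _ 0]) simp
    next
      case False
      then have s: "?dr \<le> D" "(D - ?dr, i) \<in> LM" using step Suc.prems(1) by auto
      moreover have "D - ?dr \<le> (?J + l * d) * r"
        using Suc.prems(2) by (simp add: add_mult_distrib)
      ultimately obtain k where "k \<le> l" "k * ?dr \<le> D - ?dr" "D - ?dr - k * ?dr \<le> ?J * r" "(D - ?dr - k * ?dr, i) \<in> LM"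
        using Suc.IH by blast
      then show ?thesis using s(1) by (intro exI[of _ "Suc k"]) (auto simp: diff_diff_left)
    qed
  qed
  \<comment> \<open>The index j = D n + i encodes the position (D, i) with D \<le> J r and i < n,
    and div and mod recover it. Positions that do not occur get the zero family, which is a relation
    too and contributes nothing.\<close>
  define K where "K = Suc (?J * r) * n"
  define e where "e j = (if (j div n, j mod n) \<in> LM then SOME A. N A \<and> lead A (j div n) (j mod n) else (\<lambda>_. 0))" for j
  have e: "N (e j) \<and> lead (e j) (j div n) (j mod n)" if "(j div n, j mod n) \<in> LM" for j
  proof -
    have "\<exists>A. N A \<and> lead A (j div n) (j mod n)" using that by (simp add: LM_def)
    from someI_ex[OF this] show ?thesis using that by (simp add: e_def)
  qed
  have e0: "e j = (\<lambda>_. 0)" if "(j div n, j mod n) \<notin> LM" for j using that by (simp add: e_def)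
  have eN: "N (e j)" for j
    using e[of j] e0[of j] by (cases "(j div n, j mod n) \<in> LM") (auto simp: N_def)
  have e_filt: "e j i \<in> filt B ?J" if "j < K" "i < n" for i j
  proof (cases "(j div n, j mod n) \<in> LM")
    case True
    have "j div n < Suc (?J * r)"
      using \<open>j < K\<close> unfolding K_def by (rule less_mult_imp_div_less)
    then have "j div n \<le> ?J * r" by (rule less_Suc_eq_le[THEN iffD1])
    moreover have "degree (e j i) \<le> j div n" using e[OF True] that by (simp add: lead_def)
    moreover have "e j i \<in> B" using eN[of j] that by (simp add: N_def)
    ultimately show ?thesis by (simp add: filt_def)
  qed (simp add: e0)
  have rep: "\<exists>c. (\<forall>j. c j \<in> filt B (l * d)) \<and> (\<forall>i<n. A i = (\<Sum>j<K. c j \<star> e j i))"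
    if "N A" "\<forall>j<n. degree (A j) \<le> D" "D \<le> (?J + l * d) * r" for A D l
    using that
  proof (induction D arbitrary: A rule: less_induct)
    case (less D)
    \<comment> \<open>Inner induction at fixed order D: the coefficients at order D are eliminated
      index by index, t being the number of indices already treated. When all are gone, the order
      has dropped and the outer induction takes over.\<close>
    have "\<exists>c. (\<forall>j. c j \<in> filt B (l * d)) \<and> (\<forall>i<n. A i = (\<Sum>j<K. c j \<star> e j i))"
      if "N A" "\<forall>j<n. degree (A j) \<le> D" "t \<le> n" "\<forall>j<t. Polynomial.coeff (A j) D = 0" for A t
      using that
    proof (induction "n - t" arbitrary: A t)
      case 0
      then have t: "t = n" by simp
      show ?case
      proof (cases D)
        case 0
        have "A i = 0" if "i < n" for i
          using \<open>\<forall>j<n. degree (A j) \<le> D\<close> \<open>\<forall>j<t. Polynomial.coeff (A j) D = 0\<close> that t 0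
          by (metis le_zero_eq leading_coeff_0_iff)
        then show ?thesis by (intro exI[of _ "\<lambda>_. 0"]) simp
      next
        case (Suc D')
        have "degree (A j) \<le> D'" if "j < n" for j
        proof -
          have "degree (A j) \<le> D" "Polynomial.coeff (A j) D = 0" using "0.prems" that t by auto
          then show ?thesis using Suc by (metis le_SucE coeff_0 degree_0 le0 leading_coeff_0_iff)
        qed
        then show ?thesis using less.IH[of D' A] Suc "0.prems"(1) less.prems(3) by simp
      qed
    next
      case (Suc k)
      then have t: "t < n" "k = n - Suc t" by auto
      show ?case
      proof (cases "Polynomial.coeff (A t) D = 0")
        case True
        then show ?thesis
          using Suc.hyps(1)[OF t(2), of A] Suc.prems t(1) by (simp add: less_Suc_eq)
      next
        case False
        have "lead A D t" using Suc.prems False t by (simp add: lead_def)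
        then have "(D, t) \<in> LM" using Suc.prems by (auto simp: LM_def)
        then obtain m where m: "m \<le> l" "m * ?dr \<le> D" "D - m * ?dr \<le> ?J * r" "(D - m * ?dr, t) \<in> LM"
          using reach less.prems(3) by blast
        define j0 where "j0 = (D - m * ?dr) * n + t"
        have j0: "j0 div n = D - m * ?dr" "j0 mod n = t" using t by (simp_all add: j0_def)
        have "(D - m * ?dr) * n + t < Suc (D - m * ?dr) * n" using t by simp
        also have "\<dots> \<le> K" unfolding K_def using m(3) by (intro mult_le_mono1) simp
        finally have j0K: "j0 < K" by (simp add: j0_def)
        let ?E = "op_pow E m"
        have E': "?E \<in> B" "?E \<noteq> 0" "degree ?E = m * ?dr" "?E \<in> filt B (l * d)"
          using E pow_nonzero degree_pow filt_mono[OF filt_pow[OF E(4), of m]] m(1) by auto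
        \<comment> \<open>The stored generator, moved by a power of E to the leading position (D, t)
          of A. A constant multiple of it cancels the coefficient of A t at order D and leaves the
          earlier zeros intact.\<close>
        define H where "H = (\<lambda>i. e j0 i \<star> ?E)"
        have NH: "N H" "lead H D t"
          using N_mult[OF eN E'(1)] lead_mult[of "e j0" "D - m * ?dr" t ?E] e[of j0] j0 m E'
          by (auto simp: H_def)
        have At: "A t \<in> B" "A t \<noteq> 0" "degree (A t) = D"
          using Suc.prems False t le_degree[OF False] by (auto simp: N_def le_antisym)
        have Ht: "H t \<in> B" "H t \<noteq> 0" "degree (H t) = D"
          using NH t le_degree[of "H t" D] by (auto simp: N_def lead_def le_antisym)
        have "degree (A t) = degree (H t)" using At Ht by simp
        then obtain c where "c \<noteq> 0" and c: "A t - const_op c \<star> H t = 0 \<or> degree (A t - const_op c \<star> H t) < degree (A t)"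
          by (rule cancel_lead[OF At(1) Ht(1) At(2) Ht(2)])
        define A' where "A' = (\<lambda>i. A i - const_op c \<star> H i)"
        have NA': "N A'"
        proof -
          have "(\<Sum>i<n. f i \<diamondop> (const_op c \<star> H i)) = (\<Sum>i<n. f i \<diamondop> H i) \<diamondop> const_op c"
          proof -
            have "const_op c \<star> H i = H i \<star> const_op c" if "i < n" for i
              using NH that by (simp add: N_def mult_comm)
            then show ?thesis by (simp add: op_action_sum_left op_action_mult)
          qed
          then show ?thesis
            using NH Suc.prems(1) by (simp add: N_def A'_def op_action_diff_right sum_subtractf)
        qed
        have degA': "\<forall>j<n. degree (A' j) \<le> D"
          using NH(2) Suc.prems(2) unfolding A'_def lead_def
          by (auto simp: const_op_mult intro!: degree_diff_le intro: order.trans[OF degree_smult_le])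
        have coA': "Polynomial.coeff (A' j) D = 0" if "j < Suc t" for j
        proof (cases "j = t")
          case True
          have "Polynomial.coeff (A t - const_op c \<star> H t) D = 0"
            using c At(3) coeff_eq_0[of "A t - const_op c \<star> H t" D] by (auto simp del: coeff_diff)
          then show ?thesis using True by (simp only: A'_def)
        next
          case False
          then have "j < t" using that by simp
          then show ?thesis using Suc.prems(4) NH(2) by (simp add: A'_def lead_def const_op_mult)
        qed
        obtain c1 where c1: "\<forall>j. c1 j \<in> filt B (l * d)" "\<forall>i<n. A' i = (\<Sum>j<K. c1 j \<star> e j i)"
          using Suc.hyps(1)[OF t(2) NA' degA'] t(1) coA' by auto
        let ?c = "\<lambda>j. c1 j + (if j = j0 then const_op c \<star> ?E else 0)"
        have mem: "const_op c \<star> ?E \<in> filt B (l * d)" using filt_mult[of "const_op c" 0 ?E "l * d"] E' by simp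
        have "A i = (\<Sum>j<K. ?c j \<star> e j i)" if i: "i < n" for i
        proof -
          have "(\<Sum>j<K. ?c j \<star> e j i) = (\<Sum>j<K. c1 j \<star> e j i) + (\<Sum>j<K. if j = j0 then const_op c \<star> ?E \<star> e j0 i else 0)"
            unfolding sum.distrib[symmetric] by (intro sum.cong refl) (simp add: op_mult_add_left)
          also have "\<dots> = A' i + const_op c \<star> H i"
          proof -
            have "e j0 i \<in> B" using eN[of j0] i by (simp add: N_def)
            then have "const_op c \<star> ?E \<star> e j0 i = const_op c \<star> H i"
              using E' by (simp add: H_def op_mult_assoc mult_comm)
            then show ?thesis using c1(2) i j0K by simp
          qed
          finally show ?thesis by (simp add: A'_def)
        qed
        then show ?thesis using c1(1) mem by (intro exI[of _ ?c]) simp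
      qed
    qed
    from this[of A 0] show ?case using less.prems by simp
  qed
  show thesis
  proof (rule that[of K e b])
    show "\<forall>j<K. \<forall>i<n. e j i \<in> filt B ?J" using e_filt by blast
    show "\<forall>j<K. (\<Sum>i<n. f i \<diamondop> e j i) = 0" using eN by (simp add: N_def)
    show "\<forall>l A. (\<forall>i<n. A i \<in> filt B (?J + l * d)) \<and> (\<Sum>i<n. f i \<diamondop> A i) = 0 \<longrightarrow>
       (\<exists>c. (\<forall>j. c j \<in> filt B (l * d)) \<and> (\<forall>i<n. A i = (\<Sum>j<K. c j \<star> e j i)))"
    proof (intro allI impI)
      fix l A assume "(\<forall>i<n. A i \<in> filt B (?J + l * d)) \<and> (\<Sum>i<n. f i \<diamondop> A i) = 0"
      then have "N A" "\<forall>j<n. degree (A j) \<le> (?J + l * d) * r" by (auto simp: N_def filt_def)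
      then show "\<exists>c. (\<forall>j. c j \<in> filt B (l * d)) \<and> (\<forall>i<n. A i = (\<Sum>j<K. c j \<star> e j i))"
        using rep by blast
    qed
  qed
qed

lemma finsum_relation_sheaf:
  assumes M: "Module.module (OX W) (msec F W)"
    and s: "\<And>i. i < n \<Longrightarrow> mres F U W (s i) \<in> carrier (msec F W)"
    and g: "\<And>j. j < K \<Longrightarrow> g j \<in> carrier (msec (relation_sheaf X F U n s) W)"
  shows "(\<Oplus>\<^bsub>msec (relation_sheaf X F U n s) W\<^esub>j\<in>{..<K::nat}. g j) = (\<lambda>i\<in>{..<n}. \<Oplus>\<^bsub>OX W\<^esub>j\<in>{..<K}. g j i)"
  using g
proof (induction K)
  interpret M: Module.module "OX W" "msec F W" by (rule M)
  interpret N: abelian_monoid "msec (relation_sheaf X F U n s) W"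
    using relation_sheaf_abelian_monoid[OF M s] .
  case 0
  show ?case using N.finsum_empty by (simp add: M.R.finsum_empty)
next
  interpret M: Module.module "OX W" "msec F W" by (rule M)
  interpret N: abelian_monoid "msec (relation_sheaf X F U n s) W"
    using relation_sheaf_abelian_monoid[OF M s] .
  case (Suc K)
  have "(\<Oplus>\<^bsub>msec (relation_sheaf X F U n s) W\<^esub>j\<in>{..<Suc K}. g j)
     = g K \<oplus>\<^bsub>msec (relation_sheaf X F U n s) W\<^esub> (\<Oplus>\<^bsub>msec (relation_sheaf X F U n s) W\<^esub>j\<in>{..<K}. g j)"
    using Suc.prems by (intro finsum_lessThan_Suc N.abelian_monoid_axioms) blast
  also have "(\<Oplus>\<^bsub>msec (relation_sheaf X F U n s) W\<^esub>j\<in>{..<K}. g j) = (\<lambda>i\<in>{..<n}. \<Oplus>\<^bsub>OX W\<^esub>j\<in>{..<K}. g j i)"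
    by (rule Suc.IH, rule Suc.prems, simp)
  also have "g K \<oplus>\<^bsub>msec (relation_sheaf X F U n s) W\<^esub> (\<lambda>i\<in>{..<n}. \<Oplus>\<^bsub>OX W\<^esub>j\<in>{..<K}. g j i)
     = (\<lambda>i\<in>{..<n}. \<Oplus>\<^bsub>OX W\<^esub>j\<in>{..<Suc K}. g j i)"
  proof -
    have "g K i \<oplus>\<^bsub>OX W\<^esub> (\<Oplus>\<^bsub>OX W\<^esub>j\<in>{..<K}. g j i) = (\<Oplus>\<^bsub>OX W\<^esub>j\<in>{..<Suc K}. g j i)" if "i < n" for i
    proof (rule finsum_lessThan_Suc[symmetric, OF M.R.abelian_monoid_axioms])
      show "(\<lambda>j. g j i) \<in> {..<Suc K} \<rightarrow> carrier (OX W)"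
      proof
        fix j assume "j \<in> {..<Suc K}"
        then have "g j \<in> {..<n} \<rightarrow>\<^sub>E carrier (OX W)" using Suc.prems by simp
        then show "g j i \<in> carrier (OX W)" using that by auto
      qed
    qed
    then show ?thesis by (auto intro!: restrict_ext)
  qed
  finally show ?case .
qed

text \<open>Over a common denominator R, relations among the sections f_i/R are relations among the
  numerators f_i. Dividing the generators from \<open>relation_generators\<close> by a local unit h
  of degree J turns them into sections near x.\<close>

lemma F0_relations_finite_type:
  assumes U: "is_open X U" and s: "s \<in> {..<n} \<rightarrow> carrier (msec F0 U)"
  shows "finite_type_on X (relation_sheaf X F0 U n s) U"
  unfolding finite_type_on_def
proof
  let ?Rel = "relation_sheaf X F0 U n s"
  fix x assume x: "x \<in> U"
  note subU = open_subset_pts[OF U]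
  have xp: "x \<in> pts" using x subU by auto
  have neU: "U \<noteq> {}" using x by auto
  obtain E d where E: "E \<in> B" "E \<noteq> 0" "d > 0" "degree E = d * r" "E \<in> filt B d" by (rule elliptic_filt)
  have sFK: "s i \<in> FK" "s i \<in> F0_carrier U" if "i < n" for i using s that F0_carrierD(1)[OF _ subU] by auto
  obtain f R where R: "R \<in> B" "R \<noteq> 0" "\<forall>i<n. s i = fr (f i) R"
    by (rule FK_common_finite[OF sFK(1)])
  obtain K :: nat and e :: "nat \<Rightarrow> nat \<Rightarrow> diffop" and b :: nat where e: "\<forall>j<K. \<forall>i<n. e j i \<in> filt B (Suc b * d)" "\<forall>j<K. (\<Sum>i<n. f i \<diamondop> e j i) = 0"
    and gen: "\<forall>l A. (\<forall>i<n. A i \<in> filt B (Suc b * d + l * d)) \<and> (\<Sum>i<n. f i \<diamondop> A i) = 0 \<longrightarrow>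
       (\<exists>c. (\<forall>j. c j \<in> filt B (l * d)) \<and> (\<forall>i<n. A i = (\<Sum>j<K. c j \<star> e j i)))"
    by (rule relation_generators[OF E(1,2,4,5,3), of n f])
  let ?J = "Suc b * d"
  obtain h where h: "h \<in> B" "h \<noteq> 0" "h \<in> filt B ?J" "x \<in> basic ?J h"
    by (rule neighbourhood_cases[OF E(1,2,4,5) xp])
  let ?V = "U \<inter> basic ?J h"
  have V: "is_open X ?V" using h U by (intro openin_Int) simp_all
  have xV: "x \<in> ?V" using x h by simp
  have sW: "s i \<in> F0_carrier W" if "i < n" "W \<subseteq> U" "W \<noteq> {}" for i W
    using F0_carrier_mono[OF that(2,3) sFK(2)[OF that(1)]] .
  have relsum: "(\<Oplus>\<^bsub>msec F0 W\<^esub>i\<in>{..<n}. a i \<odot>\<^bsub>msec F0 W\<^esub> mres F0 U W (s i)) = fr (\<Sum>i<n. f i \<diamondop> A i) (R \<star> Q)"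
    if W: "is_open X W" "W \<noteq> {}" "W \<subseteq> U" and A: "\<And>i. i < n \<Longrightarrow> regular_on W (A i) Q" and Q: "Q \<in> B" "Q \<noteq> 0"
     and a: "\<And>i. i < n \<Longrightarrow> a i = sect W (A i) Q" for W A Q a
  proof -
    interpret M: Module.module "OX W" "msec F0 W" by (rule F0_module[OF W(1)])
    have cl: "sect W (A i) Q \<odot>\<^bsub>msec F0 W\<^esub> fr (f i) R \<in> carrier (msec F0 W)" if "i < n" for i
      using R(3) W A sW[of i W] that by (intro M.smult_closed) auto
    have "(\<Oplus>\<^bsub>msec F0 W\<^esub>i\<in>{..<n}. a i \<odot>\<^bsub>msec F0 W\<^esub> mres F0 U W (s i)) =
        (\<Oplus>\<^bsub>msec F0 W\<^esub>i\<in>{..<n}. sect W (A i) Q \<odot>\<^bsub>msec F0 W\<^esub> fr (f i) R)"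
      using a R(3) W cl by (intro M.M.finsum_cong') (auto simp del: F0_simps(4))
    also have "\<dots> = fr (\<Sum>i<n. f i \<diamondop> A i) (R \<star> Q)"
      using A sW[of _ W] W R by (intro finsum_F0 W R Q) auto
    finally show ?thesis .
  qed
  define sg where "sg = (\<lambda>W j. \<lambda>i\<in>{..<n}. sect W (e j i) h)"
  have ereg: "regular_on W (e j i) h" if "j < K" "i < n" "W \<subseteq> ?V" for W i j
    using that e h by (intro regular_on_basic[of _ ?J]) auto
  have sg: "sg W j \<in> carrier (msec ?Rel W)" if j: "j < K" and W: "is_open X W" "W \<noteq> {}" "W \<subseteq> ?V" for W j
  proof -
    have "(\<Oplus>\<^bsub>msec F0 W\<^esub>i\<in>{..<n}. sg W j i \<odot>\<^bsub>msec F0 W\<^esub> mres F0 U W (s i)) = fr (\<Sum>i<n. f i \<diamondop> e j i) (R \<star> h)"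
      using W j ereg by (intro relsum h) (auto simp: sg_def)
    also have "\<dots> = fr 0 1" using e(2) j R h by (simp add: fr_eq_zero_iff)
    finally show ?thesis using ereg[OF j _ W(3)] W by (auto simp: sg_def)
  qed
  have lg: "locally_generated_by X ?Rel ?V K (sg ?V)"
    unfolding locally_generated_by_def
  proof (intro allI impI)
    fix W t y assume *: "is_open X W \<and> W \<subseteq> ?V \<and> t \<in> carrier (msec ?Rel W) \<and> y \<in> W"
    then have W: "is_open X W" "W \<subseteq> ?V" "y \<in> W" and t: "t \<in> {..<n} \<rightarrow>\<^sub>E carrier (OX W)"
      and t0: "(\<Oplus>\<^bsub>msec F0 W\<^esub>i\<in>{..<n}. t i \<odot>\<^bsub>msec F0 W\<^esub> mres F0 U W (s i)) = fr 0 1" by auto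
    have sub: "W \<subseteq> pts" using open_subset_pts[OF W(1)] .
    have yp: "y \<in> pts" using sub W by auto
    have tc: "t i \<in> carrier (OX W)" if "i < n" for i using t that by auto
    obtain m Q A where Q: "Q \<in> filt B m" "tmon Q m \<notin> y" "Q \<noteq> 0" "\<forall>i<n. A i \<in> filt B m"
      and tA: "\<forall>i<n. \<forall>W' \<subseteq> W \<inter> basic m Q. rres X W W' (t i) = sect W' (A i) Q"
      by (rule sections_common_local[OF W(1,3) tc])
    have QB: "Q \<in> B" using Q by auto
    let ?W = "W \<inter> basic m Q"
    have W1: "is_open X ?W" using W Q by (intro openin_Int) simp_all
    have yW: "y \<in> ?W" using W Q yp by (auto simp: basic_def)
    have ne: "?W \<noteq> {}" using yW by blast
    have subV: "?W \<subseteq> ?V" using W by auto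
    have Areg: "regular_on ?W (A i) Q" if "i < n" for i
      using that Q by (intro regular_on_basic[of _ m]) auto
    have tW: "rres X W ?W (t i) = sect ?W (A i) Q" if "i < n" for i using tA that by blast
    \<comment> \<open>The fraction found on the smaller set represents t i on all of W, so the
      relation over W becomes an identity between numerators.\<close>
    have rel: "(\<Sum>i<n. f i \<diamondop> A i) = 0"
    proof -
      have neW: "W \<noteq> {}" using W by auto
      have tA': "t i = sect W (A i) Q \<and> regular_on W (A i) Q" if i: "i < n" for i
      proof -
        obtain C T where c: "t i = sect W C T" "regular_on W C T" by (rule sectE[OF W(1) tc[OF i]])
        have "sect ?W C T = sect ?W (A i) Q" using tW[OF i] c by simp
        then have eq: "C \<star> Q = A i \<star> T"
          using sect_eqD[OF W1 ne regular_on_mono[OF c(2)] Areg[OF i]] by simp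
        have fr: "fraction (A i) Q" using Areg[OF i] by (simp add: regular_on_def)
        have "regular_on W (A i) Q" by (rule regular_on_cong[OF c(2) fr eq])
        then show ?thesis using sect_eqI[OF c(2) _ eq] c(1) by simp
      qed
      have "fr (\<Sum>i<n. f i \<diamondop> A i) (R \<star> Q) = fr 0 1"
        using relsum[OF W(1) neW, of A Q t] tA' t0 W QB Q(3) by simp
      then show ?thesis using R QB Q(3) by (simp add: fr_eq_zero_iff)
    qed
    obtain d' where d': "d = Suc d'" using E(3) by (cases d) auto
    \<comment> \<open>Here the denominator becomes Q^d h of degree J + m d, which matches the
      degrees in \<open>relation_generators\<close> with l = m.\<close>
    let ?T = "op_pow Q d' \<star> h"
    let ?Q = "Q \<star> ?T"
    have T: "?T \<in> filt B (d' * m + ?J)" "?T \<noteq> 0" using filt_mult[OF filt_pow[OF Q(1)] h(3)] Q h pow_nonzero by auto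
    have QT0: "?Q \<in> filt B (m + (d' * m + ?J))" using filt_mult[OF Q(1) T(1)] .
    have dm: "m + (d' * m + ?J) = ?J + m * d" using d' by (simp add: algebra_simps)
    have QT: "?Q \<in> filt B (?J + m * d)" "?Q \<noteq> 0" "?Q \<in> B" using QT0 Q T by (auto simp only: dm, auto)
    have sub1: "?W \<subseteq> basic (?J + m * d) ?Q"
    proof
      fix q assume q: "q \<in> ?W"
      then have "q \<in> pts" "tmon Q m \<notin> q" "tmon h ?J \<notin> q" using subV by (auto simp: basic_def)
      then have "tmon ?T (d' * m + ?J) \<notin> q"
        using pt_prime[of q "op_pow Q d'" "d' * m" h ?J] pt_pow[of q Q m d'] Q(1) h(3) filt_pow[OF Q(1)] by simp
      then have "tmon ?Q (m + (d' * m + ?J)) \<notin> q"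
        using pt_prime[OF \<open>q \<in> pts\<close> Q(1) T(1)] \<open>tmon Q m \<notin> q\<close> by simp
      then show "q \<in> basic (?J + m * d) ?Q" using \<open>q \<in> pts\<close> by (simp only: basic_def dm mem_Collect_eq simp_thms)
    qed
    have AT: "A i \<star> ?T \<in> filt B (?J + m * d)" if "i < n" for i
      using filt_mult[of "A i" m ?T] Q(4) T(1) that unfolding dm[symmetric] by blast
    have "(\<Sum>i<n. f i \<diamondop> (A i \<star> ?T)) = (\<Sum>i<n. f i \<diamondop> A i) \<diamondop> ?T"
      by (simp only: op_action_sum_left op_action_mult)
    then have "(\<Sum>i<n. f i \<diamondop> (A i \<star> ?T)) = 0" using rel by simp
    then obtain c where c: "\<forall>j. c j \<in> filt B (m * d)" "\<forall>i<n. A i \<star> ?T = (\<Sum>j<K. c j \<star> e j i)"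
      using gen[rule_format, of "\<lambda>i. A i \<star> ?T" m] AT by blast
    have ch: "c j \<star> h \<in> filt B (?J + m * d)" for j
      using filt_mult[of "c j" "m * d" h ?J] c(1) h(3) by (simp only: add.commute)
    have creg: "regular_on ?W (c j \<star> h) ?Q" for j
      using ch QT(1,2) sub1 by (rule regular_on_basic)
    define a where "a = (\<lambda>j. sect ?W (c j \<star> h) ?Q)"
    have M: "Module.module (OX ?W) (msec F0 ?W)" by (rule F0_module[OF W1])
    have sW1: "mres F0 U ?W (s i) \<in> carrier (msec F0 ?W)" if "i < n" for i
      using sW[OF that _ ne] subV ne by auto
    have prod: "a j \<otimes>\<^bsub>OX ?W\<^esub> sg ?W j i = sect ?W ((c j \<star> h) \<star> e j i) (?Q \<star> h)" if "j < K" "i < n" for i j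
      using sect_mult[OF W1 creg ereg[OF that subV]] that by (simp add: a_def sg_def)
    have preg: "regular_on ?W ((c j \<star> h) \<star> e j i) (?Q \<star> h)" if "j < K" "i < n" for i j
      by (rule regular_on_mult[OF open_subset_pts[OF W1] creg ereg[OF that subV]])
    have smem: "a j \<odot>\<^bsub>msec ?Rel ?W\<^esub> sg ?W j \<in> carrier (msec ?Rel ?W)" if j: "j < K" for j
    proof -
      have "(\<Oplus>\<^bsub>msec F0 ?W\<^esub>i\<in>{..<n}. (a j \<odot>\<^bsub>msec ?Rel ?W\<^esub> sg ?W j) i \<odot>\<^bsub>msec F0 ?W\<^esub> mres F0 U ?W (s i))
         = fr (\<Sum>i<n. f i \<diamondop> ((c j \<star> h) \<star> e j i)) (R \<star> (?Q \<star> h))"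
        using W1 ne subV preg[OF j] prod[OF j] QT h by (intro relsum) auto
      also have "(\<Sum>i<n. f i \<diamondop> ((c j \<star> h) \<star> e j i)) = (\<Sum>i<n. f i \<diamondop> e j i) \<diamondop> (c j \<star> h)"
      proof -
        have "c j \<in> B" "\<And>i. i < n \<Longrightarrow> e j i \<in> B" using c(1) e(1) j by auto
        then show ?thesis using h by (simp add: op_action_sum_left op_action_mult[symmetric] mult_comm)
      qed
      also have "(\<Sum>i<n. f i \<diamondop> e j i) = 0" using e(2) j by blast
      finally show ?thesis
        using preg[OF j] prod[OF j] W1 QT R h by (auto simp: fr_eq_zero_iff)
    qed
    have "(\<Oplus>\<^bsub>msec ?Rel ?W\<^esub>j\<in>{..<K}. a j \<odot>\<^bsub>msec ?Rel ?W\<^esub> sg ?W j)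
       = (\<lambda>i\<in>{..<n}. \<Oplus>\<^bsub>OX ?W\<^esub>j\<in>{..<K}. (a j \<odot>\<^bsub>msec ?Rel ?W\<^esub> sg ?W j) i)"
      by (rule finsum_relation_sheaf[OF M sW1 smem])
    also have "\<dots> = (\<lambda>i\<in>{..<n}. rres X W ?W (t i))"
    proof (intro restrict_ext)
      interpret M: Module.module "OX ?W" "msec F0 ?W" by (rule M)
      fix i assume "i \<in> {..<n}"
      then have i: "i < n" by simp
      have fQ: "fraction 0 (?Q \<star> h)" using QT h by (simp add: fraction_def)
      have "(\<Oplus>\<^bsub>OX ?W\<^esub>j\<in>{..<K}. (a j \<odot>\<^bsub>msec ?Rel ?W\<^esub> sg ?W j) i)
         = (\<Oplus>\<^bsub>OX ?W\<^esub>j\<in>{..<K}. sect ?W ((c j \<star> h) \<star> e j i) (?Q \<star> h))"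
        using preg prod i W1 by (intro M.R.finsum_cong') auto
      also have "\<dots> = sect ?W (\<Sum>j<K. (c j \<star> h) \<star> e j i) (?Q \<star> h)"
        by (rule finsum_OX[OF W1 _ fQ, THEN conjunct1]) (rule preg[OF _ i])
      also have "(\<Sum>j<K. (c j \<star> h) \<star> e j i) = (\<Sum>j<K. c j \<star> e j i) \<star> h"
      proof -
        have "(\<Sum>j<K. c j \<star> e j i) \<star> h = (\<Sum>j<K. c j \<star> e j i \<star> h)"
          by (induction K) (auto simp: op_mult_add_left)
        also have "\<dots> = (\<Sum>j<K. (c j \<star> h) \<star> e j i)"
        proof (intro sum.cong refl)
          fix j assume "j \<in> {..<K}"
          then have "e j i \<in> B" using e(1) i by auto
          then show "c j \<star> e j i \<star> h = (c j \<star> h) \<star> e j i"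
            using mult_comm[of "e j i" h] h(1) by (simp only: op_mult_assoc)
        qed
        finally show ?thesis by simp
      qed
      also have "\<dots> = (A i \<star> ?T) \<star> h" using c(2) i by simp
      also have "sect ?W ((A i \<star> ?T) \<star> h) (?Q \<star> h) = sect ?W (A i) Q"
      proof -
        have AB: "A i \<in> B" "?T \<in> B" using Q(4) i T(1) by auto
        have eq: "A i \<star> (?Q \<star> h) = ((A i \<star> ?T) \<star> h) \<star> Q"
        proof -
          have "A i \<star> ((Q \<star> ?T) \<star> h) = A i \<star> ((?T \<star> h) \<star> Q)"
            using mult_comm[OF QB mult_B[OF AB(2) h(1)]] by (simp only: op_mult_assoc)
          then show ?thesis by (simp only: op_mult_assoc)
        qed
        have f: "fraction ((A i \<star> ?T) \<star> h) (?Q \<star> h)" using AB QT h by (simp add: fraction_def)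
        have "regular_on ?W ((A i \<star> ?T) \<star> h) (?Q \<star> h)"
          by (rule regular_on_cong[OF Areg[OF i] f eq])
        then show ?thesis using sect_eqI[OF Areg[OF i] _ eq] by simp
      qed
      also have "\<dots> = rres X W ?W (t i)" using tW[OF i] by simp
      finally show "(\<Oplus>\<^bsub>OX ?W\<^esub>j\<in>{..<K}. (a j \<odot>\<^bsub>msec ?Rel ?W\<^esub> sg ?W j) i) = rres X W ?W (t i)" .
    qed
    also have "\<dots> = mres ?Rel W ?W t" by simp
    finally have eq: "mres ?Rel W ?W t = (\<Oplus>\<^bsub>msec ?Rel ?W\<^esub>j\<in>{..<K}. a j \<odot>\<^bsub>msec ?Rel ?W\<^esub> sg ?W j)" by simp
    have sgres: "mres ?Rel ?V ?W (sg ?V j) = sg ?W j" for j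
      using subV by (auto simp: sg_def intro!: restrict_ext)
    show "\<exists>W' a. is_open X W' \<and> y \<in> W' \<and> W' \<subseteq> W \<and> a \<in> {..<K} \<rightarrow> carrier (OX W') \<and>
      mres ?Rel W W' t = (\<Oplus>\<^bsub>msec ?Rel W'\<^esub>j\<in>{..<K}. a j \<odot>\<^bsub>msec ?Rel W'\<^esub> mres ?Rel ?V W' (sg ?V j))"
    proof (intro exI conjI)
      show "is_open X ?W" "y \<in> ?W" "?W \<subseteq> W" using W1 yW by simp_all
      show "a \<in> {..<K} \<rightarrow> carrier (OX ?W)" using W1 creg by (simp add: a_def)
      show "mres ?Rel W ?W t = (\<Oplus>\<^bsub>msec ?Rel ?W\<^esub>j\<in>{..<K}. a j \<odot>\<^bsub>msec ?Rel ?W\<^esub> mres ?Rel ?V ?W (sg ?V j))"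
        unfolding sgres by (rule eq)
    qed
  qed
  have "sg ?V \<in> {..<K} \<rightarrow> carrier (msec ?Rel ?V)" using sg V xV by blast
  then show "\<exists>V n s. is_open X V \<and> x \<in> V \<and> V \<subseteq> U \<and> s \<in> {..<n} \<rightarrow> carrier (msec ?Rel V) \<and>
        locally_generated_by X ?Rel V n s"
    using V xV lg by (intro exI[of _ ?V] exI[of _ K] exI[of _ "sg ?V"]) blast
qed

theorem F0_spectral_pair: "spectral_pair B F0 phi0"
  unfolding spectral_pair_def coherent_def
  using F0_sheaf F0_torsion_free F0_affine_iso F0_global_iso F0_finite_type F0_relations_finite_type by blast

end

lemma locally_generated_byD:
  assumes "locally_generated_by X F V n s" "is_open X W" "W \<subseteq> V" "t \<in> carrier (msec F W)" "y \<in> W"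
  shows "\<exists>W' a. is_open X W' \<and> y \<in> W' \<and> W' \<subseteq> W \<and> a \<in> {..<n} \<rightarrow> carrier (rsec X W') \<and>
     mres F W W' t = (\<Oplus>\<^bsub>msec F W'\<^esub>i\<in>{..<n}. a i \<odot>\<^bsub>msec F W'\<^esub> mres F V W' (s i))"
  using assms(1)[unfolded locally_generated_by_def, rule_format, OF conjI[OF assms(2) conjI[OF assms(3) conjI[OF assms(4,5)]]]] .

lemma minus_eq_zeroD:
  assumes "abelian_group M" "x \<in> carrier M" "y \<in> carrier M" "x \<ominus>\<^bsub>M\<^esub> y = \<zero>\<^bsub>M\<^esub>"
  shows "x = y"
proof -
  interpret abelian_group M by fact
  have "x = (x \<ominus>\<^bsub>M\<^esub> y) \<oplus>\<^bsub>M\<^esub> y" using assms(2,3) by (simp add: minus_eq a_assoc l_neg)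
  also have "\<dots> = y" unfolding assms(4) using assms(3) by simp
  finally show ?thesis .
qed

section \<open>Embedding a spectral sheaf into the fractions\<close>

locale spectral_sheaf = spectral B for B :: "diffop set" +
  fixes F :: "(spt, sfun, 'm) mod_presheaf" and \<phi> :: "'m \<Rightarrow> complex poly"
  assumes pair: "spectral_pair B F \<phi>"
begin

abbreviation Fs :: "spt set \<Rightarrow> 'm set" where "Fs U \<equiv> carrier (msec F U)"
abbreviation res :: "spt set \<Rightarrow> spt set \<Rightarrow> 'm \<Rightarrow> 'm" where "res \<equiv> mres F"

lemma sheaf: "module_sheaf X F"
  using pair by (simp add: spectral_pair_def)

lemma F_module: "is_open X U \<Longrightarrow> Module.module (OX U) (msec F U)"
  using sheaf by (simp add: module_sheaf_def)

lemma smult_closed: "is_open X U \<Longrightarrow> a \<in> carrier (OX U) \<Longrightarrow> s \<in> Fs U \<Longrightarrow> a \<odot>\<^bsub>msec F U\<^esub> s \<in> Fs U"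
  using Module.module.smult_closed[OF F_module] by blast

lemma sheaf_res:
  "\<forall>U V. is_open X U \<and> is_open X V \<and> V \<subseteq> U \<longrightarrow>
        res U V \<in> Fs U \<rightarrow> Fs V \<and>
        (\<forall>s\<in>Fs U. \<forall>t\<in>Fs U. res U V (s \<oplus>\<^bsub>msec F U\<^esub> t) = res U V s \<oplus>\<^bsub>msec F V\<^esub> res U V t) \<and>
        (\<forall>a\<in>carrier (OX U). \<forall>s\<in>Fs U. res U V (a \<odot>\<^bsub>msec F U\<^esub> s) = rres X U V a \<odot>\<^bsub>msec F V\<^esub> res U V s)"
  "\<forall>U. is_open X U \<longrightarrow> (\<forall>s\<in>Fs U. res U U s = s)"
  "\<forall>U V W. is_open X U \<and> is_open X V \<and> is_open X W \<and> W \<subseteq> V \<and> V \<subseteq> U \<longrightarrow>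
        (\<forall>s\<in>Fs U. res V W (res U V s) = res U W s)"
  by (insert sheaf, unfold module_sheaf_def, (elim conjE, assumption)+)

context
  fixes U V assumes UV: "is_open X U" "is_open X V" "V \<subseteq> U"
begin

lemma res_closed: "s \<in> Fs U \<Longrightarrow> res U V s \<in> Fs V"
  and res_add: "s \<in> Fs U \<Longrightarrow> t \<in> Fs U \<Longrightarrow> res U V (s \<oplus>\<^bsub>msec F U\<^esub> t) = res U V s \<oplus>\<^bsub>msec F V\<^esub> res U V t"
  and res_smult: "a \<in> carrier (OX U) \<Longrightarrow> s \<in> Fs U \<Longrightarrow>
    res U V (a \<odot>\<^bsub>msec F U\<^esub> s) = rres X U V a \<odot>\<^bsub>msec F V\<^esub> res U V s"
proof -
  note * = sheaf_res(1)[rule_format, OF conjI[OF UV(1) conjI[OF UV(2,3)]]]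
  show "s \<in> Fs U \<Longrightarrow> res U V s \<in> Fs V" using * by (elim conjE) (rule funcset_mem)
  show "s \<in> Fs U \<Longrightarrow> t \<in> Fs U \<Longrightarrow> res U V (s \<oplus>\<^bsub>msec F U\<^esub> t) = res U V s \<oplus>\<^bsub>msec F V\<^esub> res U V t"
    using * by (elim conjE) simp
  show "a \<in> carrier (OX U) \<Longrightarrow> s \<in> Fs U \<Longrightarrow>
    res U V (a \<odot>\<^bsub>msec F U\<^esub> s) = rres X U V a \<odot>\<^bsub>msec F V\<^esub> res U V s"
    using * by (elim conjE) simp
qed

lemma res_smult_sect:
  "regular_on U A Q \<Longrightarrow> s \<in> Fs U \<Longrightarrow>
    res U V (sect U A Q \<odot>\<^bsub>msec F U\<^esub> s) = sect V A Q \<odot>\<^bsub>msec F V\<^esub> res U V s"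
  using res_smult[OF sect_closed[OF UV(1)]] UV(3) by simp

lemma res_zero: "res U V \<zero>\<^bsub>msec F U\<^esub> = \<zero>\<^bsub>msec F V\<^esub>"
proof -
  interpret U: Module.module "OX U" "msec F U" by (rule F_module[OF UV(1)])
  interpret V: Module.module "OX V" "msec F V" by (rule F_module[OF UV(2)])
  have "res U V \<zero>\<^bsub>msec F U\<^esub> = res U V \<zero>\<^bsub>msec F U\<^esub> \<oplus>\<^bsub>msec F V\<^esub> res U V \<zero>\<^bsub>msec F U\<^esub>"
    using res_add[OF U.M.zero_closed U.M.zero_closed] by simp
  then show ?thesis using res_closed[OF U.M.zero_closed] by (metis V.M.add.r_cancel_one')
qed

lemma res_minus:
  assumes "s \<in> Fs U" "t \<in> Fs U"
  shows "res U V (s \<ominus>\<^bsub>msec F U\<^esub> t) = res U V s \<ominus>\<^bsub>msec F V\<^esub> res U V t"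
proof -
  interpret U: Module.module "OX U" "msec F U" by (rule F_module[OF UV(1)])
  interpret V: Module.module "OX V" "msec F V" by (rule F_module[OF UV(2)])
  have "res U V (\<ominus>\<^bsub>msec F U\<^esub> t) \<oplus>\<^bsub>msec F V\<^esub> res U V t = \<zero>\<^bsub>msec F V\<^esub>"
    using res_add[of "\<ominus>\<^bsub>msec F U\<^esub> t" t] assms res_zero by (simp add: U.M.l_neg)
  then have "\<ominus>\<^bsub>msec F V\<^esub> res U V t = res U V (\<ominus>\<^bsub>msec F U\<^esub> t)"
    using res_closed assms by (intro V.M.minus_equality) auto
  then show ?thesis using res_add[of s "\<ominus>\<^bsub>msec F U\<^esub> t"] assms by (simp add: U.M.minus_eq V.M.minus_eq)
qed

lemma res_finsum:
  assumes "\<And>i. i < n \<Longrightarrow> s i \<in> Fs U"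
  shows "res U V (\<Oplus>\<^bsub>msec F U\<^esub>i\<in>{..<n::nat}. s i) = (\<Oplus>\<^bsub>msec F V\<^esub>i\<in>{..<n}. res U V (s i))"
  using assms
proof (induction n)
  interpret U: Module.module "OX U" "msec F U" by (rule F_module[OF UV(1)])
  interpret V: Module.module "OX V" "msec F V" by (rule F_module[OF UV(2)])
  case 0
  then show ?case using res_zero by (simp add: U.M.finsum_empty V.M.finsum_empty)
next
  interpret U: Module.module "OX U" "msec F U" by (rule F_module[OF UV(1)])
  interpret V: Module.module "OX V" "msec F V" by (rule F_module[OF UV(2)])
  case (Suc n)
  have "finsum (msec F U) s {..<Suc n} = s n \<oplus>\<^bsub>msec F U\<^esub> finsum (msec F U) s {..<n}"
    using Suc.prems by (intro finsum_lessThan_Suc U.M.abelian_monoid_axioms) auto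
  moreover have "finsum (msec F V) (\<lambda>i. res U V (s i)) {..<Suc n} = res U V (s n) \<oplus>\<^bsub>msec F V\<^esub> finsum (msec F V) (\<lambda>i. res U V (s i)) {..<n}"
    using Suc.prems res_closed by (intro finsum_lessThan_Suc V.M.abelian_monoid_axioms) auto
  moreover have "finsum (msec F U) s {..<n} \<in> Fs U" using Suc.prems by (intro U.M.finsum_closed) auto
  ultimately show ?case using Suc res_add by simp
qed

end

lemma res_comp:
  "is_open X U \<Longrightarrow> is_open X V \<Longrightarrow> is_open X W \<Longrightarrow> W \<subseteq> V \<Longrightarrow> V \<subseteq> U \<Longrightarrow> s \<in> Fs U \<Longrightarrow> res V W (res U V s) = res U W s"
  using sheaf_res(3) by simp

lemma res_id: "is_open X U \<Longrightarrow> s \<in> Fs U \<Longrightarrow> res U U s = s"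
  using sheaf_res(2) by simp

lemma locality:
  assumes "\<And>V. V \<in> \<U> \<Longrightarrow> is_open X V" "s \<in> Fs (\<Union>\<U>)" "t \<in> Fs (\<Union>\<U>)"
    "\<And>V. V \<in> \<U> \<Longrightarrow> res (\<Union>\<U>) V s = res (\<Union>\<U>) V t"
  shows "s = t"
proof -
  have "\<forall>\<U>. (\<forall>U\<in>\<U>. is_open X U) \<longrightarrow> (\<forall>s\<in>Fs (\<Union>\<U>). \<forall>t\<in>Fs (\<Union>\<U>). (\<forall>U\<in>\<U>. res (\<Union>\<U>) U s = res (\<Union>\<U>) U t) \<longrightarrow> s = t)"
    using sheaf unfolding module_sheaf_def by (elim conjE) assumption
  from this[rule_format, of \<U> s t] show ?thesis using assms by simp
qed

lemma gluing:
  assumes "\<And>V. V \<in> \<U> \<Longrightarrow> is_open X V" "\<And>V. V \<in> \<U> \<Longrightarrow> s V \<in> Fs V"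
    "\<And>V W. V \<in> \<U> \<Longrightarrow> W \<in> \<U> \<Longrightarrow> res V (V \<inter> W) (s V) = res W (V \<inter> W) (s W)"
  shows "\<exists>t\<in>Fs (\<Union>\<U>). \<forall>V\<in>\<U>. res (\<Union>\<U>) V t = s V"
proof -
  have "\<forall>\<U> s. (\<forall>U\<in>\<U>. is_open X U \<and> s U \<in> Fs U) \<and>
        (\<forall>U\<in>\<U>. \<forall>V\<in>\<U>. res U (U \<inter> V) (s U) = res V (U \<inter> V) (s V)) \<longrightarrow>
        (\<exists>t\<in>Fs (\<Union>\<U>). \<forall>U\<in>\<U>. res (\<Union>\<U>) U t = s U)"
    using sheaf unfolding module_sheaf_def by (elim conjE) assumption
  from spec[OF spec[OF this, of \<U>], of s]
  show ?thesis
    by (rule mp) (intro conjI ballI assms; assumption)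
qed

text \<open>Locality for the empty cover of the empty set.\<close>

lemma empty_unique: "s \<in> Fs {} \<Longrightarrow> t \<in> Fs {} \<Longrightarrow> s = t"
  using locality[of "{}" s t] by simp

lemma torsion:
  assumes "is_open X U" "a \<in> carrier (OX U)" "s \<in> Fs U" "a \<odot>\<^bsub>msec F U\<^esub> s = \<zero>\<^bsub>msec F U\<^esub>"
  shows "a = \<zero>\<^bsub>OX U\<^esub> \<or> s = \<zero>\<^bsub>msec F U\<^esub>"
  using pair assms unfolding spectral_pair_def torsion_free_def by blast

lemma finite_type:
  assumes "x \<in> pts"
  obtains V n s where "is_open X V" "x \<in> V" "\<forall>i<n. s i \<in> Fs V" "locally_generated_by X F V n s"
proof -
  have "finite_type_on X F (whole X)" using pair by (simp add: spectral_pair_def coherent_def)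
  then have "\<exists>V n s. is_open X V \<and> x \<in> V \<and> V \<subseteq> whole X \<and> s \<in> {..<n} \<rightarrow> Fs V \<and> locally_generated_by X F V n s"
    using assms unfolding finite_type_on_def by simp
  then obtain V n s where "is_open X V \<and> x \<in> V \<and> V \<subseteq> whole X \<and> s \<in> {..<n} \<rightarrow> Fs V \<and> locally_generated_by X F V n s"
    by (elim exE)
  then show thesis by (intro that[of V n s]) auto
qed

lemma relations_finite_type:
  assumes "is_open X U" "s \<in> {..<n} \<rightarrow> Fs U"
  shows "finite_type_on X (relation_sheaf X F U n s) U"
  using pair assms unfolding spectral_pair_def coherent_def by blast

text \<open>The annihilator of a section \<open>s\<close> is the sheaf of relations of the family consisting of \<open>s\<close>
  alone, hence of finite type. If \<open>s\<close> vanishes on a nonempty open set, the annihilator is nonzero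
  there, so near every point some nonzero section annihilates \<open>s\<close>.\<close>

lemma res_eq_zeroD:
  assumes UV: "is_open X U" "is_open X V" "V \<subseteq> U" "V \<noteq> {}" and s: "s \<in> Fs U" and z: "res U V s = \<zero>\<^bsub>msec F V\<^esub>"
  shows "s = \<zero>\<^bsub>msec F U\<^esub>"
proof -
  let ?Rel = "relation_sheaf X F U (1::nat) (\<lambda>_. s)"
  interpret U: Module.module "OX U" "msec F U" by (rule F_module[OF UV(1)])
  have near: "\<exists>W. is_open X W \<and> x \<in> W \<and> W \<subseteq> U \<and> res U W s = \<zero>\<^bsub>msec F W\<^esub>" if x: "x \<in> U" for x
  proof -
    have ft: "finite_type_on X ?Rel U" using relations_finite_type[of U "\<lambda>_. s" 1] UV(1) s by simp
    then obtain W n a where *: "is_open X W \<and> x \<in> W \<and> W \<subseteq> U \<and> a \<in> {..<n} \<rightarrow> carrier (msec ?Rel W) \<and>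
        locally_generated_by X ?Rel W n a"
      using x unfolding finite_type_on_def by metis
    then have W: "is_open X W" "x \<in> W" "W \<subseteq> U" and a: "\<And>i. i < n \<Longrightarrow> a i \<in> carrier (msec ?Rel W)"
      and gen: "locally_generated_by X ?Rel W n a" by auto
    interpret W: Module.module "OX W" "msec F W" by (rule F_module[OF W(1)])
    have sW: "res U W s \<in> Fs W" using res_closed[OF UV(1) W(1,3) s] .
    have one: "{..<1::nat} = {0}" by auto
    have a0: "a i 0 \<in> carrier (OX W)" "a i 0 \<odot>\<^bsub>msec F W\<^esub> res U W s = \<zero>\<^bsub>msec F W\<^esub>" if "i < n" for i
    proof -
      have ai: "a i \<in> {..<1} \<rightarrow>\<^sub>E carrier (OX W)" 
        "(\<Oplus>\<^bsub>msec F W\<^esub>k\<in>{..<1}. a i k \<odot>\<^bsub>msec F W\<^esub> res U W s) = \<zero>\<^bsub>msec F W\<^esub>"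
        using a[OF that] by auto
      show "a i 0 \<in> carrier (OX W)" using ai(1) by auto
      then have "(\<Oplus>\<^bsub>msec F W\<^esub>k\<in>{..<1}. a i k \<odot>\<^bsub>msec F W\<^esub> res U W s) = a i 0 \<odot>\<^bsub>msec F W\<^esub> res U W s"
        unfolding one using sW W.M.finsum_insert[of "{}" 0 "\<lambda>k. a i k \<odot>\<^bsub>msec F W\<^esub> res U W s"] by simp
      then show "a i 0 \<odot>\<^bsub>msec F W\<^esub> res U W s = \<zero>\<^bsub>msec F W\<^esub>" using ai(2) by simp
    qed
    show ?thesis
    proof (cases "\<exists>i<n. a i 0 \<noteq> \<zero>\<^bsub>OX W\<^esub>")
      case True
      then have "res U W s = \<zero>\<^bsub>msec F W\<^esub>" using torsion[OF W(1) a0(1) sW a0(2)] by blast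
      then show ?thesis using W by blast
    next
      case False
      let ?V = "V \<inter> W"
      have V': "is_open X ?V" using UV W by (intro openin_Int)
      have ne: "?V \<noteq> {}" using open_Int_nonempty[OF UV(2) W(1) UV(4)] W(2) by blast
      interpret V': Module.module "OX ?V" "msec F ?V" by (rule F_module[OF V'])
      have zV: "res U ?V s = \<zero>\<^bsub>msec F ?V\<^esub>"
      proof -
        have "res V ?V (res U V s) = res U ?V s" using res_comp UV V' s by auto
        then show ?thesis using z res_zero[OF UV(2) V'] by simp
      qed
      \<comment> \<open>All generators of the annihilator vanish in this case. But s is zero on V
        \<inter> W, so the unit function is a relation there; expressing it by the generators near
        the generic point would give 1 = 0.\<close>
      define t where "t = (\<lambda>i\<in>{..<1::nat}. \<one>\<^bsub>OX ?V\<^esub>)"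
      have "(\<Oplus>\<^bsub>msec F ?V\<^esub>k\<in>{..<1}. t k \<odot>\<^bsub>msec F ?V\<^esub> res U ?V s) = \<zero>\<^bsub>msec F ?V\<^esub>"
        unfolding one t_def zV using V'.M.finsum_insert[of "{}" "0::nat" "\<lambda>k. \<zero>\<^bsub>msec F ?V\<^esub>"]
        by (simp add: V'.M.finsum_empty)
      then have t: "t \<in> carrier (msec ?Rel ?V)" unfolding t_def by simp
      have g: "generic_pt \<in> ?V" using generic_pt_open[OF V' ne] .
      obtain W' c where W'c: "is_open X W' \<and> generic_pt \<in> W' \<and> W' \<subseteq> ?V \<and> c \<in> {..<n} \<rightarrow> carrier (OX W') \<and>
          mres ?Rel ?V W' t = (\<Oplus>\<^bsub>msec ?Rel W'\<^esub>i\<in>{..<n}. c i \<odot>\<^bsub>msec ?Rel W'\<^esub> mres ?Rel W W' (a i))"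
        using locally_generated_byD[OF gen V' Int_lower2 t g] by (elim exE)
      then have W': "is_open X W'" "generic_pt \<in> W'" "W' \<subseteq> ?V" and c: "\<And>i. i < n \<Longrightarrow> c i \<in> carrier (OX W')"
        and eq: "mres ?Rel ?V W' t = (\<Oplus>\<^bsub>msec ?Rel W'\<^esub>i\<in>{..<n}. c i \<odot>\<^bsub>msec ?Rel W'\<^esub> mres ?Rel W W' (a i))" by auto
      interpret W': Module.module "OX W'" "msec F W'" by (rule F_module[OF W'(1)])
      have sW': "res U W' s \<in> Fs W'" using res_closed[OF UV(1) W'(1) _ s] W' W by blast
      interpret N: abelian_monoid "msec ?Rel W'"
        by (rule relation_sheaf_abelian_monoid[OF F_module[OF W'(1)] sW'])
      have rz: "rres X W W' \<zero>\<^bsub>OX W\<^esub> = \<zero>\<^bsub>OX W'\<^esub>"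
        using W' W(1) by (simp add: sect_zero)
      have term0: "c i \<odot>\<^bsub>msec ?Rel W'\<^esub> mres ?Rel W W' (a i) = \<zero>\<^bsub>msec ?Rel W'\<^esub>" if "i < n" for i
        using False that c[OF that] rz by (auto intro!: restrict_ext)
      have "(\<Oplus>\<^bsub>msec ?Rel W'\<^esub>i\<in>{..<n}. c i \<odot>\<^bsub>msec ?Rel W'\<^esub> mres ?Rel W W' (a i)) = (\<Oplus>\<^bsub>msec ?Rel W'\<^esub>i\<in>{..<n}. \<zero>\<^bsub>msec ?Rel W'\<^esub>)"
        by (intro N.finsum_cong' refl Pi_I N.zero_closed term0) simp
      also have "\<dots> = \<zero>\<^bsub>msec ?Rel W'\<^esub>" by (rule N.finsum_zero)
      finally have "mres ?Rel ?V W' t = \<zero>\<^bsub>msec ?Rel W'\<^esub>" unfolding eq .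
      then have "rres X ?V W' \<one>\<^bsub>OX ?V\<^esub> = \<zero>\<^bsub>OX W'\<^esub>"
        unfolding t_def by (auto dest!: fun_cong[of _ _ "0::nat"])
      then have "sect W' 1 1 = sect W' 0 1" using W' V' by (simp add: sect_zero sect_one)
      then have "(1::diffop) \<star> 1 = 0 \<star> 1"
        using W' open_subset_pts[OF W'(1)] by (intro sect_eqD[of W'] regular_on_const) auto
      then show ?thesis by simp
    qed
  qed
  \<comment> \<open>The sets on which s vanishes cover U, and locality finishes the
    argument.\<close>
  define \<U> where "\<U> = {W. is_open X W \<and> W \<subseteq> U \<and> res U W s = \<zero>\<^bsub>msec F W\<^esub>}"
  have Un: "\<Union>\<U> = U" using near by (fastforce simp: \<U>_def)
  show ?thesis
  proof (rule locality[of \<U>, unfolded Un])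
    show "res U W s = res U W \<zero>\<^bsub>msec F U\<^esub>" if "W \<in> \<U>" for W
      using that res_zero[OF UV(1)] by (simp add: \<U>_def)
  qed (use s in \<open>auto simp: \<U>_def\<close>)
qed

lemma res_inj:
  assumes UV: "is_open X U" "is_open X V" "V \<subseteq> U" "V \<noteq> {}" and s: "s \<in> Fs U" "t \<in> Fs U" and eq: "res U V s = res U V t"
  shows "s = t"
proof -
  interpret U: Module.module "OX U" "msec F U" by (rule F_module[OF UV(1)])
  interpret V: Module.module "OX V" "msec F V" by (rule F_module[OF UV(2)])
  have "res U V (s \<ominus>\<^bsub>msec F U\<^esub> t) = \<zero>\<^bsub>msec F V\<^esub>"
    using res_minus[OF UV(1-3) s] eq res_closed[OF UV(1-3) s(2)] by (simp add: V.M.minus_eq V.M.r_neg)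
  then have "s \<ominus>\<^bsub>msec F U\<^esub> t = \<zero>\<^bsub>msec F U\<^esub>"
    using res_eq_zeroD[OF UV] s by simp
  then show ?thesis using minus_eq_zeroD[OF U.M.abelian_group_axioms s] by simp
qed

lemma torsion_cancel:
  assumes U: "is_open X U" "U \<noteq> {}" "U \<subseteq> X0" and Q: "Q \<in> B" "Q \<noteq> 0" and s: "s \<in> Fs U" "t \<in> Fs U"
    and eq: "sect U Q 1 \<odot>\<^bsub>msec F U\<^esub> s = sect U Q 1 \<odot>\<^bsub>msec F U\<^esub> t"
  shows "s = t"
proof -
  interpret U: Module.module "OX U" "msec F U" by (rule F_module[OF U(1)])
  have r: "regular_on U Q 1" "regular_on U 0 1" using regular_on_X0[OF U(3)] Q by auto
  have c: "sect U Q 1 \<in> carrier (OX U)" using r U by simp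
  have "sect U Q 1 \<odot>\<^bsub>msec F U\<^esub> (s \<ominus>\<^bsub>msec F U\<^esub> t) = sect U Q 1 \<odot>\<^bsub>msec F U\<^esub> s \<ominus>\<^bsub>msec F U\<^esub> sect U Q 1 \<odot>\<^bsub>msec F U\<^esub> t"
    using c s by (simp add: U.M.minus_eq U.smult_r_distr U.smult_r_minus)
  also have "\<dots> = \<zero>\<^bsub>msec F U\<^esub>" using eq U.smult_closed[OF c s(2)] by (simp add: U.M.minus_eq U.M.r_neg)
  finally have "sect U Q 1 = \<zero>\<^bsub>OX U\<^esub> \<or> s \<ominus>\<^bsub>msec F U\<^esub> t = \<zero>\<^bsub>msec F U\<^esub>"
    using torsion[OF U(1) c] s by simp
  moreover have "sect U Q 1 \<noteq> \<zero>\<^bsub>OX U\<^esub>"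
    using sect_eqD[OF U(1,2) r] Q by (auto simp: sect_zero U)
  ultimately show ?thesis using minus_eq_zeroD[OF U.M.abelian_group_axioms s] by simp
qed

text \<open>Local generation with explicit coefficients: all of them over one denominator that does
  not vanish at y, so that it can be cleared at once.\<close>

lemma local_combination:
  assumes V: "is_open X V" "\<forall>i<n. \<sigma> i \<in> Fs V" "locally_generated_by X F V n \<sigma>"
    and U: "is_open X U" "s \<in> Fs U" and y: "y \<in> U" "y \<in> V"
  obtains m Q A W where "is_open X W" "y \<in> W" "W \<subseteq> U \<inter> V" "W \<subseteq> basic m Q" "Q \<in> filt B m" "Q \<noteq> 0"
    "tmon Q m \<notin> y" "\<forall>i<(n::nat). A i \<in> filt B m"
    "res U W s = (\<Oplus>\<^bsub>msec F W\<^esub>i\<in>{..<n}. sect W (A i) Q \<odot>\<^bsub>msec F W\<^esub> res V W (\<sigma> i))"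
proof -
  let ?W = "U \<inter> V"
  have W: "is_open X ?W" "?W \<subseteq> U" "?W \<subseteq> V" "y \<in> ?W" using U V y by auto
  obtain W' a where W'a: "is_open X W' \<and> y \<in> W' \<and> W' \<subseteq> ?W \<and> a \<in> {..<n} \<rightarrow> carrier (OX W') \<and>
      res ?W W' (res U ?W s) = (\<Oplus>\<^bsub>msec F W'\<^esub>i\<in>{..<n}. a i \<odot>\<^bsub>msec F W'\<^esub> res V W' (\<sigma> i))"
    using locally_generated_byD[OF V(3) W(1,3) res_closed[OF U(1) W(1,2) U(2)] W(4)] by (elim exE)
  then have W': "is_open X W'" "y \<in> W'" "W' \<subseteq> ?W" and a: "\<And>i. i < n \<Longrightarrow> a i \<in> carrier (OX W')"
    and eq: "res U W' s = (\<Oplus>\<^bsub>msec F W'\<^esub>i\<in>{..<n}. a i \<odot>\<^bsub>msec F W'\<^esub> res V W' (\<sigma> i))"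
    using res_comp[OF U(1) W(1) _ _ W(2) U(2)] by auto
  obtain m Q A where Q: "Q \<in> filt B m" "tmon Q m \<notin> y" "Q \<noteq> 0" "\<forall>i<n. A i \<in> filt B m"
    and aA: "\<forall>i<n. \<forall>W'' \<subseteq> W' \<inter> basic m Q. rres X W' W'' (a i) = sect W'' (A i) Q"
    by (rule sections_common_local[OF W'(1,2) a])
  let ?Y = "W' \<inter> basic m Q"
  have Y: "is_open X ?Y" "?Y \<subseteq> W'" using W' Q by auto
  have yY: "y \<in> ?Y" using W' Q open_subset_pts[OF W'(1)] by (auto simp: basic_def)
  interpret Y: Module.module "OX ?Y" "msec F ?Y" by (rule F_module[OF Y(1)])
  have sig: "res V W' (\<sigma> i) \<in> Fs W'" if "i < n" for i
    using res_closed[OF V(1) W'(1)] V(2) that W' by auto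
  have sigY: "res W' ?Y (res V W' (\<sigma> i)) = res V ?Y (\<sigma> i)" "res V ?Y (\<sigma> i) \<in> Fs ?Y" if "i < n" for i
  proof -
    have "\<sigma> i \<in> Fs V" using V(2) that by blast
    then show "res W' ?Y (res V W' (\<sigma> i)) = res V ?Y (\<sigma> i)" "res V ?Y (\<sigma> i) \<in> Fs ?Y"
      using res_comp[OF V(1) W'(1) Y(1) Y(2)] res_closed[OF V(1) Y(1)] W' Y(2) by auto
  qed
  have "res U ?Y s = res W' ?Y (res U W' s)"
    using res_comp[OF U(1) W'(1) Y(1) Y(2) _ U(2)] W' by auto
  also have "\<dots> = (\<Oplus>\<^bsub>msec F ?Y\<^esub>i\<in>{..<n}. res W' ?Y (a i \<odot>\<^bsub>msec F W'\<^esub> res V W' (\<sigma> i)))"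
    unfolding eq by (intro res_finsum[OF W'(1) Y] smult_closed[OF W'(1)] a sig)
  also have "\<dots> = (\<Oplus>\<^bsub>msec F ?Y\<^esub>i\<in>{..<n}. sect ?Y (A i) Q \<odot>\<^bsub>msec F ?Y\<^esub> res V ?Y (\<sigma> i))"
  proof (intro Y.M.finsum_cong' refl)
    have reg: "regular_on ?Y (A i) Q" if "i < n" for i
      using Q that by (intro regular_on_basic[of _ m]) auto
    show "(\<lambda>i. sect ?Y (A i) Q \<odot>\<^bsub>msec F ?Y\<^esub> res V ?Y (\<sigma> i)) \<in> {..<n} \<rightarrow> Fs ?Y"
      using reg sigY(2) Y(1) by (intro Pi_I Y.smult_closed sect_closed) auto
    fix i assume "i \<in> {..<n}"
    then have i: "i < n" by simp
    have "rres X W' ?Y (a i) = sect ?Y (A i) Q" using aA i by blast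
    then show "res W' ?Y (a i \<odot>\<^bsub>msec F W'\<^esub> res V W' (\<sigma> i)) = sect ?Y (A i) Q \<odot>\<^bsub>msec F ?Y\<^esub> res V ?Y (\<sigma> i)"
      using res_smult[OF W'(1) Y a[OF i] sig[OF i]] sigY(1)[OF i] by simp
  qed
  finally show thesis using Y(1) yY W' Q by (intro that[of ?Y m Q A]) auto
qed

lemma sect_smult_smult:
  assumes "is_open X U" "regular_on U A Q" "regular_on U A' Q'" "s \<in> Fs U"
  shows "sect U A Q \<odot>\<^bsub>msec F U\<^esub> (sect U A' Q' \<odot>\<^bsub>msec F U\<^esub> s) = sect U (A \<star> A') (Q \<star> Q') \<odot>\<^bsub>msec F U\<^esub> s"
proof -
  interpret U: Module.module "OX U" "msec F U" by (rule F_module[OF assms(1)])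
  show ?thesis using U.smult_assoc1[of "sect U A Q" "sect U A' Q'" s] assms by simp
qed

lemma alg_smult_comm:
  assumes "is_open X U" "U \<subseteq> X0" "P \<in> B" "Q \<in> B" "s \<in> Fs U"
  shows "sect U P 1 \<odot>\<^bsub>msec F U\<^esub> (sect U Q 1 \<odot>\<^bsub>msec F U\<^esub> s) = sect U (P \<star> Q) 1 \<odot>\<^bsub>msec F U\<^esub> s"
    "sect U P 1 \<odot>\<^bsub>msec F U\<^esub> (sect U Q 1 \<odot>\<^bsub>msec F U\<^esub> s) = sect U Q 1 \<odot>\<^bsub>msec F U\<^esub> (sect U P 1 \<odot>\<^bsub>msec F U\<^esub> s)"
  using sect_smult_smult[OF assms(1) regular_on_X0[OF assms(2)] regular_on_X0[OF assms(2)], of P Q s]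
    sect_smult_smult[OF assms(1) regular_on_X0[OF assms(2)] regular_on_X0[OF assms(2)], of Q P s]
    assms mult_comm[of P Q] by simp_all

lemma clear_denominator:
  assumes W: "is_open X W" "W \<subseteq> X0" and Q: "Q \<in> B" "Q \<noteq> 0"
    and A: "\<And>i. i < (n::nat) \<Longrightarrow> regular_on W (A i) Q" and s: "\<And>i. i < n \<Longrightarrow> s i \<in> Fs W"
  shows "sect W Q 1 \<odot>\<^bsub>msec F W\<^esub> (\<Oplus>\<^bsub>msec F W\<^esub>i\<in>{..<n}. sect W (A i) Q \<odot>\<^bsub>msec F W\<^esub> s i) =
    (\<Oplus>\<^bsub>msec F W\<^esub>i\<in>{..<n}. sect W (A i) 1 \<odot>\<^bsub>msec F W\<^esub> s i)"
proof -
  interpret W: Module.module "OX W" "msec F W" by (rule F_module[OF W(1)])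
  have rQ: "regular_on W Q 1" by (rule regular_on_X0[OF W(2) Q(1)])
  have AB: "A i \<in> B" if "i < n" for i using A[OF that] by (simp add: regular_on_def fraction_def)
  have cl: "(\<lambda>i. sect W (A i) Q \<odot>\<^bsub>msec F W\<^esub> s i) \<in> {..<n} \<rightarrow> Fs W"
    using A s W(1) by (intro Pi_I W.smult_closed sect_closed) auto
  have "sect W Q 1 \<odot>\<^bsub>msec F W\<^esub> (\<Oplus>\<^bsub>msec F W\<^esub>i\<in>{..<n}. sect W (A i) Q \<odot>\<^bsub>msec F W\<^esub> s i) =
     (\<Oplus>\<^bsub>msec F W\<^esub>i\<in>{..<n}. sect W Q 1 \<odot>\<^bsub>msec F W\<^esub> (sect W (A i) Q \<odot>\<^bsub>msec F W\<^esub> s i))"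
    using rQ W(1) cl by (intro W.finsum_smult_ldistr) auto
  also have "\<dots> = (\<Oplus>\<^bsub>msec F W\<^esub>i\<in>{..<n}. sect W (A i) 1 \<odot>\<^bsub>msec F W\<^esub> s i)"
  proof (intro W.M.finsum_cong' refl)
    show "(\<lambda>i. sect W (A i) 1 \<odot>\<^bsub>msec F W\<^esub> s i) \<in> {..<n} \<rightarrow> Fs W"
      using regular_on_X0[OF W(2) AB] s W(1) by (intro Pi_I W.smult_closed sect_closed) auto
    fix i assume "i \<in> {..<n}"
    then have i: "i < n" by simp
    have "sect W Q 1 \<odot>\<^bsub>msec F W\<^esub> (sect W (A i) Q \<odot>\<^bsub>msec F W\<^esub> s i) = sect W (Q \<star> A i) (1 \<star> Q) \<odot>\<^bsub>msec F W\<^esub> s i"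
      by (rule sect_smult_smult[OF W(1) rQ A[OF i] s[OF i]])
    also have "sect W (Q \<star> A i) (1 \<star> Q) = sect W (A i) 1"
      using regular_on_mult[OF _ rQ A[OF i]] regular_on_X0[OF W(2) AB[OF i]] open_subset_pts[OF W(1)] AB[OF i] Q
      by (intro sect_eqI) (auto simp: mult_comm)
    finally show "sect W Q 1 \<odot>\<^bsub>msec F W\<^esub> (sect W (A i) Q \<odot>\<^bsub>msec F W\<^esub> s i) = sect W (A i) 1 \<odot>\<^bsub>msec F W\<^esub> s i" .
  qed
  finally show ?thesis .
qed

definition pre :: "complex poly \<Rightarrow> 'm" where
  "pre f = inv_into (Fs X0) \<phi> f"

abbreviation alg_act :: "spt set \<Rightarrow> diffop \<Rightarrow> 'm \<Rightarrow> 'm" where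
  "alg_act U P s \<equiv> sect U P 1 \<odot>\<^bsub>msec F U\<^esub> s"

lemma phi_iso:
  "bij_betw \<phi> (Fs X0) UNIV"
  "s \<in> Fs X0 \<Longrightarrow> t \<in> Fs X0 \<Longrightarrow> \<phi> (s \<oplus>\<^bsub>msec F X0\<^esub> t) = \<phi> s + \<phi> t"
  "P \<in> B \<Longrightarrow> s \<in> Fs X0 \<Longrightarrow> \<phi> (alg_act X0 P s) = \<phi> s \<diamondop> P"
proof -
  have *: "mod_iso (alg_ring B) (sections_on_affine B F) spectral_module \<phi>"
    using pair by (simp add: spectral_pair_def)
  show "bij_betw \<phi> (Fs X0) UNIV"
    using * by (simp add: mod_iso_def sections_on_affine_def restrict_scalars_def spectral_module_def)
  show "s \<in> Fs X0 \<Longrightarrow> t \<in> Fs X0 \<Longrightarrow> \<phi> (s \<oplus>\<^bsub>msec F X0\<^esub> t) = \<phi> s + \<phi> t"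
    using * by (simp add: mod_iso_def sections_on_affine_def restrict_scalars_def spectral_module_def)
  show "P \<in> B \<Longrightarrow> s \<in> Fs X0 \<Longrightarrow> \<phi> (alg_act X0 P s) = \<phi> s \<diamondop> P"
    using * alg_section_eq
    by (simp add: mod_iso_def sections_on_affine_def restrict_scalars_def spectral_module_def diffop_ring_def)
qed

lemma pre_closed [simp]: "pre f \<in> Fs X0" and phi_pre [simp]: "\<phi> (pre f) = f"
  using phi_iso(1) unfolding pre_def bij_betw_def by (metis UNIV_I inv_into_into, metis UNIV_I f_inv_into_f)

lemma pre_phi: "s \<in> Fs X0 \<Longrightarrow> pre (\<phi> s) = s"
  using phi_iso(1) unfolding pre_def bij_betw_def by (metis inv_into_f_f)

lemma pre_eqI: "s \<in> Fs X0 \<Longrightarrow> \<phi> s = f \<Longrightarrow> pre f = s"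
  using pre_phi by blast

lemma alg_act_closed: "is_open X U \<Longrightarrow> U \<subseteq> X0 \<Longrightarrow> P \<in> B \<Longrightarrow> s \<in> Fs U \<Longrightarrow> alg_act U P s \<in> Fs U"
  using regular_on_X0 by (intro smult_closed) auto

lemma pre_act: "P \<in> B \<Longrightarrow> pre (f \<diamondop> P) = alg_act X0 P (pre f)"
  by (rule pre_eqI) (simp_all add: phi_iso(3) alg_act_closed)

lemma pre_add: "pre (f + g) = pre f \<oplus>\<^bsub>msec F X0\<^esub> pre g"
proof -
  interpret X0: Module.module "OX X0" "msec F X0" by (rule F_module) simp
  show ?thesis by (rule pre_eqI) (simp_all add: phi_iso(2))
qed

lemma res_alg_act:
  "is_open X U \<Longrightarrow> is_open X V \<Longrightarrow> V \<subseteq> U \<Longrightarrow> U \<subseteq> X0 \<Longrightarrow> P \<in> B \<Longrightarrow> s \<in> Fs U \<Longrightarrow>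
    res U V (alg_act U P s) = alg_act V P (res U V s)"
  using regular_on_X0 by (intro res_smult_sect) auto

lemma glue2:
  assumes V: "is_open X V" "is_open X W" and s: "s \<in> Fs V" "t \<in> Fs W" and eq: "res V (V \<inter> W) s = res W (V \<inter> W) t"
  obtains u where "u \<in> Fs (V \<union> W)" "res (V \<union> W) V u = s" "res (V \<union> W) W u = t"
\<comment> \<open>Gluing takes a family indexed by open sets, so two sections over the same set have
  to be treated apart.\<close>
proof (cases "V = W")
  case True
  then have "s = t" using eq s V res_id by simp
  then show thesis using that[of s] True s V res_id by simp
next
  case False
  let ?s = "\<lambda>Y. if Y = V then s else t"
  have compat: "res Y (Y \<inter> Z) (?s Y) = res Z (Y \<inter> Z) (?s Z)" if "Y \<in> {V, W}" "Z \<in> {V, W}" for Y Z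
    using that eq False by (auto simp: Int_commute)
  have "\<exists>u\<in>Fs (\<Union>{V, W}). \<forall>Y\<in>{V, W}. res (\<Union>{V, W}) Y u = ?s Y"
  proof (rule gluing)
    show "is_open X Y" if "Y \<in> {V, W}" for Y using that V by auto
    show "?s Y \<in> Fs Y" if "Y \<in> {V, W}" for Y using that s by auto
  qed (rule compat)
  then obtain u where u: "u \<in> Fs (\<Union>{V, W})" "\<forall>Y\<in>{V, W}. res (\<Union>{V, W}) Y u = ?s Y"
    by blast
  then show thesis using that[of u] False by simp
qed

text \<open>The elements \<open>R\<close> of \<open>B\<close> for which this holds over the basic open set defined by \<open>R\<close> form
  an ideal.\<close>

lemma clear_to_affine:
  assumes U: "is_open X U" "U \<subseteq> X0" "U \<noteq> {}" and s: "s \<in> Fs U"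
  obtains Q T where "Q \<in> B" "Q \<noteq> 0" "T \<in> Fs X0" "alg_act U Q s = res X0 U T"
proof -
  define good where "good R Q T \<longleftrightarrow> Q \<in> B \<and> Q \<noteq> 0 \<and> T \<in> Fs (aff R) \<and>
     alg_act (aff R \<inter> U) Q (res U (aff R \<inter> U) s) = res (aff R) (aff R \<inter> U) T" for R Q T
  define J where "J = {R \<in> B. \<exists>Q T. good R Q T}"
  have gU: "generic_pt \<in> U" using generic_pt_open U by blast
  have opn: "is_open X (aff R \<inter> U)" "is_open X (aff R)" "aff R \<subseteq> X0" "aff R \<inter> U \<subseteq> X0" if "R \<in> B" for R
    using that U aff_X0 by (auto intro!: openin_Int)
  have "1 \<in> J"
  proof (rule affine_cover)
    show "J \<subseteq> B" by (auto simp: J_def)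
    have "\<zero>\<^bsub>msec F {}\<^esub> \<in> Fs {}"
    proof -
      interpret E: Module.module "OX {}" "msec F {}" by (rule F_module) simp
      show ?thesis by simp
    qed
    moreover have "alg_act {} 1 (res U {} s) = res {} {} \<zero>\<^bsub>msec F {}\<^esub>"
      using calculation U s by (intro empty_unique) (auto intro!: alg_act_closed res_closed)
    ultimately have "good 0 1 \<zero>\<^bsub>msec F {}\<^esub>" by (simp add: good_def)
    then show J0: "0 \<in> J" unfolding J_def by auto
    show "R \<star> P \<in> J" if "R \<in> J" "P \<in> B" for R P
    proof -
      obtain Q T where R: "R \<in> B" and g: "good R Q T" using \<open>R \<in> J\<close> by (auto simp: J_def)
      let ?D = "aff R" and ?D' = "aff (R \<star> P)"
      have sub: "?D' \<subseteq> ?D" using aff_mult R \<open>P \<in> B\<close> by auto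
      have RP: "R \<star> P \<in> B" using R \<open>P \<in> B\<close> by simp
      have sub': "?D' \<inter> U \<subseteq> ?D \<inter> U" using sub by blast
      have "res U (?D' \<inter> U) s = res (?D \<inter> U) (?D' \<inter> U) (res U (?D \<inter> U) s)"
        using opn[OF R] opn[OF RP] U s sub' by (intro res_comp[symmetric]) auto
      moreover have "alg_act (?D' \<inter> U) Q (res (?D \<inter> U) (?D' \<inter> U) (res U (?D \<inter> U) s)) =
          res (?D \<inter> U) (?D' \<inter> U) (alg_act (?D \<inter> U) Q (res U (?D \<inter> U) s))"
        using opn[OF R] opn[OF RP] U s sub' g
        by (intro res_alg_act[symmetric]) (auto simp: good_def intro!: res_closed)
      ultimately have "alg_act (?D' \<inter> U) Q (res U (?D' \<inter> U) s) = res (?D \<inter> U) (?D' \<inter> U) (alg_act (?D \<inter> U) Q (res U (?D \<inter> U) s))"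
        by simp
      also have "\<dots> = res (?D \<inter> U) (?D' \<inter> U) (res ?D (?D \<inter> U) T)" using g by (simp add: good_def)
      also have "\<dots> = res ?D (?D' \<inter> U) T" using opn[OF R] opn[OF RP] g sub by (intro res_comp) (auto simp: good_def)
      also have "\<dots> = res ?D' (?D' \<inter> U) (res ?D ?D' T)"
        using opn[OF R] opn[OF RP] g sub by (intro res_comp[symmetric]) (auto simp: good_def)
      finally have "good (R \<star> P) Q (res ?D ?D' T)"
        using g res_closed[of ?D ?D' T] opn[OF R] opn[OF RP] sub by (simp add: good_def)
      then show ?thesis using RP unfolding J_def by blast
    qed
    show "R1 + R2 \<in> J" if "R1 \<in> J" "R2 \<in> J" for R1 R2
    \<comment> \<open>Outside the trivial cases all three distinguished sets contain the generic
      point, so the intersections below are nonempty and restriction to them is injective.\<close>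
    proof (cases "R1 = 0 \<or> R2 = 0 \<or> R1 + R2 = 0")
      case True
      then show ?thesis using that J0 by auto
    next
      case False
      obtain Q1 T1 where R1: "R1 \<in> B" and g1: "good R1 Q1 T1" using \<open>R1 \<in> J\<close> by (auto simp: J_def)
      obtain Q2 T2 where R2: "R2 \<in> B" and g2: "good R2 Q2 T2" using \<open>R2 \<in> J\<close> by (auto simp: J_def)
      let ?D1 = "aff R1" and ?D2 = "aff R2" and ?D = "aff (R1 + R2)" and ?Q = "Q1 \<star> Q2"
      have R: "R1 + R2 \<in> B" using R1 R2 by simp
      have gen: "generic_pt \<in> ?D1" "generic_pt \<in> ?D2" "generic_pt \<in> ?D" using generic_pt_aff R1 R2 R False by auto
      have Q: "Q1 \<in> B" "Q1 \<noteq> 0" "Q2 \<in> B" "Q2 \<noteq> 0" "?Q \<in> B" "?Q \<noteq> 0" using g1 g2 by (auto simp: good_def)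
      have T: "T1 \<in> Fs ?D1" "T2 \<in> Fs ?D2" using g1 g2 by (auto simp: good_def)
      \<comment> \<open>Multiplying crosswise gives both sections the common denominator Q1 Q2. Each
        then restricts to Q1 Q2 s inside U, so they agree on D1 \<inter> D2 and glue to a section
        that covers \<open>aff (R1 + R2)\<close>.\<close>
      define S1 where "S1 = alg_act ?D1 Q2 T1"
      define S2 where "S2 = alg_act ?D2 Q1 T2"
      have S: "S1 \<in> Fs ?D1" "S2 \<in> Fs ?D2"
        unfolding S1_def S2_def using opn[OF R1] opn[OF R2] Q T by (auto intro!: alg_act_closed)
      have key: "res (aff R') V (alg_act (aff R') P T) = alg_act V (P \<star> P') (res U V s)"
        if V: "is_open X V" "V \<subseteq> aff R' \<inter> U" and R': "R' \<in> B" and P: "P \<in> B" and g: "good R' P' T" for R' V P P' T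
      proof -
        let ?E = "aff R'"
        have T: "T \<in> Fs ?E" "P' \<in> B" using g by (auto simp: good_def)
        have V': "V \<subseteq> ?E" "V \<subseteq> U" "V \<subseteq> X0" using V opn[OF R'] by auto
        have sE: "res U (?E \<inter> U) s \<in> Fs (?E \<inter> U)" using opn[OF R'] U s by (intro res_closed) auto
        have "res ?E V (alg_act ?E P T) = alg_act V P (res ?E V T)"
          using opn[OF R'] V V' P T by (intro res_alg_act)
        also have "res ?E V T = res (?E \<inter> U) V (res ?E (?E \<inter> U) T)"
          using opn[OF R'] V T by (intro res_comp[symmetric]) auto
        also have "res ?E (?E \<inter> U) T = alg_act (?E \<inter> U) P' (res U (?E \<inter> U) s)" using g by (simp add: good_def)
        also have "res (?E \<inter> U) V \<dots> = alg_act V P' (res (?E \<inter> U) V (res U (?E \<inter> U) s))"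
          using opn[OF R'] V V' T sE by (intro res_alg_act) auto
        also have "res (?E \<inter> U) V (res U (?E \<inter> U) s) = res U V s"
          using opn[OF R'] V U s by (intro res_comp) auto
        also have "alg_act V P (alg_act V P' (res U V s)) = alg_act V (P \<star> P') (res U V s)"
          using V V' P T U s by (intro alg_smult_comm(1)) (auto intro!: res_closed)
        finally show ?thesis .
      qed
      have key1: "res ?D1 V S1 = alg_act V ?Q (res U V s)" if "is_open X V" "V \<subseteq> ?D1 \<inter> U" for V
        unfolding S1_def using key[OF that R1 Q(3) g1] Q by (simp add: mult_comm)
      have key2: "res ?D2 V S2 = alg_act V ?Q (res U V s)" if "is_open X V" "V \<subseteq> ?D2 \<inter> U" for V
        unfolding S2_def using key[OF that R2 Q(1) g2] by simp
      have agree: "res ?D1 (?D1 \<inter> ?D2) S1 = res ?D2 (?D1 \<inter> ?D2) S2"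
      proof (rule res_inj[of "?D1 \<inter> ?D2" "?D1 \<inter> ?D2 \<inter> U"])
        show o: "is_open X (?D1 \<inter> ?D2)" "is_open X (?D1 \<inter> ?D2 \<inter> U)"
          using opn(2)[OF R1] opn(2)[OF R2] U(1) by (auto intro!: openin_Int)
        show "?D1 \<inter> ?D2 \<inter> U \<noteq> {}" using gen gU by blast
        show "res ?D1 (?D1 \<inter> ?D2) S1 \<in> Fs (?D1 \<inter> ?D2)" "res ?D2 (?D1 \<inter> ?D2) S2 \<in> Fs (?D1 \<inter> ?D2)"
          using opn(2)[OF R1] opn(2)[OF R2] S o by (auto intro!: res_closed)
        have "res (?D1 \<inter> ?D2) (?D1 \<inter> ?D2 \<inter> U) (res ?D1 (?D1 \<inter> ?D2) S1) = res ?D1 (?D1 \<inter> ?D2 \<inter> U) S1"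
          using opn(2)[OF R1] S o by (intro res_comp) auto
        moreover have "res (?D1 \<inter> ?D2) (?D1 \<inter> ?D2 \<inter> U) (res ?D2 (?D1 \<inter> ?D2) S2) = res ?D2 (?D1 \<inter> ?D2 \<inter> U) S2"
          using opn(2)[OF R2] S o by (intro res_comp) auto
        ultimately show "res (?D1 \<inter> ?D2) (?D1 \<inter> ?D2 \<inter> U) (res ?D1 (?D1 \<inter> ?D2) S1) =
            res (?D1 \<inter> ?D2) (?D1 \<inter> ?D2 \<inter> U) (res ?D2 (?D1 \<inter> ?D2) S2)"
          using key1[OF o(2)] key2[OF o(2)] by (simp add: Int_lower1 le_infI1)
      qed auto
      obtain T where T': "T \<in> Fs (?D1 \<union> ?D2)" "res (?D1 \<union> ?D2) ?D1 T = S1" "res (?D1 \<union> ?D2) ?D2 T = S2"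
        by (rule glue2[OF opn(2)[OF R1] opn(2)[OF R2] S agree])
      let ?Y = "?D1 \<union> ?D2"
      have Y: "is_open X ?Y" "?D \<subseteq> ?Y" "?D1 \<subseteq> ?Y" using opn(2)[OF R1] opn(2)[OF R2] aff_add[OF R1 R2] by auto
      have TD: "res ?Y ?D T \<in> Fs ?D" using Y opn[OF R] T' by (intro res_closed) auto
      have "alg_act (?D \<inter> U) ?Q (res U (?D \<inter> U) s) = res ?D (?D \<inter> U) (res ?Y ?D T)"
      proof (rule res_inj[of "?D \<inter> U" "?D1 \<inter> (?D \<inter> U)"])
        show o: "is_open X (?D \<inter> U)" "is_open X (?D1 \<inter> (?D \<inter> U))"
          using opn(1)[OF R] opn(2)[OF R1] by (auto intro!: openin_Int)
        show "?D1 \<inter> (?D \<inter> U) \<noteq> {}" using gen gU by blast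
        have sD: "res U (?D \<inter> U) s \<in> Fs (?D \<inter> U)" using o U s by (intro res_closed) auto
        show "alg_act (?D \<inter> U) ?Q (res U (?D \<inter> U) s) \<in> Fs (?D \<inter> U)"
          using o opn[OF R] Q sD by (intro alg_act_closed) auto
        show "res ?D (?D \<inter> U) (res ?Y ?D T) \<in> Fs (?D \<inter> U)" by (rule res_closed[OF _ _ _ TD]) (use o opn[OF R] in auto)
        have "res (?D \<inter> U) (?D1 \<inter> (?D \<inter> U)) (alg_act (?D \<inter> U) ?Q (res U (?D \<inter> U) s))
           = alg_act (?D1 \<inter> (?D \<inter> U)) ?Q (res (?D \<inter> U) (?D1 \<inter> (?D \<inter> U)) (res U (?D \<inter> U) s))"
          using o opn[OF R] Q sD by (intro res_alg_act) auto
        also have "res (?D \<inter> U) (?D1 \<inter> (?D \<inter> U)) (res U (?D \<inter> U) s) = res U (?D1 \<inter> (?D \<inter> U)) s"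
          using o U s by (intro res_comp) auto
        also have "alg_act (?D1 \<inter> (?D \<inter> U)) ?Q (res U (?D1 \<inter> (?D \<inter> U)) s) = res ?D1 (?D1 \<inter> (?D \<inter> U)) S1"
          by (rule key1[OF o(2), symmetric]) blast
        also have "\<dots> = res ?Y (?D1 \<inter> (?D \<inter> U)) T"
          unfolding T'(2)[symmetric] using Y o opn[OF R1] T' by (intro res_comp) auto
        also have "\<dots> = res ?D (?D1 \<inter> (?D \<inter> U)) (res ?Y ?D T)"
          using Y o opn[OF R] T' by (intro res_comp[symmetric]) auto
        also have "\<dots> = res (?D \<inter> U) (?D1 \<inter> (?D \<inter> U)) (res ?D (?D \<inter> U) (res ?Y ?D T))"
          using o opn[OF R] TD by (intro res_comp[symmetric]) auto
        finally show "res (?D \<inter> U) (?D1 \<inter> (?D \<inter> U)) (alg_act (?D \<inter> U) ?Q (res U (?D \<inter> U) s)) =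
          res (?D \<inter> U) (?D1 \<inter> (?D \<inter> U)) (res ?D (?D \<inter> U) (res ?Y ?D T))" .
      qed auto
      then have "good (R1 + R2) ?Q (res ?Y ?D T)" using Q TD by (simp add: good_def)
      then show ?thesis using R unfolding J_def by blast
    qed
    show "\<exists>R\<in>J. q \<in> aff R" if q: "q \<in> X0" for q
    proof -
      have "q \<in> pts" using q X0_sub_pts by auto
      then obtain V n \<sigma> where V: "is_open X V" "q \<in> V" "\<forall>i<n. \<sigma> i \<in> Fs V" "locally_generated_by X F V n \<sigma>"
        by (rule finite_type)
      obtain R where R: "R \<in> B" "R \<noteq> 0" "q \<in> aff R" "aff R \<subseteq> V" by (rule aff_base[OF V(1,2) q])
      have gV: "generic_pt \<in> V" using generic_pt_open V by blast
      \<comment> \<open>The generators live near q, but s is expressed through them near the generic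
        point, where both are defined. After the denominator Q is cleared, the right side makes
        sense on all of \<open>aff R\<close>, and injectivity of restriction extends the
        identity.\<close>
      obtain m Q A W where W: "is_open X W" "generic_pt \<in> W" "W \<subseteq> U \<inter> V" "W \<subseteq> basic m Q" "Q \<in> filt B m" "Q \<noteq> 0"
        "tmon Q m \<notin> generic_pt" "\<forall>i<n. A i \<in> filt B m"
        "res U W s = (\<Oplus>\<^bsub>msec F W\<^esub>i\<in>{..<n}. sect W (A i) Q \<odot>\<^bsub>msec F W\<^esub> res V W (\<sigma> i))"
        by (rule local_combination[OF V(1,3,4) U(1) s gU gV])
      let ?D = "aff R"
      interpret D: Module.module "OX ?D" "msec F ?D" by (rule F_module[OF opn(2)[OF R(1)]])
      have sD: "res V ?D (\<sigma> i) \<in> Fs ?D" if "i < n" for i using V R opn[OF R(1)] that by (intro res_closed) auto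
      have sW: "res V W (\<sigma> i) \<in> Fs W" if "i < n" for i using V W that by (intro res_closed) auto
      have AB: "A i \<in> B" if "i < n" for i using W(8) that by auto
      define T where "T = (\<Oplus>\<^bsub>msec F ?D\<^esub>i\<in>{..<n}. alg_act ?D (A i) (res V ?D (\<sigma> i)))"
      have Tt: "alg_act ?D (A i) (res V ?D (\<sigma> i)) \<in> Fs ?D" if "i < n" for i
        using opn[OF R(1)] AB sD that by (intro alg_act_closed) auto
      then have T: "T \<in> Fs ?D" unfolding T_def by (intro D.M.finsum_closed) auto
      let ?E = "?D \<inter> U" and ?W = "W \<inter> ?D"
      have o: "is_open X ?E" "is_open X ?W" "?W \<subseteq> ?E" "?W \<subseteq> W" "?W \<subseteq> ?D" "?W \<subseteq> X0" "?W \<subseteq> U" "W \<subseteq> U" "W \<subseteq> X0"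
        using opn[OF R(1)] W U by (auto intro!: openin_Int)
      interpret W: Module.module "OX W" "msec F W" by (rule F_module[OF W(1)])
      interpret W': Module.module "OX ?W" "msec F ?W" by (rule F_module[OF o(2)])
      have QB: "Q \<in> B" using W by auto
      have sE: "res U ?E s \<in> Fs ?E" using o U s by (intro res_closed) auto
      have "alg_act ?E Q (res U ?E s) = res ?D ?E T"
      proof (rule res_inj[OF o(1,2,3)])
        show "?W \<noteq> {}" using W(2) generic_pt_aff R by blast
        show "alg_act ?E Q (res U ?E s) \<in> Fs ?E" using o opn[OF R(1)] QB sE by (intro alg_act_closed) auto
        show "res ?D ?E T \<in> Fs ?E" by (rule res_closed[OF _ _ _ T]) (use o opn[OF R(1)] in auto)
        have rw: "W \<subseteq> X0" using o by simp
        have sWs: "res U W s \<in> Fs W" by (rule res_closed[OF U(1) W(1) o(8) s])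
        have "res ?E ?W (alg_act ?E Q (res U ?E s)) = alg_act ?W Q (res ?E ?W (res U ?E s))"
          using o opn[OF R(1)] QB sE by (intro res_alg_act) auto
        also have "res ?E ?W (res U ?E s) = res U ?W s" using o U s by (intro res_comp) auto
        also have "res U ?W s = res W ?W (res U W s)" using o U s W by (intro res_comp[symmetric]) auto
        also have "alg_act ?W Q \<dots> = res W ?W (alg_act W Q (res U W s))"
          by (rule res_alg_act[symmetric, OF W(1) o(2,4,9) QB sWs])
        also have "alg_act W Q (res U W s) = (\<Oplus>\<^bsub>msec F W\<^esub>i\<in>{..<n}. alg_act W (A i) (res V W (\<sigma> i)))"
          unfolding W(9) using W rw QB sW by (intro clear_denominator) (auto intro!: regular_on_basic[of _ m])
        also have "res W ?W \<dots> = (\<Oplus>\<^bsub>msec F ?W\<^esub>i\<in>{..<n}. res W ?W (alg_act W (A i) (res V W (\<sigma> i))))"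
          using o W AB sW by (intro res_finsum alg_act_closed) auto
        also have "\<dots> = (\<Oplus>\<^bsub>msec F ?W\<^esub>i\<in>{..<n}. res ?D ?W (alg_act ?D (A i) (res V ?D (\<sigma> i))))"
        proof (intro W'.M.finsum_cong' refl)
          show "(\<lambda>i. res ?D ?W (alg_act ?D (A i) (res V ?D (\<sigma> i)))) \<in> {..<n} \<rightarrow> Fs ?W"
            using o opn[OF R(1)] Tt by (intro Pi_I res_closed) auto
          fix i assume "i \<in> {..<n}"
          then have i: "i < n" by simp
          have "res W ?W (alg_act W (A i) (res V W (\<sigma> i))) = alg_act ?W (A i) (res W ?W (res V W (\<sigma> i)))"
            using o W AB[OF i] sW[OF i] by (intro res_alg_act) auto
          also have "res W ?W (res V W (\<sigma> i)) = res V ?W (\<sigma> i)"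
            using o W V i by (intro res_comp) auto
          also have "\<dots> = res ?D ?W (res V ?D (\<sigma> i))"
            using o opn[OF R(1)] R V i by (intro res_comp[symmetric]) auto
          also have "alg_act ?W (A i) \<dots> = res ?D ?W (alg_act ?D (A i) (res V ?D (\<sigma> i)))"
            using o opn[OF R(1)] AB[OF i] sD[OF i] by (intro res_alg_act[symmetric]) auto
          finally show "res W ?W (alg_act W (A i) (res V W (\<sigma> i))) = res ?D ?W (alg_act ?D (A i) (res V ?D (\<sigma> i)))" .
        qed
        also have "\<dots> = res ?D ?W T"
          unfolding T_def using o opn[OF R(1)] Tt by (intro res_finsum[symmetric]) auto
        also have "\<dots> = res ?E ?W (res ?D ?E T)" using o opn[OF R(1)] T by (intro res_comp[symmetric]) auto
        finally show "res ?E ?W (alg_act ?E Q (res U ?E s)) = res ?E ?W (res ?D ?E T)" .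
      qed
      then have "good R Q T" using QB W(6) T by (simp add: good_def)
      then show ?thesis using R unfolding J_def by blast
    qed
  qed
  then obtain Q T where "good 1 Q T" by (auto simp: J_def)
  moreover have "X0 \<inter> U = U" using U by auto
  ultimately show thesis using U s res_id by (intro that[of Q T]) (auto simp: good_def)
qed

end

context spectral begin

lemma reg_open:
  assumes "y \<in> pts" "fraction A C" "reg y A C"
  obtains V where "is_open X V" "y \<in> V" "regular_on V A C"
proof -
  obtain A' R m where *: "A' \<in> filt B m" "R \<in> filt B m" "tmon R m \<notin> y" "R \<noteq> 0" "fraction A' R" "A \<star> R = A' \<star> C"
    by (rule regE[OF assms(1,3)])
  have "regular_on (basic m R) A' R" using * by (intro regular_on_basic) auto
  then have "regular_on (basic m R) A C" by (rule regular_on_cong) (use assms * in auto)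
  then show thesis using * assms(1) by (intro that[of "basic m R"]) (simp_all, simp add: basic_def)
qed

end

section \<open>The embedding of sections into fractions\<close>

context spectral_sheaf begin

text \<open>The relation Q s = f on the affine part of U, where the polynomial f stands for the
  section over X0 that \<phi> sends to f. The map \<open>psi\<close> collects all such f/Q.\<close>

definition rep :: "spt set \<Rightarrow> 'm \<Rightarrow> complex poly \<Rightarrow> diffop \<Rightarrow> bool" where
  "rep U s f Q \<longleftrightarrow> Q \<in> B \<and> Q \<noteq> 0 \<and> alg_act (U \<inter> X0) Q (res U (U \<inter> X0) s) = res X0 (U \<inter> X0) (pre f)"

definition psi :: "spt set \<Rightarrow> 'm \<Rightarrow> (complex poly \<times> diffop) set" where
  "psi U s = {(f, Q). rep U s f Q}"

lemma open_X0_Int: "is_open X U \<Longrightarrow> is_open X (U \<inter> X0)"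
  by (simp add: openin_Int)

lemma Int_X0_nonempty: "is_open X U \<Longrightarrow> U \<noteq> {} \<Longrightarrow> U \<inter> X0 \<noteq> {}"
  using open_Int_nonempty[of U X0] X0_nonempty by simp

lemma rep_exists:
  assumes U: "is_open X U" "U \<noteq> {}" and s: "s \<in> Fs U"
  obtains f Q where "rep U s f Q"
proof -
  have s': "res U (U \<inter> X0) s \<in> Fs (U \<inter> X0)" using U s open_X0_Int by (intro res_closed) auto
  obtain Q T where QT: "Q \<in> B" "Q \<noteq> 0" "T \<in> Fs X0" "alg_act (U \<inter> X0) Q (res U (U \<inter> X0) s) = res X0 (U \<inter> X0) T"
    by (rule clear_to_affine[OF open_X0_Int[OF U(1)] _ Int_X0_nonempty[OF U] s']) auto
  then have "rep U s (\<phi> T) Q" by (simp add: rep_def pre_phi)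
  then show thesis by (rule that)
qed

text \<open>Two representatives are compared over U \<inter> X0: injectivity of restriction lifts
  the comparison to X0, where \<phi> turns it into cross multiplication, and torsion freeness allows
  the converse cancellation.\<close>

lemma psi_rep:
  assumes U: "is_open X U" "U \<noteq> {}" and s: "s \<in> Fs U" and rep: "rep U s f Q"
  shows "psi U s = fr f Q"
proof -
  let ?U = "U \<inter> X0"
  have o: "is_open X ?U" "?U \<subseteq> X0" "?U \<noteq> {}" "?U \<subseteq> U" using U open_X0_Int Int_X0_nonempty by auto
  have s': "res U ?U s \<in> Fs ?U" using U s o by (intro res_closed) auto
  have Q: "Q \<in> B" "Q \<noteq> 0" "alg_act ?U Q (res U ?U s) = res X0 ?U (pre f)" using rep by (auto simp: rep_def)
  have rp: "res X0 ?U (pre g) \<in> Fs ?U" for g using o by (intro res_closed) auto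
  have rpre: "res X0 ?U (pre (g \<diamondop> P)) = alg_act ?U P (res X0 ?U (pre g))" if "P \<in> B" for g P
    unfolding pre_act[OF that] using o that by (intro res_alg_act) auto
  have "rep U s g R \<longleftrightarrow> R \<in> B \<and> R \<noteq> 0 \<and> f \<diamondop> R = g \<diamondop> Q" for g R
  proof (cases "R \<in> B \<and> R \<noteq> 0")
    case True
    then have R: "R \<in> B" "R \<noteq> 0" by auto
    have rs: "alg_act ?U R (res U ?U s) \<in> Fs ?U" using o R s' by (intro alg_act_closed)
    have 1: "res X0 ?U (pre (f \<diamondop> R)) = alg_act ?U Q (alg_act ?U R (res U ?U s))"
      using rpre[OF R(1), of f] Q(3) alg_smult_comm(2)[OF o(1,2) R(1) Q(1) s'] by simp
    have 2: "res X0 ?U (pre (g \<diamondop> Q)) = alg_act ?U Q (res X0 ?U (pre g))" by (rule rpre[OF Q(1)])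
    show ?thesis
    proof
      assume "rep U s g R"
      then have "alg_act ?U R (res U ?U s) = res X0 ?U (pre g)" by (simp add: rep_def)
      then have "res X0 ?U (pre (f \<diamondop> R)) = res X0 ?U (pre (g \<diamondop> Q))" using 1 2 by simp
      then have "pre (f \<diamondop> R) = pre (g \<diamondop> Q)" using res_inj[OF open_X0 o(1,2,3)] by simp
      then show "R \<in> B \<and> R \<noteq> 0 \<and> f \<diamondop> R = g \<diamondop> Q" using R phi_pre by metis
    next
      assume "R \<in> B \<and> R \<noteq> 0 \<and> f \<diamondop> R = g \<diamondop> Q"
      then have "alg_act ?U Q (alg_act ?U R (res U ?U s)) = alg_act ?U Q (res X0 ?U (pre g))" using 1 2 by simp
      then have "alg_act ?U R (res U ?U s) = res X0 ?U (pre g)"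
        by (rule torsion_cancel[OF o(1,3,2) Q(1,2) rs rp])
      then show "rep U s g R" using R by (simp add: rep_def)
    qed
  qed (auto simp: rep_def)
  then show ?thesis by (auto simp: psi_def fr_def)
qed

lemma psi_E:
  assumes "is_open X U" "U \<noteq> {}" "s \<in> Fs U"
  obtains f Q where "rep U s f Q" "Q \<in> B" "Q \<noteq> 0" "psi U s = fr f Q"
proof -
  obtain f Q where r: "rep U s f Q" by (rule rep_exists[OF assms])
  then show thesis using psi_rep[OF assms r] that by (auto simp: rep_def)
qed

lemma psi_FK: "is_open X U \<Longrightarrow> U \<noteq> {} \<Longrightarrow> s \<in> Fs U \<Longrightarrow> psi U s \<in> FK"
  by (erule (2) psi_E) simp

lemma rep_iff:
  assumes "is_open X U" "U \<noteq> {}" "s \<in> Fs U" "Q \<in> B" "Q \<noteq> 0"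
  shows "rep U s f Q \<longleftrightarrow> psi U s = fr f Q"
proof
  assume "psi U s = fr f Q"
  moreover have "(f, Q) \<in> fr f Q" using assms by (simp add: fr_def)
  ultimately show "rep U s f Q" by (auto simp: psi_def)
qed (rule psi_rep[OF assms(1-3)])

lemma psi_res:
  assumes UV: "is_open X U" "is_open X V" "V \<subseteq> U" "V \<noteq> {}" and s: "s \<in> Fs U"
  shows "psi V (res U V s) = psi U s"
proof -
  have ne: "U \<noteq> {}" using UV by auto
  obtain f Q where r: "rep U s f Q" "Q \<in> B" "Q \<noteq> 0" "psi U s = fr f Q" by (rule psi_E[OF UV(1) ne s])
  let ?U = "U \<inter> X0" and ?V = "V \<inter> X0"
  have o: "is_open X ?U" "is_open X ?V" "?V \<subseteq> ?U" "?U \<subseteq> U" "?U \<subseteq> X0" "?V \<subseteq> V" using UV open_X0_Int by auto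
  have s': "res U ?U s \<in> Fs ?U" using UV o s by (intro res_closed) auto
  have "alg_act ?V Q (res V ?V (res U V s)) = alg_act ?V Q (res ?U ?V (res U ?U s))"
    using res_comp[OF UV(1,2) o(2,6) UV(3) s] res_comp[OF UV(1) o(1,2,3,4) s] by simp
  also have "\<dots> = res ?U ?V (alg_act ?U Q (res U ?U s))"
    by (rule res_alg_act[symmetric, OF o(1,2,3,5) r(2) s'])
  also have "\<dots> = res ?U ?V (res X0 ?U (pre f))" using r(1) by (simp add: rep_def)
  also have "\<dots> = res X0 ?V (pre f)" using o by (intro res_comp) auto
  finally have "rep V (res U V s) f Q" using r by (simp add: rep_def)
  then show ?thesis using psi_rep[OF UV(2,4)] res_closed[OF UV(1-3) s] r by simp
qed

lemma psi_add:
  assumes U: "is_open X U" "U \<noteq> {}" and s: "s \<in> Fs U" "t \<in> Fs U"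
  shows "psi U (s \<oplus>\<^bsub>msec F U\<^esub> t) = fadd (psi U s) (psi U t)"
proof -
  let ?U = "U \<inter> X0"
  have o: "is_open X ?U" "?U \<subseteq> U" "?U \<subseteq> X0" using U open_X0_Int by auto
  interpret U: Module.module "OX U" "msec F U" by (rule F_module[OF U(1)])
  interpret U': Module.module "OX ?U" "msec F ?U" by (rule F_module[OF o(1)])
  obtain f g Q where *: "Q \<in> B" "Q \<noteq> 0" "psi U s = fr f Q" "psi U t = fr g Q"
    by (rule FK_common[OF psi_FK[OF U s(1)] psi_FK[OF U s(2)]])
  have r: "rep U s f Q" "rep U t g Q" using rep_iff[OF U s(1)] rep_iff[OF U s(2)] * by auto
  have s': "res U ?U s \<in> Fs ?U" "res U ?U t \<in> Fs ?U" using U o s by (auto intro!: res_closed)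
  have c: "sect ?U Q 1 \<in> carrier (OX ?U)" using o regular_on_X0[OF o(3) *(1)] by simp
  have "alg_act ?U Q (res U ?U (s \<oplus>\<^bsub>msec F U\<^esub> t)) = alg_act ?U Q (res U ?U s) \<oplus>\<^bsub>msec F ?U\<^esub> alg_act ?U Q (res U ?U t)"
    using res_add[OF U(1) o(1,2) s] U'.smult_r_distr[OF c s'] by simp
  also have "\<dots> = res X0 ?U (pre f) \<oplus>\<^bsub>msec F ?U\<^esub> res X0 ?U (pre g)" using r by (simp add: rep_def)
  also have "\<dots> = res X0 ?U (pre (f + g))"
    unfolding pre_add using o by (intro res_add[symmetric]) auto
  finally have "rep U (s \<oplus>\<^bsub>msec F U\<^esub> t) (f + g) Q" using * by (simp add: rep_def)
  then show ?thesis using psi_rep[OF U U.M.a_closed[OF s]] * by simp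
qed

lemma psi_smult:
  assumes U: "is_open X U" "U \<noteq> {}" and s: "s \<in> Fs U" and A: "regular_on U A C"
  shows "psi U (sect U A C \<odot>\<^bsub>msec F U\<^esub> s) = fsm A C (psi U s)"
proof -
  let ?U = "U \<inter> X0"
  have o: "is_open X ?U" "?U \<subseteq> U" "?U \<subseteq> X0" using U open_X0_Int by auto
  obtain f Q where r: "rep U s f Q" "Q \<in> B" "Q \<noteq> 0" "psi U s = fr f Q" by (rule psi_E[OF U s])
  have fA: "fraction A C" using A by (simp add: regular_on_def)
  then have AC: "A \<in> B" "C \<in> B" "C \<noteq> 0" by (auto simp: fraction_def)
  have s': "res U ?U s \<in> Fs ?U" using U o s by (intro res_closed) auto
  have A': "regular_on ?U A C" using A o by (auto intro: regular_on_mono)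
  have QC: "regular_on ?U (Q \<star> C) 1" using regular_on_X0[OF o(3)] r AC by simp
  have eq: "(Q \<star> C \<star> A) \<star> 1 = (A \<star> Q) \<star> (1 \<star> C)" using r AC by (simp add: mult_ac_B)
  have r1: "regular_on ?U (Q \<star> C \<star> A) (1 \<star> C)" by (rule regular_on_mult[OF open_subset_pts[OF o(1)] QC A'])
  have r2: "regular_on ?U (A \<star> Q) 1" using regular_on_X0[OF o(3)] r AC by simp
  have "alg_act ?U (Q \<star> C) (res U ?U (sect U A C \<odot>\<^bsub>msec F U\<^esub> s)) = alg_act ?U (Q \<star> C) (sect ?U A C \<odot>\<^bsub>msec F ?U\<^esub> res U ?U s)"
    using res_smult_sect[OF U(1) o(1,2) A s] by simp
  also have "\<dots> = sect ?U (Q \<star> C \<star> A) (1 \<star> C) \<odot>\<^bsub>msec F ?U\<^esub> res U ?U s"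
    by (rule sect_smult_smult[OF o(1) QC A' s'])
  also have "sect ?U (Q \<star> C \<star> A) (1 \<star> C) = sect ?U (A \<star> Q) 1"
    by (rule sect_eqI[OF r1 r2 eq])
  also have "sect ?U (A \<star> Q) 1 \<odot>\<^bsub>msec F ?U\<^esub> res U ?U s = alg_act ?U A (alg_act ?U Q (res U ?U s))"
    by (rule alg_smult_comm(1)[symmetric, OF o(1,3) AC(1) r(2) s'])
  also have "\<dots> = alg_act ?U A (res X0 ?U (pre f))" using r(1) by (simp add: rep_def)
  also have "\<dots> = res X0 ?U (pre (f \<diamondop> A))"
    unfolding pre_act[OF AC(1)] using o AC by (intro res_alg_act[symmetric]) auto
  finally have "rep U (sect U A C \<odot>\<^bsub>msec F U\<^esub> s) (f \<diamondop> A) (Q \<star> C)" using r AC by (simp add: rep_def)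
  then have "psi U (sect U A C \<odot>\<^bsub>msec F U\<^esub> s) = fr (f \<diamondop> A) (Q \<star> C)"
    using U s A by (intro psi_rep) (auto intro!: smult_closed)
  then show ?thesis using r fA by simp
qed

lemma psi_inj:
  assumes U: "is_open X U" "U \<noteq> {}" and s: "s \<in> Fs U" "t \<in> Fs U" and eq: "psi U s = psi U t"
  shows "s = t"
proof -
  let ?U = "U \<inter> X0"
  have o: "is_open X ?U" "?U \<subseteq> U" "?U \<subseteq> X0" "?U \<noteq> {}" using U open_X0_Int Int_X0_nonempty by auto
  obtain f Q where r: "rep U s f Q" "Q \<in> B" "Q \<noteq> 0" "psi U s = fr f Q" by (rule psi_E[OF U s(1)])
  then have r': "rep U t f Q" using rep_iff[OF U s(2) r(2,3)] eq by simp
  have s': "res U ?U s \<in> Fs ?U" "res U ?U t \<in> Fs ?U" using U o s by (auto intro!: res_closed)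
  have "alg_act ?U Q (res U ?U s) = alg_act ?U Q (res U ?U t)" using r r' by (simp add: rep_def)
  then have "res U ?U s = res U ?U t" by (rule torsion_cancel[OF o(1,4,3) r(2,3) s'])
  then show ?thesis using res_inj[OF U(1) o(1,2,4) s] by simp
qed

lemma psi_X0: "s \<in> Fs X0 \<Longrightarrow> psi X0 s = fr (\<phi> s) 1"
proof -
  assume s: "s \<in> Fs X0"
  interpret X0: Module.module "OX X0" "msec F X0" by (rule F_module) simp
  have "alg_act X0 1 s = s" using s sect_one[of X0] X0.smult_one by simp
  then have "rep X0 s (\<phi> s) 1" using s by (simp add: rep_def pre_phi res_id)
  then show "psi X0 s = fr (\<phi> s) 1" using s X0_nonempty by (intro psi_rep) auto
qed

text \<open>The image in K of the stalk at y. Because \<open>psi\<close> is injective and compatible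
  with restriction, elements of this set stand for germs.\<close>

definition F_stalk :: "spt \<Rightarrow> (complex poly \<times> diffop) set \<Rightarrow> bool" where
  "F_stalk y x \<longleftrightarrow> (\<exists>U s. is_open X U \<and> y \<in> U \<and> s \<in> Fs U \<and> psi U s = x)"

lemma F_stalk_FK: "F_stalk y x \<Longrightarrow> x \<in> FK"
  unfolding F_stalk_def using psi_FK by blast

lemma F_stalkI: "is_open X U \<Longrightarrow> y \<in> U \<Longrightarrow> s \<in> Fs U \<Longrightarrow> F_stalk y (psi U s)"
  unfolding F_stalk_def by blast

lemma F_stalkE:
  assumes "F_stalk y x" "is_open X V" "y \<in> V"
  obtains U s where "is_open X U" "y \<in> U" "U \<subseteq> V" "s \<in> Fs U" "psi U s = x"
proof -
  obtain U s where *: "is_open X U" "y \<in> U" "s \<in> Fs U" "psi U s = x" using assms(1) unfolding F_stalk_def by blast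
  let ?W = "U \<inter> V"
  have W: "is_open X ?W" "?W \<subseteq> U" "?W \<noteq> {}" using * assms by (auto intro!: openin_Int)
  then show thesis
    using * assms psi_res[OF *(1) W *(3)] res_closed[OF *(1) W(1,2) *(3)] by (intro that[of ?W "res U ?W s"]) auto
qed

lemma F_stalk_add:
  assumes "F_stalk y x" "F_stalk y z" shows "F_stalk y (fadd x z)"
proof -
  obtain V t where V: "is_open X V" "y \<in> V" "t \<in> Fs V" "psi V t = z" using assms(2) unfolding F_stalk_def by blast
  obtain U s where U: "is_open X U" "y \<in> U" "U \<subseteq> V" "s \<in> Fs U" "psi U s = x" by (rule F_stalkE[OF assms(1) V(1,2)])
  have ne: "U \<noteq> {}" using U by auto
  have t: "res V U t \<in> Fs U" "psi U (res V U t) = z" using res_closed[OF V(1) U(1,3) V(3)] psi_res[OF V(1) U(1,3) ne V(3)] V by auto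
  interpret U: Module.module "OX U" "msec F U" by (rule F_module[OF U(1)])
  have "psi U (s \<oplus>\<^bsub>msec F U\<^esub> res V U t) = fadd x z" using psi_add[OF U(1) ne U(4) t(1)] U t by simp
  then show ?thesis using F_stalkI[OF U(1,2) U.M.a_closed[OF U(4) t(1)]] by simp
qed

lemma F_stalk_smult:
  assumes "y \<in> pts" "F_stalk y x" "fraction A C" "reg y A C"
  shows "F_stalk y (fsm A C x)"
proof -
  obtain V where V: "is_open X V" "y \<in> V" "regular_on V A C" by (rule reg_open[OF assms(1,3,4)])
  obtain U s where U: "is_open X U" "y \<in> U" "U \<subseteq> V" "s \<in> Fs U" "psi U s = x" by (rule F_stalkE[OF assms(2) V(1,2)])
  have ne: "U \<noteq> {}" using U by auto
  have r: "regular_on U A C" using V(3) U(3) by (rule regular_on_mono)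
  have "psi U (sect U A C \<odot>\<^bsub>msec F U\<^esub> s) = fsm A C x" using psi_smult[OF U(1) ne U(4) r] U by simp
  moreover have "sect U A C \<odot>\<^bsub>msec F U\<^esub> s \<in> Fs U" using U r by (intro smult_closed) auto
  ultimately show ?thesis using F_stalkI[OF U(1,2)] by metis
qed

text \<open>Local sections with the same image x agree on overlaps by injectivity of
  \<open>psi\<close>, so they glue.\<close>

lemma psi_glue:
  assumes U: "is_open X U" "U \<noteq> {}" and x: "\<And>y. y \<in> U \<Longrightarrow> F_stalk y x"
  obtains s where "s \<in> Fs U" "psi U s = x"
proof -
  define \<U> where "\<U> = {V. is_open X V \<and> V \<subseteq> U \<and> V \<noteq> {} \<and> (\<exists>s\<in>Fs V. psi V s = x)}"
  define \<sigma> where "\<sigma> V = (SOME s. s \<in> Fs V \<and> psi V s = x)" for V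
  have sg: "\<sigma> V \<in> Fs V \<and> psi V (\<sigma> V) = x" if "V \<in> \<U>" for V
    unfolding \<sigma>_def by (rule someI_ex) (use that in \<open>auto simp: \<U>_def\<close>)
  have op: "is_open X V" "V \<subseteq> U" "V \<noteq> {}" if "V \<in> \<U>" for V using that by (auto simp: \<U>_def)
  have "\<exists>V\<in>\<U>. y \<in> V" if y: "y \<in> U" for y
  proof -
    obtain V s where "is_open X V" "y \<in> V" "V \<subseteq> U" "s \<in> Fs V" "psi V s = x"
      by (rule F_stalkE[OF x[OF y] U(1) y])
    then show ?thesis by (intro bexI[of _ V]) (auto simp: \<U>_def)
  qed
  then have Un: "\<Union>\<U> = U" using op by blast
  have "\<exists>t\<in>Fs (\<Union>\<U>). \<forall>V\<in>\<U>. res (\<Union>\<U>) V t = \<sigma> V"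
  proof (rule gluing)
    fix V W assume V: "V \<in> \<U>" and W: "W \<in> \<U>"
    have o: "is_open X (V \<inter> W)" using op V W by (auto intro!: openin_Int)
    have ne: "V \<inter> W \<noteq> {}" using open_Int_nonempty op V W by auto
    show "res V (V \<inter> W) (\<sigma> V) = res W (V \<inter> W) (\<sigma> W)"
    proof (rule psi_inj[OF o ne])
      show "res V (V \<inter> W) (\<sigma> V) \<in> Fs (V \<inter> W)" "res W (V \<inter> W) (\<sigma> W) \<in> Fs (V \<inter> W)"
        using op V W o sg by (auto intro!: res_closed)
      show "psi (V \<inter> W) (res V (V \<inter> W) (\<sigma> V)) = psi (V \<inter> W) (res W (V \<inter> W) (\<sigma> W))"
        using psi_res[OF op(1)[OF V] o _ ne, of "\<sigma> V"] psi_res[OF op(1)[OF W] o _ ne, of "\<sigma> W"] sg[OF V] sg[OF W] by simp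
    qed
  qed (use op sg in auto)
  then obtain t where t: "t \<in> Fs U" "\<forall>V\<in>\<U>. res U V t = \<sigma> V" unfolding Un by blast
  obtain V where V: "V \<in> \<U>" using Un U(2) by blast
  have "psi U t = psi V (res U V t)" using psi_res[OF U(1) op(1-3)[OF V] t(1)] by simp
  also have "\<dots> = x" using t(2) V sg by simp
  finally show thesis using t(1) that by blast
qed

section \<open>Stalks over the affine part\<close>

lemma F_stalk_fr: "y \<in> X0 \<Longrightarrow> F_stalk y (fr f 1)"
  using F_stalkI[of X0 y "pre f"] psi_X0[of "pre f"] by simp

lemma F_stalk_X0I:
  assumes y: "y \<in> X0" and x: "in_stalk y x"
  shows "F_stalk y x"
proof -
  have yp: "y \<in> pts" using y X0_sub_pts by auto
  obtain f Q where *: "Q \<in> B" "y \<in> aff Q" "x = fr f Q" using x in_stalk_X0[OF y] by blast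
  have Q: "Q \<noteq> 0" using *(2) by auto
  have f: "fraction 1 Q" using * Q by (simp add: fraction_def)
  have "reg y 1 Q"
    using * frac_at_basic[of 1 "Suc (degree Q)" Q y] filt_degree_Suc[OF *(1)] by (auto simp: aff_def basic_def)
  then have "F_stalk y (fsm 1 Q (fr f 1))" by (rule F_stalk_smult[OF yp F_stalk_fr[OF y] f])
  then show ?thesis using f * by simp
qed

text \<open>This is the extension property of quasi-coherent sheaves. A section x over
  \<open>aff Q\<close> is multiplied by a power of Q until it extends to X0; there \<phi> makes it a
  polynomial f, and x = f/Q^N. The elements R for which some Q^N x extends over \<open>aff R\<close>
  form the ideal \<open>I\<close>.\<close>

lemma F_stalk_X0D:
  assumes y: "y \<in> X0" and x: "F_stalk y x"
  shows "in_stalk y x"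
proof -
  obtain U s where U: "is_open X U" "y \<in> U" "U \<subseteq> X0" "s \<in> Fs U" "psi U s = x"
    by (rule F_stalkE[OF x open_X0 y])
  have neU: "U \<noteq> {}" using U by auto
  obtain Q where Q: "Q \<in> B" "Q \<noteq> 0" "y \<in> aff Q" "aff Q \<subseteq> U" by (rule aff_base[OF U(1,2) y])
  have xK: "x \<in> FK" by (rule F_stalk_FK[OF x])
  have sub: "w \<in> pts" if "w \<in> X0" for w using that X0_sub_pts by auto
  have regX0: "reg w A 1" "fraction A 1" if "w \<in> X0" "A \<in> B" for w A
    using regular_on_X0[of "{w}" A] that by (auto simp: regular_on_def fraction_def)
  define I where "I = {R \<in> B. \<exists>N. \<forall>w\<in>aff R. F_stalk w (fsm (op_pow Q N) 1 x)}"
  have more: "F_stalk w (fsm (op_pow Q (M + N)) 1 x)" if w: "w \<in> X0" and F: "F_stalk w (fsm (op_pow Q N) 1 x)" for w N M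
  proof -
    have "F_stalk w (fsm (op_pow Q M) 1 (fsm (op_pow Q N) 1 x))"
      using F_stalk_smult[OF sub[OF w] F] regX0[OF w, of "op_pow Q M"] Q by simp
    then show ?thesis
      using fsm_mult[OF xK, of "op_pow Q M" 1 "op_pow Q N" 1] Q by (simp add: op_pow_add fraction_def)
  qed
  have "1 \<in> I"
  proof (rule affine_cover)
    show "I \<subseteq> B" "0 \<in> I" by (auto simp: I_def)
    show "P + R \<in> I" if "P \<in> I" "R \<in> I" for P R
    proof -
      obtain M where M: "P \<in> B" "\<forall>w\<in>aff P. F_stalk w (fsm (op_pow Q M) 1 x)" using \<open>P \<in> I\<close> by (auto simp: I_def)
      obtain N where N: "R \<in> B" "\<forall>w\<in>aff R. F_stalk w (fsm (op_pow Q N) 1 x)" using \<open>R \<in> I\<close> by (auto simp: I_def)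
      have "F_stalk w (fsm (op_pow Q (M + N)) 1 x)" if "w \<in> aff (P + R)" for w
      proof -
        have w: "w \<in> X0" using aff_X0[of "P + R"] that M N by auto
        consider "w \<in> aff P" | "w \<in> aff R" using aff_add[OF M(1) N(1)] \<open>w \<in> aff (P + R)\<close> by blast
        then show ?thesis using more[OF w, of N M] more[OF w, of M N] M N by cases (auto simp: add.commute)
      qed
      then show ?thesis using M N unfolding I_def by auto
    qed
    show "P \<star> R \<in> I" if "P \<in> I" "R \<in> B" for P R using that aff_mult by (auto simp: I_def)
    show "\<exists>R\<in>I. z \<in> aff R" if z: "z \<in> X0" for z
    proof -
      obtain V n \<sigma> where V: "is_open X V" "z \<in> V" "\<forall>i<n. \<sigma> i \<in> Fs V" "locally_generated_by X F V n \<sigma>"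
        by (rule finite_type[OF sub[OF z]])
      obtain g where g: "g \<in> B" "g \<noteq> 0" "z \<in> aff g" "aff g \<subseteq> V" by (rule aff_base[OF V(1,2) z])
      have neV: "V \<noteq> {}" using V by auto
      \<comment> \<open>The fraction x is appended to the images of the generators as entry n, to
        give all of them a common denominator C.\<close>
      define u where "u i = (if i < n then psi V (\<sigma> i) else x)" for i
      have uK: "u i \<in> FK" if "i < Suc n" for i using psi_FK[OF V(1) neV] V(3) xK by (auto simp: u_def)
      obtain h C where h: "C \<in> B" "C \<noteq> 0" "\<forall>i<Suc n. u i = fr (h i) C" by (rule FK_common_finite[OF uK])
      have hs: "psi V (\<sigma> i) = fr (h i) C" if "i < n" for i using h(3) that by (auto simp: u_def less_Suc_eq)
      have hx: "x = fr (h n) C" using h(3) by (auto simp: u_def)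
      \<comment> \<open>The R such that R x is a combination of the generators with coefficients in
        B. Locally on \<open>aff (g \<star> Q)\<close>, where both x and the generators are defined,
        such R exist; so a power of g Q lies in J.\<close>
      define J where "J = {R \<in> B. \<exists>A. (\<forall>i<n. A i \<in> B) \<and> h n \<diamondop> R = (\<Sum>i<n. h i \<diamondop> A i)}"
      have JI: "P \<in> J" if "P \<in> B" "\<forall>i<n. A i \<in> B" "h n \<diamondop> P = (\<Sum>i<n. h i \<diamondop> A i)" for P A
        unfolding J_def using that by (intro CollectI conjI exI[of _ A])
      obtain N where N: "op_pow (g \<star> Q) N \<in> J"
      proof (rule nullstellensatz[of J "g \<star> Q"])
        show "J \<subseteq> B" by (auto simp: J_def)
        show "0 \<in> J" by (auto simp: J_def intro!: exI[of _ "\<lambda>_. 0"])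
        show "P + R \<in> J" if "P \<in> J" "R \<in> J" for P R
        proof -
          obtain A A' where A: "\<forall>i<n. A i \<in> B" "h n \<diamondop> P = (\<Sum>i<n. h i \<diamondop> A i)"
            "\<forall>i<n. A' i \<in> B" "h n \<diamondop> R = (\<Sum>i<n. h i \<diamondop> A' i)" using \<open>P \<in> J\<close> \<open>R \<in> J\<close> by (auto simp: J_def)
          then have "h n \<diamondop> (P + R) = (\<Sum>i<n. h i \<diamondop> (A i + A' i))" "\<forall>i<n. A i + A' i \<in> B"
            by (simp_all add: op_action_add_right sum.distrib)
          moreover have "P + R \<in> B" using that by (simp add: J_def)
          ultimately show ?thesis by (intro JI)
        qed
        show "P \<star> R \<in> J" if "P \<in> J" "R \<in> B" for P R
        proof -
          obtain A where A: "\<forall>i<n. A i \<in> B" "h n \<diamondop> P = (\<Sum>i<n. h i \<diamondop> A i)" using \<open>P \<in> J\<close> by (auto simp: J_def)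
          then have "h n \<diamondop> (P \<star> R) = (\<Sum>i<n. h i \<diamondop> (A i \<star> R))" "\<forall>i<n. A i \<star> R \<in> B"
            using \<open>R \<in> B\<close> by (simp_all add: op_action_mult op_action_sum_left)
          moreover have "P \<star> R \<in> B" using that by (simp add: J_def)
          ultimately show ?thesis by (intro JI)
        qed
        show "g \<star> Q \<in> B" using g Q by simp
        show "\<exists>R\<in>J. v \<in> aff R" if v: "v \<in> aff (g \<star> Q)" for v
        proof -
          have v': "v \<in> V" "v \<in> U" "v \<in> X0" using v aff_mult[OF g(1) Q(1)] g Q aff_X0[OF g(1)] by auto
          obtain m R A W where W: "is_open X W" "v \<in> W" "W \<subseteq> U \<inter> V" "W \<subseteq> basic m R" "R \<in> filt B m" "R \<noteq> 0"
             "tmon R m \<notin> v" "\<forall>i<n. A i \<in> filt B m"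
             "res U W s = (\<Oplus>\<^bsub>msec F W\<^esub>i\<in>{..<n}. sect W (A i) R \<odot>\<^bsub>msec F W\<^esub> res V W (\<sigma> i))"
            by (rule local_combination[OF V(1,3,4) U(1,4) v'(2,1)])
          have neW: "W \<noteq> {}" using W by auto
          have W0: "W \<subseteq> X0" using W U by auto
          have RB: "R \<in> B" using W by auto
          have AB: "A i \<in> B" if "i < n" for i using W(8) that by auto
          have sW: "res V W (\<sigma> i) \<in> Fs W" if "i < n" for i using V W that by (intro res_closed) auto
          have sWs: "res U W s \<in> Fs W" by (rule res_closed[OF U(1) W(1) _ U(4)]) (use W in auto)
          have "psi W (alg_act W R (res U W s)) = fsm R 1 x"
            using psi_smult[OF W(1) neW sWs regular_on_X0[OF W0 RB]] psi_res[OF U(1) W(1) _ neW U(4)] W U by auto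
          also have "\<dots> = fr (h n \<diamondop> R) C" using h RB hx by (simp add: frac_one)
          finally have 1: "psi W (alg_act W R (res U W s)) = fr (h n \<diamondop> R) C" .
          have "alg_act W R (res U W s) = (\<Oplus>\<^bsub>msec F W\<^esub>i\<in>{..<n}. alg_act W (A i) (res V W (\<sigma> i)))"
            unfolding W(9) using W W0 RB sW by (intro clear_denominator) (auto intro!: regular_on_basic[of _ m])
          moreover have "psi W (\<Oplus>\<^bsub>msec F W\<^esub>i\<in>{..<k}. alg_act W (A i) (res V W (\<sigma> i))) = fr (\<Sum>i<k. h i \<diamondop> A i) C" if "k \<le> n" for k
            using that
          proof (induction k)
            interpret W: Module.module "OX W" "msec F W" by (rule F_module[OF W(1)])
            case 0
            have "rep W \<zero>\<^bsub>msec F W\<^esub> 0 1"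
            proof -
              have o: "is_open X (W \<inter> X0)" "W \<inter> X0 \<subseteq> W" using W open_X0_Int by auto
              interpret W': Module.module "OX (W \<inter> X0)" "msec F (W \<inter> X0)" by (rule F_module[OF o(1)])
              interpret Y: Module.module "OX X0" "msec F X0" by (rule F_module) simp
              have "pre 0 = \<zero>\<^bsub>msec F X0\<^esub>"
              proof (rule pre_eqI)
                show "\<phi> \<zero>\<^bsub>msec F X0\<^esub> = 0" using phi_iso(2)[of "\<zero>\<^bsub>msec F X0\<^esub>" "\<zero>\<^bsub>msec F X0\<^esub>"] by simp
              qed simp
              then have "res X0 (W \<inter> X0) (pre 0) = \<zero>\<^bsub>msec F (W \<inter> X0)\<^esub>" using res_zero[of X0 "W \<inter> X0"] o by simp
              moreover have "alg_act (W \<inter> X0) 1 (res W (W \<inter> X0) \<zero>\<^bsub>msec F W\<^esub>) = \<zero>\<^bsub>msec F (W \<inter> X0)\<^esub>"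
                using res_zero[OF W(1) o] W'.smult_one[of "\<zero>\<^bsub>msec F (W \<inter> X0)\<^esub>"] sect_one[OF o(1)] by simp
              ultimately show ?thesis by (simp add: rep_def)
            qed
            then have "psi W \<zero>\<^bsub>msec F W\<^esub> = fr 0 1" by (intro psi_rep W neW) simp_all
            also have "\<dots> = fr 0 C" using h by (simp add: fr_eq_iff)
            finally show ?case by (simp add: W.M.finsum_empty)
          next
            interpret W: Module.module "OX W" "msec F W" by (rule F_module[OF W(1)])
            case (Suc k)
            have k: "k < n" "k \<le> n" using Suc.prems by auto
            let ?t = "\<lambda>i. alg_act W (A i) (res V W (\<sigma> i))"
            have tc: "?t i \<in> Fs W" if "i < n" for i by (rule alg_act_closed[OF W(1) W0 AB[OF that] sW[OF that]])
            have "finsum (msec F W) ?t {..<Suc k} = ?t k \<oplus>\<^bsub>msec F W\<^esub> finsum (msec F W) ?t {..<k}"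
              using tc Suc.prems by (intro finsum_lessThan_Suc W.M.abelian_monoid_axioms) auto
            moreover have "finsum (msec F W) ?t {..<k} \<in> Fs W" using tc k by (intro W.M.finsum_closed) auto
            moreover have "psi W (?t k) = fr (h k \<diamondop> A k) C"
              using psi_smult[OF W(1) neW sW[OF k(1)] regular_on_X0[OF W0 AB[OF k(1)]]]
                psi_res[OF V(1) W(1) _ neW, of "\<sigma> k"] W(3) V(3) k(1) hs[OF k(1)] h AB[OF k(1)] by (simp add: frac_one)
            ultimately show ?case
              using psi_add[OF W(1) neW tc[OF k(1)]] Suc.IH[OF k(2)] h by (simp add: add.commute)
          qed
          ultimately have "fr (h n \<diamondop> R) C = fr (\<Sum>i<n. h i \<diamondop> A i) C" using 1 by simp
          then have "h n \<diamondop> R = (\<Sum>i<n. h i \<diamondop> A i)" using h by (simp add: fr_eq_iff act_cancel)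
          then have "R \<in> J" using RB AB by (intro JI) auto
          moreover have "v \<in> aff R" using aff_iff[OF v'(3) W(5)] W(7) by simp
          ultimately show ?thesis by blast
        qed
      qed
      then obtain A where A: "\<forall>i<n. A i \<in> B" "h n \<diamondop> op_pow (g \<star> Q) N = (\<Sum>i<n. h i \<diamondop> A i)" by (auto simp: J_def)
      let ?g = "op_pow g N" and ?Q = "op_pow Q N"
      have gN: "?g \<in> B" "?g \<noteq> 0" "?Q \<in> B" using g Q pow_nonzero by auto
      \<comment> \<open>From (g Q)^N x = \<Sum> A_i \<sigma>_i one divides by g^N, which is
        invertible on \<open>aff g\<close>; hence Q^N x lies in the stalks there.\<close>
      have "F_stalk w (fsm ?Q 1 x)" if w: "w \<in> aff g" for w
      proof -
        have w': "w \<in> X0" "w \<in> V" using w aff_X0[OF g(1)] g(4) by auto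
        have "w \<in> aff ?g" using aff_pow[OF g(1)] w by blast
        then have r: "reg w B' ?g" if "B' \<in> B" for B'
        proof -
          let ?k = "max (Suc (degree ?g)) (degree B')"
          have m: "B' \<in> filt B ?k" "?g \<in> filt B ?k" using that gN by (auto intro: filt_degree)
          then have "tmon ?g ?k \<notin> w" using aff_iff[OF w'(1) m(2)] \<open>w \<in> aff ?g\<close> by simp
          then show ?thesis using frac_at_basic[OF m] by simp
        qed
        have sum: "F_stalk w (fr (\<Sum>i<k. h i \<diamondop> A i) (C \<star> ?g))" if "k \<le> n" for k
          using that
        proof (induction k)
          case 0
          have "fr 0 (C \<star> ?g) = fr 0 1" using h gN by (simp add: fr_eq_iff)
          then show ?case using F_stalk_fr[OF w'(1), of 0] by simp
        next
          case (Suc k)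
          have k: "k < n" "A k \<in> B" using Suc.prems A by auto
          have f: "fraction (A k) ?g" using k gN by (simp add: fraction_def)
          have "F_stalk w (psi V (\<sigma> k))" using V k w' by (intro F_stalkI) auto
          then have "F_stalk w (fsm (A k) ?g (psi V (\<sigma> k)))" by (rule F_stalk_smult[OF sub[OF w'(1)] _ f r[OF k(2)]])
          then have "F_stalk w (fr (h k \<diamondop> A k) (C \<star> ?g))" using hs[OF k(1)] h f by simp
          from F_stalk_add[OF this Suc.IH] show ?case using Suc.prems h gN by (simp add: add.commute)
        qed
        have "fsm ?Q 1 x = fr (h n \<diamondop> ?Q) C" using hx h gN by (simp add: frac_one)
        also have "\<dots> = fr (h n \<diamondop> ?Q \<diamondop> ?g) (C \<star> ?g)" using fr_cancel(1)[of C ?g "h n \<diamondop> ?Q"] h gN by simp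
        also have "h n \<diamondop> ?Q \<diamondop> ?g = h n \<diamondop> op_pow (g \<star> Q) N"
          using pow_mult_distrib[OF g(1) Q(1)] act_comm[OF gN(3,1)] by (simp add: op_action_mult)
        finally show ?thesis using sum[of n] A by simp
      qed
      then have "g \<in> I" using g unfolding I_def by blast
      then show ?thesis using g by blast
    qed
  qed
  then obtain N where N: "\<forall>w\<in>X0. F_stalk w (fsm (op_pow Q N) 1 x)" by (auto simp: I_def)
  obtain t where t: "t \<in> Fs X0" "psi X0 t = fsm (op_pow Q N) 1 x"
    by (rule psi_glue[OF open_X0 X0_nonempty]) (use N in auto)
  obtain f R where R: "R \<in> B" "R \<noteq> 0" "x = fr f R" by (rule FK_E[OF xK])
  have QN: "op_pow Q N \<in> B" "op_pow Q N \<noteq> 0" using Q pow_nonzero by auto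
  have "fr (f \<diamondop> op_pow Q N) R = fr (\<phi> t) 1" using psi_X0[OF t(1)] t(2) R QN by (simp add: frac_one)
  then have "f \<diamondop> op_pow Q N = \<phi> t \<diamondop> R" using R by (simp add: fr_eq_iff)
  then have "x = fr (\<phi> t) (op_pow Q N)" using R QN by (simp add: fr_eq_iff)
  moreover have "y \<in> aff (op_pow Q N)" using aff_pow[OF Q(1)] Q(3) by blast
  ultimately show ?thesis using in_stalk_X0[OF y] QN by blast
qed

end

context spectral begin

section \<open>The stalk at infinity\<close>

lemma reg_pinf:
  assumes "fraction A C" "degree A \<le> degree C"
  shows "reg pinf A C"
proof -
  have AC: "A \<in> B" "C \<in> B" "C \<noteq> 0" using assms by (auto simp: fraction_def)
  obtain n where n: "degree C = r * n" using r_dvd[OF AC(2)] by blast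
  then have "A \<in> filt B n" "C \<in> filt B n" "degree C = n * r" using AC assms by (auto simp: filt_def mult.commute)
  then show ?thesis using frac_at_basic[of A n C pinf] pinf(2)[of C n] AC by blast
qed

text \<open>A submodule of K over the local ring at infinity that contains H. The functions regular
  at infinity are the A/C with ord A \<le> ord C.\<close>

definition lattice :: "(complex poly \<times> diffop) set set \<Rightarrow> bool" where
  "lattice L \<longleftrightarrow> L \<subseteq> FK \<and> (\<forall>x\<in>L. \<forall>z\<in>L. fadd x z \<in> L) \<and>
     (\<forall>x\<in>L. \<forall>A C. fraction A C \<and> degree A \<le> degree C \<longrightarrow> fsm A C x \<in> L) \<and>
     (\<forall>f. degree f < r \<longrightarrow> fr f 1 \<in> L)"

lemma latticeD:
  assumes "lattice L"
  shows "x \<in> L \<Longrightarrow> x \<in> FK" "x \<in> L \<Longrightarrow> z \<in> L \<Longrightarrow> fadd x z \<in> L"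
    "x \<in> L \<Longrightarrow> fraction A C \<Longrightarrow> degree A \<le> degree C \<Longrightarrow> fsm A C x \<in> L"
    "degree f < r \<Longrightarrow> fr f 1 \<in> L"
  using assms unfolding lattice_def by auto

text \<open>The remainder term h/Q belongs to the maximal ideal at infinity times the model's stalk.
  The last clause therefore says that this stalk is H plus that product, which is the input for
  Nakayama's lemma.\<close>

lemma pinf_division:
  assumes "Q \<in> B" "Q \<noteq> 0"
  obtains g h where "fr f Q = fadd (fr g 1) (fr h Q)" "h = 0 \<or> degree h < degree Q"
    "degree f < degree Q + r \<Longrightarrow> degree g < r"
proof -
  obtain g h where gh: "f = g \<diamondop> Q + h" "h = 0 \<or> degree h < degree Q" by (rule act_division[OF assms])
  have "fr g 1 = fr (g \<diamondop> Q) Q" using assms by (simp add: fr_eq_iff)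
  then have 1: "fr f Q = fadd (fr g 1) (fr h Q)" using gh assms by simp
  have "degree g < r" if "degree f < degree Q + r"
  proof (cases "g = 0")
    case False
    have "degree (g \<diamondop> Q) = degree g + degree Q" using act_nonzero(2)[OF assms False] .
    moreover have "g \<diamondop> Q = f - h" using gh by simp
    moreover have "degree (f - h) < degree Q + r"
      using that gh(2) r_pos by (intro degree_diff_less) auto
    ultimately show ?thesis by simp
  qed simp
  then show thesis using 1 gh(2) that by blast
qed

text \<open>Nakayama's lemma for one additional generator.\<close>

lemma lattice_absorb:
  assumes L: "lattice L" and e: "in_stalk pinf e"
    and gen: "\<And>x. in_stalk pinf x \<Longrightarrow> \<exists>l\<in>L. \<exists>A C. fraction A C \<and> degree A \<le> degree C \<and> x = fadd l (fsm A C e)"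
  shows "e \<in> L"
proof -
  have eK: "e \<in> FK" using in_stalk_FK[OF pinf(1) e] .
  obtain f Q where f: "Q \<in> B" "Q \<noteq> 0" "e = fr f Q" by (rule FK_E[OF eK])
  have df: "degree f < degree Q + r" using e in_stalk_pinf[OF f(1,2)] f by simp
  obtain g h where gh: "fr f Q = fadd (fr g 1) (fr h Q)" "h = 0 \<or> degree h < degree Q" "degree g < r"
    by (rule pinf_division[OF f(1,2), of f]) (use df in auto)
  \<comment> \<open>The quotient C1/A1 has order -r and is a local parameter. Dividing h/Q by it
    keeps the fraction in the stalk, so the hypothesis applies to the result x'.\<close>
  obtain A1 C1 where AC: "A1 \<in> B" "C1 \<in> B" "A1 \<noteq> 0" "C1 \<noteq> 0" "degree A1 = degree C1 + r"
    by (rule degree_difference)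
  define x' where "x' = fr (h \<diamondop> A1) (Q \<star> C1)"
  have "degree (h \<diamondop> A1) < degree (Q \<star> C1) + r"
    using degree_op_action_le[of h A1] gh(2) AC f r_pos by (auto simp: op_mult_nonzero)
  then have "in_stalk pinf x'" unfolding x'_def using in_stalk_pinf f AC by simp
  then obtain l A C where l: "l \<in> L" "fraction A C" "degree A \<le> degree C" "x' = fadd l (fsm A C e)"
    using gen by blast
  have lK: "l \<in> FK" using latticeD(1)[OF L l(1)] .
  have m: "A \<in> B" "C \<in> B" "C \<noteq> 0" using l(2) by (auto simp: fraction_def)
  obtain l' f' T where T: "T \<in> B" "T \<noteq> 0" "l = fr l' T" "e = fr f' T" by (rule FK_common[OF lK eK])
  \<comment> \<open>With x' = l + (A/C) e, the equation e = g + (C1/A1) x' becomes (1 -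
    (A/C)(C1/A1)) e = g + (C1/A1) l. The element D is the bracket cleared of denominators. It has
    the order of C A1, so the bracket is a unit and e lies in L.\<close>
  let ?D = "C \<star> A1 - A \<star> C1"
  have dCA: "degree (C \<star> A1) = degree C + degree A1" using m AC by (simp add: op_mult_nonzero)
  have less: "degree (A \<star> C1) < degree (C \<star> A1)"
    using op_mult_degree_le[of A C1] l(3) AC dCA r_pos by linarith
  then have D: "degree ?D = degree (C \<star> A1)"
    using degree_add_eq_left[of "- (A \<star> C1)" "C \<star> A1"] by simp
  have D0: "?D \<noteq> 0" "?D \<in> B" using less m AC by auto
  have x'eq: "x' = fr (l' \<diamondop> C + f' \<diamondop> A) (T \<star> C)"
  proof -
    have "l = fr (l' \<diamondop> C) (T \<star> C)" using fr_cancel(1)[of T C l'] T m by simp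
    moreover have "fsm A C e = fr (f' \<diamondop> A) (T \<star> C)" using T l(2) by simp
    ultimately show ?thesis using l(4) fadd_fr[of "T \<star> C" "l' \<diamondop> C" "f' \<diamondop> A"] T m by simp
  qed
  have hx: "fr h Q = fsm C1 A1 x'"
  proof -
    have "Q \<star> C1 \<star> A1 = Q \<star> (A1 \<star> C1)" using mult_comm[of C1 A1] AC by (simp add: op_mult_assoc)
    moreover have "fsm C1 A1 x' = fr (h \<diamondop> A1 \<diamondop> C1) (Q \<star> C1 \<star> A1)"
      unfolding x'_def using f AC by (simp add: fraction_def)
    ultimately show ?thesis
      using fr_cancel(1)[of Q "A1 \<star> C1" h] f AC by (simp add: op_action_mult)
  qed
  have "fr h Q = fr ((l' \<diamondop> C + f' \<diamondop> A) \<diamondop> C1) (T \<star> C \<star> A1)"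
    unfolding hx x'eq using T m AC by (simp add: fraction_def)
  moreover have "fr g 1 = fr (g \<diamondop> (T \<star> C \<star> A1)) (T \<star> C \<star> A1)" using T m AC by (simp add: fr_eq_iff)
  moreover have "fr f' T = fr (f' \<diamondop> (C \<star> A1)) (T \<star> C \<star> A1)"
    using fr_cancel(1)[of T "C \<star> A1" f'] T m AC by (simp add: op_mult_assoc)
  moreover have "e = fadd (fr g 1) (fr h Q)" using f gh by simp
  ultimately have "fr (f' \<diamondop> (C \<star> A1)) (T \<star> C \<star> A1) =
     fr (g \<diamondop> (T \<star> C \<star> A1) + (l' \<diamondop> C + f' \<diamondop> A) \<diamondop> C1) (T \<star> C \<star> A1)"
    using T m AC by simp
  then have "f' \<diamondop> (C \<star> A1) = g \<diamondop> (T \<star> C \<star> A1) + (l' \<diamondop> C + f' \<diamondop> A) \<diamondop> C1"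
    using T m AC by (simp add: fr_eq_iff act_cancel)
  then have fD: "f' \<diamondop> ?D = g \<diamondop> (T \<star> (C \<star> A1)) + l' \<diamondop> (C \<star> C1)"
    by (simp add: op_action_diff_right op_action_add_left op_action_mult[symmetric] op_mult_assoc)
  have "e = fr (f' \<diamondop> ?D) (T \<star> ?D)" using fr_cancel(1)[of T ?D f'] T D0 by simp
  also have "\<dots> = fadd (fr (g \<diamondop> (T \<star> (C \<star> A1))) (T \<star> ?D)) (fr (l' \<diamondop> (C \<star> C1)) (T \<star> ?D))"
    unfolding fD using T D0 by simp
  also have "fr (l' \<diamondop> (C \<star> C1)) (T \<star> ?D) = fsm (C \<star> C1) ?D l"
    using T D0 m AC by (simp add: fraction_def)
  also have "fr (g \<diamondop> (T \<star> (C \<star> A1))) (T \<star> ?D) = fsm (C \<star> A1) ?D (fr g 1)"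
  proof -
    have "fr (g \<diamondop> (C \<star> A1)) ?D = fr (g \<diamondop> (C \<star> A1) \<diamondop> T) (T \<star> ?D)"
      using fr_cancel(2)[of ?D T] T D0 by simp
    also have "g \<diamondop> (C \<star> A1) \<diamondop> T = g \<diamondop> (T \<star> (C \<star> A1))"
      using mult_comm[of "C \<star> A1" T] T m AC by (simp add: op_action_mult[symmetric])
    finally show ?thesis using D0 m AC by (simp add: fraction_def)
  qed
  finally have "e = fadd (fsm (C \<star> A1) ?D (fr g 1)) (fsm (C \<star> C1) ?D l)" .
  moreover have "fsm (C \<star> A1) ?D (fr g 1) \<in> L"
    using D D0 m AC by (intro latticeD(3)[OF L] latticeD(4)[OF L] gh(3)) (auto simp: fraction_def)
  moreover have "fsm (C \<star> C1) ?D l \<in> L"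
    using D D0 m AC l op_mult_degree_le[of C C1] dCA by (intro latticeD(3)[OF L]) (auto simp: fraction_def)
  ultimately show ?thesis using latticeD(2)[OF L] by metis
qed

text \<open>Adjoins one generator, so that \<open>lattice_absorb\<close> can later remove the
  generators one at a time.\<close>

lemma lattice_extend:
  assumes L: "lattice L" and e: "in_stalk pinf e"
  defines "L' \<equiv> {fadd l (fsm A C e) | l A C. l \<in> L \<and> fraction A C \<and> degree A \<le> degree C}"
  shows "lattice L'" "L \<subseteq> L'"
proof -
  interpret FK: abelian_group FKgrp by (rule FK_abelian)
  have eK: "e \<in> FK" using in_stalk_FK[OF pinf(1) e] .
  have f0: "fraction 0 1" by (simp add: fraction_def)
  have e0: "fsm 0 1 e = fr 0 1"
  proof -
    obtain f Q where "Q \<in> B" "Q \<noteq> 0" "e = fr f Q" by (rule FK_E[OF eK])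
    then show ?thesis using f0 by (simp add: fr_eq_zero_iff)
  qed
  have sub: "l \<in> L'" if l: "l \<in> L" for l
  proof -
    have "l = fadd l (fsm 0 1 e)" using FK.r_zero[of l] latticeD(1)[OF L l] e0 by simp
    moreover have "degree (0 :: diffop) \<le> degree (1 :: diffop)" by simp
    ultimately show ?thesis unfolding L'_def mem_Collect_eq using l f0 by (intro exI conjI)
  qed
  then show "L \<subseteq> L'" by blast
  show "lattice L'"
    unfolding lattice_def
  proof (intro conjI ballI allI impI)
    show "L' \<subseteq> FK" using latticeD(1)[OF L] eK by (auto simp: L'_def)
    show "fr f 1 \<in> L'" if "degree f < r" for f using latticeD(4)[OF L that] sub by blast
    fix x assume "x \<in> L'"
    then obtain l A C where x: "x = fadd l (fsm A C e)" "l \<in> L" "fraction A C" "degree A \<le> degree C" by (auto simp: L'_def)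
    have m: "A \<in> B" "C \<in> B" "C \<noteq> 0" "l \<in> FK" using x latticeD(1)[OF L] by (auto simp: fraction_def)
    {
      fix z assume "z \<in> L'"
      then obtain l' A' C' where z: "z = fadd l' (fsm A' C' e)" "l' \<in> L" "fraction A' C'" "degree A' \<le> degree C'" by (auto simp: L'_def)
      have m': "A' \<in> B" "C' \<in> B" "C' \<noteq> 0" "l' \<in> FK" using z latticeD(1)[OF L] by (auto simp: fraction_def)
      have mem: "fsm A C e \<in> carrier FKgrp" "fsm A' C' e \<in> carrier FKgrp" "l \<in> carrier FKgrp" "l' \<in> carrier FKgrp"
        using x(3) z(3) m m' eK by auto
      have "(l \<oplus>\<^bsub>FKgrp\<^esub> fsm A C e) \<oplus>\<^bsub>FKgrp\<^esub> (l' \<oplus>\<^bsub>FKgrp\<^esub> fsm A' C' e) =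
         (l \<oplus>\<^bsub>FKgrp\<^esub> l') \<oplus>\<^bsub>FKgrp\<^esub> (fsm A C e \<oplus>\<^bsub>FKgrp\<^esub> fsm A' C' e)"
        using mem by (simp only: FK.a_ac FK.a_closed)
      then have "fadd x z = fadd (fadd l l') (fadd (fsm A C e) (fsm A' C' e))"
        unfolding x(1) z(1) FKgrp_simps .
      also have "fadd (fsm A C e) (fsm A' C' e) = fsm (A \<star> C' + A' \<star> C) (C \<star> C') e"
        using fsm_add[OF eK x(3) z(3)] by simp
      finally have "fadd x z = fadd (fadd l l') (fsm (A \<star> C' + A' \<star> C) (C \<star> C') e)" .
      moreover have "degree (A \<star> C' + A' \<star> C) \<le> degree (C \<star> C')"
        using op_mult_degree_le[of A C'] op_mult_degree_le[of A' C] x(4) z(4) m m'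
        by (intro degree_add_le) (auto simp: op_mult_nonzero)
      ultimately show "fadd x z \<in> L'"
        unfolding L'_def using latticeD(2)[OF L x(2) z(2)] frac_add[OF x(3) z(3)] by blast
    next
      fix A' C' assume A': "fraction A' C' \<and> degree A' \<le> degree C'"
      then have m': "A' \<in> B" "C' \<in> B" "C' \<noteq> 0" by (auto simp: fraction_def)
      have "fsm A' C' x = fadd (fsm A' C' l) (fsm (A' \<star> A) (C' \<star> C) e)"
        using fsm_fadd[of l "fsm A C e" A' C'] fsm_mult[OF eK, of A' C' A C] x A' m eK by simp
      moreover have "degree (A' \<star> A) \<le> degree (C' \<star> C)"
        using op_mult_degree_le[of A' A] x(4) A' m m' by (auto simp: op_mult_nonzero)
      ultimately show "fsm A' C' x \<in> L'"
        unfolding L'_def using latticeD(3)[OF L x(2)] frac_mult[of A' C' A C] x(3) A' by blast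
    }
  qed
qed

text \<open>The stalk is generated by finitely many fractions \<partial>^i / E. Adding all of them
  to L gives a chain of lattices whose last member contains the stalk; Nakayama's lemma then shows,
  downwards along the chain, that each generator already lies in the previous member.\<close>

lemma lattice_stalk:
  assumes L: "lattice L" and x: "in_stalk pinf x"
  shows "x \<in> L"
proof -
  obtain E d where E: "E \<in> B" "E \<noteq> 0" "d > 0" "degree E = d * r" "E \<in> filt B d" by (rule elliptic_filt)
  let ?n = "Suc d * r"
  define e where "e i = fr (Polynomial.monom 1 i) E" for i
  have e: "in_stalk pinf (e i)" if "i < ?n" for i
    unfolding e_def using that in_stalk_pinf[OF E(1,2)] E by (simp add: degree_monom_eq)
  define step where "step K i = {fadd l (fsm A C (e i)) | l A C. l \<in> K \<and> fraction A C \<and> degree A \<le> degree C}" for K i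
  define T where "T = rec_nat L (\<lambda>i K. step K i)"
  have T0: "T 0 = L" and TS: "T (Suc i) = step (T i) i" for i by (simp_all add: T_def)
  have lat: "lattice (T i)" if "i \<le> ?n" for i
    using that
  proof (induction i)
    case (Suc i)
    then show ?case using lattice_extend(1)[of "T i" "e i"] e[of i] by (simp add: TS step_def)
  qed (simp add: T0 L)
  have all: "y \<in> T ?n" if y: "in_stalk pinf y" for y
  proof -
    obtain m f Q where Q: "Q \<in> filt B m" "tmon Q m \<notin> pinf" "Q \<in> B" "Q \<noteq> 0" "degree f < Suc m * r" "y = fr f Q"
      by (rule in_stalkE[OF pinf(1) y])
    have dQ: "degree Q = m * r" using pinf(2)[OF Q(1)] Q(2) by simp
    obtain d' where d': "d = Suc d'" using E(3) by (cases d) auto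
    \<comment> \<open>The same expansion as for finite type, with the elliptic operator itself as
      local unit at infinity.\<close>
    let ?T = "op_pow Q d' \<star> E"
    let ?Q = "Q \<star> ?T"
    have T: "?T \<in> filt B (d' * m + d)" "?T \<noteq> 0" "?T \<in> B"
      using filt_mult[OF filt_pow[OF Q(1)] E(5)] Q E pow_nonzero by auto
    have dT: "degree ?T = (d' * m + d) * r"
      using Q E pow_nonzero degree_pow dQ by (simp add: op_mult_nonzero add_mult_distrib)
    have QT: "?Q \<noteq> 0" "?Q \<in> B" "degree ?Q = (d * m + d) * r"
      using Q T dT dQ d' by (auto simp: op_mult_nonzero add_mult_distrib)
    have "degree (f \<diamondop> ?T) < Suc (m + (d' * m + d)) * r" by (rule degree_act_filt[OF T(1) Q(5)])
    then have "degree (f \<diamondop> ?T) < Suc (d * m + d) * r" using d' by (simp add: add_ac)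
    then obtain c where c: "\<forall>i. c i \<in> filt B (d * m)" "f \<diamondop> ?T = (\<Sum>i<?n. Polynomial.monom 1 i \<diamondop> c i)"
      using spectral_module_generators[OF E(1,2,4,5)] by blast
    have cB: "c i \<in> B" for i using c(1) by auto
    have fc: "fraction (c i \<star> E) ?Q" for i using cB E QT by (simp add: fraction_def)
    have dc: "degree (c i \<star> E) \<le> degree ?Q" for i
      using filt_mult[of "c i" "d * m" E d] c(1) E(5) QT(3) by (simp add: filt_def)
    have gen: "fsm (c i \<star> E) ?Q (e i) = fr (Polynomial.monom 1 i \<diamondop> c i) ?Q" for i
    proof -
      have "fsm (c i \<star> E) ?Q (e i) = fr (Polynomial.monom 1 i \<diamondop> c i \<diamondop> E) (E \<star> ?Q)"
        unfolding e_def using E fc by (simp add: op_action_mult)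
      then show ?thesis using fr_cancel(2)[OF QT(2,1) E(1,2)] by simp
    qed
    have "fr (\<Sum>i<k. Polynomial.monom 1 i \<diamondop> c i) ?Q \<in> T k" if "k \<le> ?n" for k
      using that
    proof (induction k)
      case 0
      have "fr 0 ?Q = fr 0 1" using QT by (simp add: fr_eq_iff)
      then show ?case using latticeD(4)[OF L, of 0] T0 by simp
    next
      case (Suc k)
      have "fr (\<Sum>i<Suc k. Polynomial.monom 1 i \<diamondop> c i) ?Q =
         fadd (fr (\<Sum>i<k. Polynomial.monom 1 i \<diamondop> c i) ?Q) (fsm (c k \<star> E) ?Q (e k))"
        unfolding gen using QT by simp
      moreover have "fr (\<Sum>i<k. Polynomial.monom 1 i \<diamondop> c i) ?Q \<in> T k" using Suc by simp
      ultimately show ?case unfolding TS step_def mem_Collect_eq using fc[of k] dc[of k] by (intro exI conjI)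
    qed
    from this[of ?n] have "fr (f \<diamondop> ?T) ?Q \<in> T ?n" using c(2) by simp
    moreover have "fr (f \<diamondop> ?T) ?Q = y" using fr_cancel(1)[of Q ?T f] Q T by simp
    ultimately show ?thesis by simp
  qed
  \<comment> \<open>Descending induction: k generators have been removed from the end of the
    chain.\<close>
  have "\<forall>y. in_stalk pinf y \<longrightarrow> y \<in> T (?n - k)" if "k \<le> ?n" for k
    using that
  proof (induction k)
    case 0
    then show ?case using all by simp
  next
    case (Suc k)
    let ?i = "?n - Suc k"
    have i: "?i < ?n" "Suc ?i = ?n - k" using Suc.prems by auto
    have IH: "\<forall>y. in_stalk pinf y \<longrightarrow> y \<in> step (T ?i) ?i" using Suc i TS[of ?i] by simp
    have ei: "e ?i \<in> T ?i"
    proof (rule lattice_absorb[OF lat e[OF i(1)]])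
      show "?i \<le> ?n" by simp
      show "\<exists>l\<in>T ?i. \<exists>A C. fraction A C \<and> degree A \<le> degree C \<and> y = fadd l (fsm A C (e ?i))" if "in_stalk pinf y" for y
        using IH that unfolding step_def by blast
    qed
    have li: "lattice (T ?i)" using lat by simp
    show ?case
    proof (intro allI impI)
      fix y assume "in_stalk pinf y"
      then obtain l A C where "l \<in> T ?i" "fraction A C" "degree A \<le> degree C" "y = fadd l (fsm A C (e ?i))"
        using IH unfolding step_def by blast
      then show "y \<in> T ?i" using latticeD(2,3)[OF li] ei by blast
    qed
  qed
  from this[of ?n] show ?thesis using x T0 by simp
qed

end

section \<open>Identification of all stalks and uniqueness of the pair\<close>

context spectral_sheaf begin

lemma global_iso: "bij_betw (\<lambda>s. \<phi> (res pts X0 s)) (Fs pts) {f. degree f < r}"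
proof -
  have "mod_iso complex_ring (global_sections B F) (low_space r) (\<lambda>s. \<phi> (res (whole X) X0 s))"
    using pair by (simp add: spectral_pair_def)
  then show ?thesis
    by (simp add: mod_iso_def low_space_carrier global_sections_def restrict_scalars_def)
qed

lemma psi_pts:
  assumes s: "s \<in> Fs pts"
  shows "psi pts s = fr (\<phi> (res pts X0 s)) 1" "degree (\<phi> (res pts X0 s)) < r"
proof -
  have "res pts X0 s \<in> Fs X0" using s X0_sub_pts by (intro res_closed) auto
  then show "psi pts s = fr (\<phi> (res pts X0 s)) 1"
    using psi_res[OF open_pts open_X0 X0_sub_pts X0_nonempty s] psi_X0 by simp
  show "degree (\<phi> (res pts X0 s)) < r" using global_iso s unfolding bij_betw_def by blast
qed

lemma F_stalk_pinf: "F_stalk pinf x \<longleftrightarrow> in_stalk pinf x"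
proof
  have lat: "lattice {x. F_stalk pinf x}"
    unfolding lattice_def
  proof (intro conjI ballI allI impI)
    show "{x. F_stalk pinf x} \<subseteq> FK" using F_stalk_FK by auto
    show "fadd x z \<in> {x. F_stalk pinf x}" if "x \<in> {x. F_stalk pinf x}" "z \<in> {x. F_stalk pinf x}" for x z
      using F_stalk_add that by simp
    show "fsm A C x \<in> {x. F_stalk pinf x}" if "x \<in> {x. F_stalk pinf x}" "fraction A C \<and> degree A \<le> degree C" for x A C
      using F_stalk_smult[OF pinf(1)] reg_pinf that by simp
    show "fr f 1 \<in> {x. F_stalk pinf x}" if "degree f < r" for f
    proof -
      have "f \<in> (\<lambda>s. \<phi> (res pts X0 s)) ` Fs pts" using global_iso that by (simp add: bij_betw_def)
      then obtain s where s: "s \<in> Fs pts" "f = \<phi> (res pts X0 s)" by (rule imageE)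
      have "F_stalk pinf (psi pts s)" by (rule F_stalkI[OF open_pts pinf(1) s(1)])
      then show ?thesis using psi_pts(1)[OF s(1)] s(2) by simp
    qed
  qed
  show *: "in_stalk pinf x \<Longrightarrow> F_stalk pinf x" for x using lattice_stalk[OF lat] by simp
  assume x: "F_stalk pinf x"
  obtain f Q where f: "Q \<in> B" "Q \<noteq> 0" "x = fr f Q" by (rule FK_E[OF F_stalk_FK[OF x]])
  obtain g h where gh: "fr f Q = fadd (fr g 1) (fr h Q)" "h = 0 \<or> degree h < degree Q"
    by (rule pinf_division[OF f(1,2), of f])
  have h: "in_stalk pinf (fr c Q)" if "c = h \<or> c = - h" for c
    using in_stalk_pinf[OF f(1,2), of c] gh(2) that r_pos by auto
  \<comment> \<open>Since h/Q lies in the model's stalk, which is already known to be contained in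
    the stalk of F, subtracting it leaves a polynomial g in the stalk of F at infinity. It lies in
    the stalks over X0 as well, so g is a global section and its degree is below r.\<close>
  have "F_stalk pinf (fadd x (fr (- h) Q))" using F_stalk_add[OF x *] h by simp
  moreover have "fadd x (fr (- h) Q) = fr g 1"
  proof -
    have "fr g 1 = fr (g \<diamondop> Q) Q" using f by (simp add: fr_eq_iff)
    then show ?thesis using gh(1) f by simp
  qed
  ultimately have g: "F_stalk pinf (fr g 1)" by simp
  obtain s where s: "s \<in> Fs pts" "psi pts s = fr g 1"
  proof (rule psi_glue[OF open_pts _ , of "fr g 1"])
    show "pts \<noteq> {}" using pinf(1) by blast
    show "F_stalk y (fr g 1)" if "y \<in> pts" for y using pts_cases[OF that] g F_stalk_fr by metis
  qed
  then have "degree g < r" using psi_pts[OF s(1)] by (simp add: fr_eq_iff)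
  then have "in_stalk pinf (fr g 1)" using in_stalk_pinf[of 1 g] by simp
  then show "in_stalk pinf x" using in_stalk_add[OF pinf(1) _ h[of h]] gh(1) f by simp
qed

lemma F_stalk_iff: "y \<in> pts \<Longrightarrow> F_stalk y x \<longleftrightarrow> in_stalk y x"
  by (erule pts_cases) (auto simp: F_stalk_pinf intro: F_stalk_X0I F_stalk_X0D)

lemma psi_bij:
  assumes U: "is_open X U" "U \<noteq> {}"
  shows "bij_betw (psi U) (Fs U) (F0_carrier U)"
  unfolding bij_betw_def
proof
  note sub = open_subset_pts[OF U(1)]
  show "inj_on (psi U) (Fs U)" using psi_inj[OF U] by (auto intro: inj_onI)
  show "psi U ` Fs U = F0_carrier U"
  proof (intro equalityI subsetI)
    fix x assume "x \<in> psi U ` Fs U"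
    then obtain s where s: "s \<in> Fs U" "x = psi U s" by blast
    show "x \<in> F0_carrier U"
    proof (rule F0_carrierI[OF _ _ U(2)])
      show "x \<in> FK" using psi_FK[OF U s(1)] s by simp
      show "in_stalk q x" if "q \<in> U" for q
        using F_stalk_iff F_stalkI[OF U(1) that s(1)] s(2) sub that by blast
    qed
  next
    fix x assume x: "x \<in> F0_carrier U"
    obtain s where "s \<in> Fs U" "psi U s = x"
      by (rule psi_glue[OF U, of x]) (use F0_carrierD(2)[OF x sub] F_stalk_iff sub in auto)
    then show "x \<in> psi U ` Fs U" by blast
  qed
qed

text \<open>Over the empty set every pair would represent the only section, so \<open>psi\<close>
  yields no fraction there; the value is set to the zero section of the model.\<close>

definition Psi :: "spt set \<Rightarrow> 'm \<Rightarrow> (complex poly \<times> diffop) set" where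
  "Psi U s = (if U = {} then fr 0 1 else psi U s)"

lemma empty_sections: "Fs {} = {\<zero>\<^bsub>msec F {}\<^esub>}"
proof -
  interpret E: Module.module "OX {}" "msec F {}" by (rule F_module) simp
  show ?thesis using empty_unique E.M.zero_closed by blast
qed

theorem Psi_sheaf_iso: "sheaf_iso X F F0 Psi"
  unfolding sheaf_iso_def
proof (intro conjI allI impI ballI)
  fix U assume U: "is_open X U"
  interpret U: Module.module "OX U" "msec F U" by (rule F_module[OF U])
  interpret FK: abelian_group FKgrp by (rule FK_abelian)
  show "mod_iso (OX U) (msec F U) (msec F0 U) (Psi U)"
  proof (cases "U = {}")
    case True
    have "bij_betw (Psi {}) {\<zero>\<^bsub>msec F {}\<^esub>} {fr 0 1}" by (simp add: Psi_def bij_betw_def)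
    then show ?thesis
      using True FK.l_zero[of "fr 0 1"] by (simp add: mod_iso_def empty_sections Psi_def F0_smult_def)
  next
    case False
    have "Psi U (a \<odot>\<^bsub>msec F U\<^esub> s) = a \<odot>\<^bsub>msec F0 U\<^esub> Psi U s" if "a \<in> carrier (OX U)" "s \<in> Fs U" for a s
    proof -
      obtain A C where A: "a = sect U A C" "regular_on U A C" by (rule sectE[OF U \<open>a \<in> carrier (OX U)\<close>])
      then show ?thesis
        using psi_smult[OF U False that(2) A(2)] F0_smult_sect[OF U False A(2) psi_FK[OF U False that(2)]] False
        by (simp add: Psi_def)
    qed
    moreover have "Psi U = psi U" using False by (simp add: Psi_def fun_eq_iff)
    ultimately show ?thesis
      using psi_bij[OF U False] psi_add[OF U False] by (simp add: mod_iso_def)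
  qed
next
  fix U V s assume UV: "is_open X U \<and> is_open X V \<and> V \<subseteq> U" and s: "s \<in> Fs U"
  then show "Psi V (res U V s) = mres F0 U V (Psi U s)"
    using psi_res[of U V s] by (auto simp: Psi_def)
qed

lemma Psi_X0: "s \<in> Fs X0 \<Longrightarrow> Psi X0 s = fr (\<phi> s) 1"
  using psi_X0 X0_nonempty by (simp add: Psi_def)

end

lemma sheaf_iso_compose_inverse:
  fixes F :: "('p, 'r, 'm) mod_presheaf" and F' :: "('p, 'r, 'n) mod_presheaf" and H :: "('p, 'r, 'k) mod_presheaf"
  assumes F: "module_sheaf X F" and F': "module_sheaf X F'" and \<psi>: "sheaf_iso X F H \<psi>" and \<psi>': "sheaf_iso X F' H \<psi>'"
  shows "sheaf_iso X F F' (\<lambda>U s. inv_into (carrier (msec F' U)) (\<psi>' U) (\<psi> U s))"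
proof -
  define \<chi> where "\<chi> U s = inv_into (carrier (msec F' U)) (\<psi>' U) (\<psi> U s)" for U s
  have mF: "Module.module (rsec X U) (msec F U)" and mF': "Module.module (rsec X U) (msec F' U)" if "is_open X U" for U
    using F F' that by (simp_all add: module_sheaf_def)
  have iso: "mod_iso (rsec X U) (msec F U) (msec H U) (\<psi> U)" and iso': "mod_iso (rsec X U) (msec F' U) (msec H U) (\<psi>' U)"
    if "is_open X U" for U
    using \<psi> \<psi>' that by (simp_all add: sheaf_iso_def)
  have res: "\<psi> V (mres F U V s) = mres H U V (\<psi> U s)" if "is_open X U" "is_open X V" "V \<subseteq> U" "s \<in> carrier (msec F U)" for U V s
    using \<psi> that by (simp add: sheaf_iso_def)
  have res': "\<psi>' V (mres F' U V s) = mres H U V (\<psi>' U s)" if "is_open X U" "is_open X V" "V \<subseteq> U" "s \<in> carrier (msec F' U)" for U V s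
    using \<psi>' that by (simp add: sheaf_iso_def)
  have resF: "mres F U V s \<in> carrier (msec F V)" if "is_open X U" "is_open X V" "V \<subseteq> U" "s \<in> carrier (msec F U)" for U V s
  proof -
    have "mres F U V \<in> carrier (msec F U) \<rightarrow> carrier (msec F V)" using F that(1-3) by (simp add: module_sheaf_def)
    then show ?thesis using that(4) by blast
  qed
  have resF': "mres F' U V s \<in> carrier (msec F' V)" if "is_open X U" "is_open X V" "V \<subseteq> U" "s \<in> carrier (msec F' U)" for U V s
  proof -
    have "mres F' U V \<in> carrier (msec F' U) \<rightarrow> carrier (msec F' V)" using F' that(1-3) by (simp add: module_sheaf_def)
    then show ?thesis using that(4) by blast
  qed
  have chi: "\<chi> U s \<in> carrier (msec F' U)" "\<psi>' U (\<chi> U s) = \<psi> U s" if "is_open X U" "s \<in> carrier (msec F U)" for U s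
  proof -
    have "\<psi> U s \<in> \<psi>' U ` carrier (msec F' U)"
      using iso[OF that(1)] iso'[OF that(1)] that(2) unfolding mod_iso_def bij_betw_def by blast
    then show "\<chi> U s \<in> carrier (msec F' U)" "\<psi>' U (\<chi> U s) = \<psi> U s"
      unfolding \<chi>_def by (rule inv_into_into, rule f_inv_into_f)
  qed
  have chiI: "\<chi> U s = t" if "is_open X U" "s \<in> carrier (msec F U)" "t \<in> carrier (msec F' U)" "\<psi>' U t = \<psi> U s" for U s t
    using chi[OF that(1,2)] iso'[OF that(1)] that(3,4) unfolding mod_iso_def bij_betw_def inj_on_def by metis
  have "sheaf_iso X F F' \<chi>"
    unfolding sheaf_iso_def
  proof (intro conjI allI impI ballI)
    fix U assume U: "is_open X U"
    interpret F: Module.module "rsec X U" "msec F U" by (rule mF[OF U])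
    interpret F': Module.module "rsec X U" "msec F' U" by (rule mF'[OF U])
    note i = iso[OF U, unfolded mod_iso_def] and i' = iso'[OF U, unfolded mod_iso_def]
    have "bij_betw (\<chi> U) (carrier (msec F U)) (carrier (msec F' U))"
    proof -
      have "bij_betw (inv_into (carrier (msec F' U)) (\<psi>' U)) (carrier (msec H U)) (carrier (msec F' U))"
        using i' by (simp add: bij_betw_inv_into)
      then have "bij_betw (inv_into (carrier (msec F' U)) (\<psi>' U) \<circ> \<psi> U) (carrier (msec F U)) (carrier (msec F' U))"
        using i bij_betw_trans by blast
      then show ?thesis by (simp add: \<chi>_def[abs_def] comp_def)
    qed
    moreover have "\<chi> U (s \<oplus>\<^bsub>msec F U\<^esub> t) = \<chi> U s \<oplus>\<^bsub>msec F' U\<^esub> \<chi> U t" if "s \<in> carrier (msec F U)" "t \<in> carrier (msec F U)" for s t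
      using i i' chi[OF U] that by (intro chiI[OF U]) simp_all
    moreover have "\<chi> U (a \<odot>\<^bsub>msec F U\<^esub> s) = a \<odot>\<^bsub>msec F' U\<^esub> \<chi> U s" if "a \<in> carrier (rsec X U)" "s \<in> carrier (msec F U)" for a s
      using i i' chi[OF U] that by (intro chiI[OF U]) simp_all
    ultimately show "mod_iso (rsec X U) (msec F U) (msec F' U) (\<chi> U)" by (simp add: mod_iso_def)
  next
    fix U V s assume UV: "is_open X U \<and> is_open X V \<and> V \<subseteq> U" and s: "s \<in> carrier (msec F U)"
    then show "\<chi> V (mres F U V s) = mres F' U V (\<chi> U s)"
      using chi[of U s] res[of U V s] res'[of U V "\<chi> U s"] resF[of U V s] resF'[of U V "\<chi> U s"] by (intro chiI) auto
  qed
  then show ?thesis by (simp add: \<chi>_def[abs_def])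
qed

context spectral begin

text \<open>Both sheaves are identified with the model, and \<psi> is one identification followed by
  the inverse of the other. Over X0 they send s to \<phi> s / 1 and s' to \<phi>' s' / 1, which
  forces the compatibility with \<phi> and \<phi>'.\<close>

theorem spectral_pair_unique:
  assumes p: "spectral_pair B F \<phi>" and p': "spectral_pair B F' \<phi>'"
  shows "\<exists>\<psi>. sheaf_iso (curve B) F F' \<psi> \<and> (\<forall>s\<in>carrier (msec F X0). \<phi>' (\<psi> X0 s) = \<phi> s)"
proof -
  interpret p: spectral_sheaf B F \<phi> by unfold_locales (rule p)
  interpret p': spectral_sheaf B F' \<phi>' by unfold_locales (rule p')
  let ?\<psi> = "\<lambda>U s. inv_into (carrier (msec F' U)) (p'.Psi U) (p.Psi U s)"
  have iso: "sheaf_iso (curve B) F F' ?\<psi>"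
    by (rule sheaf_iso_compose_inverse[OF p.sheaf p'.sheaf p.Psi_sheaf_iso p'.Psi_sheaf_iso])
  have "\<phi>' (?\<psi> X0 s) = \<phi> s" if s: "s \<in> carrier (msec F X0)" for s
  proof -
    have b: "bij_betw (p'.Psi X0) (carrier (msec F' X0)) (F0_carrier X0)"
      using p'.Psi_sheaf_iso open_X0 by (simp add: sheaf_iso_def mod_iso_def)
    have "p.Psi X0 s \<in> F0_carrier X0" using p.Psi_X0[OF s] F0_X0 by auto
    then have im: "p.Psi X0 s \<in> p'.Psi X0 ` carrier (msec F' X0)" using b by (simp add: bij_betw_def)
    have "p'.Psi X0 (?\<psi> X0 s) = p.Psi X0 s" using f_inv_into_f[OF im] .
    moreover have "?\<psi> X0 s \<in> carrier (msec F' X0)" using inv_into_into[OF im] .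
    ultimately show ?thesis using p.Psi_X0[OF s] p'.Psi_X0 by (simp add: fr_eq_iff)
  qed
  then show ?thesis using iso by blast
qed

section \<open>First cohomology\<close>

definition fdiff :: "(complex poly \<times> diffop) set \<Rightarrow> (complex poly \<times> diffop) set \<Rightarrow> (complex poly \<times> diffop) set" where
  "fdiff x y = x \<ominus>\<^bsub>FKgrp\<^esub> y"

lemma fdiff_fr [simp]: "Q \<in> B \<Longrightarrow> Q \<noteq> 0 \<Longrightarrow> fdiff (fr f Q) (fr g Q) = fr (f - g) Q"
  by (simp add: fdiff_def a_minus_def FK_uminus)

lemma fdiff_FK [simp]: "x \<in> FK \<Longrightarrow> y \<in> FK \<Longrightarrow> fdiff x y \<in> FK"
  using FK_common[of x y] by (metis fdiff_fr fr_FK)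

lemma FK_common3:
  assumes "x \<in> FK" "y \<in> FK" "z \<in> FK"
  obtains f g h Q where "Q \<in> B" "Q \<noteq> 0" "x = fr f Q" "y = fr g Q" "z = fr h Q"
proof -
  have "(if i = 0 then x else if i = 1 then y else z) \<in> FK" if "i < 3" for i :: nat using assms by simp
  then obtain h R where *: "R \<in> B" "R \<noteq> 0" "\<forall>i<3::nat. (if i = 0 then x else if i = 1 then y else z) = fr (h i) R"
    by (rule FK_common_finite)
  show thesis
    using *(3)[rule_format, of 0] *(3)[rule_format, of 1] *(3)[rule_format, of 2]
    by (intro that[OF *(1,2), of "h 0" "h 1" "h 2"]) auto
qed

lemma fdiff_fadd:
  assumes "x \<in> FK" "y \<in> FK" "z \<in> FK"
  shows "fadd (fdiff x y) (fdiff y z) = fdiff x z" "fdiff (fdiff x z) (fdiff y z) = fdiff x y"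
    "fdiff (fadd x y) x = y" "fdiff x (fadd y z) = fdiff (fdiff x y) z"
    "fdiff (fdiff x y) (fdiff x z) = fdiff z y" "fadd (fdiff x y) y = x"
proof -
  obtain f g h Q where *: "Q \<in> B" "Q \<noteq> 0" "x = fr f Q" "y = fr g Q" "z = fr h Q" by (rule FK_common3[OF assms])
  then show "fadd (fdiff x y) (fdiff y z) = fdiff x z" "fdiff (fdiff x z) (fdiff y z) = fdiff x y"
    "fdiff (fadd x y) x = y" "fdiff x (fadd y z) = fdiff (fdiff x y) z"
    "fdiff (fdiff x y) (fdiff x z) = fdiff z y" "fadd (fdiff x y) y = x"
    by (simp_all add: algebra_simps)
qed

lemma fdiff_fdiff_swap:
  assumes "x \<in> FK" "y \<in> FK" "z \<in> FK" "w \<in> FK"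
  shows "fdiff (fdiff x y) (fdiff z w) = fdiff (fdiff x z) (fdiff y w)"
proof -
  obtain f g Q where 1: "Q \<in> B" "Q \<noteq> 0" "x = fr f Q" "y = fr g Q" by (rule FK_common[OF assms(1,2)])
  obtain h k R where 2: "R \<in> B" "R \<noteq> 0" "z = fr h R" "w = fr k R" by (rule FK_common[OF assms(3,4)])
  have QR: "Q \<star> R \<in> B" "Q \<star> R \<noteq> 0" using 1 2 by auto
  have "x = fr (f \<diamondop> R) (Q \<star> R)" "y = fr (g \<diamondop> R) (Q \<star> R)" "z = fr (h \<diamondop> Q) (Q \<star> R)" "w = fr (k \<diamondop> Q) (Q \<star> R)"
    using 1 2 fr_cancel by auto
  then show ?thesis using QR by (simp add: algebra_simps)
qed

lemma fsm_fdiff: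
  assumes "x \<in> FK" "y \<in> FK" "fraction A C"
  shows "fsm A C (fdiff x y) = fdiff (fsm A C x) (fsm A C y)"
proof -
  obtain f g Q where *: "Q \<in> B" "Q \<noteq> 0" "x = fr f Q" "y = fr g Q" by (rule FK_common[OF assms(1,2)])
  have "Q \<star> C \<in> B" "Q \<star> C \<noteq> 0" using * assms(3) by (auto simp: fraction_def)
  then show ?thesis using * assms(3) by (simp add: op_action_diff_left)
qed

lemma in_stalk_uminus:
  assumes "q \<in> pts" "Q \<in> B" "Q \<noteq> 0" "in_stalk q (fr f Q)"
  shows "in_stalk q (fr (- f) Q)"
proof -
  have "fraction (- 1) 1" by (simp add: fraction_def)
  moreover have "reg q (- 1) 1"
    using regular_on_uminus[OF regular_on_const[of "{q}" 1]] assms(1) by (simp add: regular_on_def)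
  ultimately have "in_stalk q (fsm (- 1) 1 (fr f Q))" using in_stalk_smult[OF assms(1,4)] by blast
  moreover have "fsm (- 1) 1 (fr f Q) = fr (- f) Q" using assms \<open>fraction (- 1) 1\<close> by (simp add: op_action_minus_right)
  ultimately show ?thesis by simp
qed

lemma in_stalk_fdiff:
  assumes q: "q \<in> pts" and x: "in_stalk q x" "in_stalk q y"
  shows "in_stalk q (fdiff x y)"
proof -
  obtain f g Q where *: "Q \<in> B" "Q \<noteq> 0" "x = fr f Q" "y = fr g Q"
    by (rule FK_common[OF in_stalk_FK[OF q x(1)] in_stalk_FK[OF q x(2)]])
  have "in_stalk q (fadd x (fr (- g) Q))"
    using x(2) * by (intro in_stalk_add[OF q x(1)] in_stalk_uminus[OF q *(1,2)]) simp
  then show ?thesis using * by simp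
qed

lemma reg_X0: "q \<in> X0 \<Longrightarrow> A \<in> B \<Longrightarrow> reg q A 1"
  using regular_on_X0[of "{q}" A] by (simp add: regular_on_def)

lemma in_stalk_X0_smult: "q \<in> X0 \<Longrightarrow> A \<in> B \<Longrightarrow> in_stalk q x \<Longrightarrow> in_stalk q (fsm A 1 x)"
  using in_stalk_smult[of q x A 1] X0_sub_pts reg_X0 by (auto simp: frac_one)

text \<open>The denominators of \<delta> form an ideal, and at each point of \<open>aff Q\<close>
  one of them does not vanish; so a power of Q is a denominator.\<close>

lemma clear_poles:
  assumes Q: "Q \<in> B" and d: "\<delta> \<in> FK" and loc: "\<And>q. q \<in> aff Q \<Longrightarrow> in_stalk q \<delta>"
  obtains N h where "fsm (op_pow Q N) 1 \<delta> = fr h 1"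
proof -
  define J where "J = {R \<in> B. \<exists>h. fsm R 1 \<delta> = fr h 1}"
  obtain f T where T: "T \<in> B" "T \<noteq> 0" "\<delta> = fr f T" by (rule FK_E[OF d])
  have J_iff: "R \<in> J \<longleftrightarrow> R \<in> B \<and> (\<exists>h. f \<diamondop> R = h \<diamondop> T)" for R
    using T by (auto simp: J_def frac_one fr_eq_iff)
  obtain N where "op_pow Q N \<in> J"
  proof (rule nullstellensatz[of J Q])
    show "J \<subseteq> B" by (auto simp: J_def)
    show "0 \<in> J" unfolding J_iff by (auto intro!: exI[of _ 0])
    show "P + R \<in> J" if "P \<in> J" "R \<in> J" for P R
    proof -
      obtain g h where "f \<diamondop> P = g \<diamondop> T" "f \<diamondop> R = h \<diamondop> T" using \<open>P \<in> J\<close> \<open>R \<in> J\<close> by (auto simp: J_iff)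
      then have "f \<diamondop> (P + R) = (g + h) \<diamondop> T" by (simp add: op_action_add_left op_action_add_right)
      then show ?thesis using that unfolding J_iff by auto
    qed
    show "P \<star> R \<in> J" if "P \<in> J" "R \<in> B" for P R
    proof -
      obtain g where "f \<diamondop> P = g \<diamondop> T" using \<open>P \<in> J\<close> by (auto simp: J_iff)
      then have "f \<diamondop> (P \<star> R) = (g \<diamondop> R) \<diamondop> T" using act_comm[OF T(1) that(2), of g] by (simp add: op_action_mult)
      then show ?thesis using that unfolding J_iff by auto
    qed
    show "Q \<in> B" by fact
    show "\<exists>R\<in>J. q \<in> aff R" if q: "q \<in> aff Q" for q
    proof -
      have "q \<in> X0" using q aff_X0[OF Q] by blast
      then obtain g R where R: "R \<in> B" "q \<in> aff R" "\<delta> = fr g R" using loc[OF q] in_stalk_X0 by blast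
      have "R \<noteq> 0" using R(2) by auto
      then have "f \<diamondop> R = g \<diamondop> T" using R T by (simp add: fr_eq_iff)
      then have "R \<in> J" using R J_iff by blast
      then show ?thesis using R by blast
    qed
  qed
  then show thesis using that by (auto simp: J_def)
qed

text \<open>The family \<beta> is a section over X0 of the constant sheaf K modulo the model, and
  \<kappa> lifts it. Near z the constant \<beta> z is a lift. Multiplying by a power of Q makes it a
  lift of Q^N \<beta> on all of X0. The R for which R \<beta> lifts form an ideal, which therefore
  contains 1.\<close>

lemma affine_splitting:
  assumes \<beta>: "\<And>w. w \<in> X0 \<Longrightarrow> \<beta> w \<in> FK"
    and loc: "\<And>z. z \<in> X0 \<Longrightarrow> \<exists>V. is_open X V \<and> z \<in> V \<and> (\<forall>w\<in>V \<inter> X0. in_stalk w (fdiff (\<beta> w) (\<beta> z)))"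
  obtains \<kappa> where "\<kappa> \<in> FK" "\<And>w. w \<in> X0 \<Longrightarrow> in_stalk w (fdiff (\<beta> w) \<kappa>)"
proof -
  have p: "w \<in> pts" if "w \<in> X0" for w using that X0_sub_pts by blast
  have nbhd: "\<exists>Q\<in>B. Q \<noteq> 0 \<and> z \<in> aff Q \<and> (\<forall>w\<in>aff Q. in_stalk w (fdiff (\<beta> w) (\<beta> z)))" if z: "z \<in> X0" for z
  proof -
    obtain V where V: "is_open X V" "z \<in> V" "\<forall>w\<in>V \<inter> X0. in_stalk w (fdiff (\<beta> w) (\<beta> z))" using loc[OF z] by (elim exE conjE)
    obtain Q where Q: "Q \<in> B" "Q \<noteq> 0" "z \<in> aff Q" "aff Q \<subseteq> V" by (rule aff_base[OF V(1,2) z])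
    then show ?thesis using V(3) aff_X0[OF Q(1)] by blast
  qed
  \<comment> \<open>A single power of Q must work at all points of X0 at once. So the set of R for
    which one N works on \<open>aff R\<close> is itself treated as an ideal and shown to contain
    1.\<close>
  have ann: "\<exists>N. \<forall>w\<in>X0. in_stalk w (fsm (op_pow Q N) 1 (fdiff (\<beta> w) (\<beta> z)))"
    if z: "z \<in> X0" and Q: "Q \<in> B" "Q \<noteq> 0" "\<forall>w\<in>aff Q. in_stalk w (fdiff (\<beta> w) (\<beta> z))" for z Q
  proof -
    define D where "D w = fdiff (\<beta> w) (\<beta> z)" for w
    have D: "D w \<in> FK" if "w \<in> X0" for w using \<beta> z that by (simp add: D_def)
    have QN: "op_pow Q N \<in> B" for N using Q by simp
    have more: "in_stalk w (fsm (op_pow Q (M + N)) 1 (D w))" if "w \<in> X0" "in_stalk w (fsm (op_pow Q N) 1 (D w))" for w M N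
    proof -
      have "fsm (op_pow Q (M + N)) 1 (D w) = fsm (op_pow Q M) 1 (fsm (op_pow Q N) 1 (D w))"
        using fsm_mult[OF D[OF that(1)], of "op_pow Q M" 1 "op_pow Q N" 1] QN by (simp add: op_pow_add frac_one)
      then show ?thesis using in_stalk_X0_smult[OF that(1) QN that(2)] by simp
    qed
    define I where "I = {R \<in> B. \<exists>N. \<forall>w\<in>aff R. in_stalk w (fsm (op_pow Q N) 1 (D w))}"
    have "1 \<in> I"
    proof (rule affine_cover)
      show "I \<subseteq> B" by (auto simp: I_def)
      show "0 \<in> I" by (simp add: I_def)
      show "P + R \<in> I" if PR: "P \<in> I" "R \<in> I" for P R
      proof -
        obtain M N where MN: "\<forall>w\<in>aff P. in_stalk w (fsm (op_pow Q M) 1 (D w))" "\<forall>w\<in>aff R. in_stalk w (fsm (op_pow Q N) 1 (D w))"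
          using PR by (auto simp: I_def)
        have m: "P \<in> B" "R \<in> B" using PR by (auto simp: I_def)
        have "in_stalk w (fsm (op_pow Q (M + N)) 1 (D w))" if "w \<in> aff (P + R)" for w
        proof -
          have w0: "w \<in> X0" using that m aff_X0[of "P + R"] by auto
          have "w \<in> aff P \<or> w \<in> aff R" using that aff_add[OF m] by blast
          then show ?thesis using more[OF w0, of N M] more[OF w0, of M N] MN by (auto simp: add.commute)
        qed
        then show ?thesis using m unfolding I_def by auto
      qed
      show "P \<star> R \<in> I" if "P \<in> I" "R \<in> B" for P R
      proof -
        obtain M where "\<forall>w\<in>aff P. in_stalk w (fsm (op_pow Q M) 1 (D w))" "P \<in> B" using \<open>P \<in> I\<close> by (auto simp: I_def)
        then show ?thesis using that aff_mult[of P R] unfolding I_def by auto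
      qed
      show "\<exists>R\<in>I. u \<in> aff R" if u: "u \<in> X0" for u
      proof -
        obtain g where g: "g \<in> B" "g \<noteq> 0" "u \<in> aff g" "\<forall>w\<in>aff g. in_stalk w (fdiff (\<beta> w) (\<beta> u))"
          using nbhd[OF u] by blast
        \<comment> \<open>On \<open>aff (g \<star> Q)\<close> both constants \<beta> z and \<beta> u
          approximate \<beta>, so their difference D u is regular there and only has poles where g Q
          vanishes.\<close>
        have "in_stalk q (D u)" if q: "q \<in> aff (g \<star> Q)" for q
        proof -
          have q': "q \<in> aff g" "q \<in> aff Q" "q \<in> X0" using q aff_mult[OF g(1) Q(1)] aff_X0[OF Q(1)] by auto
          have "in_stalk q (fdiff (\<beta> q) (\<beta> z))" "in_stalk q (fdiff (\<beta> q) (\<beta> u))" using g q' Q by auto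
          from in_stalk_fdiff[OF p[OF q'(3)] this] show ?thesis
            using fdiff_fadd(5)[of "\<beta> q" "\<beta> z" "\<beta> u"] \<beta> q' z u by (simp add: D_def)
        qed
        note loc_gQ = this
        have gQ: "g \<star> Q \<in> B" using g Q by simp
        obtain N h where h: "fsm (op_pow (g \<star> Q) N) 1 (D u) = fr h 1"
          by (rule clear_poles[OF gQ D[OF u] loc_gQ])
        obtain f T where T: "T \<in> B" "T \<noteq> 0" "D u = fr f T" by (rule FK_E[OF D[OF u]])
        let ?g = "op_pow g N" and ?Q = "op_pow Q N"
        have gN: "?g \<in> B" "?g \<noteq> 0" "?Q \<in> B" using g Q pow_nonzero by auto
        have "fr (f \<diamondop> (?g \<star> ?Q)) T = fr h 1" using h T gN pow_mult_distrib[OF g(1) Q(1)] by (simp add: frac_one)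
        then have "f \<diamondop> (?g \<star> ?Q) = h \<diamondop> T" using T by (simp add: fr_eq_iff)
        then have "f \<diamondop> ?Q \<diamondop> ?g = h \<diamondop> T" using gN mult_comm[of ?g ?Q] by (simp add: op_action_mult[symmetric])
        \<comment> \<open>Only the power of g remains in the denominator, so Q^N D u is regular on
          \<open>aff g\<close>. There \<beta> differs from \<beta> u by elements of the stalks,
          which carries the bound from D u to D w.\<close>
        then have eq: "fsm ?Q 1 (D u) = fr h ?g" using T gN by (simp add: frac_one fr_eq_iff)
        have "in_stalk w (fsm ?Q 1 (D w))" if w: "w \<in> aff g" for w
        proof -
          have w0: "w \<in> X0" using w aff_X0[OF g(1)] by blast
          have "in_stalk w (fr h ?g)" unfolding in_stalk_X0[OF w0] using gN aff_pow[OF g(1)] w by blast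
          moreover have "in_stalk w (fsm ?Q 1 (fdiff (\<beta> w) (\<beta> u)))"
            using in_stalk_X0_smult[OF w0 gN(3)] g w by blast
          ultimately have "in_stalk w (fadd (fsm ?Q 1 (fdiff (\<beta> w) (\<beta> u))) (fsm ?Q 1 (D u)))"
            using in_stalk_add[OF p[OF w0]] eq by simp
          also have "fadd (fsm ?Q 1 (fdiff (\<beta> w) (\<beta> u))) (fsm ?Q 1 (D u)) = fsm ?Q 1 (fadd (fdiff (\<beta> w) (\<beta> u)) (D u))"
            using \<beta> D w0 u gN by (intro fsm_fadd[symmetric]) (auto simp: frac_one)
          also have "fadd (fdiff (\<beta> w) (\<beta> u)) (D u) = D w"
            unfolding D_def using \<beta> w0 u z by (intro fdiff_fadd(1)) auto
          finally show ?thesis .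
        qed
        then have "g \<in> I" using g unfolding I_def by blast
        then show ?thesis using g by blast
      qed
    qed
    then show ?thesis by (simp add: I_def D_def)
  qed
  \<comment> \<open>The elements R for which R \<beta> has a lift over all of X0.\<close>
  define I where "I = {R \<in> B. \<exists>\<kappa>\<in>FK. \<forall>w\<in>X0. in_stalk w (fdiff (fsm R 1 (\<beta> w)) \<kappa>)}"
  have "1 \<in> I"
  proof (rule affine_cover)
    show "I \<subseteq> B" by (auto simp: I_def)
    have "in_stalk w (fdiff (fsm 0 1 (\<beta> w)) (fr 0 1))" if w: "w \<in> X0" for w
    proof -
      obtain f T where T: "T \<in> B" "T \<noteq> 0" "\<beta> w = fr f T" by (rule FK_E[OF \<beta>[OF w]])
      then have "fsm 0 1 (\<beta> w) = fr 0 1" by (simp add: frac_one fr_eq_zero_iff)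
      then show ?thesis using in_stalk_zero[OF p[OF w]] by simp
    qed
    then show "0 \<in> I" unfolding I_def by (auto intro!: bexI[of _ "fr 0 1"])
    show "P + R \<in> I" if PR: "P \<in> I" "R \<in> I" for P R
    proof -
      obtain x y where x: "x \<in> FK" "\<forall>w\<in>X0. in_stalk w (fdiff (fsm P 1 (\<beta> w)) x)"
        and y: "y \<in> FK" "\<forall>w\<in>X0. in_stalk w (fdiff (fsm R 1 (\<beta> w)) y)" using PR by (auto simp: I_def)
      have m: "P \<in> B" "R \<in> B" using PR by (auto simp: I_def)
      have "in_stalk w (fdiff (fsm (P + R) 1 (\<beta> w)) (fadd x y))" if w: "w \<in> X0" for w
      proof -
        obtain f g h T where T: "T \<in> B" "T \<noteq> 0" "\<beta> w = fr f T" "x = fr g T" "y = fr h T"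
          by (rule FK_common3[OF \<beta>[OF w] x(1) y(1)])
        have "in_stalk w (fadd (fdiff (fsm P 1 (\<beta> w)) x) (fdiff (fsm R 1 (\<beta> w)) y))"
          using in_stalk_add[OF p[OF w]] x(2) y(2) w by blast
        then show ?thesis using T m by (simp add: frac_one op_action_add_right algebra_simps)
      qed
      then show ?thesis using m x(1) y(1) unfolding I_def by (auto intro!: bexI[of _ "fadd x y"])
    qed
    show "P \<star> R \<in> I" if PR: "P \<in> I" "R \<in> B" for P R
    proof -
      obtain x where x: "x \<in> FK" "\<forall>w\<in>X0. in_stalk w (fdiff (fsm P 1 (\<beta> w)) x)" using PR by (auto simp: I_def)
      have m: "P \<in> B" using PR by (auto simp: I_def)
      have "in_stalk w (fdiff (fsm (P \<star> R) 1 (\<beta> w)) (fsm R 1 x))" if w: "w \<in> X0" for w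
      proof -
        have "in_stalk w (fsm R 1 (fdiff (fsm P 1 (\<beta> w)) x))" using in_stalk_X0_smult[OF w PR(2)] x(2) w by blast
        also have "fsm R 1 (fdiff (fsm P 1 (\<beta> w)) x) = fdiff (fsm R 1 (fsm P 1 (\<beta> w))) (fsm R 1 x)"
          using \<beta>[OF w] x m PR by (intro fsm_fdiff) (auto simp: frac_one)
        also have "fsm R 1 (fsm P 1 (\<beta> w)) = fsm (P \<star> R) 1 (\<beta> w)"
          using fsm_mult[OF \<beta>[OF w], of R 1 P 1] m PR mult_comm[of P R] by (simp add: frac_one)
        finally show ?thesis .
      qed
      then show ?thesis using m x(1) PR unfolding I_def by (auto simp: frac_one intro!: bexI[of _ "fsm R 1 x"])
    qed
    show "\<exists>R\<in>I. z \<in> aff R" if z: "z \<in> X0" for z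
    proof -
      obtain Q where Q: "Q \<in> B" "Q \<noteq> 0" "z \<in> aff Q" "\<forall>w\<in>aff Q. in_stalk w (fdiff (\<beta> w) (\<beta> z))"
        using nbhd[OF z] by blast
      obtain N where N: "\<forall>w\<in>X0. in_stalk w (fsm (op_pow Q N) 1 (fdiff (\<beta> w) (\<beta> z)))"
        using ann[OF z Q(1,2,4)] by blast
      have "in_stalk w (fdiff (fsm (op_pow Q N) 1 (\<beta> w)) (fsm (op_pow Q N) 1 (\<beta> z)))" if w: "w \<in> X0" for w
      proof -
        have "fraction (op_pow Q N) 1" using Q by (simp add: frac_one)
        from fsm_fdiff[OF \<beta>[OF w] \<beta>[OF z] this] show ?thesis using N w by metis
      qed
      moreover have "fsm (op_pow Q N) 1 (\<beta> z) \<in> FK" using \<beta>[OF z] Q by (simp add: frac_one)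
      ultimately have "op_pow Q N \<in> I" using Q unfolding I_def by auto
      moreover have "z \<in> aff (op_pow Q N)" using aff_pow[OF Q(1)] Q(3) by blast
      ultimately show ?thesis by blast
    qed
  qed
  then obtain \<kappa> where \<kappa>: "\<kappa> \<in> FK" "\<forall>w\<in>X0. in_stalk w (fdiff (fsm 1 1 (\<beta> w)) \<kappa>)" by (auto simp: I_def)
  have "fsm 1 1 (\<beta> w) = \<beta> w" if w: "w \<in> X0" for w
  proof -
    obtain f T where "T \<in> B" "T \<noteq> 0" "\<beta> w = fr f T" by (rule FK_E[OF \<beta>[OF w]])
    then show ?thesis by (simp add: frac_one)
  qed
  then show thesis using \<kappa> by (intro that[of \<kappa>]) auto
qed

text \<open>At infinity, \<beta> - \<kappa> is a polynomial g plus an element of the stalk. Adding g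
  to \<kappa> repairs the point at infinity and changes nothing on X0, where polynomials lie in
  every stalk.\<close>

lemma splitting:
  assumes \<beta>: "\<And>w. w \<in> pts \<Longrightarrow> \<beta> w \<in> FK"
    and loc: "\<And>z. z \<in> pts \<Longrightarrow> \<exists>V. is_open X V \<and> z \<in> V \<and> (\<forall>w\<in>V. in_stalk w (fdiff (\<beta> w) (\<beta> z)))"
  obtains \<kappa> where "\<kappa> \<in> FK" "\<And>w. w \<in> pts \<Longrightarrow> in_stalk w (fdiff (\<beta> w) \<kappa>)"
proof -
  obtain \<kappa> where \<kappa>: "\<kappa> \<in> FK" "\<And>w. w \<in> X0 \<Longrightarrow> in_stalk w (fdiff (\<beta> w) \<kappa>)"
  proof (rule affine_splitting[of \<beta>])
    show "\<beta> w \<in> FK" if "w \<in> X0" for w using \<beta> that X0_sub_pts by blast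
    show "\<exists>V. is_open X V \<and> z \<in> V \<and> (\<forall>w\<in>V \<inter> X0. in_stalk w (fdiff (\<beta> w) (\<beta> z)))" if "z \<in> X0" for z
      using loc[of z] that X0_sub_pts by (metis IntD1 subsetD)
  qed (rule that)
  obtain f Q where f: "Q \<in> B" "Q \<noteq> 0" "fdiff (\<beta> pinf) \<kappa> = fr f Q"
    by (rule FK_E[OF fdiff_FK[OF \<beta>[OF pinf(1)] \<kappa>(1)]])
  obtain g h where gh: "fr f Q = fadd (fr g 1) (fr h Q)" "h = 0 \<or> degree h < degree Q"
    by (rule pinf_division[OF f(1,2), of f])
  have g: "fr g 1 \<in> FK" by simp
  show thesis
  proof (rule that[of "fadd \<kappa> (fr g 1)"])
    show "fadd \<kappa> (fr g 1) \<in> FK" using \<kappa> by simp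
    fix w assume w: "w \<in> pts"
    have eq: "fdiff (\<beta> w) (fadd \<kappa> (fr g 1)) = fdiff (fdiff (\<beta> w) \<kappa>) (fr g 1)"
      using \<beta>[OF w] \<kappa>(1) g by (rule fdiff_fadd(4))
    show "in_stalk w (fdiff (\<beta> w) (fadd \<kappa> (fr g 1)))"
      using w
    proof (cases rule: pts_cases)
      case 1
      then show ?thesis unfolding eq using in_stalk_fdiff[OF w \<kappa>(2)] in_stalk_X0_fr by blast
    next
      case 2
      have "fdiff (fadd (fr g 1) (fr h Q)) (fr g 1) = fr h Q" using f by (intro fdiff_fadd(3)[OF g _ g]) simp
      then have "fdiff (\<beta> w) (fadd \<kappa> (fr g 1)) = fr h Q" unfolding eq unfolding 2 f(3) gh(1) .
      moreover have "in_stalk pinf (fr h Q)" using in_stalk_pinf[OF f(1,2), of h] gh(2) r_pos by auto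
      ultimately show ?thesis using 2 by simp
    qed
  qed
qed

end

section \<open>Cech cocycles with values in the fractions\<close>

context spectral_sheaf begin

lemma psi_zero:
  assumes U: "is_open X U" "U \<noteq> {}"
  shows "psi U \<zero>\<^bsub>msec F U\<^esub> = fr 0 1"
proof -
  interpret U: Module.module "OX U" "msec F U" by (rule F_module[OF U(1)])
  obtain f Q where f: "Q \<in> B" "Q \<noteq> 0" "psi U \<zero>\<^bsub>msec F U\<^esub> = fr f Q"
    by (rule FK_E[OF psi_FK[OF U U.M.zero_closed]])
  have "fr f Q = fr (f + f) Q" using psi_add[OF U U.M.zero_closed U.M.zero_closed] f by simp
  then have "f \<diamondop> Q = (f + f) \<diamondop> Q" using f by (simp add: fr_eq_iff)
  then have "f = 0" using f act_cancel[of Q f "f + f"] by simp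
  then show ?thesis using f by (simp add: fr_eq_zero_iff)
qed

lemma psi_minus:
  assumes U: "is_open X U" "U \<noteq> {}" and s: "s \<in> Fs U" "t \<in> Fs U"
  shows "psi U (s \<ominus>\<^bsub>msec F U\<^esub> t) = fdiff (psi U s) (psi U t)"
proof -
  interpret U: Module.module "OX U" "msec F U" by (rule F_module[OF U(1)])
  have d: "s \<ominus>\<^bsub>msec F U\<^esub> t \<in> Fs U" using s by simp
  have "t \<oplus>\<^bsub>msec F U\<^esub> (s \<ominus>\<^bsub>msec F U\<^esub> t) = s"
    using s U.M.r_neg1[OF s(2)] by (simp add: a_minus_def U.M.a_lcomm U.M.r_neg)
  then have "psi U s = fadd (psi U t) (psi U (s \<ominus>\<^bsub>msec F U\<^esub> t))" using psi_add[OF U s(2) d] by simp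
  then show ?thesis
    using fdiff_fadd(3)[OF psi_FK[OF U s(2)] psi_FK[OF U d] psi_FK[OF U d]] by simp
qed

lemma cocycleD:
  assumes c: "(U, c) \<in> cech_cocycles X F"
  shows "x \<in> pts \<Longrightarrow> is_open X (U x)" "x \<in> pts \<Longrightarrow> x \<in> U x"
    "x \<in> pts \<Longrightarrow> y \<in> pts \<Longrightarrow> c x y \<in> Fs (U x \<inter> U y)"
    "x \<in> pts \<Longrightarrow> y \<in> pts \<Longrightarrow> z \<in> pts \<Longrightarrow>
       psi (U x \<inter> U z) (c x z) = fadd (psi (U x \<inter> U y) (c x y)) (psi (U y \<inter> U z) (c y z))"
proof -
  show o: "is_open X (U x)" "x \<in> U x" if "x \<in> pts" for x
    using c that by (auto simp: cech_cocycles_def pt_cover_def)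
  show m: "c x y \<in> Fs (U x \<inter> U y)" if "x \<in> pts" "y \<in> pts" for x y
    using c that by (auto simp: cech_cocycles_def)
  assume p: "x \<in> pts" "y \<in> pts" "z \<in> pts"
  have ne: "U x \<noteq> {}" "U y \<noteq> {}" "U z \<noteq> {}" using o p by blast+
  let ?W = "U x \<inter> U y \<inter> U z"
  have oI: "is_open X (U x \<inter> U y)" "is_open X (U y \<inter> U z)" "is_open X (U x \<inter> U z)" "is_open X ?W"
    using o p by (auto intro!: openin_Int)
  have "U x \<inter> U y \<noteq> {}" using open_Int_nonempty o p ne by simp
  then have W: "?W \<noteq> {}" using open_Int_nonempty[OF oI(1), of "U z"] o p ne by simp
  interpret W: Module.module "OX ?W" "msec F ?W" by (rule F_module[OF oI(4)])
  have "\<forall>x\<in>pts. \<forall>y\<in>pts. \<forall>z\<in>pts. let W = U x \<inter> U y \<inter> U z in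
       res (U x \<inter> U z) W (c x z) = res (U x \<inter> U y) W (c x y) \<oplus>\<^bsub>msec F W\<^esub> res (U y \<inter> U z) W (c y z)"
    using c by (simp add: cech_cocycles_def)
  then have "res (U x \<inter> U z) ?W (c x z) = res (U x \<inter> U y) ?W (c x y) \<oplus>\<^bsub>msec F ?W\<^esub> res (U y \<inter> U z) ?W (c y z)"
    using p by (simp add: Let_def)
  moreover have "psi ?W (res (U x \<inter> U z) ?W (c x z)) = psi (U x \<inter> U z) (c x z)"
    by (rule psi_res[OF oI(3,4) _ W m]) (use p in auto)
  moreover have "psi ?W (res (U x \<inter> U y) ?W (c x y)) = psi (U x \<inter> U y) (c x y)"
    by (rule psi_res[OF oI(1,4) _ W m]) (use p in auto)
  moreover have "psi ?W (res (U y \<inter> U z) ?W (c y z)) = psi (U y \<inter> U z) (c y z)"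
    by (rule psi_res[OF oI(2,4) _ W m]) (use p in auto)
  moreover have "res (U x \<inter> U y) ?W (c x y) \<in> Fs ?W"
    by (rule res_closed[OF oI(1,4) _ m]) (use p in auto)
  moreover have "res (U y \<inter> U z) ?W (c y z) \<in> Fs ?W"
    by (rule res_closed[OF oI(2,4) _ m]) (use p in auto)
  ultimately show "psi (U x \<inter> U z) (c x z) = fadd (psi (U x \<inter> U y) (c x y)) (psi (U y \<inter> U z) (c y z))"
    using psi_add[OF oI(4) W] by metis
qed

text \<open>Once embedded in K, a cocycle \<gamma> is the coboundary of \<beta> y = \<gamma>(p, y),
  with the point at infinity as base point p. Near z this \<beta> is constant modulo stalks because
  \<gamma>(z, w) is a section near w. Subtracting \<kappa> moves all values into the stalks, where
  they lift to sections over smaller neighbourhoods.\<close>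

lemma cocycle_splits:
  assumes c: "(U, c) \<in> cech_cocycles X F"
  obtains W b where "\<And>x. x \<in> pts \<Longrightarrow> is_open X (W x) \<and> x \<in> W x \<and> W x \<subseteq> U x \<and> b x \<in> Fs (W x)"
    "\<And>x y. x \<in> pts \<Longrightarrow> y \<in> pts \<Longrightarrow> psi (U x \<inter> U y) (c x y) = fdiff (psi (W y) (b y)) (psi (W x) (b x))"
proof -
  note cD = cocycleD[OF c]
  define \<gamma> where "\<gamma> x y = psi (U x \<inter> U y) (c x y)" for x y
  have o: "is_open X (U x \<inter> U y)" "U x \<inter> U y \<noteq> {}" if "x \<in> pts" "y \<in> pts" for x y
  proof -
    show "is_open X (U x \<inter> U y)" using cD that by (auto intro!: openin_Int)
    have "U x \<noteq> {}" "U y \<noteq> {}" using cD(2) that by blast+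
    then show "U x \<inter> U y \<noteq> {}" using cD(1) that by (intro open_Int_nonempty)
  qed
  have FK: "\<gamma> x y \<in> FK" if "x \<in> pts" "y \<in> pts" for x y
    unfolding \<gamma>_def using that by (intro psi_FK o cD(3))
  define \<beta> where "\<beta> = \<gamma> pinf"
  have \<beta>: "\<beta> w \<in> FK" if "w \<in> pts" for w unfolding \<beta>_def using that pinf(1) FK by blast
  have diff: "\<gamma> x y = fdiff (\<beta> y) (\<beta> x)" if "x \<in> pts" "y \<in> pts" for x y
  proof -
    have "\<beta> y = fadd (\<beta> x) (\<gamma> x y)" unfolding \<beta>_def \<gamma>_def using that pinf(1) by (intro cD(4))
    then show ?thesis using fdiff_fadd(3)[OF \<beta>[OF that(1)] FK[OF that] FK[OF that]] by simp
  qed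
  obtain \<kappa> where \<kappa>: "\<kappa> \<in> FK" "\<And>w. w \<in> pts \<Longrightarrow> in_stalk w (fdiff (\<beta> w) \<kappa>)"
  proof (rule splitting[of \<beta>])
    show "\<beta> w \<in> FK" if "w \<in> pts" for w by (rule \<beta>[OF that])
    fix z assume z: "z \<in> pts"
    have "in_stalk w (fdiff (\<beta> w) (\<beta> z))" if w: "w \<in> U z" for w
    proof -
      have wp: "w \<in> pts" using w open_subset_pts[OF cD(1)[OF z]] by blast
      have "F_stalk w (\<gamma> z w)" unfolding \<gamma>_def using cD z wp w by (intro F_stalkI o) auto
      then show ?thesis using diff[OF z wp] F_stalk_iff[OF wp] by simp
    qed
    then show "\<exists>V. is_open X V \<and> z \<in> V \<and> (\<forall>w\<in>V. in_stalk w (fdiff (\<beta> w) (\<beta> z)))"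
      using cD z by blast
  qed (rule that)
  have "\<exists>W b. is_open X W \<and> x \<in> W \<and> W \<subseteq> U x \<and> b \<in> Fs W \<and> psi W b = fdiff (\<beta> x) \<kappa>" if x: "x \<in> pts" for x
  proof -
    have st: "F_stalk x (fdiff (\<beta> x) \<kappa>)" using \<kappa>(2)[OF x] F_stalk_iff[OF x] by simp
    obtain W b where "is_open X W" "x \<in> W" "W \<subseteq> U x" "b \<in> Fs W" "psi W b = fdiff (\<beta> x) \<kappa>"
      by (rule F_stalkE[OF st cD(1)[OF x] cD(2)[OF x]])
    then show ?thesis by (intro exI conjI)
  qed
  then obtain W b where Wb: "\<And>x. x \<in> pts \<Longrightarrow> is_open X (W x) \<and> x \<in> W x \<and> W x \<subseteq> U x \<and> b x \<in> Fs (W x) \<and> psi (W x) (b x) = fdiff (\<beta> x) \<kappa>"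
    by metis
  show thesis
  proof (rule that[of W b])
    show "is_open X (W x) \<and> x \<in> W x \<and> W x \<subseteq> U x \<and> b x \<in> Fs (W x)" if "x \<in> pts" for x using Wb[OF that] by simp
    show "psi (U x \<inter> U y) (c x y) = fdiff (psi (W y) (b y)) (psi (W x) (b x))" if "x \<in> pts" "y \<in> pts" for x y
      using diff[OF that] Wb[OF that(1)] Wb[OF that(2)] fdiff_fadd(2)[OF \<beta>[OF that(2)] \<beta>[OF that(1)] \<kappa>(1)]
      by (simp add: \<gamma>_def)
  qed
qed

text \<open>Both cocycles split, and the difference of the two splittings, restricted to common
  neighbourhoods, witnesses the relation. Hence all cocycles form a single class.\<close>

lemma cocycles_related:
  assumes c: "(U, c) \<in> cech_cocycles X F" and d: "(V, d) \<in> cech_cocycles X F"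
  shows "((U, c), (V, d)) \<in> cech_rel X F"
proof -
  obtain W1 b1 where 1: "\<And>x. x \<in> pts \<Longrightarrow> is_open X (W1 x) \<and> x \<in> W1 x \<and> W1 x \<subseteq> U x \<and> b1 x \<in> Fs (W1 x)"
    "\<And>x y. x \<in> pts \<Longrightarrow> y \<in> pts \<Longrightarrow> psi (U x \<inter> U y) (c x y) = fdiff (psi (W1 y) (b1 y)) (psi (W1 x) (b1 x))"
    by (rule cocycle_splits[OF c]) (rule that)
  obtain W2 b2 where 2: "\<And>x. x \<in> pts \<Longrightarrow> is_open X (W2 x) \<and> x \<in> W2 x \<and> W2 x \<subseteq> V x \<and> b2 x \<in> Fs (W2 x)"
    "\<And>x y. x \<in> pts \<Longrightarrow> y \<in> pts \<Longrightarrow> psi (V x \<inter> V y) (d x y) = fdiff (psi (W2 y) (b2 y)) (psi (W2 x) (b2 x))"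
    by (rule cocycle_splits[OF d]) (rule that)
  define W where "W x = W1 x \<inter> W2 x" for x
  define b where "b x = res (W1 x) (W x) (b1 x) \<ominus>\<^bsub>msec F (W x)\<^esub> res (W2 x) (W x) (b2 x)" for x
  have W: "is_open X (W x)" "x \<in> W x" "W x \<subseteq> W1 x" "W x \<subseteq> W2 x" "W x \<subseteq> U x \<inter> V x" if "x \<in> pts" for x
    using 1(1)[OF that] 2(1)[OF that] by (auto simp: W_def intro!: openin_Int)
  have FK1: "psi (W1 x) (b1 x) \<in> FK" and FK2: "psi (W2 x) (b2 x) \<in> FK" if "x \<in> pts" for x
    using 1(1)[OF that] 2(1)[OF that] by (auto intro!: psi_FK)
  have b: "b x \<in> Fs (W x)" "psi (W x) (b x) = fdiff (psi (W1 x) (b1 x)) (psi (W2 x) (b2 x))" if x: "x \<in> pts" for x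
  proof -
    interpret M: Module.module "OX (W x)" "msec F (W x)" by (rule F_module[OF W(1)[OF x]])
    have ne: "W x \<noteq> {}" using W(2)[OF x] by blast
    have r1: "res (W1 x) (W x) (b1 x) \<in> Fs (W x)" "psi (W x) (res (W1 x) (W x) (b1 x)) = psi (W1 x) (b1 x)"
      using 1(1)[OF x] W[OF x] ne psi_res[of "W1 x" "W x" "b1 x"] res_closed[of "W1 x" "W x" "b1 x"] by simp_all
    have r2: "res (W2 x) (W x) (b2 x) \<in> Fs (W x)" "psi (W x) (res (W2 x) (W x) (b2 x)) = psi (W2 x) (b2 x)"
      using 2(1)[OF x] W[OF x] ne psi_res[of "W2 x" "W x" "b2 x"] res_closed[of "W2 x" "W x" "b2 x"] by simp_all
    show "b x \<in> Fs (W x)" unfolding b_def using r1 r2 by simp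
    show "psi (W x) (b x) = fdiff (psi (W1 x) (b1 x)) (psi (W2 x) (b2 x))"
      unfolding b_def using psi_minus[OF W(1)[OF x] ne r1(1) r2(1)] r1 r2 by simp
  qed
  have "res (U x \<inter> U y) (W x \<inter> W y) (c x y) \<ominus>\<^bsub>msec F (W x \<inter> W y)\<^esub> res (V x \<inter> V y) (W x \<inter> W y) (d x y) =
        res (W y) (W x \<inter> W y) (b y) \<ominus>\<^bsub>msec F (W x \<inter> W y)\<^esub> res (W x) (W x \<inter> W y) (b x)"
    if x: "x \<in> pts" and y: "y \<in> pts" for x y
  proof -
    let ?Z = "W x \<inter> W y"
    have "W x \<noteq> {}" "W y \<noteq> {}" using W(2) x y by blast+
    then have Z: "is_open X ?Z" "?Z \<noteq> {}" using W(1)[OF x] W(1)[OF y] openin_Int open_Int_nonempty by simp_all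
    interpret Z: Module.module "OX ?Z" "msec F ?Z" by (rule F_module[OF Z(1)])
    have UV: "is_open X (U x \<inter> U y)" "is_open X (V x \<inter> V y)" "?Z \<subseteq> U x \<inter> U y" "?Z \<subseteq> V x \<inter> V y"
      using cocycleD(1)[OF c x] cocycleD(1)[OF c y] cocycleD(1)[OF d x] cocycleD(1)[OF d y] W(5)[OF x] W(5)[OF y]
      by (auto intro!: openin_Int)
    have m: "c x y \<in> Fs (U x \<inter> U y)" "d x y \<in> Fs (V x \<inter> V y)" using cocycleD(3)[OF c] cocycleD(3)[OF d] x y by auto
    have s: "res (U x \<inter> U y) ?Z (c x y) \<in> Fs ?Z" "res (V x \<inter> V y) ?Z (d x y) \<in> Fs ?Z"
      "res (W y) ?Z (b y) \<in> Fs ?Z" "res (W x) ?Z (b x) \<in> Fs ?Z"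
      using res_closed[OF UV(1) Z(1) UV(3) m(1)] res_closed[OF UV(2) Z(1) UV(4) m(2)]
        res_closed[OF W(1)[OF y] Z(1) Int_lower2 b(1)[OF y]] res_closed[OF W(1)[OF x] Z(1) Int_lower1 b(1)[OF x]]
      by simp_all
    have p: "psi ?Z (res (U x \<inter> U y) ?Z (c x y)) = psi (U x \<inter> U y) (c x y)"
      "psi ?Z (res (V x \<inter> V y) ?Z (d x y)) = psi (V x \<inter> V y) (d x y)"
      "psi ?Z (res (W y) ?Z (b y)) = psi (W y) (b y)" "psi ?Z (res (W x) ?Z (b x)) = psi (W x) (b x)"
      using psi_res[OF UV(1) Z(1) UV(3) Z(2) m(1)] psi_res[OF UV(2) Z(1) UV(4) Z(2) m(2)]
        psi_res[OF W(1)[OF y] Z(1) Int_lower2 Z(2) b(1)[OF y]] psi_res[OF W(1)[OF x] Z(1) Int_lower1 Z(2) b(1)[OF x]]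
      by auto
    have "psi ?Z (res (U x \<inter> U y) ?Z (c x y) \<ominus>\<^bsub>msec F ?Z\<^esub> res (V x \<inter> V y) ?Z (d x y)) =
      psi ?Z (res (W y) ?Z (b y) \<ominus>\<^bsub>msec F ?Z\<^esub> res (W x) ?Z (b x))"
      unfolding psi_minus[OF Z s(1,2)] psi_minus[OF Z s(3,4)] p 1(2)[OF x y] 2(2)[OF x y] b(2)[OF x] b(2)[OF y]
      by (rule fdiff_fdiff_swap[OF FK1[OF y] FK1[OF x] FK2[OF y] FK2[OF x]])
    then show ?thesis by (rule psi_inj[OF Z Z.M.minus_closed[OF s(1,2)] Z.M.minus_closed[OF s(3,4)]])
  qed
  then show ?thesis
    unfolding cech_rel_def mem_Collect_eq case_prod_conv pt_cover_def Let_def whole_X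
    using c d W(1,2,5) b(1) by (intro conjI exI[of _ W] exI[of _ b]) blast+
qed

lemma zero_cocycle: "(\<lambda>_. whole X, \<lambda>_ _. \<zero>\<^bsub>msec F (whole X)\<^esub>) \<in> cech_cocycles X F"
proof -
  interpret M: Module.module "OX pts" "msec F pts" by (rule F_module) simp
  show ?thesis using res_id[of pts "\<zero>\<^bsub>msec F pts\<^esub>"] by (simp add: cech_cocycles_def pt_cover_def Let_def)
qed

theorem H1_trivial: "H1 X F = {H1_zero X F}"
proof -
  have rel: "cech_rel X F = cech_cocycles X F \<times> cech_cocycles X F"
    using cocycles_related by (auto simp: cech_rel_def)
  show ?thesis
    unfolding H1_def H1_zero_def rel quotient_def using zero_cocycle by auto
qed

end

text \<open>Evaluates the operations on germs, which are unions over all pairs of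
  representatives.\<close>

lemma UN_pairs_const:
  assumes "A \<noteq> {}" "B \<noteq> {}" "\<And>U a V b. (U, a) \<in> A \<Longrightarrow> (V, b) \<in> B \<Longrightarrow> f U a V b = c"
  shows "(\<Union>(U, a)\<in>A. \<Union>(V, b)\<in>B. f U a V b) = c"
proof (intro equalityI subsetI)
  fix x assume "x \<in> (\<Union>(U, a)\<in>A. \<Union>(V, b)\<in>B. f U a V b)"
  then show "x \<in> c" using assms(3) by auto
next
  fix x assume x: "x \<in> c"
  obtain p q where "p \<in> A" "q \<in> B" using assms(1,2) by blast
  then show "x \<in> (\<Union>(U, a)\<in>A. \<Union>(V, b)\<in>B. f U a V b)"
    using x assms(3)[of "fst p" "snd p" "fst q" "snd q"] by (auto intro!: bexI[of _ p] bexI[of _ q] simp: case_prod_beta)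
qed

context spectral begin

section \<open>The fiber at infinity\<close>

lemma reg_pinf_iff:
  assumes "fraction A C"
  shows "reg pinf A C \<longleftrightarrow> degree A \<le> degree C"
proof
  have AC: "A \<in> B" "C \<in> B" "C \<noteq> 0" using assms by (auto simp: fraction_def)
  assume "reg pinf A C"
  then obtain A' R m where *: "A' \<in> filt B m" "R \<in> filt B m" "tmon R m \<notin> pinf" "R \<noteq> 0" "fraction A' R" "A \<star> R = A' \<star> C"
    by (rule regE[OF pinf(1)])
  show "degree A \<le> degree C"
  proof (cases "A = 0")
    case False
    have "degree R = m * r" using pinf(2)[OF *(2)] *(3) by simp
    moreover have "degree A' \<le> m * r" using *(1) by (simp add: filt_def)
    moreover have "degree (A \<star> R) = degree A + degree R" using False * AC by (intro op_mult_nonzero) auto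
    moreover have "degree (A' \<star> C) \<le> degree A' + degree C" by (rule op_mult_degree_le)
    ultimately show ?thesis using *(6) by simp
  qed simp
qed (rule reg_pinf[OF assms])

text \<open>Turns out to describe the maximal ideal at infinity times the stalk, by
  \<open>max_ideal_stalk_eq\<close>. The case f = 0 is listed because the zero polynomial has degree
  0.\<close>

definition small :: "(complex poly \<times> diffop) set \<Rightarrow> bool" where
  "small x \<longleftrightarrow> (\<exists>f Q. Q \<in> B \<and> Q \<noteq> 0 \<and> (f = 0 \<or> degree f < degree Q) \<and> x = fr f Q)"

lemma small_fr:
  assumes "Q \<in> B" "Q \<noteq> 0"
  shows "small (fr f Q) \<longleftrightarrow> f = 0 \<or> degree f < degree Q"
proof
  assume "small (fr f Q)"
  then obtain g R where *: "R \<in> B" "R \<noteq> 0" "g = 0 \<or> degree g < degree R" "fr f Q = fr g R"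
    by (auto simp: small_def)
  have eq: "f \<diamondop> R = g \<diamondop> Q" using * assms by (simp add: fr_eq_iff)
  show "f = 0 \<or> degree f < degree Q"
  proof (cases "f = 0")
    case False
    have "f \<diamondop> R \<noteq> 0" "degree (f \<diamondop> R) = degree f + degree R" using act_nonzero[OF *(1,2) False] by auto
    moreover from this eq have g: "g \<noteq> 0" by auto
    moreover have "degree (g \<diamondop> Q) = degree g + degree Q" using act_nonzero(2)[OF assms g] .
    ultimately show ?thesis using eq *(3) by simp
  qed simp
qed (use assms in \<open>auto simp: small_def\<close>)

lemma small_E:
  assumes "small x"
  obtains f Q where "Q \<in> B" "Q \<noteq> 0" "f = 0 \<or> degree f < degree Q" "x = fr f Q"
  using assms by (auto simp: small_def)

lemma small_stalk: "small x \<Longrightarrow> in_stalk pinf x"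
  using r_pos by (elim small_E) (auto simp: in_stalk_pinf)

lemma small_FK: "small x \<Longrightarrow> x \<in> FK"
  by (auto elim: small_E)

lemma small_add:
  assumes "small x" "small y"
  shows "small (fadd x y)"
proof -
  obtain f g Q where *: "Q \<in> B" "Q \<noteq> 0" "x = fr f Q" "y = fr g Q"
    by (rule FK_common[OF small_FK[OF assms(1)] small_FK[OF assms(2)]])
  then have "f = 0 \<or> degree f < degree Q" "g = 0 \<or> degree g < degree Q" using assms by (simp_all add: small_fr)
  then have "f + g = 0 \<or> degree (f + g) < degree Q" by (auto intro: degree_add_less)
  then show ?thesis using * by (simp add: small_fr)
qed

text \<open>Orders in B are multiples of r, so ord A < ord C already means ord A + r \<le> ord C.
  This gain of r absorbs the allowance ord f < ord Q + r granted to elements of the stalk.\<close>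

lemma small_fsm:
  assumes x: "in_stalk pinf x" and A: "fraction A C" "A = 0 \<or> degree A < degree C"
  shows "small (fsm A C x)"
proof -
  have AC: "A \<in> B" "C \<in> B" "C \<noteq> 0" using A by (auto simp: fraction_def)
  obtain f Q where f: "Q \<in> B" "Q \<noteq> 0" "x = fr f Q" by (rule FK_E[OF in_stalk_FK[OF pinf(1) x]])
  have df: "degree f < degree Q + r" using x in_stalk_pinf[OF f(1,2)] f by simp
  have "f \<diamondop> A = 0 \<or> degree (f \<diamondop> A) < degree (Q \<star> C)"
  proof (cases "A = 0")
    case False
    then have "degree A < degree C" using A by simp
    moreover have "r dvd degree A" "r dvd degree C" using r_dvd AC by auto
    ultimately have "degree A + r \<le> degree C"
      by (metis dvdE mult_Suc_right mult_le_cancel1 not_less_eq_eq add.commute Suc_leI)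
    then show ?thesis using df f AC op_mult_nonzero[of Q C] degree_op_action_le[of f A] by auto
  qed simp
  then show ?thesis using f AC A by (simp add: small_fr)
qed

lemma small_fsm_stalk:
  assumes "small x" "fraction A C" "degree A \<le> degree C"
  shows "small (fsm A C x)"
proof -
  have AC: "A \<in> B" "C \<in> B" "C \<noteq> 0" using assms by (auto simp: fraction_def)
  obtain f Q where f: "Q \<in> B" "Q \<noteq> 0" "f = 0 \<or> degree f < degree Q" "x = fr f Q" by (rule small_E[OF assms(1)])
  have "f \<diamondop> A = 0 \<or> degree (f \<diamondop> A) < degree (Q \<star> C)"
    using f AC assms(3) op_mult_nonzero[of Q C] degree_op_action_le[of f A] by auto
  then show ?thesis using f AC assms by (simp add: small_fr)
qed

lemma small_uminus:
  assumes "small x"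
  obtains y where "small y" "fadd y x = fr 0 1"
proof -
  obtain f Q where f: "Q \<in> B" "Q \<noteq> 0" "f = 0 \<or> degree f < degree Q" "x = fr f Q" by (rule small_E[OF assms])
  have "small (fr (- f) Q)" using f by (simp add: small_fr)
  moreover have "fadd (fr (- f) Q) x = fr 0 1" using f by (simp add: fr_eq_zero_iff)
  ultimately show thesis by (rule that)
qed

lemma small_zero: "small (fr 0 1)"
  by (simp add: small_fr)

text \<open>The germ of A/C at infinity in closed form: all sections near infinity that are given by
  an equal fraction. With it, computations in the stalk become computations with A and C.\<close>

definition rg :: "diffop \<Rightarrow> diffop \<Rightarrow> (spt set \<times> sfun) set" where
  "rg A C = {(V, t). is_open X V \<and> pinf \<in> V \<and> (\<exists>A' C'. regular_on V A' C' \<and> t = sect V A' C' \<and> A \<star> C' = A' \<star> C)}"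

lemma frac_trans:
  assumes "fraction A C" "fraction A' C'" "fraction A'' C''" "A \<star> C' = A' \<star> C"
  shows "A \<star> C'' = A'' \<star> C \<longleftrightarrow> A' \<star> C'' = A'' \<star> C'"
proof -
  have m: "A \<in> B" "C \<in> B" "C \<noteq> 0" "A' \<in> B" "C' \<in> B" "C' \<noteq> 0" "A'' \<in> B" "C'' \<in> B" "C'' \<noteq> 0"
    using assms by (auto simp: fraction_def)
  have 1: "C' \<star> (A \<star> C'') = C \<star> (A' \<star> C'')"
    using assms(4) m by (metis op_mult_assoc mult_comm)
  have 2: "C' \<star> (A'' \<star> C) = C \<star> (A'' \<star> C')" using m by (simp add: mult_ac_B)
  have c: "D \<star> P = D \<star> P' \<longleftrightarrow> P = P'" if "D \<noteq> 0" for D P P'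
    using that op_mult_diff_right[of D P P'] by (metis op_mult_eq_0_iff right_minus_eq)
  show ?thesis using 1 2 c[OF m(3)] c[OF m(6)] by metis
qed

lemma rgerm_eq:
  assumes U: "is_open X U" "pinf \<in> U" and A: "regular_on U A C"
  shows "rgerm X pinf U (sect U A C) = rg A C"
proof -
  have "(V, t) \<in> rgerm X pinf U (sect U A C) \<longleftrightarrow> (V, t) \<in> rg A C" for V t
  proof
    assume "(V, t) \<in> rgerm X pinf U (sect U A C)"
    then obtain W where *: "is_open X V" "pinf \<in> V" "t \<in> carrier (OX V)" "is_open X W" "pinf \<in> W" "W \<subseteq> U" "W \<subseteq> V"
      "rres X U W (sect U A C) = rres X V W t" by (auto simp: germ_def)
    obtain A' C' where t: "t = sect V A' C'" "regular_on V A' C'" by (rule sectE[OF *(1,3)])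
    have "sect W A C = sect W A' C'" using * t by simp
    moreover have "W \<noteq> {}" using * by blast
    ultimately have "A \<star> C' = A' \<star> C"
      using regular_on_mono[OF A *(6)] regular_on_mono[OF t(2) *(7)] sect_eqD[OF *(4)] by blast
    then show "(V, t) \<in> rg A C" unfolding rg_def using * t by blast
  next
    assume "(V, t) \<in> rg A C"
    then obtain A' C' where *: "is_open X V" "pinf \<in> V" "regular_on V A' C'" "t = sect V A' C'" "A \<star> C' = A' \<star> C"
      by (auto simp: rg_def)
    let ?W = "U \<inter> V"
    have W: "is_open X ?W" "pinf \<in> ?W" using U * by (auto intro: openin_Int)
    have "sect ?W A C = sect ?W A' C'"
      using regular_on_mono[OF A, of ?W] regular_on_mono[OF *(3), of ?W] *(5) by (intro sect_eqI) auto
    then have "rres X U ?W (sect U A C) = rres X V ?W t" using * by simp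
    then show "(V, t) \<in> rgerm X pinf U (sect U A C)" unfolding germ_def using * W by auto
  qed
  then show ?thesis by auto
qed

lemma rg_sect:
  assumes "(V, t) \<in> rg A C" "fraction A C"
  obtains A' C' where "is_open X V" "pinf \<in> V" "regular_on V A' C'" "t = sect V A' C'" "fraction A' C'" "A \<star> C' = A' \<star> C"
  using assms by (auto simp: rg_def regular_on_def)

lemma rg_eq:
  assumes "fraction A C" "fraction A' C'" "A \<star> C' = A' \<star> C"
  shows "rg A C = rg A' C'"
  unfolding rg_def using frac_trans[OF assms(1,2) _ assms(3)] by (auto simp: regular_on_def)

lemma rg_nonempty:
  assumes "fraction A C" "degree A \<le> degree C"
  obtains V where "is_open X V" "pinf \<in> V" "regular_on V A C" "(V, sect V A C) \<in> rg A C"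
proof -
  obtain V where V: "is_open X V" "pinf \<in> V" "regular_on V A C"
    by (rule reg_open[OF pinf(1) assms(1) reg_pinf[OF assms]])
  then show thesis by (intro that[of V]) (auto simp: rg_def)
qed

lemma rg_eqD:
  assumes "fraction A C" "degree A \<le> degree C" "fraction A' C'" "rg A C = rg A' C'"
  shows "A \<star> C' = A' \<star> C"
proof -
  obtain V where V: "is_open X V" "pinf \<in> V" "regular_on V A C" "(V, sect V A C) \<in> rg A C" by (rule rg_nonempty[OF assms(1,2)])
  obtain A1 C1 where 1: "regular_on V A1 C1" "sect V A C = sect V A1 C1" "fraction A1 C1" "A' \<star> C1 = A1 \<star> C'"
    using rg_sect[OF _ assms(3)] V(4) assms(4) by metis
  have "A \<star> C1 = A1 \<star> C" using sect_eqD[OF V(1) _ V(3) 1(1,2)] V(2) by blast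
  then show ?thesis using frac_trans[OF assms(1) 1(3) assms(3)] 1(4) by metis
qed

lemma stalk_ring_carrier:
  "carrier (stalk_ring X pinf) = {rg A C | A C. fraction A C \<and> degree A \<le> degree C}"
proof (intro equalityI subsetI)
  fix a assume "a \<in> carrier (stalk_ring X pinf)"
  then obtain U s where U: "a = rgerm X pinf U s" "is_open X U" "pinf \<in> U" "s \<in> carrier (OX U)" by (auto simp: stalk_ring_def)
  obtain A C where A: "s = sect U A C" "regular_on U A C" by (rule sectE[OF U(2,4)])
  have "fraction A C" "reg pinf A C" using A(2) U(3) by (auto simp: regular_on_def)
  then show "a \<in> {rg A C | A C. fraction A C \<and> degree A \<le> degree C}"
    using rgerm_eq[OF U(2,3) A(2)] U(1) A(1) reg_pinf_iff by auto
next
  fix a assume "a \<in> {rg A C | A C. fraction A C \<and> degree A \<le> degree C}"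
  then obtain A C where a: "a = rg A C" "fraction A C" "degree A \<le> degree C" by auto
  obtain V where V: "is_open X V" "pinf \<in> V" "regular_on V A C" "(V, sect V A C) \<in> rg A C" by (rule rg_nonempty[OF a(2,3)])
  show "a \<in> carrier (stalk_ring X pinf)"
    using rgerm_eq[OF V(1-3)] V a(1) by (auto simp: stalk_ring_def intro!: exI[of _ V] exI[of _ "sect V A C"])
qed

lemma stalk_ring_mult:
  assumes A: "fraction A C" "degree A \<le> degree C" and A': "fraction A' C'" "degree A' \<le> degree C'"
  shows "rg A C \<otimes>\<^bsub>stalk_ring X pinf\<^esub> rg A' C' = rg (A \<star> A') (C \<star> C')"
proof -
  have ne: "rg A C \<noteq> {}" "rg A' C' \<noteq> {}" by (rule rg_nonempty[OF A], blast) (rule rg_nonempty[OF A'], blast)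
  have "rgerm X pinf (U \<inter> V) (rres X U (U \<inter> V) a \<otimes>\<^bsub>OX (U \<inter> V)\<^esub> rres X V (U \<inter> V) b) = rg (A \<star> A') (C \<star> C')"
    if ua: "(U, a) \<in> rg A C" and vb: "(V, b) \<in> rg A' C'" for U a V b
  proof -
    obtain A1 C1 where 1: "is_open X U" "pinf \<in> U" "regular_on U A1 C1" "a = sect U A1 C1" "fraction A1 C1" "A \<star> C1 = A1 \<star> C"
      by (rule rg_sect[OF ua A(1)])
    obtain A2 C2 where 2: "is_open X V" "pinf \<in> V" "regular_on V A2 C2" "b = sect V A2 C2" "fraction A2 C2" "A' \<star> C2 = A2 \<star> C'"
      by (rule rg_sect[OF vb A'(1)])
    let ?W = "U \<inter> V"
    have W: "is_open X ?W" "pinf \<in> ?W" using 1 2 by (auto intro: openin_Int)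
    have r: "regular_on ?W A1 C1" "regular_on ?W A2 C2" using regular_on_mono[OF 1(3)] regular_on_mono[OF 2(3)] by auto
    have m: "A \<in> B" "C \<in> B" "A' \<in> B" "C' \<in> B" "A1 \<in> B" "C1 \<in> B" "A2 \<in> B" "C2 \<in> B" using A A' 1 2 by (auto simp: fraction_def)
    have "rgerm X pinf ?W (rres X U ?W a \<otimes>\<^bsub>OX ?W\<^esub> rres X V ?W b) = rg (A1 \<star> A2) (C1 \<star> C2)"
      using 1 2 r W rgerm_eq[OF W regular_on_mult[OF open_subset_pts[OF W(1)] r]] by simp
    also have "\<dots> = rg (A \<star> A') (C \<star> C')"
    proof (rule rg_eq)
      have "(A1 \<star> A2) \<star> (C \<star> C') = (A1 \<star> C) \<star> (A2 \<star> C')" using m by (simp add: mult_ac_B)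
      also have "\<dots> = (A \<star> C1) \<star> (A' \<star> C2)" using 1 2 by simp
      also have "\<dots> = (A \<star> A') \<star> (C1 \<star> C2)" using m by (simp add: mult_ac_B)
      finally show "(A1 \<star> A2) \<star> (C \<star> C') = (A \<star> A') \<star> (C1 \<star> C2)" .
    qed (use frac_mult 1 2 A A' in auto)
    finally show ?thesis .
  qed
  from UN_pairs_const[OF ne this] show ?thesis by (simp add: stalk_ring_def)
qed

lemma stalk_ring_one: "\<one>\<^bsub>stalk_ring X pinf\<^esub> = rg 1 1"
proof -
  have "regular_on pts 1 1" by (rule regular_on_const) auto
  then show ?thesis using rgerm_eq[of pts 1 1] pinf(1) sect_one[of pts] by (simp add: stalk_ring_def)
qed

text \<open>If the orders of A and C agree, then C/A is regular and inverts A/C. If ord A is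
  smaller, a product with a regular function still has numerator of smaller order than its
  denominator and cannot be 1.\<close>

lemma max_ideal_pinf:
  "max_ideal_at X pinf = {rg A C | A C. fraction A C \<and> (A = 0 \<or> degree A < degree C)}"
proof (intro equalityI subsetI)
  let ?R = "stalk_ring X pinf"
  fix a assume "a \<in> max_ideal_at X pinf"
  then have a: "a \<in> carrier ?R" "a \<notin> Units ?R" by (auto simp: max_ideal_at_def)
  obtain A C where A: "a = rg A C" "fraction A C" "degree A \<le> degree C" using a(1) stalk_ring_carrier by auto
  have "A = 0 \<or> degree A < degree C"
  proof (rule ccontr)
    assume "\<not> ?thesis"
    then have n: "A \<noteq> 0" "degree A = degree C" using A(3) by auto
    then have C: "fraction C A" "degree C \<le> degree A" using A(2) by (auto simp: fraction_def)
    have AC: "A \<in> B" "C \<in> B" "C \<noteq> 0" using A by (auto simp: fraction_def)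
    have "rg (A \<star> C) (C \<star> A) = rg 1 1" "rg (C \<star> A) (A \<star> C) = rg 1 1"
      using AC n mult_comm[of A C] rg_eq[of "C \<star> A" "C \<star> A" 1 1] by (simp_all add: fraction_def)
    then have "rg A C \<otimes>\<^bsub>?R\<^esub> rg C A = \<one>\<^bsub>?R\<^esub>" "rg C A \<otimes>\<^bsub>?R\<^esub> rg A C = \<one>\<^bsub>?R\<^esub>"
      using stalk_ring_mult[OF A(2,3) C] stalk_ring_mult[OF C A(2,3)] stalk_ring_one by auto
    moreover have "rg C A \<in> carrier ?R" using C stalk_ring_carrier by blast
    ultimately show False using a A(1) by (auto simp: Units_def)
  qed
  then show "a \<in> {rg A C | A C. fraction A C \<and> (A = 0 \<or> degree A < degree C)}" using A by blast
next
  let ?R = "stalk_ring X pinf"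
  fix a assume "a \<in> {rg A C | A C. fraction A C \<and> (A = 0 \<or> degree A < degree C)}"
  then obtain A C where A: "a = rg A C" "fraction A C" "A = 0 \<or> degree A < degree C" by auto
  have dA: "degree A \<le> degree C" using A(3) by auto
  have "a \<notin> Units ?R"
  proof
    assume "a \<in> Units ?R"
    then obtain b where b: "b \<in> carrier ?R" "a \<otimes>\<^bsub>?R\<^esub> b = \<one>\<^bsub>?R\<^esub>" by (auto simp: Units_def)
    then obtain A' C' where A': "b = rg A' C'" "fraction A' C'" "degree A' \<le> degree C'" using stalk_ring_carrier by auto
    have m: "A \<in> B" "C \<in> B" "C \<noteq> 0" "A' \<in> B" "C' \<in> B" "C' \<noteq> 0" using A A' by (auto simp: fraction_def)
    have "rg (A \<star> A') (C \<star> C') = rg 1 1"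
      using b(2) stalk_ring_mult[OF A(2) dA A'(2,3)] stalk_ring_one A A' by simp
    moreover have "degree (A \<star> A') \<le> degree (C \<star> C')"
      using op_mult_degree_le[of A A'] dA A'(3) m by (simp add: op_mult_nonzero)
    ultimately have eq: "A \<star> A' = C \<star> C'"
      using rg_eqD[of "A \<star> A'" "C \<star> C'" 1 1] m by (simp add: fraction_def)
    have "A \<noteq> 0" using eq m op_mult_nonzero(1)[of C C'] by auto
    then have "degree (A \<star> A') < degree (C \<star> C')"
      using op_mult_degree_le[of A A'] A(3) A'(3) m by (simp add: op_mult_nonzero)
    then show False using eq by simp
  qed
  moreover have "a \<in> carrier ?R" using A dA stalk_ring_carrier by auto
  ultimately show "a \<in> max_ideal_at X pinf" by (simp add: max_ideal_at_def)
qed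

end

section \<open>Stalk and fiber of the spectral sheaf at infinity\<close>

context spectral_sheaf begin

text \<open>The germ at infinity as the set of all sections near infinity with image x in K, so that
  computations in the stalk of F become computations with fractions.\<close>

definition gm :: "(complex poly \<times> diffop) set \<Rightarrow> (spt set \<times> 'm) set" where
  "gm x = {(V, t). is_open X V \<and> pinf \<in> V \<and> t \<in> Fs V \<and> psi V t = x}"

lemma mgerm_eq:
  assumes U: "is_open X U" "pinf \<in> U" "s \<in> Fs U"
  shows "mgerm X F pinf U s = gm (psi U s)"
proof -
  have "(V, t) \<in> mgerm X F pinf U s \<longleftrightarrow> (V, t) \<in> gm (psi U s)" for V t
  proof
    assume "(V, t) \<in> mgerm X F pinf U s"
    then obtain W where *: "is_open X V" "pinf \<in> V" "t \<in> Fs V" "is_open X W" "pinf \<in> W" "W \<subseteq> U" "W \<subseteq> V"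
      "res U W s = res V W t" by (auto simp: germ_def)
    have "W \<noteq> {}" using * by blast
    then have "psi U s = psi V t"
      using psi_res[OF U(1) *(4,6) _ U(3)] psi_res[OF *(1,4,7) _ *(3)] *(8) by simp
    then show "(V, t) \<in> gm (psi U s)" unfolding gm_def using * by simp
  next
    assume "(V, t) \<in> gm (psi U s)"
    then have *: "is_open X V" "pinf \<in> V" "t \<in> Fs V" "psi V t = psi U s" by (auto simp: gm_def)
    let ?W = "U \<inter> V"
    have W: "is_open X ?W" "pinf \<in> ?W" "?W \<noteq> {}" using U * by (auto intro: openin_Int)
    have "psi ?W (res U ?W s) = psi ?W (res V ?W t)"
      using psi_res[OF U(1) W(1) Int_lower1 W(3) U(3)] psi_res[OF *(1) W(1) Int_lower2 W(3) *(3)] *(4) by simp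
    then have "res U ?W s = res V ?W t"
      using psi_inj[OF W(1,3)] res_closed[OF U(1) W(1) Int_lower1 U(3)] res_closed[OF *(1) W(1) Int_lower2 *(3)] by blast
    then show "(V, t) \<in> mgerm X F pinf U s" unfolding germ_def using * W by auto
  qed
  then show ?thesis by auto
qed

lemma gm_nonempty:
  assumes "in_stalk pinf x"
  obtains U s where "is_open X U" "pinf \<in> U" "s \<in> Fs U" "psi U s = x" "(U, s) \<in> gm x"
proof -
  have st: "F_stalk pinf x" using assms F_stalk_pinf by simp
  obtain U s where "is_open X U" "pinf \<in> U" "U \<subseteq> pts" "s \<in> Fs U" "psi U s = x"
    by (rule F_stalkE[OF st open_pts pinf(1)])
  then show thesis by (intro that[of U s]) (auto simp: gm_def)
qed

lemma gm_inj:
  assumes "in_stalk pinf x" "gm x = gm y"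
  shows "x = y"
proof -
  obtain U s where "(U, s) \<in> gm x" by (rule gm_nonempty[OF assms(1)])
  then show ?thesis using assms(2) by (auto simp: gm_def)
qed

lemma stalk_carrier: "carrier (stalk X F pinf) = {gm x | x. in_stalk pinf x}"
proof (intro equalityI subsetI)
  fix a assume "a \<in> carrier (stalk X F pinf)"
  then obtain U s where U: "a = mgerm X F pinf U s" "is_open X U" "pinf \<in> U" "s \<in> Fs U" by (auto simp: stalk_def)
  have "a = gm (psi U s)" using mgerm_eq[OF U(2-4)] U(1) by simp
  moreover have "in_stalk pinf (psi U s)" using F_stalkI[OF U(2-4)] F_stalk_pinf by simp
  ultimately show "a \<in> {gm x | x. in_stalk pinf x}" by blast
next
  fix a assume "a \<in> {gm x | x. in_stalk pinf x}"
  then obtain x where x: "a = gm x" "in_stalk pinf x" by auto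
  obtain U s where U: "is_open X U" "pinf \<in> U" "s \<in> Fs U" "psi U s = x" "(U, s) \<in> gm x" by (rule gm_nonempty[OF x(2)])
  then have "a = mgerm X F pinf U s" using mgerm_eq[OF U(1-3)] x by simp
  then show "a \<in> carrier (stalk X F pinf)" using U by (auto simp: stalk_def)
qed

lemma gm_carrier [simp]: "in_stalk pinf x \<Longrightarrow> gm x \<in> carrier (stalk X F pinf)"
  unfolding stalk_carrier by blast

lemma stalk_add:
  assumes "in_stalk pinf x" "in_stalk pinf y"
  shows "gm x \<oplus>\<^bsub>stalk X F pinf\<^esub> gm y = gm (fadd x y)"
proof -
  have ne: "gm x \<noteq> {}" "gm y \<noteq> {}" by (rule gm_nonempty[OF assms(1)], blast) (rule gm_nonempty[OF assms(2)], blast)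
  have "mgerm X F pinf (U \<inter> V) (res U (U \<inter> V) s \<oplus>\<^bsub>msec F (U \<inter> V)\<^esub> res V (U \<inter> V) t) = gm (fadd x y)"
    if us: "(U, s) \<in> gm x" and vt: "(V, t) \<in> gm y" for U s V t
  proof -
    have 1: "is_open X U" "pinf \<in> U" "s \<in> Fs U" "psi U s = x" using us by (auto simp: gm_def)
    have 2: "is_open X V" "pinf \<in> V" "t \<in> Fs V" "psi V t = y" using vt by (auto simp: gm_def)
    let ?W = "U \<inter> V"
    have W: "is_open X ?W" "pinf \<in> ?W" "?W \<noteq> {}" using 1 2 by (auto intro: openin_Int)
    interpret W: Module.module "OX ?W" "msec F ?W" by (rule F_module[OF W(1)])
    have s: "res U ?W s \<in> Fs ?W" "res V ?W t \<in> Fs ?W"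
      using res_closed[OF 1(1) W(1) Int_lower1 1(3)] res_closed[OF 2(1) W(1) Int_lower2 2(3)] by auto
    have "psi ?W (res U ?W s) = x" "psi ?W (res V ?W t) = y"
      using psi_res[OF 1(1) W(1) Int_lower1 W(3) 1(3)] psi_res[OF 2(1) W(1) Int_lower2 W(3) 2(3)] 1 2 by auto
    then show ?thesis using mgerm_eq[OF W(1,2) W.M.a_closed[OF s]] psi_add[OF W(1,3) s] by simp
  qed
  from UN_pairs_const[OF ne this] show ?thesis by (simp add: stalk_def)
qed

lemma stalk_smult:
  assumes A: "fraction A C" "degree A \<le> degree C" and x: "in_stalk pinf x"
  shows "rg A C \<odot>\<^bsub>stalk X F pinf\<^esub> gm x = gm (fsm A C x)"
proof -
  have ne: "rg A C \<noteq> {}" "gm x \<noteq> {}" by (rule rg_nonempty[OF A], blast) (rule gm_nonempty[OF x], blast)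
  have "mgerm X F pinf (U \<inter> V) (rres X U (U \<inter> V) a \<odot>\<^bsub>msec F (U \<inter> V)\<^esub> res V (U \<inter> V) t) = gm (fsm A C x)"
    if ua: "(U, a) \<in> rg A C" and vt: "(V, t) \<in> gm x" for U a V t
  proof -
    obtain A1 C1 where 1: "is_open X U" "pinf \<in> U" "regular_on U A1 C1" "a = sect U A1 C1" "fraction A1 C1" "A \<star> C1 = A1 \<star> C"
      by (rule rg_sect[OF ua A(1)])
    have 2: "is_open X V" "pinf \<in> V" "t \<in> Fs V" "psi V t = x" using vt by (auto simp: gm_def)
    let ?W = "U \<inter> V"
    have W: "is_open X ?W" "pinf \<in> ?W" "?W \<noteq> {}" using 1 2 by (auto intro: openin_Int)
    have t: "res V ?W t \<in> Fs ?W" "psi ?W (res V ?W t) = x"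
      using res_closed[OF 2(1) W(1) Int_lower2 2(3)] psi_res[OF 2(1) W(1) Int_lower2 W(3) 2(3)] 2 by auto
    have r: "regular_on ?W A1 C1" using regular_on_mono[OF 1(3)] by auto
    have "psi ?W (sect ?W A1 C1 \<odot>\<^bsub>msec F ?W\<^esub> res V ?W t) = fsm A1 C1 x" using psi_smult[OF W(1,3) t(1) r] t(2) by simp
    also have "\<dots> = fsm A C x" using 1 A in_stalk_FK[OF pinf(1) x] by (intro fsm_cong) auto
    finally show ?thesis
      using mgerm_eq[OF W(1,2) smult_closed[OF W(1) sect_closed[OF W(1) r] t(1)]] 1(4) by simp
  qed
  from UN_pairs_const[OF ne this] show ?thesis by (simp add: stalk_def)
qed

lemma stalk_zero: "\<zero>\<^bsub>stalk X F pinf\<^esub> = gm (fr 0 1)"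
proof -
  interpret P: Module.module "OX pts" "msec F pts" by (rule F_module) simp
  have "pts \<noteq> {}" using pinf(1) by blast
  then show ?thesis using mgerm_eq[OF open_pts pinf(1) P.M.zero_closed] psi_zero[OF open_pts] by (simp add: stalk_def)
qed

lemma stalk_abelian: "abelian_group (stalk X F pinf)"
proof (rule abelian_groupI)
  interpret FK: abelian_group FKgrp by (rule FK_abelian)
  note K = in_stalk_FK[OF pinf(1)]
  note add = in_stalk_add[OF pinf(1)]
  show "\<zero>\<^bsub>stalk X F pinf\<^esub> \<in> carrier (stalk X F pinf)" using in_stalk_zero[OF pinf(1)] by (simp add: stalk_zero)
  fix a assume "a \<in> carrier (stalk X F pinf)"
  then obtain x where x: "a = gm x" "in_stalk pinf x" by (auto simp: stalk_carrier)
  show "\<zero>\<^bsub>stalk X F pinf\<^esub> \<oplus>\<^bsub>stalk X F pinf\<^esub> a = a"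
    using stalk_add[OF in_stalk_zero[OF pinf(1)] x(2)] FK.l_zero[of x] K[OF x(2)] by (simp add: stalk_zero x)
  have n: "in_stalk pinf (fdiff (fr 0 1) x)" by (rule in_stalk_fdiff[OF pinf(1) in_stalk_zero[OF pinf(1)] x(2)])
  have "fadd (fdiff (fr 0 1) x) x = fr 0 1" using K[OF x(2)] by (intro fdiff_fadd(6)[of _ _ x]) auto
  then have "gm (fdiff (fr 0 1) x) \<oplus>\<^bsub>stalk X F pinf\<^esub> a = \<zero>\<^bsub>stalk X F pinf\<^esub>"
    using stalk_add[OF n x(2)] by (simp add: stalk_zero x)
  then show "\<exists>y\<in>carrier (stalk X F pinf). y \<oplus>\<^bsub>stalk X F pinf\<^esub> a = \<zero>\<^bsub>stalk X F pinf\<^esub>" using gm_carrier[OF n] by blast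
  fix b assume "b \<in> carrier (stalk X F pinf)"
  then obtain y where y: "b = gm y" "in_stalk pinf y" by (auto simp: stalk_carrier)
  show "a \<oplus>\<^bsub>stalk X F pinf\<^esub> b \<in> carrier (stalk X F pinf)" using stalk_add[OF x(2) y(2)] add[OF x(2) y(2)] x y by simp
  show "a \<oplus>\<^bsub>stalk X F pinf\<^esub> b = b \<oplus>\<^bsub>stalk X F pinf\<^esub> a"
    using stalk_add[OF x(2) y(2)] stalk_add[OF y(2) x(2)] FK.a_comm[of x y] K[OF x(2)] K[OF y(2)] x y by simp
  fix c assume "c \<in> carrier (stalk X F pinf)"
  then obtain z where z: "c = gm z" "in_stalk pinf z" by (auto simp: stalk_carrier)
  show "a \<oplus>\<^bsub>stalk X F pinf\<^esub> b \<oplus>\<^bsub>stalk X F pinf\<^esub> c = a \<oplus>\<^bsub>stalk X F pinf\<^esub> (b \<oplus>\<^bsub>stalk X F pinf\<^esub> c)"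
    using stalk_add[OF x(2) y(2)] stalk_add[OF y(2) z(2)] stalk_add[OF add[OF x(2) y(2)] z(2)] stalk_add[OF x(2) add[OF y(2) z(2)]]
      FK.a_assoc[of x y z] K[OF x(2)] K[OF y(2)] K[OF z(2)] x y z by simp
qed

lemma max_ideal_stalk_eq: "max_ideal_stalk X F pinf = {gm x | x. small x}"
proof (intro equalityI subsetI)
  let ?S = "stalk X F pinf"
  interpret S: abelian_group ?S by (rule stalk_abelian)
  fix a assume "a \<in> max_ideal_stalk X F pinf"
  then obtain n :: nat and c m where a: "a = (\<Oplus>\<^bsub>?S\<^esub>i\<in>{..<n}. c i \<odot>\<^bsub>?S\<^esub> m i)"
    "c \<in> {..<n} \<rightarrow> max_ideal_at X pinf" "m \<in> {..<n} \<rightarrow> carrier ?S"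
    by (auto simp: max_ideal_stalk_def)
  have term_small: "\<exists>x. small x \<and> c i \<odot>\<^bsub>?S\<^esub> m i = gm x" if i: "i < n" for i
  proof -
    have "c i \<in> max_ideal_at X pinf" "m i \<in> carrier ?S" using a i by auto
    then obtain A C x where *: "c i = rg A C" "fraction A C" "A = 0 \<or> degree A < degree C" "m i = gm x" "in_stalk pinf x"
      by (auto simp: max_ideal_pinf stalk_carrier)
    have "degree A \<le> degree C" using *(3) by auto
    then show ?thesis using stalk_smult[OF *(2) _ *(5)] small_fsm[OF *(5,2,3)] * by auto
  qed
  have "\<exists>x. small x \<and> (\<Oplus>\<^bsub>?S\<^esub>i\<in>{..<k}. c i \<odot>\<^bsub>?S\<^esub> m i) = gm x" if "k \<le> n" for k
    using that
  proof (induction k)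
    case 0
    show ?case using small_zero by (auto simp: stalk_zero)
  next
    case (Suc k)
    obtain x where x: "small x" "(\<Oplus>\<^bsub>?S\<^esub>i\<in>{..<k}. c i \<odot>\<^bsub>?S\<^esub> m i) = gm x" using Suc by auto
    obtain y where y: "small y" "c k \<odot>\<^bsub>?S\<^esub> m k = gm y" using term_small[of k] Suc.prems by auto
    have "c i \<odot>\<^bsub>?S\<^esub> m i \<in> carrier ?S" if "i < Suc k" for i
    proof -
      have "i < n" using that Suc.prems by simp
      then obtain z where "small z" "c i \<odot>\<^bsub>?S\<^esub> m i = gm z" using term_small by blast
      then show ?thesis using small_stalk by simp
    qed
    then have "(\<lambda>i. c i \<odot>\<^bsub>?S\<^esub> m i) \<in> {..<Suc k} \<rightarrow> carrier ?S" by blast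
    then have "(\<Oplus>\<^bsub>?S\<^esub>i\<in>{..<Suc k}. c i \<odot>\<^bsub>?S\<^esub> m i) = gm (fadd y x)"
      using finsum_lessThan_Suc[OF S.abelian_monoid_axioms] stalk_add[OF small_stalk[OF y(1)] small_stalk[OF x(1)]] x y by simp
    then show ?case using small_add[OF y(1) x(1)] by blast
  qed
  from this[of n] show "a \<in> {gm x | x. small x}" using a(1) by auto
next
  let ?S = "stalk X F pinf"
  interpret S: abelian_group ?S by (rule stalk_abelian)
  fix a assume "a \<in> {gm x | x. small x}"
  then obtain x where x: "a = gm x" "small x" by auto
  obtain f Q where f: "Q \<in> B" "Q \<noteq> 0" "f = 0 \<or> degree f < degree Q" "x = fr f Q" by (rule small_E[OF x(2)])
  obtain A C where AC: "A \<in> B" "C \<in> B" "A \<noteq> 0" "C \<noteq> 0" "degree A = degree C + r" by (rule degree_difference)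
  \<comment> \<open>The fraction x divided by the local parameter C/A. Its order rises by r, which
    keeps it in the stalk, and x is the single product (C/A) y.\<close>
  define y where "y = fr (f \<diamondop> A) (Q \<star> C)"
  have "degree (f \<diamondop> A) < degree (Q \<star> C) + r"
    using degree_op_action_le[of f A] f(2,3) AC r_pos by (auto simp: op_mult_nonzero)
  then have y: "in_stalk pinf y" unfolding y_def using in_stalk_pinf f AC by simp
  have CA: "fraction C A" "degree C \<le> degree A" "degree C < degree A" using AC r_pos by (auto simp: fraction_def)
  have "fsm C A y = fr (f \<diamondop> A \<diamondop> C) (Q \<star> C \<star> A)" unfolding y_def using f AC CA by simp
  also have "\<dots> = fr (f \<diamondop> (A \<star> C)) (Q \<star> (A \<star> C))" using mult_comm[of C A] AC by (simp add: op_mult_assoc op_action_mult)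
  also have "\<dots> = x" using fr_cancel(1)[of Q "A \<star> C" f] f AC by simp
  finally have eq: "rg C A \<odot>\<^bsub>?S\<^esub> gm y = a" using stalk_smult[OF CA(1,2) y] x by simp
  have aS: "a \<in> carrier ?S" using x small_stalk by simp
  have "rg C A \<in> max_ideal_at X pinf" using CA max_ideal_pinf by blast
  moreover have "(\<Oplus>\<^bsub>?S\<^esub>i\<in>{..<1::nat}. rg C A \<odot>\<^bsub>?S\<^esub> gm y) = a"
    using finsum_lessThan_Suc[OF S.abelian_monoid_axioms, of "\<lambda>_. a" 0] aS by (simp add: eq)
  moreover have "gm y \<in> carrier ?S" using y by simp
  ultimately show "a \<in> max_ideal_stalk X F pinf"
    unfolding max_ideal_stalk_def mem_Collect_eq
    by (intro exI[of _ 1] exI[of _ "\<lambda>_. rg C A"] exI[of _ "\<lambda>_. gm y"]) simp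
qed

lemma max_ideal_subgroup: "abelian_subgroup (max_ideal_stalk X F pinf) (stalk X F pinf)"
proof (rule abelian_subgroupI3)
  show "abelian_group (stalk X F pinf)" by (rule stalk_abelian)
  interpret S: abelian_group "stalk X F pinf" by (rule stalk_abelian)
  have inv: "\<ominus>\<^bsub>stalk X F pinf\<^esub> a \<in> max_ideal_stalk X F pinf" if a: "a \<in> max_ideal_stalk X F pinf" for a
  proof -
    obtain x where x: "small x" "a = gm x" using a max_ideal_stalk_eq by auto
    obtain y where y: "small y" "fadd y x = fr 0 1" by (rule small_uminus[OF x(1)])
    have "gm y \<oplus>\<^bsub>stalk X F pinf\<^esub> a = \<zero>\<^bsub>stalk X F pinf\<^esub>"
      using stalk_add[OF small_stalk[OF y(1)] small_stalk[OF x(1)]] y x by (simp add: stalk_zero)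
    then have "\<ominus>\<^bsub>stalk X F pinf\<^esub> a = gm y"
      using S.minus_equality x y small_stalk by simp
    then show ?thesis using y max_ideal_stalk_eq by blast
  qed
  show "additive_subgroup (max_ideal_stalk X F pinf) (stalk X F pinf)"
    unfolding additive_subgroup_def
  proof (rule group.subgroupI[OF S.a_group])
    show "max_ideal_stalk X F pinf \<subseteq> carrier (add_monoid (stalk X F pinf))"
      using small_stalk by (auto simp: max_ideal_stalk_eq)
    show "max_ideal_stalk X F pinf \<noteq> {}" using small_zero by (auto simp: max_ideal_stalk_eq)
    show "inv\<^bsub>add_monoid (stalk X F pinf)\<^esub> a \<in> max_ideal_stalk X F pinf" if "a \<in> max_ideal_stalk X F pinf" for a
      using inv[OF that] by (simp add: a_inv_def)
    show "a \<otimes>\<^bsub>add_monoid (stalk X F pinf)\<^esub> b \<in> max_ideal_stalk X F pinf"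
      if "a \<in> max_ideal_stalk X F pinf" "b \<in> max_ideal_stalk X F pinf" for a b
    proof -
      obtain x y where "small x" "a = gm x" "small y" "b = gm y" using \<open>a \<in> _\<close> \<open>b \<in> _\<close> by (auto simp: max_ideal_stalk_eq)
      then show ?thesis using stalk_add small_stalk small_add by (auto simp: max_ideal_stalk_eq)
    qed
  qed
qed

abbreviation coset :: "(complex poly \<times> diffop) set \<Rightarrow> (spt set \<times> 'm) set set" where
  "coset x \<equiv> max_ideal_stalk X F pinf +>\<^bsub>stalk X F pinf\<^esub> gm x"

lemma coset_eq:
  assumes x: "in_stalk pinf x"
  shows "coset x = {gm z | z. in_stalk pinf z \<and> small (fdiff z x)}"
proof (intro equalityI subsetI)
  note K = in_stalk_FK[OF pinf(1)]
  fix a assume "a \<in> coset x"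
  then obtain m where m: "small m" "a = gm m \<oplus>\<^bsub>stalk X F pinf\<^esub> gm x" by (auto simp: a_r_coset_def' max_ideal_stalk_eq)
  have a: "a = gm (fadd m x)" using stalk_add[OF small_stalk[OF m(1)] x] m by simp
  interpret FK: abelian_group FKgrp by (rule FK_abelian)
  have "fadd m x = fadd x m" using FK.a_comm[of m x] small_FK[OF m(1)] K[OF x] by simp
  then have "fdiff (fadd m x) x = m" using fdiff_fadd(3)[OF K[OF x] small_FK[OF m(1)] K[OF x]] by simp
  then show "a \<in> {gm z | z. in_stalk pinf z \<and> small (fdiff z x)}"
    using in_stalk_add[OF pinf(1) small_stalk[OF m(1)] x] m a by auto
next
  note K = in_stalk_FK[OF pinf(1)]
  fix a assume "a \<in> {gm z | z. in_stalk pinf z \<and> small (fdiff z x)}"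
  then obtain z where z: "a = gm z" "in_stalk pinf z" "small (fdiff z x)" by auto
  have "fadd (fdiff z x) x = z" using fdiff_fadd(6)[OF K[OF z(2)] K[OF x] K[OF x]] .
  then have "gm (fdiff z x) \<oplus>\<^bsub>stalk X F pinf\<^esub> gm x = a" using stalk_add[OF small_stalk[OF z(3)] x] z by simp
  then show "a \<in> coset x" using z by (auto simp: a_r_coset_def' max_ideal_stalk_eq)
qed

lemma small_fdiff_self: "x \<in> FK \<Longrightarrow> small (fdiff x x)"
  by (erule FK_E) (simp add: small_fr)

lemma small_fdiff_sym: "x \<in> FK \<Longrightarrow> y \<in> FK \<Longrightarrow> small (fdiff x y) \<Longrightarrow> small (fdiff y x)"
proof -
  assume xy: "x \<in> FK" "y \<in> FK" "small (fdiff x y)"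
  obtain f g Q where *: "Q \<in> B" "Q \<noteq> 0" "x = fr f Q" "y = fr g Q" by (rule FK_common[OF xy(1,2)])
  then show "small (fdiff y x)" using xy(3) degree_minus[of "f - g"] by (auto simp: small_fr)
qed

lemma coset_eq_iff:
  assumes x: "in_stalk pinf x" and y: "in_stalk pinf y"
  shows "coset x = coset y \<longleftrightarrow> small (fdiff x y)"
proof
  note K = in_stalk_FK[OF pinf(1)]
  assume "coset x = coset y"
  then have "gm x \<in> coset y" using coset_eq[OF x] x small_fdiff_self[OF K[OF x]] by auto
  then obtain z where z: "gm x = gm z" "in_stalk pinf z" "small (fdiff z y)" using coset_eq[OF y] by auto
  then show "small (fdiff x y)" using gm_inj[OF x z(1)] by simp
next
  note K = in_stalk_FK[OF pinf(1)]
  assume s: "small (fdiff x y)"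
  have "small (fdiff z x) \<longleftrightarrow> small (fdiff z y)" if z: "in_stalk pinf z" for z
    using small_add[OF _ s, of "fdiff z x"] small_add[OF _ small_fdiff_sym[OF K[OF x] K[OF y] s], of "fdiff z y"]
      fdiff_fadd(1)[OF K[OF z] K[OF x] K[OF y]] fdiff_fadd(1)[OF K[OF z] K[OF y] K[OF x]] by auto
  then show "coset x = coset y" unfolding coset_eq[OF x] coset_eq[OF y] by auto
qed

lemma coset_add:
  assumes x: "in_stalk pinf x" and y: "in_stalk pinf y"
  shows "coset x <+>\<^bsub>stalk X F pinf\<^esub> coset y = coset (fadd x y)"
proof -
  interpret M: abelian_subgroup "max_ideal_stalk X F pinf" "stalk X F pinf" by (rule max_ideal_subgroup)
  show ?thesis using M.a_rcos_sum[OF gm_carrier[OF x] gm_carrier[OF y]] stalk_add[OF x y] by simp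
qed

lemma coset_smult:
  assumes A: "fraction A C" "degree A \<le> degree C" and x: "in_stalk pinf x"
  shows "(\<Union>m\<in>coset x. max_ideal_stalk X F pinf +>\<^bsub>stalk X F pinf\<^esub> (rg A C \<odot>\<^bsub>stalk X F pinf\<^esub> m)) = coset (fsm A C x)"
proof -
  note K = in_stalk_FK[OF pinf(1)]
  have st: "in_stalk pinf (fsm A C z)" if "in_stalk pinf z" for z
    by (rule in_stalk_smult[OF pinf(1) that A(1) reg_pinf[OF A]])
  have eq: "max_ideal_stalk X F pinf +>\<^bsub>stalk X F pinf\<^esub> (rg A C \<odot>\<^bsub>stalk X F pinf\<^esub> m) = coset (fsm A C x)" if m: "m \<in> coset x" for m
  proof -
    obtain z where z: "m = gm z" "in_stalk pinf z" "small (fdiff z x)" using m coset_eq[OF x] by auto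
    have "small (fdiff (fsm A C z) (fsm A C x))"
      using small_fsm_stalk[OF z(3) A] fsm_fdiff[OF K[OF z(2)] K[OF x] A(1)] by simp
    then have "coset (fsm A C z) = coset (fsm A C x)" using coset_eq_iff[OF st[OF z(2)] st[OF x]] by simp
    then show ?thesis using stalk_smult[OF A z(2)] z(1) by simp
  qed
  have "gm x \<in> coset x" using coset_eq[OF x] x small_fdiff_self[OF K[OF x]] by auto
  then show ?thesis using eq by blast
qed

lemma psi_pts_stalk: "s \<in> Fs pts \<Longrightarrow> in_stalk pinf (psi pts s)"
  using F_stalkI[OF open_pts pinf(1)] F_stalk_pinf by blast

lemma ev_eq: "s \<in> Fs pts \<Longrightarrow> ev_at X F pinf s = coset (psi pts s)"
  using mgerm_eq[OF open_pts pinf(1)] by (simp add: ev_at_def)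

lemma regular_on_const_op: "regular_on pts (const_op c) 1"
  by (rule regular_on_const) auto

text \<open>Two polynomials that agree modulo small fractions are equal, because with denominator 1
  only 0 is small. Surjectivity is division with remainder: the quotient g has degree below r and
  gives a global section, and the remainder is small.\<close>

lemma ev_bij: "bij_betw (ev_at X F pinf) (Fs pts) (a_rcosets\<^bsub>stalk X F pinf\<^esub> max_ideal_stalk X F pinf)"
  unfolding bij_betw_def
proof
  show "inj_on (ev_at X F pinf) (Fs pts)"
  proof (rule inj_onI)
    fix s t assume st: "s \<in> Fs pts" "t \<in> Fs pts" "ev_at X F pinf s = ev_at X F pinf t"
    have "small (fdiff (psi pts s) (psi pts t))"
      using st ev_eq coset_eq_iff[OF psi_pts_stalk[OF st(1)] psi_pts_stalk[OF st(2)]] by simp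
    then have "\<phi> (res pts X0 s) = \<phi> (res pts X0 t)" using psi_pts(1)[OF st(1)] psi_pts(1)[OF st(2)] by (simp add: small_fr)
    then show "s = t" using global_iso st by (auto simp: bij_betw_def inj_on_def)
  qed
  show "ev_at X F pinf ` Fs pts = a_rcosets\<^bsub>stalk X F pinf\<^esub> max_ideal_stalk X F pinf"
  proof (intro equalityI subsetI)
    fix a assume "a \<in> ev_at X F pinf ` Fs pts"
    then obtain s where s: "s \<in> Fs pts" "a = coset (psi pts s)" using ev_eq by auto
    then show "a \<in> a_rcosets\<^bsub>stalk X F pinf\<^esub> max_ideal_stalk X F pinf"
      using gm_carrier[OF psi_pts_stalk[OF s(1)]] by (auto simp: A_RCOSETS_def')
  next
    fix a assume "a \<in> a_rcosets\<^bsub>stalk X F pinf\<^esub> max_ideal_stalk X F pinf"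
    then obtain x where x: "a = coset x" "in_stalk pinf x" by (auto simp: A_RCOSETS_def' stalk_carrier)
    obtain f Q where f: "Q \<in> B" "Q \<noteq> 0" "x = fr f Q" by (rule FK_E[OF in_stalk_FK[OF pinf(1) x(2)]])
    have df: "degree f < degree Q + r" using x(2) in_stalk_pinf[OF f(1,2)] f by simp
    obtain g h where gh: "fr f Q = fadd (fr g 1) (fr h Q)" "h = 0 \<or> degree h < degree Q" "degree g < r"
      by (rule pinf_division[OF f(1,2), of f]) (use df in auto)
    have "g \<in> (\<lambda>s. \<phi> (res pts X0 s)) ` Fs pts" using global_iso gh(3) by (simp add: bij_betw_def)
    then obtain s where s: "s \<in> Fs pts" "g = \<phi> (res pts X0 s)" by (rule imageE)
    have p: "psi pts s = fr g 1" using psi_pts(1)[OF s(1)] s(2) by simp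
    have "fdiff x (psi pts s) = fr h Q"
      unfolding p f(3) gh(1) using f(1,2) by (intro fdiff_fadd(3)[of _ _ x]) (auto simp: f)
    then have "small (fdiff x (psi pts s))" using gh(2) f by (simp add: small_fr)
    then have "a = coset (psi pts s)" using coset_eq_iff[OF x(2) psi_pts_stalk[OF s(1)]] x(1) by simp
    then show "a \<in> ev_at X F pinf ` Fs pts" using ev_eq[OF s(1)] s(1) by blast
  qed
qed

theorem ev_iso: "mod_iso complex_ring (global_sections B F) (fiber_at_inf B F) (ev_at X F pinf)"
proof -
  interpret P: Module.module "OX pts" "msec F pts" by (rule F_module) simp
  have ne: "pts \<noteq> {}" using pinf(1) by blast
  have rgc: "rgerm X pinf pts (const_section B pts c) = rg (const_op c) 1" for c
    using rgerm_eq[OF open_pts pinf(1) regular_on_const_op] const_section_eq[of pts c] by simp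
  have fc: "fraction (const_op c) 1" "degree (const_op c) \<le> degree (1 :: diffop)" for c
    using regular_on_const_op[of c] by (auto simp: regular_on_def const_op_def)
  have car: "carrier (global_sections B F) = Fs pts"
    and ca: "carrier (fiber_at_inf B F) = a_rcosets\<^bsub>stalk X F pinf\<^esub> max_ideal_stalk X F pinf"
    and ad: "\<And>s t. s \<oplus>\<^bsub>global_sections B F\<^esub> t = s \<oplus>\<^bsub>msec F pts\<^esub> t"
    and aa: "\<And>a b. a \<oplus>\<^bsub>fiber_at_inf B F\<^esub> b = a <+>\<^bsub>stalk X F pinf\<^esub> b"
    and sm: "\<And>c s. c \<odot>\<^bsub>global_sections B F\<^esub> s = const_section B pts c \<odot>\<^bsub>msec F pts\<^esub> s"
    and sa: "\<And>c a. c \<odot>\<^bsub>fiber_at_inf B F\<^esub> a =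
      (\<Union>m\<in>a. max_ideal_stalk X F pinf +>\<^bsub>stalk X F pinf\<^esub> (rg (const_op c) 1 \<odot>\<^bsub>stalk X F pinf\<^esub> m))"
    by (simp_all add: global_sections_def fiber_at_inf_def fiber_def restrict_scalars_def rgc)
  have "ev_at X F pinf (s \<oplus>\<^bsub>msec F pts\<^esub> t) = ev_at X F pinf s <+>\<^bsub>stalk X F pinf\<^esub> ev_at X F pinf t"
    if "s \<in> Fs pts" "t \<in> Fs pts" for s t
    using ev_eq[OF that(1)] ev_eq[OF that(2)] ev_eq[OF P.M.a_closed[OF that]] psi_add[OF open_pts ne that]
      coset_add[OF psi_pts_stalk[OF that(1)] psi_pts_stalk[OF that(2)]] by simp
  moreover have "ev_at X F pinf (const_section B pts c \<odot>\<^bsub>msec F pts\<^esub> s) = c \<odot>\<^bsub>fiber_at_inf B F\<^esub> ev_at X F pinf s"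
    if s: "s \<in> Fs pts" for c s
  proof -
    have "sect pts (const_op c) 1 \<odot>\<^bsub>msec F pts\<^esub> s \<in> Fs pts"
      by (rule smult_closed[OF open_pts sect_closed[OF open_pts regular_on_const_op] s])
    then show ?thesis
      unfolding sa ev_eq[OF s] coset_smult[OF fc psi_pts_stalk[OF s]]
      using ev_eq psi_smult[OF open_pts ne s regular_on_const_op] const_section_eq[of pts c] by simp
  qed
  ultimately show ?thesis unfolding mod_iso_def car ca ad aa sm using ev_bij by blast
qed

end

(* The sections of the sheaf in (1) are fractions f/P with f in the spectral module and P in B.
   The sheaves in (2) and (3) have sections in arbitrary types. *)
theorem theorem1p17:
  fixes B :: "diffop set"
  assumes "spectral_algebra B"
  shows
    "(\<exists>(F :: (spt, sfun, (complex poly \<times> diffop) set) mod_presheaf) \<phi>. spectral_pair B F \<phi>) \<and>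
     (\<forall>(F :: (spt, sfun, 'm) mod_presheaf) \<phi> (F' :: (spt, sfun, 'n) mod_presheaf) \<phi>'.
        spectral_pair B F \<phi> \<and> spectral_pair B F' \<phi>' \<longrightarrow>
        (\<exists>\<psi>. sheaf_iso (curve B) F F' \<psi> \<and>
             (\<forall>s\<in>carrier (msec F (affine_part B)). \<phi>' (\<psi> (affine_part B) s) = \<phi> s))) \<and>
     (\<forall>(F :: (spt, sfun, 'm) mod_presheaf) \<phi>.
        spectral_pair B F \<phi> \<longrightarrow>
        mod_iso complex_ring (global_sections B F) (fiber_at_inf B F)
          (ev_at (curve B) F (inf_pt B)) \<and>
        H1 (curve B) F = {H1_zero (curve B) F})"
proof (intro conjI allI impI)
  interpret spectral B by unfold_locales (rule assms)
  show "\<exists>(F :: (spt, sfun, (complex poly \<times> diffop) set) mod_presheaf) \<phi>. spectral_pair B F \<phi>"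
    using F0_spectral_pair by blast
  show "\<exists>\<psi>. sheaf_iso (curve B) F F' \<psi> \<and>
      (\<forall>s\<in>carrier (msec F (affine_part B)). \<phi>' (\<psi> (affine_part B) s) = \<phi> s)"
    if "spectral_pair B F \<phi> \<and> spectral_pair B F' \<phi>'"
    for F :: "(spt, sfun, 'm) mod_presheaf" and \<phi> and F' :: "(spt, sfun, 'n) mod_presheaf" and \<phi>'
    using spectral_pair_unique[of F \<phi> F' \<phi>'] that by simp
  fix F :: "(spt, sfun, 'm) mod_presheaf" and \<phi>
  assume "spectral_pair B F \<phi>"
  then interpret spectral_sheaf B F \<phi> by unfold_locales
  show "mod_iso complex_ring (global_sections B F) (fiber_at_inf B F) (ev_at (curve B) F (inf_pt B))"
    by (rule ev_iso)
  show "H1 (curve B) F = {H1_zero (curve B) F}" by (rule H1_trivial)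
qed

end
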